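(* Let $F$ be a finite group. Then the lamplighter group with base group $F$, $\Gamma_F=F\wr\mathbb{Z}=\left(\bigoplus_{i\in\mathbb{Z}}F\right)\rtimes\mathbb{Z}$, is a $\mathbb{Z}[1/|F|]$-semiduality group of dimension $2$.
   Context: In $\Gamma_F$, the group $\mathbb{Z}$ acts on $\bigoplus_{i\in\mathbb{Z}}F$ by shifting the indices of a sequence $(f_i)$. For a commutative ring $R$, a group $\Lambda$ is an $R$-semiduality group of dimension $d$ if: (i) $\mathrm{cd}_R(\Lambda)\le d$, where $\mathrm{cd}_R$ denotes cohomological dimension over $R$; (ii) $\Lambda$ is of type $FP_{d-1}$ over $R$; (iii) $H^k(\Lambda;R\Lambda)=0$ if $k\ne d$; (iv) $H^d(\Lambda;R\Lambda)$ is a flat $R$-module.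
   Formalization: The finite group F is assumed nontrivial; for trivial F the group is ℤ and the ring is ℤ, and H^1(ℤ; ℤ[ℤ]) ≅ ℤ is nonzero, so the claim with dimension 2 fails. *)

theory Defs
  imports "HOL-Algebra.Module" "HOL-Algebra.AbelCoset" "HOL-Algebra.Product_Groups"
    "HOL-Library.Extended_Nat"
begin

section \<open>Modules over a possibly noncommutative ring\<close>

text \<open>The library locale \<^locale>\<open>Module.module\<close> requires a commutative ring of scalars, which rules out group
  rings. Module records inherit a multiplication and a unit from ring records; they are ignored.\<close>

locale left_module = A?: ring A + M?: abelian_group M
  for A :: "('a, 'e) ring_scheme" (structure) and M :: "('a, 'm, 'f) module_scheme" (structure) +
  assumes left_smult_closed: "\<lbrakk>a \<in> carrier A; x \<in> carrier M\<rbrakk> \<Longrightarrow> a \<odot>\<^bsub>M\<^esub> x \<in> carrier M"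
    and left_smult_l_distr: "\<lbrakk>a \<in> carrier A; b \<in> carrier A; x \<in> carrier M\<rbrakk> \<Longrightarrow>
      (a \<oplus> b) \<odot>\<^bsub>M\<^esub> x = a \<odot>\<^bsub>M\<^esub> x \<oplus>\<^bsub>M\<^esub> b \<odot>\<^bsub>M\<^esub> x"
    and left_smult_r_distr: "\<lbrakk>a \<in> carrier A; x \<in> carrier M; y \<in> carrier M\<rbrakk> \<Longrightarrow>
      a \<odot>\<^bsub>M\<^esub> (x \<oplus>\<^bsub>M\<^esub> y) = a \<odot>\<^bsub>M\<^esub> x \<oplus>\<^bsub>M\<^esub> a \<odot>\<^bsub>M\<^esub> y"
    and left_smult_assoc: "\<lbrakk>a \<in> carrier A; b \<in> carrier A; x \<in> carrier M\<rbrakk> \<Longrightarrow>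
      (a \<otimes> b) \<odot>\<^bsub>M\<^esub> x = a \<odot>\<^bsub>M\<^esub> (b \<odot>\<^bsub>M\<^esub> x)"
    and left_smult_one: "x \<in> carrier M \<Longrightarrow> \<one> \<odot>\<^bsub>M\<^esub> x = x"

definition mod_hom ::
  "('a, 'e) ring_scheme \<Rightarrow> ('a, 'm, 'f) module_scheme \<Rightarrow> ('a, 'n, 'h) module_scheme \<Rightarrow> ('m \<Rightarrow> 'n) set"
  where "mod_hom A M N = {f \<in> carrier M \<rightarrow> carrier N.
    (\<forall>x\<in>carrier M. \<forall>y\<in>carrier M. f (x \<oplus>\<^bsub>M\<^esub> y) = f x \<oplus>\<^bsub>N\<^esub> f y) \<and>
    (\<forall>a\<in>carrier A. \<forall>x\<in>carrier M. f (a \<odot>\<^bsub>M\<^esub> x) = a \<odot>\<^bsub>N\<^esub> f x)}"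

text \<open>For a submodule \<open>N\<close> of \<open>M\<close>. As in the library's quotient rings, the operations on cosets are
  given by unions over representatives.\<close>

definition quotient_module :: "('a, 'm, 'f) module_scheme \<Rightarrow> 'm set \<Rightarrow> ('a, 'm set) module"
  where "quotient_module M N =
    \<lparr>carrier = a_rcosets\<^bsub>M\<^esub> N, mult = undefined, one = undefined, zero = N, add = set_add M,
     smult = (\<lambda>a X. \<Union>x\<in>X. N +>\<^bsub>M\<^esub> (a \<odot>\<^bsub>M\<^esub> x))\<rparr>"

definition finsupp :: "('a, 'e) ring_scheme \<Rightarrow> 'x set \<Rightarrow> ('x \<Rightarrow> 'a) set"
  where "finsupp A X = {u. (\<forall>x\<in>X. u x \<in> carrier A) \<and> (\<forall>x. x \<notin> X \<longrightarrow> u x = \<zero>\<^bsub>A\<^esub>) \<and>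
    finite {x. u x \<noteq> \<zero>\<^bsub>A\<^esub>}}"

definition basis_elem :: "('a, 'e) ring_scheme \<Rightarrow> 'x \<Rightarrow> 'x \<Rightarrow> 'a"
  where "basis_elem A x = (\<lambda>y. if y = x then \<one>\<^bsub>A\<^esub> else \<zero>\<^bsub>A\<^esub>)"

definition free_module :: "('a, 'e) ring_scheme \<Rightarrow> 'x set \<Rightarrow> ('a, 'x \<Rightarrow> 'a) module"
  where "free_module A X =
    \<lparr>carrier = finsupp A X, mult = undefined, one = undefined, zero = (\<lambda>_. \<zero>\<^bsub>A\<^esub>),
     add = (\<lambda>u v x. u x \<oplus>\<^bsub>A\<^esub> v x), smult = (\<lambda>a u x. a \<otimes>\<^bsub>A\<^esub> u x)\<rparr>"

text \<open>Direct summands of free modules. A projective module is a summand of the free module on its own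
  underlying set, so basis sets of type \<^typ>\<open>'m set\<close> suffice.\<close>

definition projective :: "('a, 'e) ring_scheme \<Rightarrow> ('a, 'm, 'f) module_scheme \<Rightarrow> bool"
  where "projective A M \<longleftrightarrow> left_module A M \<and>
    (\<exists>(X :: 'm set) i p. i \<in> mod_hom A M (free_module A X) \<and> p \<in> mod_hom A (free_module A X) M \<and>
      (\<forall>x\<in>carrier M. p (i x) = x))"

definition fin_gen_module :: "('a, 'e) ring_scheme \<Rightarrow> ('a, 'm, 'f) module_scheme \<Rightarrow> bool"
  where "fin_gen_module A M \<longleftrightarrow> (\<exists>S \<subseteq> carrier M. finite S \<and>
    (\<forall>x\<in>carrier M. \<exists>a \<in> S \<rightarrow> carrier A. x = (\<Oplus>\<^bsub>M\<^esub>s\<in>S. a s \<odot>\<^bsub>M\<^esub> s)))"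

text \<open>Exactness of \<open>P n \<rightarrow> \<dots> \<rightarrow> P 1 \<rightarrow> P 0 \<rightarrow> M \<rightarrow> 0\<close> with every \<open>P i\<close> projective, where the
  differential \<open>D i\<close> goes from \<open>P (i + 1)\<close> to \<open>P i\<close> and \<open>e\<close> is the augmentation. Nothing is required
  of the kernel of the leftmost map.\<close>

definition partial_proj_resolution ::
  "('a, 'e) ring_scheme \<Rightarrow> ('a, 'n, 'h) module_scheme \<Rightarrow> nat \<Rightarrow>
    (nat \<Rightarrow> ('a, 'm, 'f) module_scheme) \<Rightarrow> (nat \<Rightarrow> 'm \<Rightarrow> 'm) \<Rightarrow> ('m \<Rightarrow> 'n) \<Rightarrow> bool"
  where "partial_proj_resolution A M n P D e \<longleftrightarrow>
    (\<forall>i\<le>n. projective A (P i)) \<and>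
    e \<in> mod_hom A (P 0) M \<and> e ` carrier (P 0) = carrier M \<and>
    (\<forall>i<n. D i \<in> mod_hom A (P (Suc i)) (P i)) \<and>
    (0 < n \<longrightarrow> D 0 ` carrier (P 1) = a_kernel (P 0) M e) \<and>
    (\<forall>i. Suc i < n \<longrightarrow>
      D (Suc i) ` carrier (P (Suc (Suc i))) = a_kernel (P (Suc i)) (P i) (D i))"


section \<open>Group rings and finiteness conditions on groups\<close>

definition group_ring :: "('r, 'e) ring_scheme \<Rightarrow> ('g, 'f) monoid_scheme \<Rightarrow> ('g \<Rightarrow> 'r) ring"
  where "group_ring R G =
    \<lparr>carrier = finsupp R (carrier G),
     mult = (\<lambda>a b g. if g \<in> carrier G
       then \<Oplus>\<^bsub>R\<^esub>h\<in>{h \<in> carrier G. a h \<noteq> \<zero>\<^bsub>R\<^esub>}. a h \<otimes>\<^bsub>R\<^esub> b (inv\<^bsub>G\<^esub> h \<otimes>\<^bsub>G\<^esub> g) else \<zero>\<^bsub>R\<^esub>),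
     one = basis_elem R \<one>\<^bsub>G\<^esub>, zero = (\<lambda>_. \<zero>\<^bsub>R\<^esub>), add = (\<lambda>a b g. a g \<oplus>\<^bsub>R\<^esub> b g)\<rparr>"

definition regular_module :: "'a ring \<Rightarrow> ('a, 'a) module"
  where "regular_module A =
    \<lparr>carrier = carrier A, mult = mult A, one = one A, zero = zero A, add = add A, smult = mult A\<rparr>"

text \<open>\<open>R\<close> with trivial action of \<open>G\<close>: a group ring element acts through its augmentation.\<close>

definition trivial_module :: "('r, 'e) ring_scheme \<Rightarrow> ('g \<Rightarrow> 'r, 'r) module"
  where "trivial_module R =
    \<lparr>carrier = carrier R, mult = mult R, one = one R, zero = zero R, add = add R,
     smult = (\<lambda>a r. (\<Oplus>\<^bsub>R\<^esub>g\<in>{g. a g \<noteq> \<zero>\<^bsub>R\<^esub>}. a g) \<otimes>\<^bsub>R\<^esub> r)\<rparr>"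

text \<open>A definition cannot quantify over all types, so the modules in a resolution have to live in a
  fixed type. The type \<^typ>\<open>'g list \<Rightarrow> 'g \<Rightarrow> 'r\<close> contains the free modules on sets of lists over \<open>G\<close>.
  This is no restriction. Any finitely generated projective module is a summand of a free module on
  finitely many lists. If the trivial module has a projective resolution of length \<open>n > 0\<close>, then by
  Schanuel's lemma it has one consisting of the first \<open>n\<close> terms of the bar resolution (which are free
  on lists) and a kernel contained in the last of these; for \<open>n = 0\<close> it is itself projective.\<close>

definition has_proj_resolution_of_length ::
  "('r, 'e) ring_scheme \<Rightarrow> ('g, 'f) monoid_scheme \<Rightarrow> nat \<Rightarrow> bool"
  where "has_proj_resolution_of_length R G n \<longleftrightarrow>
    (\<exists>(P :: nat \<Rightarrow> ('g \<Rightarrow> 'r, 'g list \<Rightarrow> 'g \<Rightarrow> 'r) module) D e.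
      partial_proj_resolution (group_ring R G) (trivial_module R) (Suc n) P D e \<and>
      carrier (P (Suc n)) = {\<zero>\<^bsub>P (Suc n)\<^esub>})"

definition cohomological_dim :: "('r, 'e) ring_scheme \<Rightarrow> ('g, 'f) monoid_scheme \<Rightarrow> enat"
  where "cohomological_dim R G = (INF n \<in> {n. has_proj_resolution_of_length R G n}. enat n)"

definition type_FP :: "('r, 'e) ring_scheme \<Rightarrow> ('g, 'f) monoid_scheme \<Rightarrow> nat \<Rightarrow> bool"
  where "type_FP R G n \<longleftrightarrow>
    (\<exists>(P :: nat \<Rightarrow> ('g \<Rightarrow> 'r, 'g list \<Rightarrow> 'g \<Rightarrow> 'r) module) D e.
      partial_proj_resolution (group_ring R G) (trivial_module R) n P D e \<and>
      (\<forall>i\<le>n. fin_gen_module (group_ring R G) (P i)))"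


section \<open>Group cohomology\<close>

text \<open>Inhomogeneous cochains with values in a module \<open>M\<close> over the group ring; a \<open>k\<close>-cochain is a
  function on lists of length \<open>k\<close>. The base ring \<open>R\<close> acts through its image in the group ring.\<close>

definition cochains ::
  "('r, 'e) ring_scheme \<Rightarrow> ('g, 'f) monoid_scheme \<Rightarrow> ('g \<Rightarrow> 'r, 'm, 'h) module_scheme \<Rightarrow> nat \<Rightarrow>
    ('r, 'g list \<Rightarrow> 'm) module"
  where "cochains R G M k =
    \<lparr>carrier = {c. \<forall>xs. if xs \<in> lists (carrier G) \<and> length xs = k
       then c xs \<in> carrier M else c xs = \<zero>\<^bsub>M\<^esub>},
     mult = undefined, one = undefined, zero = (\<lambda>_. \<zero>\<^bsub>M\<^esub>),
     add = (\<lambda>c d xs. c xs \<oplus>\<^bsub>M\<^esub> d xs),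
     smult = (\<lambda>r c xs. (\<lambda>g. if g = \<one>\<^bsub>G\<^esub> then r else \<zero>\<^bsub>R\<^esub>) \<odot>\<^bsub>M\<^esub> c xs)\<rparr>"

definition alt_sign :: "('m, 'h) ring_scheme \<Rightarrow> nat \<Rightarrow> 'm \<Rightarrow> 'm"
  where "alt_sign M i x = (if even i then x else \<ominus>\<^bsub>M\<^esub> x)"

definition merge_at :: "('g, 'f) monoid_scheme \<Rightarrow> nat \<Rightarrow> 'g list \<Rightarrow> 'g list"
  where "merge_at G i xs = take i xs @ [xs ! i \<otimes>\<^bsub>G\<^esub> xs ! Suc i] @ drop (i + 2) xs"

definition coboundary ::
  "('r, 'e) ring_scheme \<Rightarrow> ('g, 'f) monoid_scheme \<Rightarrow> ('g \<Rightarrow> 'r, 'm, 'h) module_scheme \<Rightarrow> nat \<Rightarrow>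
    ('g list \<Rightarrow> 'm) \<Rightarrow> 'g list \<Rightarrow> 'm"
  where "coboundary R G M k c = (\<lambda>xs. if xs \<in> lists (carrier G) \<and> length xs = Suc k
    then basis_elem R (hd xs) \<odot>\<^bsub>M\<^esub> c (tl xs) \<oplus>\<^bsub>M\<^esub>
      (\<Oplus>\<^bsub>M\<^esub>i\<in>{..<k}. alt_sign M (Suc i) (c (merge_at G i xs))) \<oplus>\<^bsub>M\<^esub>
      alt_sign M (Suc k) (c (butlast xs))
    else \<zero>\<^bsub>M\<^esub>)"

definition cocycles ::
  "('r, 'e) ring_scheme \<Rightarrow> ('g, 'f) monoid_scheme \<Rightarrow> ('g \<Rightarrow> 'r, 'm, 'h) module_scheme \<Rightarrow> nat \<Rightarrow>
    ('g list \<Rightarrow> 'm) set"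
  where "cocycles R G M k =
    {c \<in> carrier (cochains R G M k). coboundary R G M k c = (\<lambda>_. \<zero>\<^bsub>M\<^esub>)}"

fun coboundaries ::
  "('r, 'e) ring_scheme \<Rightarrow> ('g, 'f) monoid_scheme \<Rightarrow> ('g \<Rightarrow> 'r, 'm, 'h) module_scheme \<Rightarrow> nat \<Rightarrow>
    ('g list \<Rightarrow> 'm) set"
  where
    "coboundaries R G M 0 = {\<lambda>_. \<zero>\<^bsub>M\<^esub>}"
  | "coboundaries R G M (Suc k) = coboundary R G M k ` carrier (cochains R G M k)"

definition cohomology ::
  "('r, 'e) ring_scheme \<Rightarrow> ('g, 'f) monoid_scheme \<Rightarrow> ('g \<Rightarrow> 'r, 'm, 'h) module_scheme \<Rightarrow> nat \<Rightarrow>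
    ('r, ('g list \<Rightarrow> 'm) set) module"
  where "cohomology R G M k =
    quotient_module (cochains R G M k \<lparr>carrier := cocycles R G M k\<rparr>) (coboundaries R G M k)"


section \<open>Tensor products and flatness over a commutative ring\<close>

definition tensor_relations ::
  "('r, 'e) ring_scheme \<Rightarrow> ('r, 'm, 'f) module_scheme \<Rightarrow> ('r, 'n, 'h) module_scheme \<Rightarrow>
    ('m \<times> 'n \<Rightarrow> 'r) set"
  where "tensor_relations R M N =
    (let L = free_module R (carrier M \<times> carrier N); b = basis_elem R in
      {b (x \<oplus>\<^bsub>M\<^esub> x', y) \<ominus>\<^bsub>L\<^esub> (b (x, y) \<oplus>\<^bsub>L\<^esub> b (x', y)) | x x' y.
        x \<in> carrier M \<and> x' \<in> carrier M \<and> y \<in> carrier N} \<union>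
      {b (x, y \<oplus>\<^bsub>N\<^esub> y') \<ominus>\<^bsub>L\<^esub> (b (x, y) \<oplus>\<^bsub>L\<^esub> b (x, y')) | x y y'.
        x \<in> carrier M \<and> y \<in> carrier N \<and> y' \<in> carrier N} \<union>
      {b (r \<odot>\<^bsub>M\<^esub> x, y) \<ominus>\<^bsub>L\<^esub> r \<odot>\<^bsub>L\<^esub> b (x, y) | r x y.
        r \<in> carrier R \<and> x \<in> carrier M \<and> y \<in> carrier N} \<union>
      {b (x, r \<odot>\<^bsub>N\<^esub> y) \<ominus>\<^bsub>L\<^esub> r \<odot>\<^bsub>L\<^esub> b (x, y) | r x y.
        r \<in> carrier R \<and> x \<in> carrier M \<and> y \<in> carrier N})"

definition tensor_kernel ::
  "('r, 'e) ring_scheme \<Rightarrow> ('r, 'm, 'f) module_scheme \<Rightarrow> ('r, 'n, 'h) module_scheme \<Rightarrow>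
    ('m \<times> 'n \<Rightarrow> 'r) set"
  where "tensor_kernel R M N =
    \<Inter>{H. submodule H R (free_module R (carrier M \<times> carrier N)) \<and> tensor_relations R M N \<subseteq> H}"

definition tensor_product ::
  "('r, 'e) ring_scheme \<Rightarrow> ('r, 'm, 'f) module_scheme \<Rightarrow> ('r, 'n, 'h) module_scheme \<Rightarrow>
    ('r, ('m \<times> 'n \<Rightarrow> 'r) set) module"
  where "tensor_product R M N =
    quotient_module (free_module R (carrier M \<times> carrier N)) (tensor_kernel R M N)"

definition free_map :: "('a, 'e) ring_scheme \<Rightarrow> ('x \<Rightarrow> 'y) \<Rightarrow> ('x \<Rightarrow> 'a) \<Rightarrow> 'y \<Rightarrow> 'a"
  where "free_map A f u = (\<lambda>y. \<Oplus>\<^bsub>A\<^esub>x\<in>{x. u x \<noteq> \<zero>\<^bsub>A\<^esub> \<and> f x = y}. u x)"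

text \<open>The map from \<open>M \<otimes> N\<close> to \<open>M \<otimes> N'\<close> induced by \<open>f\<close>, sending \<open>x \<otimes> y\<close> to \<open>x \<otimes> f y\<close>.\<close>

definition tensor_map ::
  "('r, 'e) ring_scheme \<Rightarrow> ('r, 'm, 'f) module_scheme \<Rightarrow> ('r, 'n', 'h) module_scheme \<Rightarrow>
    ('n \<Rightarrow> 'n') \<Rightarrow> ('m \<times> 'n \<Rightarrow> 'r) set \<Rightarrow> ('m \<times> 'n' \<Rightarrow> 'r) set"
  where "tensor_map R M N' f X =
    (\<Union>u\<in>X. tensor_kernel R M N' +>\<^bsub>free_module R (carrier M \<times> carrier N')\<^esub>
      free_map R (map_prod id f) u)"

text \<open>The type argument is the type of elements of the test modules; a statement in which it is a free
  type variable asserts flatness against all modules.\<close>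

definition flat_module ::
  "'n itself \<Rightarrow> ('r, 'e) ring_scheme \<Rightarrow> ('r, 'm, 'f) module_scheme \<Rightarrow> bool"
  where "flat_module T R M \<longleftrightarrow> Module.module R M \<and>
    (\<forall>(N :: ('r, 'n) module) (N' :: ('r, 'n) module) f.
      Module.module R N \<and> Module.module R N' \<and> f \<in> mod_hom R N N' \<and> inj_on f (carrier N) \<longrightarrow>
      inj_on (tensor_map R M N' f) (carrier (tensor_product R M N)))"


section \<open>Semiduality groups\<close>

text \<open>Type \<open>FP\<close> in degree \<open>-1\<close> is an empty condition, hence the guard \<open>0 < d\<close>.\<close>

definition semiduality_group ::
  "'n itself \<Rightarrow> ('r, 'e) ring_scheme \<Rightarrow> ('g, 'f) monoid_scheme \<Rightarrow> nat \<Rightarrow> bool"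
  where "semiduality_group T R G d \<longleftrightarrow> cring R \<and> group G \<and>
    cohomological_dim R G \<le> enat d \<and>
    (0 < d \<longrightarrow> type_FP R G (d - 1)) \<and>
    (\<forall>k. k \<noteq> d \<longrightarrow>
      carrier (cohomology R G (regular_module (group_ring R G)) k) =
        {\<zero>\<^bsub>cohomology R G (regular_module (group_ring R G)) k\<^esub>}) \<and>
    flat_module T R (cohomology R G (regular_module (group_ring R G)) d)"


section \<open>Lamplighter groups\<close>

definition semidirect_product ::
  "('n, 'e) monoid_scheme \<Rightarrow> ('h, 'f) monoid_scheme \<Rightarrow> ('h \<Rightarrow> 'n \<Rightarrow> 'n) \<Rightarrow> ('n \<times> 'h) monoid"
  where "semidirect_product N H act =
    \<lparr>carrier = carrier N \<times> carrier H,
     mult = (\<lambda>(x, h) (y, k). (x \<otimes>\<^bsub>N\<^esub> act h y, h \<otimes>\<^bsub>H\<^esub> k)),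
     one = (\<one>\<^bsub>N\<^esub>, \<one>\<^bsub>H\<^esub>)\<rparr>"

definition shift :: "int \<Rightarrow> (int \<Rightarrow> 'a) \<Rightarrow> int \<Rightarrow> 'a"
  where "shift n f = (\<lambda>i. f (i - n))"

definition lamplighter_group :: "('a, 'e) monoid_scheme \<Rightarrow> ((int \<Rightarrow> 'a) \<times> int) monoid"
  where "lamplighter_group F =
    semidirect_product (sum_group (UNIV :: int set) (\<lambda>_. F)) integer_group shift"

definition int_localization :: "nat \<Rightarrow> rat ring"
  where "int_localization n =
    \<lparr>carrier = {of_int a / of_nat n ^ k | a k. True}, mult = (*), one = 1, zero = 0, add = (+)\<rparr>"

end

theory Submission
  imports Defs "HOL-Library.Function_Algebras"
begin

text \<open>Let \<open>R = \<int>[1/|F|]\<close>. The base group is the union of the finite subgroups \<open>D j\<close> of lamp configurations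
  supported on \<open>[- j, j]\<close>, over which one can average with coefficients in \<open>R\<close>. Hence functions on the coset
  spaces of the \<open>D j\<close> are acyclic coefficients. Passing to functions on the cosets of the base group raises the
  cohomological dimension by one, and so does passing to the whole group, so cohomology vanishes above degree two.
  On the side of chains, let \<open>Y\<close> be the disjoint union of the coset spaces of the \<open>D j\<close>. The projections to the
  next coset space and the right multiplication by the generator \<open>t\<close> of the shift induce commuting endomorphisms
  \<open>\<alpha>\<close> and \<open>\<beta>\<close> of the projective module \<open>R[Y]\<close>, and the Koszul complex of \<open>1 - \<alpha>\<close> and \<open>1 - \<beta>\<close> resolves \<open>R\<close>.

  The group has one end, so that every derivation with values in its group ring over \<open>R / r\<close> is inner. For
  \<open>r = 0\<close> this is the vanishing of the first cohomology; for \<open>r \<noteq> 0\<close> it shows that the second cohomology has no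
  \<open>r\<close>-torsion. Finally, a torsion-free module over the principal ideal domain \<open>R\<close> is flat, since finitely many of
  its elements lie in a submodule with a finite basis.\<close>

section \<open>Cochain complexes with concrete coefficients\<close>

text \<open>Cohomology is defined by bar cochains, cohomological dimension by projective
  resolutions. The two are never compared: averaging is carried out once on cochains and once on
  chains.

  On cochains each passage costs one degree. Functions on the cosets of the base group form the
  intersection of a decreasing chain of acyclic modules; the obstruction is a derived limit, killed
  by summing infinite tails. Constants are the kernel of (right translation by \<open>t\<close>)
  minus the identity on these functions, and this map is onto.

  On chains the picture is a mapping telescope: \<open>1 - \<alpha>\<close> is injective, and its
  cokernel is the module of chains on the cosets of the base group, that is
  \<open>R[\<int>]\<close>. There \<open>\<beta>\<close> acts as the shift, so that
  \<open>1 - \<beta>\<close> is injective with cokernel \<open>R\<close>.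

  The lamps need at least two states: for trivial \<open>F\<close> the group is infinite cyclic,
  which has two ends and nonzero first cohomology with group ring coefficients. A lit lamp far from
  everything else is what makes the group one-ended.\<close>

definition tuples :: "('g, 'b) monoid_scheme \<Rightarrow> nat \<Rightarrow> 'g list set"
  where "tuples G k = {xs \<in> lists (carrier G). length xs = k}"

definition signed :: "nat \<Rightarrow> 'v \<Rightarrow> 'v::ab_group_add"
  where "signed i x = (if even i then x else - x)"

text \<open>Counterpart of \<open>coboundary\<close> for coefficients in a type of class
  \<open>ab_group_add\<close>, where signs and sums are those of the type. There is no guard: values
  off \<open>tuples G (Suc k)\<close> are meaningless, hence the membership hypotheses in the lemmas
  below.\<close>

definition cob :: "('g, 'b) monoid_scheme \<Rightarrow> ('g \<Rightarrow> 'v \<Rightarrow> 'v) \<Rightarrow> nat \<Rightarrow> ('g list \<Rightarrow> 'v::ab_group_add) \<Rightarrow> 'g list \<Rightarrow> 'v"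
  where "cob G act k c xs = act (hd xs) (c (tl xs)) +
    (\<Sum>i<k. signed (Suc i) (c (merge_at G i xs))) + signed (Suc k) (c (butlast xs))"

lemma signed_diff: "signed i (x - y) = signed i x - signed i y"
  and signed_zero [simp]: "signed i 0 = 0"
  and signed_Suc: "signed (Suc i) x = - signed i x"
  by (auto simp: signed_def)

lemma signed_0 [simp]: "signed 0 x = x"
  by (simp add: signed_def)

lemma signed_apply: "signed i F w = signed i (F w)"
  by (simp add: signed_def)

lemma sum_apply: "sum f S w = (\<Sum>i\<in>S. f i w)"
  by (induction S rule: infinite_finite_induct) auto

lemma merge_at_0 [simp]: "merge_at G 0 (x # y # xs) = (x \<otimes>\<^bsub>G\<^esub> y) # xs"
  by (simp add: merge_at_def)

lemma merge_at_Suc [simp]: "merge_at G (Suc i) (x # xs) = x # merge_at G i xs"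
  by (simp add: merge_at_def)

lemma (in monoid) tuples_tl: "xs \<in> tuples G (Suc k) \<Longrightarrow> tl xs \<in> tuples G k"
  by (cases xs) (auto simp: tuples_def)

lemma (in monoid) tuples_hd: "xs \<in> tuples G (Suc k) \<Longrightarrow> hd xs \<in> carrier G"
  by (cases xs) (auto simp: tuples_def)

lemma (in monoid) tuples_butlast: "xs \<in> tuples G (Suc k) \<Longrightarrow> butlast xs \<in> tuples G k"
  by (auto simp: tuples_def dest: in_set_butlastD)

lemma (in monoid) tuples_merge: "xs \<in> tuples G (Suc k) \<Longrightarrow> i < k \<Longrightarrow> merge_at G i xs \<in> tuples G k"
  by (auto simp: tuples_def merge_at_def dest: in_set_takeD in_set_dropD)

lemma tuples_Cons: "x # xs \<in> tuples G (Suc k) \<longleftrightarrow> x \<in> carrier G \<and> xs \<in> tuples G k"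
  by (auto simp: tuples_def)

lemma (in monoid) cob_cong:
  assumes "xs \<in> tuples G (Suc k)" "\<And>ys. ys \<in> tuples G k \<Longrightarrow> c ys = d ys"
  shows "cob G act k c xs = cob G act k d xs"
  using assms unfolding cob_def
  by (intro arg_cong2[of _ _ _ _ "(+)"] arg_cong2[of _ _ _ _ act] sum.cong arg_cong[of _ _ "signed _"])
    (auto simp: tuples_tl tuples_butlast tuples_merge)

text \<open>\<open>M\<close> is a subgroup of a type rather than the whole type: the coefficient
  modules \<open>coind\<close>, \<open>E j\<close> and \<open>E_inf\<close> below are nested subsets
  of one function type with one action.\<close>

locale G_module = group G for G (structure) +
  fixes act :: "'a \<Rightarrow> 'v \<Rightarrow> 'v::ab_group_add" and M :: "'v set"
  assumes zero_mem [simp]: "0 \<in> M"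
    and diff_mem: "\<lbrakk>x \<in> M; y \<in> M\<rbrakk> \<Longrightarrow> x - y \<in> M"
    and act_mem: "\<lbrakk>g \<in> carrier G; x \<in> M\<rbrakk> \<Longrightarrow> act g x \<in> M"
    and act_diff: "\<lbrakk>g \<in> carrier G; x \<in> M; y \<in> M\<rbrakk> \<Longrightarrow> act g (x - y) = act g x - act g y"
    and act_mult: "\<lbrakk>g \<in> carrier G; h \<in> carrier G; x \<in> M\<rbrakk> \<Longrightarrow> act (g \<otimes> h) x = act g (act h x)"
    and act_one: "x \<in> M \<Longrightarrow> act \<one> x = x"
begin

lemma uminus_mem: "x \<in> M \<Longrightarrow> - x \<in> M"
  using diff_mem[of 0 x] by simp

lemma add_mem: "\<lbrakk>x \<in> M; y \<in> M\<rbrakk> \<Longrightarrow> x + y \<in> M"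
  using diff_mem[of x "- y"] uminus_mem by simp

lemma sum_mem: "(\<And>i. i \<in> S \<Longrightarrow> f i \<in> M) \<Longrightarrow> sum f S \<in> M"
  by (induction S rule: infinite_finite_induct) (auto intro: add_mem)

lemma signed_mem: "x \<in> M \<Longrightarrow> signed i x \<in> M"
  by (auto simp: signed_def uminus_mem)

lemma act_zero: "g \<in> carrier G \<Longrightarrow> act g 0 = 0"
  using act_diff[of g 0 0] by simp

lemma act_uminus: "\<lbrakk>g \<in> carrier G; x \<in> M\<rbrakk> \<Longrightarrow> act g (- x) = - act g x"
  using act_diff[of g 0 x] by (simp add: act_zero)

lemma act_add: "\<lbrakk>g \<in> carrier G; x \<in> M; y \<in> M\<rbrakk> \<Longrightarrow> act g (x + y) = act g x + act g y"
  using act_diff[of g x "- y"] by (simp add: act_uminus uminus_mem)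

lemma act_signed: "\<lbrakk>g \<in> carrier G; x \<in> M\<rbrakk> \<Longrightarrow> act g (signed i x) = signed i (act g x)"
  by (auto simp: signed_def act_uminus)

lemma act_sum: "\<lbrakk>g \<in> carrier G; \<And>i. i \<in> S \<Longrightarrow> f i \<in> M\<rbrakk> \<Longrightarrow> act g (sum f S) = (\<Sum>i\<in>S. act g (f i))"
  by (induction S rule: infinite_finite_induct) (auto simp: act_zero act_add sum_mem)

lemma act_inv: "\<lbrakk>g \<in> carrier G; x \<in> M\<rbrakk> \<Longrightarrow> act g (act (inv g) x) = x"
  using act_mult[of g "inv g" x] by (simp add: act_one)

lemma cob_mem:
  assumes "xs \<in> tuples G (Suc k)" "\<And>ys. ys \<in> tuples G k \<Longrightarrow> c ys \<in> M"
  shows "cob G act k c xs \<in> M"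
  unfolding cob_def using assms
  by (intro add_mem sum_mem signed_mem act_mem) (auto simp: tuples_tl tuples_hd tuples_butlast tuples_merge)

lemma cob_diff:
  assumes "xs \<in> tuples G (Suc k)" "\<And>ys. ys \<in> tuples G k \<Longrightarrow> c ys \<in> M" "\<And>ys. ys \<in> tuples G k \<Longrightarrow> d ys \<in> M"
  shows "cob G act k (\<lambda>ys. c ys - d ys) xs = cob G act k c xs - cob G act k d xs"
  unfolding cob_def using assms
  by (simp add: act_diff tuples_tl tuples_hd signed_diff sum_subtractf)

lemma cob_zero:
  assumes "xs \<in> tuples G (Suc k)"
  shows "cob G act k (\<lambda>_. 0) xs = 0"
  using cob_diff[of xs k "\<lambda>_. 0" "\<lambda>_. 0"] assms by simp

text \<open>Coefficient maps induce cochain maps. The map \<open>\<theta>\<close> will be an average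
  over a finite subgroup, a right translation, the inclusion of the constants or a scalar
  multiplication.\<close>

lemma cob_equivariant:
  assumes "xs \<in> tuples G (Suc k)" "\<And>ys. ys \<in> tuples G k \<Longrightarrow> c ys \<in> M"
    and add: "\<And>x y. \<lbrakk>x \<in> M; y \<in> M\<rbrakk> \<Longrightarrow> \<theta> (x - y) = \<theta> x - \<theta> y"
    and eq: "\<And>g x. \<lbrakk>g \<in> carrier G; x \<in> M\<rbrakk> \<Longrightarrow> \<theta> (act g x) = act' g (\<theta> x)"
  shows "cob G act' k (\<lambda>ys. \<theta> (c ys)) xs = \<theta> (cob G act k c xs)"
proof -
  have z: "\<theta> 0 = 0"
    using add[of 0 0] by simp
  have m: "\<theta> (- x) = - \<theta> x" if "x \<in> M" for x
    using add[of 0 x] that by (simp add: z)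
  have a: "\<theta> (x + y) = \<theta> x + \<theta> y" if "x \<in> M" "y \<in> M" for x y
    using add[of x "- y"] that by (simp add: m uminus_mem)
  have s: "\<theta> (signed i x) = signed i (\<theta> x)" if "x \<in> M" for x i
    using that by (simp add: signed_def m)
  have S: "\<theta> (sum f S) = (\<Sum>i\<in>S. \<theta> (f i))" if "\<And>i. i \<in> S \<Longrightarrow> f i \<in> M" for f and S :: "nat set"
    using that by (induction S rule: infinite_finite_induct) (auto simp: z a sum_mem)
  have mem: "c (tl xs) \<in> M" "c (butlast xs) \<in> M" "i < k \<Longrightarrow> c (merge_at G i xs) \<in> M" for i
    using assms(1,2) by (auto simp: tuples_tl tuples_butlast tuples_merge)
  have mem': "act (hd xs) (c (tl xs)) \<in> M" "(\<Sum>i<k. signed (Suc i) (c (merge_at G i xs))) \<in> M"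
    "signed (Suc k) (c (butlast xs)) \<in> M"
    using mem assms(1) by (auto intro: sum_mem signed_mem act_mem tuples_hd)
  have "\<theta> (\<Sum>i<k. signed (Suc i) (c (merge_at G i xs))) = (\<Sum>i<k. signed (Suc i) (\<theta> (c (merge_at G i xs))))"
    using mem by (subst S) (auto intro: signed_mem simp: s)
  then show ?thesis
    using mem mem' tuples_hd[OF assms(1)] by (simp add: cob_def a s eq add_mem)
qed

subsection \<open>Coinduced modules\<close>

definition coind :: "('a \<Rightarrow> 'v) set"
  where "coind = {F. (\<forall>x\<in>carrier G. F x \<in> M) \<and> (\<forall>x. x \<notin> carrier G \<longrightarrow> F x = 0)}"

text \<open>The diagonal action. Right translations of the argument commute with it, which is why
  right cosets \<open>x D j\<close> and right multiplication by \<open>t\<close> give submodules and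
  endomorphisms.\<close>

definition coind_act :: "'a \<Rightarrow> ('a \<Rightarrow> 'v) \<Rightarrow> 'a \<Rightarrow> 'v"
  where "coind_act g F = (\<lambda>x. if x \<in> carrier G then act g (F (inv g \<otimes> x)) else 0)"

lemma coind_apply: "F \<in> coind \<Longrightarrow> x \<in> carrier G \<Longrightarrow> F x \<in> M"
  by (auto simp: coind_def)

lemma coind_outside: "F \<in> coind \<Longrightarrow> x \<notin> carrier G \<Longrightarrow> F x = 0"
  by (auto simp: coind_def)

lemma coind_eqI: "\<lbrakk>F \<in> coind; H \<in> coind; \<And>x. x \<in> carrier G \<Longrightarrow> F x = H x\<rbrakk> \<Longrightarrow> F = H"
  by (metis coind_outside ext)

lemma G_module_coinduced: "G_module G coind_act coind"
proof
  show "coind_act (g \<otimes> h) x = coind_act g (coind_act h x)" if "g \<in> carrier G" "h \<in> carrier G" "x \<in> coind" for g h x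
    using that by (auto simp: coind_act_def fun_eq_iff act_mult coind_apply inv_mult_group m_assoc)
  show "coind_act \<one> x = x" if "x \<in> coind" for x
    using that by (auto simp: coind_act_def fun_eq_iff act_one coind_apply coind_outside)
qed (auto simp: coind_def coind_act_def diff_mem act_mem act_diff)

definition contract :: "('a list \<Rightarrow> 'a \<Rightarrow> 'v) \<Rightarrow> 'a list \<Rightarrow> 'a \<Rightarrow> 'v"
  where "contract c xs = (\<lambda>w. if w \<in> carrier G then act w (c (inv w # xs) \<one>) else 0)"

lemma contract_mem:
  assumes "xs \<in> tuples G k" "\<And>ys. ys \<in> tuples G (Suc k) \<Longrightarrow> c ys \<in> coind"
  shows "contract c xs \<in> coind"
  using assms by (auto simp: contract_def coind_def act_mem tuples_Cons)

text \<open>In homogeneous notation the contraction inserts \<open>w\<close> in front of the arguments of the value at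
  \<open>w\<close>.\<close>

lemma contract_homotopy:
  assumes xs: "xs \<in> tuples G (Suc m)" and c: "\<And>ys. ys \<in> tuples G (Suc m) \<Longrightarrow> c ys \<in> coind"
  shows "contract (cob G coind_act (Suc m) c) xs + cob G coind_act m (contract c) xs = c xs"
proof
  interpret co: G_module G coind_act coind by (rule G_module_coinduced)
  fix w
  obtain x xs' where xs_eq: "xs = x # xs'" and x: "x \<in> carrier G" and xs': "xs' \<in> tuples G m"
    using xs by (cases xs) (auto simp: tuples_def)
  show "(contract (cob G coind_act (Suc m) c) xs + cob G coind_act m (contract c) xs) w = c xs w"
  proof (cases "w \<in> carrier G")
    case False
    then have "cob G coind_act m (contract c) xs w = 0" "c xs w = 0"
      using co.cob_mem[OF xs, of "contract c"] c xs contract_mem[of _ m c] by (auto intro: coind_outside)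
    then show ?thesis
      using False by (simp add: contract_def)
  next
    case w: True
    let ?w = "inv w"
    have cM: "c ys \<one> \<in> M" if "ys \<in> tuples G (Suc m)" for ys
      using c[OF that] by (simp add: coind_apply)
    have bl: "butlast (?w # xs) = ?w # butlast xs"
      by (simp add: xs_eq)
    have blm: "?w # butlast xs \<in> tuples G (Suc m)"
      using xs w by (simp add: tuples_Cons tuples_butlast)
    have mm: "?w # merge_at G i xs \<in> tuples G (Suc m)" if "i < m" for i
      using xs w that by (simp add: tuples_Cons tuples_merge)
    have m0: "(?w \<otimes> x) # xs' \<in> tuples G (Suc m)"
      using x xs' w by (simp add: tuples_Cons)
    have SM: "(\<Sum>i<m. signed (Suc (Suc i)) (c (?w # merge_at G i xs) \<one>)) \<in> M"
      using mm cM by (intro sum_mem signed_mem) auto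
    have aS: "act w (\<Sum>i<m. signed (Suc (Suc i)) (c (?w # merge_at G i xs) \<one>)) =
        (\<Sum>i<m. signed (Suc (Suc i)) (act w (c (?w # merge_at G i xs) \<one>)))"
      using mm cM w by (subst act_sum) (auto intro: signed_mem simp: act_signed)
    have "cob G coind_act (Suc m) c (?w # xs) \<one> =
        act ?w (c xs w) - c ((?w \<otimes> x) # xs') \<one> + (\<Sum>i<m. signed (Suc (Suc i)) (c (?w # merge_at G i xs) \<one>))
        + signed (Suc (Suc m)) (c (?w # butlast xs) \<one>)"
      by (simp add: cob_def sum.lessThan_Suc_shift bl coind_act_def w signed_apply sum_apply xs_eq del: sum.lessThan_Suc)
        (simp add: signed_def)
    then have "contract (cob G coind_act (Suc m) c) xs w =
        act w (act ?w (c xs w)) - act w (c ((?w \<otimes> x) # xs') \<one>)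
        + (\<Sum>i<m. signed (Suc (Suc i)) (act w (c (?w # merge_at G i xs) \<one>)))
        + signed (Suc (Suc m)) (act w (c (?w # butlast xs) \<one>))"
      using w cM[OF blm] cM[OF m0] SM coind_apply[OF c[OF xs] w] cM[OF mm]
      by (simp add: contract_def act_add act_diff aS act_signed add_mem diff_mem signed_mem act_mem)
    also have "act w (act ?w (c xs w)) = c xs w"
      using act_inv[OF w] coind_apply[OF c[OF xs] w] by simp
    finally have 1: "contract (cob G coind_act (Suc m) c) xs w =
        c xs w - act w (c ((?w \<otimes> x) # xs') \<one>)
        + (\<Sum>i<m. signed (Suc (Suc i)) (act w (c (?w # merge_at G i xs) \<one>)))
        + signed (Suc (Suc m)) (act w (c (?w # butlast xs) \<one>))" .
    \<comment> \<open>Here the action of \<open>x\<close> moves the evaluation point to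
      \<open>inv x \<otimes> w\<close>, so the inserted entry becomes
      \<open>inv w \<otimes> x\<close>. This term cancels the first inner face of the other summand;
      the remaining faces cancel because the inserted entry shifts their position, and thus their
      sign, by one.\<close>
    have "cob G coind_act m (contract c) xs w = act x (act (inv x \<otimes> w) (c (inv (inv x \<otimes> w) # xs') \<one>))
        + (\<Sum>i<m. signed (Suc i) (act w (c (?w # merge_at G i xs) \<one>)))
        + signed (Suc m) (act w (c (?w # butlast xs) \<one>))"
      using w x by (simp add: cob_def coind_act_def contract_def signed_apply sum_apply xs_eq)
    also have "inv (inv x \<otimes> w) = ?w \<otimes> x"
      using w x by (simp add: inv_mult_group)
    also have "act x (act (inv x \<otimes> w) (c ((?w \<otimes> x) # xs') \<one>)) = act w (c ((?w \<otimes> x) # xs') \<one>)"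
      using w x cM[OF m0] act_mult[of x "inv x \<otimes> w"] by (simp add: m_assoc[symmetric])
    finally show ?thesis
      using 1 by (simp add: signed_Suc sum_negf)
  qed
qed

text \<open>The homotopy formula turns \<open>\<delta>\<^sub>k \<delta>\<^sub>k\<^sub>-\<^sub>1 = 0\<close> into \<open>h \<delta>\<^sub>k\<^sub>+\<^sub>1 \<delta>\<^sub>k = 0\<close>, which
  is the vanishing of \<open>\<delta>\<^sub>k\<^sub>+\<^sub>1 \<delta>\<^sub>k\<close> at the unit; right translations reach the other points.\<close>

lemma cob_cob_coinduced:
  assumes "xs \<in> tuples G (Suc (Suc k))" "\<And>ys. ys \<in> tuples G k \<Longrightarrow> c ys \<in> coind"
  shows "cob G coind_act (Suc k) (cob G coind_act k c) xs = 0"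
  using assms
proof (induction k arbitrary: c xs)
  interpret co: G_module G coind_act coind by (rule G_module_coinduced)
  case 0
  then obtain x y where xy: "xs = [x, y]" "x \<in> carrier G" "y \<in> carrier G"
    by (auto simp: tuples_def length_Suc_conv)
  have c: "c [] \<in> coind"
    using 0 by (simp add: tuples_def)
  show ?case
    unfolding xy(1) using c xy(2,3) co.act_diff[of x "coind_act y (c [])" "c []"]
    by (simp add: cob_def signed_def co.act_mult co.act_mem fun_diff_def fun_eq_iff)
next
  interpret co: G_module G coind_act coind by (rule G_module_coinduced)
  case (Suc k)
  let ?d = "\<lambda>k. cob G coind_act k"
  have at_one: "?d (Suc (Suc k)) (?d (Suc k) c) ys \<one> = 0"
    if ys: "ys \<in> tuples G (Suc (Suc (Suc k)))" and c: "\<And>ys. ys \<in> tuples G (Suc k) \<Longrightarrow> c ys \<in> coind" for c ys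
  proof -
    obtain y zs where y: "ys = y # zs" "y \<in> carrier G" and zs: "zs \<in> tuples G (Suc (Suc k))"
      using ys by (cases ys) (auto simp: tuples_def)
    have dc: "?d (Suc k) c us \<in> coind" if "us \<in> tuples G (Suc (Suc k))" for us
      using co.cob_mem that c by blast
    have hc: "contract c us \<in> coind" if "us \<in> tuples G k" for us
      using contract_mem that c by blast
    have dhc: "?d k (contract c) us \<in> coind" if "us \<in> tuples G (Suc k)" for us
      using co.cob_mem that hc by blast
    have eq: "contract (?d (Suc k) c) us = c us - ?d k (contract c) us" if "us \<in> tuples G (Suc k)" for us
      using contract_homotopy[OF that, of c] c by (simp add: algebra_simps)
    have "contract (?d (Suc (Suc k)) (?d (Suc k) c)) zs + ?d (Suc k) (contract (?d (Suc k) c)) zs = ?d (Suc k) c zs"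
      using contract_homotopy[OF zs, of "?d (Suc k) c"] dc by blast
    moreover have "?d (Suc k) (contract (?d (Suc k) c)) zs = ?d (Suc k) (\<lambda>us. c us - ?d k (contract c) us) zs"
      using zs eq by (intro cob_cong) auto
    moreover have "\<dots> = ?d (Suc k) c zs - ?d (Suc k) (?d k (contract c)) zs"
      using zs c dhc by (intro co.cob_diff) auto
    moreover have "?d (Suc k) (?d k (contract c)) zs = 0"
      using Suc.IH zs hc by blast
    ultimately have "contract (?d (Suc (Suc k)) (?d (Suc k) c)) zs = 0"
      by simp
    \<comment> \<open>At \<open>inv y\<close> the contraction prepends
      \<open>inv (inv y) = y\<close>, so it recovers the value on \<open>ys\<close> at the unit up
      to the action of \<open>inv y\<close>.\<close>
    then have "contract (?d (Suc (Suc k)) (?d (Suc k) c)) zs (inv y) = 0"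
      by simp
    then have "act (inv y) (?d (Suc (Suc k)) (?d (Suc k) c) ys \<one>) = 0"
      using y by (simp add: contract_def)
    moreover have "?d (Suc (Suc k)) (?d (Suc k) c) ys \<one> \<in> M"
      using co.cob_mem[OF ys, of "?d (Suc k) c"] dc by (auto intro: coind_apply)
    ultimately show ?thesis
      using act_inv[of y] y(2) by (metis act_zero)
  qed
  show ?case
  proof
    fix w
    show "?d (Suc (Suc k)) (?d (Suc k) c) xs w = 0 w"
    proof (cases "w \<in> carrier G")
      case False
      have "?d (Suc (Suc k)) (?d (Suc k) c) xs \<in> coind"
        using Suc.prems co.cob_mem by auto
      then show ?thesis
        using False by (simp add: coind_outside)
    next
      case w: True
      define r where "r F = (\<lambda>x. if x \<in> carrier G then F (x \<otimes> w) else 0)" for F :: "'a \<Rightarrow> 'v"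
      have r: "r F \<in> coind" if "F \<in> coind" for F
        using that w by (auto simp: r_def coind_def)
      have r_diff: "r (F - H) = r F - r H" for F H
        by (auto simp: r_def)
      have r_act: "r (coind_act g F) = coind_act g (r F)" if "g \<in> carrier G" for g F
        using w that by (auto simp: r_def coind_act_def m_assoc fun_eq_iff)
      have dr: "?d (Suc k) (\<lambda>ys. r (c ys)) ys = r (?d (Suc k) c ys)" if "ys \<in> tuples G (Suc (Suc k))" for ys
        using that Suc.prems(2) by (intro co.cob_equivariant[where \<theta> = r]) (auto simp: r_diff r_act)
      have "?d (Suc (Suc k)) (?d (Suc k) (\<lambda>ys. r (c ys))) xs = ?d (Suc (Suc k)) (\<lambda>ys. r (?d (Suc k) c ys)) xs"
        using Suc.prems(1) dr by (intro cob_cong) auto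
      also have "\<dots> = r (?d (Suc (Suc k)) (?d (Suc k) c) xs)"
        using Suc.prems co.cob_mem by (intro co.cob_equivariant[where \<theta> = r]) (auto simp: r_diff r_act)
      finally have "r (?d (Suc (Suc k)) (?d (Suc k) c) xs) \<one> = 0"
        using at_one[OF Suc.prems(1), of "\<lambda>ys. r (c ys)"] Suc.prems(2) r by simp
      then show ?thesis
        using w by (simp add: r_def)
    qed
  qed
qed

definition const_fun :: "'v \<Rightarrow> 'a \<Rightarrow> 'v"
  where "const_fun x = (\<lambda>g. if g \<in> carrier G then x else 0)"

lemma const_fun_mem: "x \<in> M \<Longrightarrow> const_fun x \<in> coind"
  by (auto simp: const_fun_def coind_def)

lemma cob_const_fun:
  assumes "xs \<in> tuples G (Suc k)" "\<And>ys. ys \<in> tuples G k \<Longrightarrow> c ys \<in> M"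
  shows "cob G coind_act k (\<lambda>ys. const_fun (c ys)) xs = const_fun (cob G act k c xs)"
  using assms by (intro cob_equivariant) (auto simp: const_fun_def coind_act_def)

text \<open>The constant functions embed \<open>M\<close> equivariantly into \<open>coind\<close>,
  where the identity is already known; the embedding is injective since the carrier contains the
  unit.\<close>

lemma cob_cob:
  assumes xs: "xs \<in> tuples G (Suc (Suc k))" and c: "\<And>ys. ys \<in> tuples G k \<Longrightarrow> c ys \<in> M"
  shows "cob G act (Suc k) (cob G act k c) xs = 0"
proof -
  have "const_fun (cob G act (Suc k) (cob G act k c) xs) = cob G coind_act (Suc k) (\<lambda>ys. const_fun (cob G act k c ys)) xs"
    using xs c cob_mem by (intro cob_const_fun[symmetric]) auto
  also have "\<dots> = cob G coind_act (Suc k) (cob G coind_act k (\<lambda>ys. const_fun (c ys))) xs"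
    using xs c by (intro cob_cong) (auto simp: cob_const_fun)
  also have "\<dots> = 0"
    using xs c by (intro cob_cob_coinduced) (auto simp: const_fun_mem)
  finally show ?thesis
    by (auto simp: const_fun_def fun_eq_iff split: if_splits)
qed

end

section \<open>Vanishing of cohomology above degree two\<close>

lemma (in G_module) G_module_subset:
  assumes "N \<subseteq> M" "0 \<in> N" "\<And>x y. \<lbrakk>x \<in> N; y \<in> N\<rbrakk> \<Longrightarrow> x - y \<in> N" "\<And>g x. \<lbrakk>g \<in> carrier G; x \<in> N\<rbrakk> \<Longrightarrow> act g x \<in> N"
  shows "G_module G act N"
  using assms by unfold_locales (auto intro: act_diff act_mult act_one)

lemma (in G_module) coinduced_acyclic:
  assumes "\<And>ys. ys \<in> tuples G (Suc m) \<Longrightarrow> c ys \<in> coind"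
    and "\<And>ys. ys \<in> tuples G (Suc (Suc m)) \<Longrightarrow> cob G coind_act (Suc m) c ys = 0"
    and xs: "xs \<in> tuples G (Suc m)"
  shows "cob G coind_act m (contract c) xs = c xs"
proof -
  have "contract (cob G coind_act (Suc m) c) xs = 0"
    using xs assms(2) by (auto simp: contract_def tuples_Cons act_zero fun_eq_iff)
  then show ?thesis
    using contract_homotopy[OF xs, of c] assms(1) by simp
qed

text \<open>An extension of the integers by a locally finite kernel: \<open>ht\<close> is the
  projection, \<open>t\<close> a lift of the generator, and the \<open>D j\<close> exhaust the
  kernel. \<open>D_conj\<close> says that conjugation by \<open>t\<close> climbs only one level, so
  that \<open>x D j \<mapsto> x t D (Suc j)\<close> is well defined.\<close>

locale tower_group = group G for G (structure) +
  fixes D :: "nat \<Rightarrow> 'a set" and t :: 'a and ht :: "'a \<Rightarrow> int"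
  assumes D_subgroup: "subgroup (D j) G"
    and D_finite: "finite (D j)"
    and D_Suc: "D j \<subseteq> D (Suc j)"
    and D_conj: "h \<in> D j \<Longrightarrow> inv t \<otimes> h \<otimes> t \<in> D (Suc j)"
    and t_closed [simp]: "t \<in> carrier G"
    and ht_mult: "\<lbrakk>x \<in> carrier G; y \<in> carrier G\<rbrakk> \<Longrightarrow> ht (x \<otimes> y) = ht x + ht y"
    and ht_t: "ht t = 1"
    and ht_eq_0_iff: "x \<in> carrier G \<Longrightarrow> ht x = 0 \<longleftrightarrow> (\<exists>j. x \<in> D j)"
begin

lemma D_mono: "i \<le> j \<Longrightarrow> D i \<subseteq> D j"
  by (rule lift_Suc_mono_le[of D i j, OF D_Suc])

lemma D_closed: "h \<in> D j \<Longrightarrow> h \<in> carrier G"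
  by (rule subgroup.mem_carrier[OF D_subgroup])

lemma D_ht: "h \<in> D j \<Longrightarrow> ht h = 0"
  using ht_eq_0_iff[of h] D_closed[of h] by auto

lemma card_D: "of_nat (card (D j)) \<noteq> (0::rat)"
  using D_finite[of j] subgroup.one_closed[OF D_subgroup, of j] by (auto simp: card_eq_0_iff)

lemma ht_one: "ht \<one> = 0"
  using ht_mult[of \<one> \<one>] by simp

lemma ht_inv: "x \<in> carrier G \<Longrightarrow> ht (inv x) = - ht x"
  using ht_mult[of "inv x" x] by (simp add: ht_one)

lemma ht_pow: "ht (t [^] (i::int)) = i"
proof -
  have nat: "ht (t [^] (n::nat)) = int n" for n
    by (induction n) (auto simp: ht_one ht_mult ht_t)
  show ?thesis
    by (cases i rule: int_cases2) (simp_all only: int_pow_int int_pow_neg_int ht_inv nat nat_pow_closed t_closed)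
qed

text \<open>The component of \<open>x\<close> in the kernel of \<open>ht\<close>, relative to the
  representative \<open>t [^] ht x\<close> of its coset.\<close>

definition base :: "'a \<Rightarrow> 'a"
  where "base x = inv (t [^] ht x) \<otimes> x"

lemma base_D: "x \<in> carrier G \<Longrightarrow> \<exists>j. base x \<in> D j"
  using ht_eq_0_iff[of "base x"] by (simp add: base_def ht_mult ht_inv ht_pow)

lemma pow_base: "x \<in> carrier G \<Longrightarrow> t [^] ht x \<otimes> base x = x"
  by (simp add: base_def m_assoc[symmetric])

subsection \<open>Averaging over the finite subgroups\<close>

definition avg :: "nat \<Rightarrow> ('a \<Rightarrow> rat) \<Rightarrow> 'a \<Rightarrow> rat"
  where "avg j a = (\<lambda>x. if x \<in> carrier G then (\<Sum>h\<in>D j. a (x \<otimes> h)) / of_nat (card (D j)) else 0)"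

lemma avg_translate:
  assumes "x \<in> carrier G" "h \<in> D j"
  shows "avg j a (x \<otimes> h) = avg j a x"
proof -
  have h: "h \<in> carrier G"
    using assms D_closed by blast
  have "bij_betw (\<lambda>k. h \<otimes> k) (D j) (D j)"
    by (rule bij_betwI[of _ _ _ "\<lambda>k. inv h \<otimes> k"])
      (use assms h D_closed in \<open>auto simp: m_assoc[symmetric] intro: subgroup.m_closed[OF D_subgroup]
        subgroup.m_inv_closed[OF D_subgroup]\<close>)
  then have "(\<Sum>k\<in>D j. a (x \<otimes> h \<otimes> k)) = (\<Sum>k\<in>D j. a (x \<otimes> k))"
    using sum.reindex_bij_betw[of _ "D j" "D j" "\<lambda>k. a (x \<otimes> k)"] assms(1) h D_closed
    by (simp add: m_assoc cong: sum.cong)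
  then show ?thesis
    using assms h by (simp add: avg_def)
qed

lemma avg_fixed:
  assumes "x \<in> carrier G" "\<And>h. h \<in> D j \<Longrightarrow> a (x \<otimes> h) = a x"
  shows "avg j a x = a x"
  using assms card_D[of j] by (simp add: avg_def cong: sum.cong)

lemma avg_diff: "avg j (\<lambda>y. a y - b y) x = avg j a x - avg j b x"
  by (simp add: avg_def sum_subtractf diff_divide_distrib)

end

text \<open>Averages divide by \<open>card (D j)\<close>. The ambient functions are therefore
  rational valued, while \<open>M\<close> itself is only assumed to be closed under these particular
  divisions, as the group ring over \<open>loc n\<close> will be.\<close>

locale tower_module = tower_group G D t ht + G_module G act M
  for G :: "('a, 'b) monoid_scheme" (structure) and D t ht and act :: "'a \<Rightarrow> ('x \<Rightarrow> rat) \<Rightarrow> 'x \<Rightarrow> rat" and M +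
  assumes scale_mem: "x \<in> M \<Longrightarrow> (\<lambda>z. x z / of_nat (card (D j))) \<in> M"
    and act_scale: "\<lbrakk>g \<in> carrier G; x \<in> M\<rbrakk> \<Longrightarrow>
      act g (\<lambda>z. x z / of_nat (card (D j))) = (\<lambda>z. act g x z / of_nat (card (D j)))"
begin

definition avgf :: "nat \<Rightarrow> ('a \<Rightarrow> 'x \<Rightarrow> rat) \<Rightarrow> 'a \<Rightarrow> 'x \<Rightarrow> rat"
  where "avgf j F = (\<lambda>x z. avg j (\<lambda>y. F y z) x)"

definition E :: "nat \<Rightarrow> ('a \<Rightarrow> 'x \<Rightarrow> rat) set"
  where "E j = {F \<in> coind. \<forall>x\<in>carrier G. \<forall>h\<in>D j. F (x \<otimes> h) = F x}"

text \<open>Invariance under every \<open>D j\<close> is invariance under the kernel of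
  \<open>ht\<close>: these are the functions that depend on \<open>ht x\<close> alone.\<close>

definition E_inf :: "('a \<Rightarrow> 'x \<Rightarrow> rat) set"
  where "E_inf = (\<Inter>j. E j)"

lemma E_coM: "F \<in> E j \<Longrightarrow> F \<in> coind"
  by (simp add: E_def)

lemma E_inf_E: "F \<in> E_inf \<Longrightarrow> F \<in> E j"
  by (simp add: E_inf_def)

lemma E_translate: "\<lbrakk>F \<in> E j; x \<in> carrier G; h \<in> D j\<rbrakk> \<Longrightarrow> F (x \<otimes> h) = F x"
  by (simp add: E_def)

lemma E_Suc: "E (Suc j) \<subseteq> E j"
  using D_Suc by (auto simp: E_def)

lemma G_module_E: "G_module G coind_act (E j)"
proof -
  interpret co: G_module G coind_act coind by (rule G_module_coinduced)
  show ?thesis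
  proof (rule co.G_module_subset)
    show "coind_act g F \<in> E j" if "g \<in> carrier G" "F \<in> E j" for g F
    proof -
      have "coind_act g F (x \<otimes> h) = coind_act g F x" if x: "x \<in> carrier G" and h: "h \<in> D j" for x h
        using that E_translate[OF \<open>F \<in> E j\<close>, of "inv g \<otimes> x" h] \<open>g \<in> carrier G\<close> D_closed[OF h]
        by (simp add: coind_act_def m_assoc)
      then show ?thesis
        using co.act_mem[OF that(1) E_coM[OF that(2)]] by (simp add: E_def)
    qed
  qed (auto simp: E_def co.diff_mem)
qed

lemma G_module_E_inf: "G_module G coind_act E_inf"
proof -
  interpret co: G_module G coind_act coind by (rule G_module_coinduced)
  interpret E: G_module G coind_act "E j" for j by (rule G_module_E)
  show ?thesis
    by (rule co.G_module_subset) (auto simp: E_inf_def E_coM E.diff_mem E.act_mem)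
qed

lemma avgf_eq:
  "x \<in> carrier G \<Longrightarrow> avgf j F x = (\<lambda>z. (\<Sum>h\<in>D j. F (x \<otimes> h)) z / of_nat (card (D j)))"
  by (simp add: avgf_def avg_def sum_apply)

lemma avgf_mem:
  assumes "F \<in> coind"
  shows "avgf j F \<in> E j"
proof -
  have "avgf j F x \<in> M" if "x \<in> carrier G" for x
    unfolding avgf_eq[OF that] using that assms D_closed by (intro scale_mem sum_mem coind_apply) auto
  moreover have "avgf j F x = 0" if "x \<notin> carrier G" for x
    using that by (simp add: avgf_def avg_def fun_eq_iff)
  moreover have "avgf j F (x \<otimes> h) = avgf j F x" if "x \<in> carrier G" "h \<in> D j" for x h
    using that by (simp add: avgf_def avg_translate)
  ultimately show ?thesis
    by (simp add: E_def coind_def)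
qed

lemma avgf_diff: "avgf j (F - H) = avgf j F - avgf j H"
  by (simp add: avgf_def fun_eq_iff avg_diff)

lemma avgf_coact:
  assumes "g \<in> carrier G" "F \<in> coind"
  shows "avgf j (coind_act g F) = coind_act g (avgf j F)"
proof
  fix x
  show "avgf j (coind_act g F) x = coind_act g (avgf j F) x"
  proof (cases "x \<in> carrier G")
    case True
    have F: "F (inv g \<otimes> x \<otimes> h) \<in> M" if "h \<in> D j" for h
      using assms True D_closed[OF that] by (simp add: coind_apply)
    have "(\<Sum>h\<in>D j. coind_act g F (x \<otimes> h)) = (\<Sum>h\<in>D j. act g (F (inv g \<otimes> x \<otimes> h)))"
      using assms True D_closed by (intro sum.cong) (auto simp: coind_act_def m_assoc)
    also have "\<dots> = act g (\<Sum>h\<in>D j. F (inv g \<otimes> x \<otimes> h))"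
      using assms(1) F by (simp add: act_sum)
    finally show ?thesis
      using True assms(1) F by (simp add: coind_act_def avgf_eq act_scale sum_mem)
  qed (simp add: avgf_def avg_def coind_act_def fun_eq_iff)
qed

lemma avgf_fixed:
  assumes "F \<in> E j"
  shows "avgf j F = F"
proof (rule coind_eqI)
  show "avgf j F x = F x" if "x \<in> carrier G" for x
    using that E_translate[OF assms] by (simp add: avgf_def avg_fixed fun_eq_iff)
qed (use assms avgf_mem E_coM in blast)+

text \<open>Averaging is an equivariant projection of \<open>coind\<close> onto \<open>E j\<close>,
  so a primitive in the acyclic module \<open>coind\<close> can be averaged into \<open>E j\<close>
  without changing its coboundary.\<close>

lemma E_acyclic:
  assumes c: "\<And>ys. ys \<in> tuples G (Suc m) \<Longrightarrow> c ys \<in> E j"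
    and z: "\<And>ys. ys \<in> tuples G (Suc (Suc m)) \<Longrightarrow> cob G coind_act (Suc m) c ys = 0"
  obtains b where "\<And>ys. ys \<in> tuples G m \<Longrightarrow> b ys \<in> E j"
    and "\<And>ys. ys \<in> tuples G (Suc m) \<Longrightarrow> cob G coind_act m b ys = c ys"
proof
  interpret co: G_module G coind_act coind by (rule G_module_coinduced)
  have cc: "contract c ys \<in> coind" if "ys \<in> tuples G m" for ys
    using contract_mem[OF that] c E_coM by blast
  show "avgf j (contract c ys) \<in> E j" if "ys \<in> tuples G m" for ys
    using cc[OF that] by (rule avgf_mem)
  show "cob G coind_act m (\<lambda>ys. avgf j (contract c ys)) ys = c ys" if "ys \<in> tuples G (Suc m)" for ys
  proof -
    have "cob G coind_act m (\<lambda>ys. avgf j (contract c ys)) ys = avgf j (cob G coind_act m (contract c) ys)"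
      using that cc by (intro co.cob_equivariant[where \<theta> = "avgf j"]) (auto simp: avgf_diff avgf_coact)
    also have "cob G coind_act m (contract c) ys = c ys"
      using that c z E_coM by (intro coinduced_acyclic) auto
    finally show ?thesis
      using avgf_fixed c that by simp
  qed
qed

section \<open>Functions on the cosets of the base group: vanishing of the derived limit\<close>

definition level :: "'a \<Rightarrow> nat"
  where "level x = (LEAST l. base x \<in> D l)"

text \<open>The formal sum of the \<open>a i\<close> over \<open>i \<ge> j\<close>, made finite at each point by subtracting the
  values at the representative \<open>t [^] ht x\<close> of the coset of \<open>x\<close>.\<close>

definition tail :: "(nat \<Rightarrow> 'a \<Rightarrow> 'x \<Rightarrow> rat) \<Rightarrow> nat \<Rightarrow> 'a \<Rightarrow> 'x \<Rightarrow> rat"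
  where "tail a j = (\<lambda>x. if x \<in> carrier G
    then (\<Sum>i<level x. a i x - a i (t [^] ht x)) - (\<Sum>i<j. a i x) else 0)"

lemma level_D:
  assumes "x \<in> carrier G" "level x \<le> l"
  shows "base x \<in> D l"
proof -
  have "base x \<in> D (level x)"
    unfolding level_def using base_D[OF assms(1)] by (rule LeastI_ex)
  then show ?thesis
    using D_mono[OF assms(2)] by auto
qed

text \<open>For \<open>i \<ge> level x\<close> the points \<open>x\<close> and
  \<open>t [^] ht x\<close> lie in the same coset of \<open>D i\<close>, so the summands cancel. Any
  larger bound may therefore replace \<open>level x\<close>, in particular a bound common to two
  points.\<close>

lemma tail_eq:
  assumes a: "\<And>i. a i \<in> E i" and x: "x \<in> carrier G" and L: "level x \<le> L"
  shows "tail a j x = (\<Sum>i<L. a i x - a i (t [^] ht x)) - (\<Sum>i<j. a i x)"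
proof -
  have "(\<Sum>i<level x. a i x - a i (t [^] ht x)) = (\<Sum>i<L. a i x - a i (t [^] ht x))"
  proof (rule sum.mono_neutral_left)
    show "\<forall>i\<in>{..<L} - {..<level x}. a i x - a i (t [^] ht x) = 0"
      using E_translate[OF a, of "t [^] ht x" "base x"] level_D[OF x] by (auto simp: pow_base[OF x])
  qed (use L in auto)
  then show ?thesis
    using x by (simp add: tail_def)
qed

lemma tail_mem:
  assumes a: "\<And>i. a i \<in> E i"
  shows "tail a j \<in> E j"
proof -
  have aM: "a i x \<in> M" if "x \<in> carrier G" for i x
    using that a E_coM coind_apply by blast
  have "tail a j \<in> coind"
    using aM by (auto simp: coind_def tail_def intro!: diff_mem sum_mem)
  moreover have "tail a j (x \<otimes> h) = tail a j x" if x: "x \<in> carrier G" and h: "h \<in> D j" for x h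
  proof -
    define L where "L = Max {level x, level (x \<otimes> h), j}"
    have L: "level x \<le> L" "level (x \<otimes> h) \<le> L" "j \<le> L"
      by (auto simp: L_def)
    have xh: "x \<otimes> h \<in> carrier G" and ht: "ht (x \<otimes> h) = ht x"
      using x h D_closed D_ht ht_mult by auto
    have *: "(\<Sum>i<L. f i) - (\<Sum>i<j. f i) = (\<Sum>i=j..<L. f i)" for f :: "nat \<Rightarrow> 'x \<Rightarrow> rat"
      using sum_diff[of "{..<L}" "{..<j}" f] L(3) by (simp add: lessThan_minus_lessThan)
    \<comment> \<open>Up to a function of the height the tail is a sum of the \<open>a i\<close>
      with \<open>i \<ge> j\<close>, and each of these is invariant under \<open>D i\<close>, which
      contains \<open>D j\<close>.\<close>
    have "tail a j y = (\<Sum>i=j..<L. a i y) - (\<Sum>i<L. a i (t [^] ht x))"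
      if "y \<in> carrier G" "level y \<le> L" "ht y = ht x" for y
      using tail_eq[OF a that(1,2), of j] *[of "\<lambda>i. a i y"] that(3) by (simp add: sum_subtractf algebra_simps)
    moreover have "(\<Sum>i=j..<L. a i (x \<otimes> h)) = (\<Sum>i=j..<L. a i x)"
    proof (rule sum.cong)
      show "a i (x \<otimes> h) = a i x" if "i \<in> {j..<L}" for i
        using E_translate[OF a[of i] x] h D_mono[of j i] that by auto
    qed simp
    ultimately show ?thesis
      using x xh ht L by simp
  qed
  ultimately show ?thesis
    by (simp add: E_def)
qed

lemma tail_diff: "a j \<in> coind \<Longrightarrow> tail a j - tail a (Suc j) = a j"
  by (auto simp: tail_def coind_outside fun_eq_iff)

text \<open>Primitives chosen in the modules \<open>E j\<close> need not agree, but consecutive ones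
  differ by a cocycle of \<open>E j\<close>, hence by a coboundary. The tails of these corrections
  make the primitives independent of \<open>j\<close>. Acyclicity of \<open>E j\<close> is used in
  two consecutive degrees, so one degree is lost.\<close>

lemma E_inf_acyclic:
  assumes c: "\<And>ys. ys \<in> tuples G (Suc (Suc m)) \<Longrightarrow> c ys \<in> E_inf"
    and z: "\<And>ys. ys \<in> tuples G (Suc (Suc (Suc m))) \<Longrightarrow> cob G coind_act (Suc (Suc m)) c ys = 0"
  obtains b where "\<And>ys. ys \<in> tuples G (Suc m) \<Longrightarrow> b ys \<in> E_inf"
    and "\<And>ys. ys \<in> tuples G (Suc (Suc m)) \<Longrightarrow> cob G coind_act (Suc m) b ys = c ys"
proof -
  interpret co: G_module G coind_act coind by (rule G_module_coinduced)
  interpret E: G_module G coind_act "E j" for j by (rule G_module_E)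
  let ?d = "cob G coind_act"
  have "\<exists>b. (\<forall>ys\<in>tuples G (Suc m). b ys \<in> E j) \<and> (\<forall>ys\<in>tuples G (Suc (Suc m)). ?d (Suc m) b ys = c ys)" for j
    by (rule E_acyclic[of "Suc m" c j]) (use c z E_inf_E in auto)
  then obtain b where b: "\<And>j ys. ys \<in> tuples G (Suc m) \<Longrightarrow> b j ys \<in> E j"
    and db: "\<And>j ys. ys \<in> tuples G (Suc (Suc m)) \<Longrightarrow> ?d (Suc m) (b j) ys = c ys"
    by metis
  have bS: "b (Suc j) ys \<in> E j" if "ys \<in> tuples G (Suc m)" for j ys
    using b[OF that] E_Suc by blast
  have "\<exists>a. (\<forall>ys\<in>tuples G m. a ys \<in> E j) \<and>
      (\<forall>ys\<in>tuples G (Suc m). ?d m a ys = b j ys - b (Suc j) ys)" for j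
  proof (rule E_acyclic[of m "\<lambda>ys. b j ys - b (Suc j) ys" j])
    show "b j ys - b (Suc j) ys \<in> E j" if "ys \<in> tuples G (Suc m)" for ys
      using b[OF that] bS[OF that] by (rule E.diff_mem)
    show "?d (Suc m) (\<lambda>ys. b j ys - b (Suc j) ys) ys = 0" if "ys \<in> tuples G (Suc (Suc m))" for ys
      using that b bS db by (subst E.cob_diff) auto
  qed auto
  then obtain a where a: "\<And>j ys. ys \<in> tuples G m \<Longrightarrow> a j ys \<in> E j"
    and da: "\<And>j ys. ys \<in> tuples G (Suc m) \<Longrightarrow> ?d m (a j) ys = b j ys - b (Suc j) ys"
    by metis
  \<comment> \<open>By \<open>tail_diff\<close>, \<open>C j - C (Suc j) = a j\<close>: subtracting
    the coboundary of \<open>C j\<close> from \<open>b j\<close> removes the dependence on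
    \<open>j\<close>.\<close>
  define C where "C j ys = tail (\<lambda>i. a i ys) j" for j ys
  have C: "C j ys \<in> E j" if "ys \<in> tuples G m" for j ys
    unfolding C_def using a that by (intro tail_mem)
  define b' where "b' j ys = b j ys - ?d m (C j) ys" for j ys
  have b': "b' j ys \<in> E j" if "ys \<in> tuples G (Suc m)" for j ys
    unfolding b'_def using that b C by (intro E.diff_mem E.cob_mem) auto
  have b'_Suc: "b' j ys = b' (Suc j) ys" if ys: "ys \<in> tuples G (Suc m)" for j ys
  proof -
    have "?d m (\<lambda>ys. C j ys - C (Suc j) ys) ys = ?d m (a j) ys"
    proof (rule cob_cong[OF ys])
      show "C j zs - C (Suc j) zs = a j zs" if "zs \<in> tuples G m" for zs
        using tail_diff[of "\<lambda>i. a i zs" j] E_coM[OF a[OF that, of j]] by (simp add: C_def)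
    qed
    moreover have "?d m (\<lambda>ys. C j ys - C (Suc j) ys) ys = ?d m (C j) ys - ?d m (C (Suc j)) ys"
      using ys C E_coM by (intro co.cob_diff) auto
    ultimately show ?thesis
      using da[OF ys, of j] by (simp add: b'_def algebra_simps)
  qed
  have const: "b' j ys = b' 0 ys" if "ys \<in> tuples G (Suc m)" for j ys
  proof (induction j)
    case (Suc j)
    then show ?case
      using b'_Suc[OF that, of j] by simp
  qed simp
  show ?thesis
  proof
    show "b' 0 ys \<in> E_inf" if "ys \<in> tuples G (Suc m)" for ys
      unfolding E_inf_def
    proof
      show "b' 0 ys \<in> E j" for j
        using b'[OF that, of j] const[OF that, of j] by simp
    qed
    show "?d (Suc m) (b' 0) ys = c ys" if "ys \<in> tuples G (Suc (Suc m))" for ys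
    proof -
      have "?d (Suc m) (b' 0) ys = ?d (Suc m) (b 0) ys - ?d (Suc m) (?d m (C 0)) ys"
        unfolding b'_def using that b C by (intro E.cob_diff[where j = 0] E.cob_mem) auto
      then show ?thesis
        using that db E.cob_cob[of ys m "C 0" 0] C by simp
    qed
  qed
qed

lemma E_inf_apply:
  assumes "F \<in> E_inf" "x \<in> carrier G"
  shows "F x = F (t [^] ht x)"
proof -
  obtain j where "base x \<in> D j"
    using base_D assms(2) by blast
  then show ?thesis
    using E_translate[OF E_inf_E[OF assms(1)], of "t [^] ht x" "base x" j] pow_base[OF assms(2)] by simp
qed

lemma E_infI:
  assumes "F \<in> coind" "\<And>x y. \<lbrakk>x \<in> carrier G; y \<in> carrier G; ht x = ht y\<rbrakk> \<Longrightarrow> F x = F y"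
  shows "F \<in> E_inf"
proof -
  have "F (x \<otimes> h) = F x" if "x \<in> carrier G" "h \<in> D j" for x h j
    using that by (intro assms(2)) (simp_all add: ht_mult D_closed[OF that(2)] D_ht[OF that(2)])
  then show ?thesis
    using assms(1) by (simp add: E_inf_def E_def)
qed

section \<open>From the base group to the whole group\<close>

definition right_t :: "('a \<Rightarrow> 'x \<Rightarrow> rat) \<Rightarrow> 'a \<Rightarrow> 'x \<Rightarrow> rat"
  where "right_t F = (\<lambda>x. if x \<in> carrier G then F (x \<otimes> t) else 0)"

lemma right_t_mem:
  assumes "F \<in> E_inf"
  shows "right_t F \<in> E_inf"
proof (rule E_infI)
  show "right_t F \<in> coind"
    using E_coM[OF E_inf_E[OF assms]] by (auto simp: right_t_def coind_def)
  show "right_t F x = right_t F y" if "x \<in> carrier G" "y \<in> carrier G" "ht x = ht y" for x y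
    using that E_inf_apply[OF assms, of "x \<otimes> t"] E_inf_apply[OF assms, of "y \<otimes> t"]
    by (simp add: right_t_def ht_mult ht_t)
qed

text \<open>The discrete antiderivative that vanishes at 0, with the usual sign convention for a
  reversed range.\<close>

definition int_sum :: "(int \<Rightarrow> 'v::ab_group_add) \<Rightarrow> int \<Rightarrow> 'v"
  where "int_sum f i = (if 0 \<le> i then sum f {0..<i} else - sum f {i..<0})"

lemma int_sum_step: "int_sum f (i + 1) - int_sum f i = f i"
proof (cases "0 \<le> i")
  case True
  then have "{0..<i + 1} = insert i {0..<i}"
    by auto
  then show ?thesis
    using True by (simp add: int_sum_def)
next
  case False
  then have "{i..<0} = insert i {i + 1..<0}"
    by auto
  then show ?thesis
    using False by (auto simp: int_sum_def)
qed

definition integrate :: "('a \<Rightarrow> 'x \<Rightarrow> rat) \<Rightarrow> 'a \<Rightarrow> 'x \<Rightarrow> rat"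
  where "integrate F = (\<lambda>x. if x \<in> carrier G then int_sum (\<lambda>i. F (t [^] i)) (ht x) else 0)"

lemma integrate_mem: "F \<in> E_inf \<Longrightarrow> integrate F \<in> E_inf"
proof (rule E_infI)
  assume "F \<in> E_inf"
  then have "F x \<in> M" if "x \<in> carrier G" for x
    using that by (intro coind_apply E_coM[where j = 0] E_inf_E)
  then show "integrate F \<in> coind"
    by (auto simp: coind_def integrate_def int_sum_def intro!: uminus_mem sum_mem)
qed (simp add: integrate_def)

text \<open>Surjectivity of \<open>right_t\<close> minus the identity on \<open>E_inf\<close>. Its
  kernel consists of the constants, a copy of \<open>M\<close>, so this is the short exact sequence
  behind the second dimension shift.\<close>

lemma integrate_step:
  assumes "F \<in> E_inf"
  shows "right_t (integrate F) - integrate F = F"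
proof (rule coind_eqI)
  interpret E: G_module G coind_act E_inf by (rule G_module_E_inf)
  show "right_t (integrate F) - integrate F \<in> coind"
    using assms by (intro E_coM[where j = 0] E_inf_E E.diff_mem right_t_mem integrate_mem)
  show "(right_t (integrate F) - integrate F) x = F x" if "x \<in> carrier G" for x
    using that E_inf_apply[OF assms that] by (simp add: right_t_def integrate_def ht_mult ht_t int_sum_step)
qed (rule E_coM[OF E_inf_E[OF assms, of 0]])

text \<open>Regard the cocycle as one with constant values and take a primitive \<open>b\<close> in
  \<open>E_inf\<close>. Since constants are fixed by \<open>right_t\<close>, the defect
  \<open>right_t b - b\<close> is a cocycle one degree lower; a primitive of it, integrated along
  the powers of \<open>t\<close>, corrects \<open>b\<close> to a primitive with constant values. The
  lower use of \<open>E_inf_acyclic\<close> must still be in degree at least two, which gives the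
  bound three.\<close>

theorem acyclic_above_2:
  assumes c: "\<And>ys. ys \<in> tuples G (Suc (Suc (Suc m))) \<Longrightarrow> c ys \<in> M"
    and z: "\<And>ys. ys \<in> tuples G (Suc (Suc (Suc (Suc m)))) \<Longrightarrow> cob G act (Suc (Suc (Suc m))) c ys = 0"
  obtains b where "\<And>ys. ys \<in> tuples G (Suc (Suc m)) \<Longrightarrow> b ys \<in> M"
    and "\<And>ys. ys \<in> tuples G (Suc (Suc (Suc m))) \<Longrightarrow> cob G act (Suc (Suc m)) b ys = c ys"
proof -
  interpret co: G_module G coind_act coind by (rule G_module_coinduced)
  interpret E: G_module G coind_act E_inf by (rule G_module_E_inf)
  let ?d = "cob G coind_act"
  have const: "const_fun x \<in> E_inf" if "x \<in> M" for x
    using that by (intro E_infI const_fun_mem) (auto simp: const_fun_def)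
  have rt_diff: "right_t (F - H) = right_t F - right_t H" for F H
    by (auto simp: right_t_def fun_eq_iff)
  have rt_act: "right_t (coind_act g F) = coind_act g (right_t F)" if "g \<in> carrier G" for g F
    using that by (auto simp: right_t_def coind_act_def m_assoc fun_eq_iff)
  obtain b where b: "\<And>ys. ys \<in> tuples G (Suc (Suc m)) \<Longrightarrow> b ys \<in> E_inf"
    and db: "\<And>ys. ys \<in> tuples G (Suc (Suc (Suc m))) \<Longrightarrow> ?d (Suc (Suc m)) b ys = const_fun (c ys)"
  proof (rule E_inf_acyclic[of "Suc m" "\<lambda>ys. const_fun (c ys)"])
    show "?d (Suc (Suc (Suc m))) (\<lambda>ys. const_fun (c ys)) ys = 0"
      if "ys \<in> tuples G (Suc (Suc (Suc (Suc m))))" for ys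
      using that c z by (subst cob_const_fun) (auto simp: const_fun_def fun_eq_iff)
  qed (use c const in auto)
  have rb: "right_t (b ys) \<in> E_inf" if "ys \<in> tuples G (Suc (Suc m))" for ys
    using b[OF that] by (rule right_t_mem)
  have rtb: "?d (Suc (Suc m)) (\<lambda>ys. right_t (b ys)) ys = right_t (const_fun (c ys))"
    if "ys \<in> tuples G (Suc (Suc (Suc m)))" for ys
    using that b db E.cob_equivariant[of ys "Suc (Suc m)" b right_t coind_act] by (simp add: rt_diff rt_act)
  have rt_const: "right_t (const_fun x) = const_fun x" for x
    by (auto simp: right_t_def const_fun_def)
  obtain a where a: "\<And>ys. ys \<in> tuples G (Suc m) \<Longrightarrow> a ys \<in> E_inf"
    and da: "\<And>ys. ys \<in> tuples G (Suc (Suc m)) \<Longrightarrow> ?d (Suc m) a ys = right_t (b ys) - b ys"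
  proof (rule E_inf_acyclic[of m "\<lambda>ys. right_t (b ys) - b ys"])
    show "?d (Suc (Suc m)) (\<lambda>ys. right_t (b ys) - b ys) ys = 0"
      if "ys \<in> tuples G (Suc (Suc (Suc m)))" for ys
      using that b rb db rtb by (subst E.cob_diff) (auto simp: rt_const)
  qed (use b rb E.diff_mem in auto)
  define C where "C ys = integrate (a ys)" for ys
  have C: "C ys \<in> E_inf" if "ys \<in> tuples G (Suc m)" for ys
    using a[OF that] by (simp add: C_def integrate_mem)
  define b' where "b' ys = b ys - ?d (Suc m) C ys" for ys
  have b': "b' ys \<in> E_inf" if "ys \<in> tuples G (Suc (Suc m))" for ys
    using that b C by (auto simp: b'_def intro!: E.diff_mem E.cob_mem)
  have inv: "right_t (b' ys) = b' ys" if ys: "ys \<in> tuples G (Suc (Suc m))" for ys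
  proof -
    have "?d (Suc m) (\<lambda>ys. right_t (C ys) - C ys) ys = ?d (Suc m) a ys"
      using ys a by (intro cob_cong) (auto simp: C_def integrate_step)
    moreover have "?d (Suc m) (\<lambda>ys. right_t (C ys) - C ys) ys = ?d (Suc m) (\<lambda>ys. right_t (C ys)) ys - ?d (Suc m) C ys"
      using ys C right_t_mem by (intro E.cob_diff) auto
    moreover have "?d (Suc m) (\<lambda>ys. right_t (C ys)) ys = right_t (?d (Suc m) C ys)"
      using ys C by (intro E.cob_equivariant[where \<theta> = right_t]) (auto simp: rt_diff rt_act)
    ultimately show ?thesis
      using da[OF ys] by (simp add: b'_def rt_diff algebra_simps)
  qed
  \<comment> \<open>Elements of \<open>E_inf\<close> depend only on the height, and invariance under
    \<open>right_t\<close> removes that dependence too.\<close>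
  have const_b': "b' ys = const_fun (b' ys \<one>)" if ys: "ys \<in> tuples G (Suc (Suc m))" for ys
  proof (rule coind_eqI)
    let ?f = "\<lambda>i::int. b' ys (t [^] i)"
    have step: "?f (i + 1) = ?f i" for i
      using fun_cong[OF inv[OF ys], of "t [^] i"] by (simp add: right_t_def int_pow_mult)
    have pos: "?f (int n) = ?f 0" for n
    proof (induction n)
      case (Suc n)
      then show ?case
        using step[of "int n"] by (simp add: add.commute)
    qed simp
    have neg: "?f (- int n) = ?f 0" for n
    proof (induction n)
      case (Suc n)
      then show ?case
        using step[of "- int (Suc n)"] by simp
    qed simp
    have all: "?f i = ?f 0" for i
      using pos neg by (cases i rule: int_cases2) auto
    show "b' ys x = const_fun (b' ys \<one>) x" if "x \<in> carrier G" for x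
      using E_inf_apply[OF b'[OF ys] that] all[of "ht x"] that by (simp add: const_fun_def)
    show "b' ys \<in> coind"
      using b'[OF ys] by (intro E_coM[where j = 0] E_inf_E)
    then show "const_fun (b' ys \<one>) \<in> coind"
      by (intro const_fun_mem coind_apply) auto
  qed
  show ?thesis
  proof
    show b'M: "b' ys \<one> \<in> M" if "ys \<in> tuples G (Suc (Suc m))" for ys
      using b'[OF that] by (intro coind_apply E_coM[where j = 0] E_inf_E) auto
    show "cob G act (Suc (Suc m)) (\<lambda>ys. b' ys \<one>) ys = c ys" if ys: "ys \<in> tuples G (Suc (Suc (Suc m)))" for ys
    proof -
      have "const_fun (cob G act (Suc (Suc m)) (\<lambda>ys. b' ys \<one>) ys) = ?d (Suc (Suc m)) (\<lambda>ys. const_fun (b' ys \<one>)) ys"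
        using ys b'M by (intro cob_const_fun[symmetric]) auto
      also have "\<dots> = ?d (Suc (Suc m)) b' ys"
        using ys const_b' by (intro cob_cong) auto
      also have "\<dots> = const_fun (c ys)"
      proof -
        have "?d (Suc (Suc m)) b' ys = ?d (Suc (Suc m)) b ys - ?d (Suc (Suc m)) (?d (Suc m) C) ys"
          unfolding b'_def using ys b C by (intro E.cob_diff E.cob_mem) auto
        then show ?thesis
          using ys db E.cob_cob[of ys "Suc m" C] C by simp
      qed
      finally show ?thesis
        by (auto simp: const_fun_def fun_eq_iff split: if_splits)
    qed
  qed
qed

end

section \<open>The group ring over a localization of the integers\<close>

text \<open>The structures below have the operations of a function type on a restricted carrier;
  this lemma and the next one replace their sums and negatives by those of the type.\<close>

lemma finsum_eq_sum:
  assumes "abelian_monoid M" and add: "add M = (+)" and zero: "\<zero>\<^bsub>M\<^esub> = (0::'v::ab_group_add)"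
    and f: "f \<in> S \<rightarrow> carrier M"
  shows "finsum M f S = sum f S"
proof -
  interpret abelian_monoid M by fact
  show ?thesis
    using f
  proof (induction S rule: infinite_finite_induct)
    case (infinite S)
    then show ?case by (simp add: zero finsum_infinite)
  next
    case (insert x S)
    then show ?case
      by (simp add: Pi_def) (simp add: add)
  qed (simp add: zero)
qed

lemma a_inv_eq_uminus:
  assumes "abelian_group M" and add: "add M = (+)" and zero: "\<zero>\<^bsub>M\<^esub> = (0::'v::ab_group_add)"
    and x: "x \<in> carrier M" "- x \<in> carrier M"
  shows "\<ominus>\<^bsub>M\<^esub> x = - x"
proof -
  interpret abelian_group M by fact
  show ?thesis
    using minus_equality[of "- x" x] x by (simp add: add zero)
qed

lemma int_localization_simps [simp]:
  "mult (int_localization n) = (*)" "one (int_localization n) = 1"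
  "zero (int_localization n) = 0" "add (int_localization n) = (+)"
  by (simp_all add: int_localization_def)

definition loc :: "nat \<Rightarrow> rat set"
  where "loc n = carrier (int_localization n)"

lemma loc_iff: "x \<in> loc n \<longleftrightarrow> (\<exists>a k. x = of_int a / of_nat n ^ k)"
  by (auto simp: loc_def int_localization_def)

lemma carrier_int_localization [simp]: "carrier (int_localization n) = loc n"
  by (simp add: loc_def)

lemma loc_int [simp]: "of_int a \<in> loc n"
  unfolding loc_iff by (rule exI[of _ a], rule exI[of _ 0]) simp

lemma loc_0 [simp]: "0 \<in> loc n" and loc_1 [simp]: "1 \<in> loc n"
  using loc_int[of 0] loc_int[of 1] by simp_all

lemma loc_uminus: "x \<in> loc n \<Longrightarrow> - x \<in> loc n"
  unfolding loc_iff by (metis minus_divide_left of_int_minus)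

lemma loc_mult: "\<lbrakk>x \<in> loc n; y \<in> loc n\<rbrakk> \<Longrightarrow> x * y \<in> loc n"
  unfolding loc_iff by (metis of_int_mult power_add times_divide_times_eq)

lemma loc_add:
  assumes "0 < n" "x \<in> loc n" "y \<in> loc n"
  shows "x + y \<in> loc n"
proof -
  obtain a k b l where x: "x = of_int a / of_nat n ^ k" and y: "y = of_int b / of_nat n ^ l"
    using assms by (auto simp: loc_iff)
  have "x + y = of_int (a * int n ^ l + b * int n ^ k) / of_nat n ^ (k + l)"
    using assms(1) by (simp add: x y field_simps power_add)
  then show ?thesis
    unfolding loc_iff by blast
qed

lemma loc_diff: "\<lbrakk>0 < n; x \<in> loc n; y \<in> loc n\<rbrakk> \<Longrightarrow> x - y \<in> loc n"
  using loc_add[of n x "- y"] loc_uminus by simp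

lemma loc_sum: "\<lbrakk>0 < n; \<And>i. i \<in> S \<Longrightarrow> f i \<in> loc n\<rbrakk> \<Longrightarrow> sum f S \<in> loc n"
  by (induction S rule: infinite_finite_induct) (auto intro: loc_add)

text \<open>The orders of the finite subgroups that are averaged over will be powers of
  \<open>n\<close>.\<close>

lemma loc_divide_power: "x \<in> loc n \<Longrightarrow> x / of_nat (n ^ m) \<in> loc n"
  unfolding loc_iff by (auto simp: power_add[symmetric]) blast

lemma cring_int_localization:
  assumes "0 < n"
  shows "cring (int_localization n)"
proof (rule cringI)
  show "abelian_group (int_localization n)"
  proof (rule abelian_groupI)
    show "\<exists>y\<in>carrier (int_localization n). y \<oplus>\<^bsub>int_localization n\<^esub> x = \<zero>\<^bsub>int_localization n\<^esub>"
      if "x \<in> carrier (int_localization n)" for x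
      using that loc_uminus by (intro bexI[of _ "- x"]) auto
  qed (auto simp: loc_add assms)
  show "Group.comm_monoid (int_localization n)"
    by (rule comm_monoidI) (auto simp: loc_mult)
qed (auto simp: algebra_simps)

locale loc_group_ring = group G for G :: "('g, 'b) monoid_scheme" (structure) +
  fixes n :: nat
  assumes n_pos: "0 < n"
begin

abbreviation R :: "rat ring" where "R \<equiv> int_localization n"
abbreviation RG :: "('g \<Rightarrow> rat) ring" where "RG \<equiv> group_ring (int_localization n) G"

lemma cring_R: "cring R"
  by (rule cring_int_localization[OF n_pos])

lemma abelian_group_R: "abelian_group R"
  using cring_R by (simp add: cring_def ring_def)

lemma finsum_R: "f \<in> S \<rightarrow> loc n \<Longrightarrow> finsum R f S = sum f S"
  using abelian_group_R by (intro finsum_eq_sum) (auto simp: abelian_group_def)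

lemma RG_iff: "a \<in> carrier RG \<longleftrightarrow>
    (\<forall>x\<in>carrier G. a x \<in> loc n) \<and> (\<forall>x. x \<notin> carrier G \<longrightarrow> a x = 0) \<and> finite {x. a x \<noteq> 0}"
  by (simp add: group_ring_def finsupp_def)

lemma RG_apply: "a \<in> carrier RG \<Longrightarrow> a x \<in> loc n"
  unfolding RG_iff by (cases "x \<in> carrier G") auto

lemma RG_outside: "a \<in> carrier RG \<Longrightarrow> x \<notin> carrier G \<Longrightarrow> a x = 0"
  by (simp add: RG_iff)

lemma RG_finite: "a \<in> carrier RG \<Longrightarrow> finite {x. a x \<noteq> 0}"
  by (simp add: RG_iff)

lemma RG_supp: "a \<in> carrier RG \<Longrightarrow> {x. a x \<noteq> 0} \<subseteq> carrier G"
  by (auto simp: RG_iff)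

lemma RG_eqI: "\<lbrakk>a \<in> carrier RG; b \<in> carrier RG; \<And>x. x \<in> carrier G \<Longrightarrow> a x = b x\<rbrakk> \<Longrightarrow> a = b"
  by (metis RG_outside ext)

lemma RG_add [simp]: "add RG = (+)" and RG_zero [simp]: "zero RG = 0"
  by (simp_all add: group_ring_def fun_eq_iff)

lemma RG_zero_mem [simp]: "0 \<in> carrier RG"
  by (simp add: RG_iff)

lemma RG_diff_mem:
  assumes "a \<in> carrier RG" "b \<in> carrier RG"
  shows "a - b \<in> carrier RG"
proof -
  have "{x. (a - b) x \<noteq> 0} \<subseteq> {x. a x \<noteq> 0} \<union> {x. b x \<noteq> 0}"
    by auto
  then have "finite {x. (a - b) x \<noteq> 0}"
    using assms RG_finite by (meson finite_Un finite_subset)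
  then show ?thesis
    using assms n_pos by (auto simp: RG_iff loc_diff)
qed

lemma RG_uminus_mem: "a \<in> carrier RG \<Longrightarrow> - a \<in> carrier RG"
  using RG_diff_mem[of 0 a] by simp

lemma RG_add_mem: "\<lbrakk>a \<in> carrier RG; b \<in> carrier RG\<rbrakk> \<Longrightarrow> a + b \<in> carrier RG"
  using RG_diff_mem[of a "- b"] RG_uminus_mem[of b] by simp

lemma RG_sum_mem: "(\<And>i. i \<in> S \<Longrightarrow> f i \<in> carrier RG) \<Longrightarrow> sum f S \<in> carrier RG"
  by (induction S rule: infinite_finite_induct) (auto intro: RG_add_mem)

lemma RG_scale_mem:
  assumes "r \<in> loc n" "a \<in> carrier RG"
  shows "(\<lambda>x. r * a x) \<in> carrier RG"
proof -
  have "finite {x. r * a x \<noteq> 0}"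
    using RG_finite[OF assms(2)] by (rule finite_subset[rotated]) auto
  then show ?thesis
    using assms by (auto simp: RG_iff loc_mult)
qed

lemma abelian_group_RG: "abelian_group RG"
proof (rule abelian_groupI)
  show "\<exists>b\<in>carrier RG. b \<oplus>\<^bsub>RG\<^esub> a = \<zero>\<^bsub>RG\<^esub>" if "a \<in> carrier RG" for a
    using RG_uminus_mem[OF that] by (intro bexI[of _ "- a"]) auto
qed (auto simp: RG_add_mem add_ac)

definition translate :: "'g \<Rightarrow> ('g \<Rightarrow> rat) \<Rightarrow> 'g \<Rightarrow> rat"
  where "translate g a = (\<lambda>x. if x \<in> carrier G then a (inv g \<otimes> x) else 0)"

lemma translate_mem:
  assumes "g \<in> carrier G" "a \<in> carrier RG"
  shows "translate g a \<in> carrier RG"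
proof -
  have "{x. translate g a x \<noteq> 0} \<subseteq> (\<lambda>x. g \<otimes> x) ` {x. a x \<noteq> 0}"
  proof
    fix x
    assume "x \<in> {x. translate g a x \<noteq> 0}"
    then have "x \<in> carrier G" "a (inv g \<otimes> x) \<noteq> 0"
      by (auto simp: translate_def split: if_splits)
    then show "x \<in> (\<lambda>x. g \<otimes> x) ` {x. a x \<noteq> 0}"
      using assms(1) by (intro image_eqI[of _ _ "inv g \<otimes> x"]) (auto simp: m_assoc[symmetric])
  qed
  then have "finite {x. translate g a x \<noteq> 0}"
    using RG_finite[OF assms(2)] finite_surj by blast
  then show ?thesis
    using assms RG_apply by (auto simp: RG_iff translate_def)
qed

lemma G_module_RG: "G_module G translate (carrier RG)"
proof unfold_locales
  show "translate (g \<otimes> h) x = translate g (translate h x)"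
    if "g \<in> carrier G" "h \<in> carrier G" "x \<in> carrier RG" for g h x
    using that by (auto simp: translate_def fun_eq_iff inv_mult_group m_assoc)
  show "translate \<one> x = x" if "x \<in> carrier RG" for x
    using that by (auto simp: translate_def fun_eq_iff RG_outside)
qed (auto simp: RG_diff_mem translate_mem, auto simp: translate_def fun_eq_iff)

text \<open>Admitting any finite superset of the support allows several convolutions to be written
  over one summation set, as distributivity and associativity require.\<close>

lemma mult_eq_sum:
  assumes "a \<in> carrier RG" "b \<in> carrier RG" "finite S" "S \<subseteq> carrier G" "{x. a x \<noteq> 0} \<subseteq> S" "x \<in> carrier G"
  shows "(a \<otimes>\<^bsub>RG\<^esub> b) x = (\<Sum>h\<in>S. a h * b (inv h \<otimes> x))"
proof -
  have "(a \<otimes>\<^bsub>RG\<^esub> b) x = (\<Sum>h\<in>{h \<in> carrier G. a h \<noteq> 0}. a h * b (inv h \<otimes> x))"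
    using assms RG_apply by (auto simp: group_ring_def loc_mult intro!: finsum_R)
  also have "\<dots> = (\<Sum>h\<in>S. a h * b (inv h \<otimes> x))"
    using assms by (intro sum.mono_neutral_left) auto
  finally show ?thesis .
qed

lemma mult_outside: "x \<notin> carrier G \<Longrightarrow> (a \<otimes>\<^bsub>RG\<^esub> b) x = 0"
  by (simp add: group_ring_def)

lemma mult_supp:
  assumes "a \<in> carrier RG" "b \<in> carrier RG"
  shows "{x. (a \<otimes>\<^bsub>RG\<^esub> b) x \<noteq> 0} \<subseteq> (\<lambda>(h, k). h \<otimes> k) ` ({x. a x \<noteq> 0} \<times> {x. b x \<noteq> 0})"
proof
  fix x
  assume x: "x \<in> {x. (a \<otimes>\<^bsub>RG\<^esub> b) x \<noteq> 0}"
  then have xG: "x \<in> carrier G"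
    using mult_outside by blast
  have "(\<Sum>h\<in>{x. a x \<noteq> 0}. a h * b (inv h \<otimes> x)) \<noteq> 0"
    using x mult_eq_sum[OF assms RG_finite[OF assms(1)] RG_supp[OF assms(1)] order_refl xG] by simp
  then obtain h where h: "a h \<noteq> 0" "b (inv h \<otimes> x) \<noteq> 0"
    by (metis (mono_tags, lifting) mem_Collect_eq mult_zero_right sum.neutral)
  moreover have "h \<in> carrier G"
    using h RG_supp[OF assms(1)] by blast
  ultimately show "x \<in> (\<lambda>(h, k). h \<otimes> k) ` ({x. a x \<noteq> 0} \<times> {x. b x \<noteq> 0})"
    using xG by (intro image_eqI[of _ _ "(h, inv h \<otimes> x)"]) (auto simp: m_assoc[symmetric])
qed

lemma mult_mem:
  assumes "a \<in> carrier RG" "b \<in> carrier RG"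
  shows "a \<otimes>\<^bsub>RG\<^esub> b \<in> carrier RG"
proof -
  have "finite {x. (a \<otimes>\<^bsub>RG\<^esub> b) x \<noteq> 0}"
    using mult_supp[OF assms] RG_finite[OF assms(1)] RG_finite[OF assms(2)]
    by (meson finite_SigmaI finite_imageI finite_subset)
  moreover have "(a \<otimes>\<^bsub>RG\<^esub> b) x \<in> loc n" if "x \<in> carrier G" for x
    using mult_eq_sum[OF assms RG_finite[OF assms(1)] RG_supp[OF assms(1)] order_refl that] assms RG_apply n_pos
    by (auto intro!: loc_sum loc_mult)
  ultimately show ?thesis
    by (simp add: RG_iff mult_outside)
qed

lemma mult_assoc_RG:
  assumes a: "a \<in> carrier RG" and b: "b \<in> carrier RG" and c: "c \<in> carrier RG"
  shows "(a \<otimes>\<^bsub>RG\<^esub> b) \<otimes>\<^bsub>RG\<^esub> c = a \<otimes>\<^bsub>RG\<^esub> (b \<otimes>\<^bsub>RG\<^esub> c)"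
proof (rule RG_eqI)
  fix x
  assume x: "x \<in> carrier G"
  let ?A = "{x. a x \<noteq> 0}" and ?B = "{x. b x \<noteq> 0}"
  let ?K = "(\<lambda>(h, k). h \<otimes> k) ` (?A \<times> ?B)"
  note A = RG_finite[OF a] RG_supp[OF a] and B = RG_finite[OF b] RG_supp[OF b]
  have K: "finite ?K" "?K \<subseteq> carrier G"
    using A B by auto
  \<comment> \<open>Left translation by \<open>inv h\<close> carries the common summation set onto
    one that contains the support of \<open>b\<close>, so the inner sum over \<open>?K\<close> is a
    full convolution.\<close>
  have inner: "(\<Sum>k\<in>?K. b (inv h \<otimes> k) * c (inv k \<otimes> x)) = (b \<otimes>\<^bsub>RG\<^esub> c) (inv h \<otimes> x)" if h: "a h \<noteq> 0" for h
  proof -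
    have hG: "h \<in> carrier G"
      using h A by auto
    let ?L = "(\<lambda>k. inv h \<otimes> k) ` ?K"
    have inj: "inj_on (\<lambda>k. inv h \<otimes> k) ?K"
    proof (rule inj_onI)
      fix k k' assume "k \<in> ?K" "k' \<in> ?K" and eq: "inv h \<otimes> k = inv h \<otimes> k'"
      then have "k \<in> carrier G" "k' \<in> carrier G"
        using K(2) by blast+
      then show "k = k'"
        using eq Units_l_cancel[of "inv h" k k'] hG by (simp add: Units_eq)
    qed
    have "?B \<subseteq> ?L"
    proof
      fix y assume y: "y \<in> ?B"
      then have "y \<in> carrier G" using B by auto
      then show "y \<in> ?L"
        using y h hG by (intro image_eqI[of _ _ "h \<otimes> y"]) (auto simp: m_assoc[symmetric])
    qed
    then have "(b \<otimes>\<^bsub>RG\<^esub> c) (inv h \<otimes> x) = (\<Sum>l\<in>?L. b l * c (inv l \<otimes> (inv h \<otimes> x)))"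
      using K hG x by (intro mult_eq_sum[OF b c]) auto
    also have "\<dots> = (\<Sum>k\<in>?K. b (inv h \<otimes> k) * c (inv (inv h \<otimes> k) \<otimes> (inv h \<otimes> x)))"
      using inj by (simp add: sum.reindex)
    also have "\<dots> = (\<Sum>k\<in>?K. b (inv h \<otimes> k) * c (inv k \<otimes> x))"
    proof (rule sum.cong)
      fix k assume "k \<in> ?K"
      then have k: "k \<in> carrier G" using K by blast
      have "h \<otimes> (inv h \<otimes> x) = x"
        using hG x by (simp add: m_assoc[symmetric])
      then have "inv (inv h \<otimes> k) \<otimes> (inv h \<otimes> x) = inv k \<otimes> x"
        using k hG x by (simp add: inv_mult_group m_assoc)
      then show "b (inv h \<otimes> k) * c (inv (inv h \<otimes> k) \<otimes> (inv h \<otimes> x)) = b (inv h \<otimes> k) * c (inv k \<otimes> x)"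
        using k hG by simp
    qed simp
    finally show ?thesis by simp
  qed
  have "((a \<otimes>\<^bsub>RG\<^esub> b) \<otimes>\<^bsub>RG\<^esub> c) x = (\<Sum>k\<in>?K. (a \<otimes>\<^bsub>RG\<^esub> b) k * c (inv k \<otimes> x))"
    using mult_supp[OF a b] K x by (intro mult_eq_sum[OF mult_mem[OF a b] c]) auto
  also have "\<dots> = (\<Sum>k\<in>?K. (\<Sum>h\<in>?A. a h * b (inv h \<otimes> k)) * c (inv k \<otimes> x))"
    using K by (intro sum.cong refl) (subst mult_eq_sum[OF a b A order_refl], auto)
  also have "\<dots> = (\<Sum>h\<in>?A. a h * (\<Sum>k\<in>?K. b (inv h \<otimes> k) * c (inv k \<otimes> x)))"
    unfolding sum_distrib_right sum_distrib_left by (subst sum.swap) (simp add: mult.assoc)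
  also have "\<dots> = (\<Sum>h\<in>?A. a h * (b \<otimes>\<^bsub>RG\<^esub> c) (inv h \<otimes> x))"
    by (rule sum.cong) (auto simp: inner)
  also have "\<dots> = (a \<otimes>\<^bsub>RG\<^esub> (b \<otimes>\<^bsub>RG\<^esub> c)) x"
    using mult_eq_sum[OF a mult_mem[OF b c] A order_refl x] by simp
  finally show "((a \<otimes>\<^bsub>RG\<^esub> b) \<otimes>\<^bsub>RG\<^esub> c) x = (a \<otimes>\<^bsub>RG\<^esub> (b \<otimes>\<^bsub>RG\<^esub> c)) x" .
qed (use assms mult_mem in auto)

lemma basis_elem_R: "basis_elem R g = (\<lambda>x. if x = g then 1 else 0)"
  by (simp add: basis_elem_def fun_eq_iff)

lemma basis_elem_mem: "g \<in> carrier G \<Longrightarrow> basis_elem R g \<in> carrier RG"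
  by (auto simp: RG_iff basis_elem_def)

lemma scaled_basis_mem: "g \<in> carrier G \<Longrightarrow> r \<in> loc n \<Longrightarrow> (\<lambda>x. if x = g then r else 0) \<in> carrier RG"
  by (auto simp: RG_iff)

lemma scaled_basis_mult:
  assumes "g \<in> carrier G" "r \<in> loc n" "b \<in> carrier RG"
  shows "(\<lambda>x. if x = g then r else 0) \<otimes>\<^bsub>RG\<^esub> b = (\<lambda>x. r * translate g b x)"
proof (rule RG_eqI)
  show "((\<lambda>x. if x = g then r else 0) \<otimes>\<^bsub>RG\<^esub> b) x = r * translate g b x" if "x \<in> carrier G" for x
  proof -
    have "{x. (if x = g then r else 0) \<noteq> 0} \<subseteq> {g}"
      by auto
    then show ?thesis
      using mult_eq_sum[OF scaled_basis_mem[OF assms(1,2)] assms(3), of "{g}" x] that assms(1)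
      by (simp add: translate_def)
  qed
qed (use assms scaled_basis_mem mult_mem RG_scale_mem translate_mem in auto)

lemma basis_mult: "\<lbrakk>g \<in> carrier G; b \<in> carrier RG\<rbrakk> \<Longrightarrow> basis_elem R g \<otimes>\<^bsub>RG\<^esub> b = translate g b"
  using scaled_basis_mult[of g 1 b] by (simp add: basis_elem_R)

lemma one_RG: "\<one>\<^bsub>RG\<^esub> = basis_elem R \<one>"
  by (simp add: group_ring_def)

lemma mult_eq_sum_translate:
  assumes "a \<in> carrier RG" "b \<in> carrier RG"
  shows "a \<otimes>\<^bsub>RG\<^esub> b = (\<Sum>h\<in>{h. a h \<noteq> 0}. (\<lambda>x. a h * translate h b x))"
proof
  fix x
  show "(a \<otimes>\<^bsub>RG\<^esub> b) x = (\<Sum>h\<in>{h. a h \<noteq> 0}. (\<lambda>x. a h * translate h b x)) x"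
    by (cases "x \<in> carrier G")
      (simp_all add: sum_apply translate_def mult_outside mult_eq_sum[OF assms RG_finite RG_supp order_refl] assms)
qed

lemma ring_RG: "ring RG"
proof (rule ringI)
  show "abelian_group RG" by (rule abelian_group_RG)
  show "monoid RG"
  proof (rule monoidI)
    show "\<one>\<^bsub>RG\<^esub> \<otimes>\<^bsub>RG\<^esub> a = a" if "a \<in> carrier RG" for a
      using that G_module.act_one[OF G_module_RG] by (simp add: one_RG basis_mult)
    show "a \<otimes>\<^bsub>RG\<^esub> \<one>\<^bsub>RG\<^esub> = a" if a: "a \<in> carrier RG" for a
    proof (rule RG_eqI)
      fix x assume x: "x \<in> carrier G"
      let ?S = "insert x {x. a x \<noteq> 0}"
      have "(a \<otimes>\<^bsub>RG\<^esub> \<one>\<^bsub>RG\<^esub>) x = (\<Sum>h\<in>?S. a h * basis_elem R \<one> (inv h \<otimes> x))"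
        unfolding one_RG using a x RG_finite[OF a] RG_supp[OF a]
        by (intro mult_eq_sum) (auto simp: basis_elem_mem)
      also have "\<dots> = (\<Sum>h\<in>?S. if h = x then a x else 0)"
      proof (rule sum.cong)
        fix h assume "h \<in> ?S"
        then have "h \<in> carrier G" using x RG_supp[OF a] by blast
        then have "inv h \<otimes> x = \<one> \<longleftrightarrow> h = x"
          using x inv_solve_left[of h \<one> x] by (metis inv_solve_left' l_inv one_closed r_one)
        then show "a h * basis_elem R \<one> (inv h \<otimes> x) = (if h = x then a x else 0)"
          by (simp add: basis_elem_def)
      qed simp
      also have "\<dots> = a x"
        using RG_finite[OF a] by (simp add: sum.delta')
      finally show "(a \<otimes>\<^bsub>RG\<^esub> \<one>\<^bsub>RG\<^esub>) x = a x" .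
    qed (use a one_RG basis_elem_mem mult_mem in auto)
  qed (simp_all add: mult_mem one_RG basis_elem_mem mult_assoc_RG)
  show "(a \<oplus>\<^bsub>RG\<^esub> b) \<otimes>\<^bsub>RG\<^esub> c = a \<otimes>\<^bsub>RG\<^esub> c \<oplus>\<^bsub>RG\<^esub> b \<otimes>\<^bsub>RG\<^esub> c"
    if abc: "a \<in> carrier RG" "b \<in> carrier RG" "c \<in> carrier RG" for a b c
  proof (rule RG_eqI)
    fix x assume x: "x \<in> carrier G"
    let ?S = "{x. a x \<noteq> 0} \<union> {x. b x \<noteq> 0}"
    have S: "finite ?S" "?S \<subseteq> carrier G" "{x. (a + b) x \<noteq> 0} \<subseteq> ?S"
      using abc RG_finite RG_supp by auto
    show "((a \<oplus>\<^bsub>RG\<^esub> b) \<otimes>\<^bsub>RG\<^esub> c) x = (a \<otimes>\<^bsub>RG\<^esub> c \<oplus>\<^bsub>RG\<^esub> b \<otimes>\<^bsub>RG\<^esub> c) x"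
      using mult_eq_sum[OF RG_add_mem[OF abc(1,2)] abc(3) S x] mult_eq_sum[OF abc(1,3) S(1,2) _ x]
        mult_eq_sum[OF abc(2,3) S(1,2) _ x]
      by (simp add: distrib_right sum.distrib plus_fun_def)
  qed (use abc in \<open>auto simp: mult_mem RG_add_mem\<close>)
  show "c \<otimes>\<^bsub>RG\<^esub> (a \<oplus>\<^bsub>RG\<^esub> b) = c \<otimes>\<^bsub>RG\<^esub> a \<oplus>\<^bsub>RG\<^esub> c \<otimes>\<^bsub>RG\<^esub> b"
    if abc: "a \<in> carrier RG" "b \<in> carrier RG" "c \<in> carrier RG" for a b c
  proof (rule RG_eqI)
    fix x assume x: "x \<in> carrier G"
    show "(c \<otimes>\<^bsub>RG\<^esub> (a \<oplus>\<^bsub>RG\<^esub> b)) x = (c \<otimes>\<^bsub>RG\<^esub> a \<oplus>\<^bsub>RG\<^esub> c \<otimes>\<^bsub>RG\<^esub> b) x"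
      using mult_eq_sum[OF abc(3) _ RG_finite RG_supp order_refl x] abc
      by (simp add: RG_add_mem distrib_left sum.distrib)
  qed (use abc in \<open>auto simp: mult_mem RG_add_mem\<close>)
qed

end

section \<open>Torsion-free modules over a localization of the integers\<close>

locale quotient = Module.module R M for R (structure) and M (structure) +
  fixes H assumes submodule: "submodule H R M"
begin

lemma H_subset: "H \<subseteq> carrier M" and H_zero: "\<zero>\<^bsub>M\<^esub> \<in> H"
  and H_smult: "\<lbrakk>a \<in> carrier R; x \<in> H\<rbrakk> \<Longrightarrow> a \<odot>\<^bsub>M\<^esub> x \<in> H"
  using submoduleE[OF submodule] subgroup.one_closed[OF submodule.axioms(1)[OF submodule]] by auto

lemma subgroup_H: "subgroup H (add_monoid M)"
  using submodule by (rule submodule.axioms(1))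

lemma abelian_subgroup_H: "abelian_subgroup H M"
  by (intro abelian_subgroupI3 additive_subgroupI subgroup_H M.abelian_group_axioms)

lemma coset_self: "x \<in> carrier M \<Longrightarrow> x \<in> H +>\<^bsub>M\<^esub> x"
  by (rule abelian_subgroup.a_rcos_self[OF abelian_subgroup_H])

lemma coset_mem_iff:
  assumes "x \<in> carrier M" "y \<in> carrier M"
  shows "y \<in> H +>\<^bsub>M\<^esub> x \<longleftrightarrow> y \<ominus>\<^bsub>M\<^esub> x \<in> H"
proof
  assume "y \<in> H +>\<^bsub>M\<^esub> x"
  then obtain h where h: "h \<in> H" "y = h \<oplus>\<^bsub>M\<^esub> x"
    by (auto simp: a_r_coset_def')
  then have "y \<ominus>\<^bsub>M\<^esub> x = h"
    using assms H_subset by (auto simp: M.minus_eq M.a_assoc M.r_neg)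
  then show "y \<ominus>\<^bsub>M\<^esub> x \<in> H"
    using h by simp
next
  assume "y \<ominus>\<^bsub>M\<^esub> x \<in> H"
  moreover have "y = (y \<ominus>\<^bsub>M\<^esub> x) \<oplus>\<^bsub>M\<^esub> x"
    using assms by (simp add: M.minus_eq M.a_assoc M.l_neg)
  ultimately show "y \<in> H +>\<^bsub>M\<^esub> x"
    unfolding a_r_coset_def' by blast
qed

lemma coset_eq_iff:
  assumes "x \<in> carrier M" "y \<in> carrier M"
  shows "H +>\<^bsub>M\<^esub> x = H +>\<^bsub>M\<^esub> y \<longleftrightarrow> x \<ominus>\<^bsub>M\<^esub> y \<in> H"
  using assms coset_self M.a_repr_independence[OF _ _ subgroup_H] coset_mem_iff by metis

lemma coset_eq_H: "x \<in> carrier M \<Longrightarrow> H +>\<^bsub>M\<^esub> x = H \<longleftrightarrow> x \<in> H"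
  using M.a_coset_join1[OF _ _ subgroup_H] M.a_coset_join2[OF _ subgroup_H] by blast

lemma carrier_quotient: "carrier (quotient_module M H) = {H +>\<^bsub>M\<^esub> x | x. x \<in> carrier M}"
  by (auto simp: quotient_module_def A_RCOSETS_def')

lemma quotient_zero: "\<zero>\<^bsub>quotient_module M H\<^esub> = H"
  by (simp add: quotient_module_def)

lemma quotient_add:
  "\<lbrakk>x \<in> carrier M; y \<in> carrier M\<rbrakk> \<Longrightarrow>
    (H +>\<^bsub>M\<^esub> x) \<oplus>\<^bsub>quotient_module M H\<^esub> (H +>\<^bsub>M\<^esub> y) = H +>\<^bsub>M\<^esub> (x \<oplus>\<^bsub>M\<^esub> y)"
  by (simp add: quotient_module_def abelian_subgroup.a_rcos_sum[OF abelian_subgroup_H])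

text \<open>All members of the union over representatives coincide, since differences of
  representatives lie in \<open>H\<close> and stay there when scaled.\<close>

lemma quotient_smult:
  assumes "a \<in> carrier R" "x \<in> carrier M"
  shows "a \<odot>\<^bsub>quotient_module M H\<^esub> (H +>\<^bsub>M\<^esub> x) = H +>\<^bsub>M\<^esub> (a \<odot>\<^bsub>M\<^esub> x)"
proof -
  have "H +>\<^bsub>M\<^esub> (a \<odot>\<^bsub>M\<^esub> y) = H +>\<^bsub>M\<^esub> (a \<odot>\<^bsub>M\<^esub> x)" if y: "y \<in> H +>\<^bsub>M\<^esub> x" for y
  proof -
    have yM: "y \<in> carrier M"
      using y M.a_r_coset_subset_G[OF H_subset assms(2)] by auto
    have "a \<odot>\<^bsub>M\<^esub> (y \<ominus>\<^bsub>M\<^esub> x) \<in> H"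
      using y coset_mem_iff[OF assms(2) yM] assms(1) H_smult by simp
    moreover have "a \<odot>\<^bsub>M\<^esub> (y \<ominus>\<^bsub>M\<^esub> x) = a \<odot>\<^bsub>M\<^esub> y \<ominus>\<^bsub>M\<^esub> a \<odot>\<^bsub>M\<^esub> x"
      using assms yM by (simp add: M.minus_eq smult_r_distr smult_r_minus)
    ultimately show ?thesis
      using assms yM by (subst coset_eq_iff) auto
  qed
  then have "(\<Union>y\<in>H +>\<^bsub>M\<^esub> x. H +>\<^bsub>M\<^esub> (a \<odot>\<^bsub>M\<^esub> y)) = (\<Union>y\<in>H +>\<^bsub>M\<^esub> x. H +>\<^bsub>M\<^esub> (a \<odot>\<^bsub>M\<^esub> x))"
    by (intro SUP_cong) simp_all
  also have "\<dots> = H +>\<^bsub>M\<^esub> (a \<odot>\<^bsub>M\<^esub> x)"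
    using coset_self[OF assms(2)] by blast
  finally show ?thesis
    by (simp add: quotient_module_def)
qed

lemma module_quotient: "Module.module R (quotient_module M H)"
proof (rule Module.moduleI)
  let ?Q = "quotient_module M H"
  note [simp] = carrier_quotient quotient_zero quotient_add quotient_smult
  show "cring R" ..
  show "abelian_group ?Q"
  proof (rule abelian_groupI)
    show "\<zero>\<^bsub>?Q\<^esub> \<in> carrier ?Q"
      using coset_eq_H[of "\<zero>\<^bsub>M\<^esub>"] H_zero by auto
    show "\<zero>\<^bsub>?Q\<^esub> \<oplus>\<^bsub>?Q\<^esub> X = X" if "X \<in> carrier ?Q" for X
      using that coset_eq_H[of "\<zero>\<^bsub>M\<^esub>"] H_zero quotient_add[of "\<zero>\<^bsub>M\<^esub>"] by auto
    show "\<exists>Y\<in>carrier ?Q. Y \<oplus>\<^bsub>?Q\<^esub> X = \<zero>\<^bsub>?Q\<^esub>" if X: "X \<in> carrier ?Q" for X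
    proof -
      obtain x where x: "X = H +>\<^bsub>M\<^esub> x" "x \<in> carrier M"
        using X by auto
      then show ?thesis
        using coset_eq_H[of "\<zero>\<^bsub>M\<^esub>"] H_zero
        by (intro bexI[of _ "H +>\<^bsub>M\<^esub> (\<ominus>\<^bsub>M\<^esub> x)"]) (auto simp: M.l_neg)
    qed
  qed (auto simp: M.a_ac intro: M.a_closed)
qed (auto simp: carrier_quotient quotient_zero quotient_add quotient_smult smult_l_distr smult_r_distr smult_assoc1)

end

section \<open>Independent families over a localization of the integers\<close>

locale loc_module =
  fixes n :: nat and M :: "(rat, 'm, 'f) module_scheme" (structure)
  assumes n_pos: "0 < n" and module: "Module.module (int_localization n) M"

sublocale loc_module \<subseteq> Module.module "int_localization n" M
  by (rule module)

context loc_module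
begin

lemma sm_closed [simp]: "\<lbrakk>a \<in> loc n; x \<in> carrier M\<rbrakk> \<Longrightarrow> a \<odot> x \<in> carrier M"
  using smult_closed[of a x] by simp

lemma sm_add: "\<lbrakk>a \<in> loc n; b \<in> loc n; x \<in> carrier M\<rbrakk> \<Longrightarrow> (a + b) \<odot> x = a \<odot> x \<oplus> b \<odot> x"
  using smult_l_distr[of a b x] by simp

lemma sm_mult: "\<lbrakk>a \<in> loc n; b \<in> loc n; x \<in> carrier M\<rbrakk> \<Longrightarrow> (a * b) \<odot> x = a \<odot> (b \<odot> x)"
  using smult_assoc1[of a b x] by simp

lemma sm_distr: "\<lbrakk>a \<in> loc n; x \<in> carrier M; y \<in> carrier M\<rbrakk> \<Longrightarrow> a \<odot> (x \<oplus> y) = a \<odot> x \<oplus> a \<odot> y"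
  using smult_r_distr[of a x y] by simp

lemma sm_one [simp]: "x \<in> carrier M \<Longrightarrow> 1 \<odot> x = x"
  using smult_one[of x] by simp

lemma sm_zero [simp]: "x \<in> carrier M \<Longrightarrow> 0 \<odot> x = \<zero>"
  using smult_l_null[of x] by simp

lemma sm_zero_right [simp]: "a \<in> loc n \<Longrightarrow> a \<odot> \<zero> = \<zero>"
  using smult_r_null[of a] by simp

lemma sm_finsum: "\<lbrakk>finite A; a \<in> loc n; f \<in> A \<rightarrow> carrier M\<rbrakk> \<Longrightarrow> a \<odot> finsum M f A = finsum M (\<lambda>i. a \<odot> f i) A"
  using finsum_smult_ldistr[of A a f] by simp

definition comb :: "'i set \<Rightarrow> ('i \<Rightarrow> 'm) \<Rightarrow> ('i \<Rightarrow> rat) \<Rightarrow> 'm"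
  where "comb I z a = finsum M (\<lambda>i. a i \<odot> z i) I"

definition span :: "'i set \<Rightarrow> ('i \<Rightarrow> 'm) \<Rightarrow> 'm set"
  where "span I z = {comb I z a | a. a \<in> I \<rightarrow> loc n}"

lemma comb_closed: "\<lbrakk>z \<in> I \<rightarrow> carrier M; a \<in> I \<rightarrow> loc n\<rbrakk> \<Longrightarrow> comb I z a \<in> carrier M"
  unfolding comb_def by (intro finsum_closed) (auto simp: Pi_iff)

lemma comb_add:
  assumes "z \<in> I \<rightarrow> carrier M" "a \<in> I \<rightarrow> loc n" "b \<in> I \<rightarrow> loc n"
  shows "comb I z (\<lambda>i. a i + b i) = comb I z a \<oplus> comb I z b"
proof -
  have "comb I z (\<lambda>i. a i + b i) = finsum M (\<lambda>i. a i \<odot> z i \<oplus> b i \<odot> z i) I"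
    unfolding comb_def using assms by (intro finsum_cong') (auto simp: sm_add Pi_iff)
  also have "\<dots> = comb I z a \<oplus> comb I z b"
    unfolding comb_def using assms by (intro finsum_addf) (auto simp: Pi_iff)
  finally show ?thesis .
qed

lemma comb_scale:
  assumes "finite I" "z \<in> I \<rightarrow> carrier M" "a \<in> I \<rightarrow> loc n" "r \<in> loc n"
  shows "comb I z (\<lambda>i. r * a i) = r \<odot> comb I z a"
  unfolding comb_def using assms
  by (subst sm_finsum) (auto simp: sm_mult Pi_iff intro!: finsum_cong')

text \<open>A Euclidean step: the coefficient \<open>b i\<close> is reduced by a multiple of \<open>b j\<close> at the price of changing
  the generator \<open>z j\<close>.\<close>

lemma comb_step:
  assumes I: "finite I" "i \<in> I" "j \<in> I" "i \<noteq> j" and z: "z \<in> I \<rightarrow> carrier M" and b: "b \<in> I \<rightarrow> loc n" and s: "s \<in> loc n"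
  shows "comb I z b = comb I (z(j := z j \<oplus> s \<odot> z i)) (b(i := b i - s * b j))"
proof -
  define K where "K = I - {i, j}"
  have IK: "I = insert i (insert j K)" and K: "finite K" "i \<notin> insert j K" "j \<notin> K"
    using I by (auto simp: K_def)
  have zi: "z i \<in> carrier M" "z j \<in> carrier M" and bi: "b i \<in> loc n" "b j \<in> loc n"
    using I z b by auto
  have zK: "z k \<in> carrier M" and bK: "b k \<in> loc n" if "k \<in> K" for k
    using that z b by (auto simp: IK)
  let ?z = "z(j := z j \<oplus> s \<odot> z i)" and ?b = "b(i := b i - s * b j)"
  have d: "b i - s * b j \<in> loc n"
    using bi s n_pos by (simp add: loc_diff loc_mult)
  have eqK: "finsum M (\<lambda>k. ?b k \<odot> ?z k) K = finsum M (\<lambda>k. b k \<odot> z k) K"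
    using K zK bK by (intro finsum_cong') auto
  have inK: "finsum M (\<lambda>k. b k \<odot> z k) K \<in> carrier M"
    using zK bK by (intro finsum_closed) auto
  have L: "comb I z b = b i \<odot> z i \<oplus> (b j \<odot> z j \<oplus> finsum M (\<lambda>k. b k \<odot> z k) K)"
    unfolding comb_def IK using K zi bi zK bK by (simp add: Pi_iff)
  have "comb I ?z ?b = (b i - s * b j) \<odot> z i \<oplus> (b j \<odot> (z j \<oplus> s \<odot> z i) \<oplus> finsum M (\<lambda>k. ?b k \<odot> ?z k) K)"
    unfolding comb_def IK using K zi bi zK bK s d I(4) by (simp add: Pi_iff)
  also have "\<dots> = (b i - s * b j) \<odot> z i \<oplus> (b j \<odot> z j \<oplus> (s * b j) \<odot> z i \<oplus> finsum M (\<lambda>k. b k \<odot> z k) K)"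
    unfolding eqK using zi bi s by (simp add: sm_distr sm_mult[symmetric] mult.commute)
  also have "\<dots> = ((b i - s * b j) \<odot> z i \<oplus> (s * b j) \<odot> z i) \<oplus> (b j \<odot> z j \<oplus> finsum M (\<lambda>k. b k \<odot> z k) K)"
    using zi bi s d inK by (simp add: loc_mult M.a_ac)
  also have "(b i - s * b j) \<odot> z i \<oplus> (s * b j) \<odot> z i = b i \<odot> z i"
    using sm_add[of "b i - s * b j" "s * b j" "z i"] zi bi s d by (simp add: loc_mult)
  finally show ?thesis
    unfolding L by (rule sym)
qed

lemma span_remove:
  assumes I: "finite I" "i \<in> I" and z: "z \<in> I \<rightarrow> carrier M" and zi: "z i = \<zero>"
  shows "span I z \<subseteq> span (I - {i}) z"
proof
  fix x assume "x \<in> span I z"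
  then obtain a where a: "a \<in> I \<rightarrow> loc n" "x = comb I z a"
    by (auto simp: span_def)
  have "comb I z a = comb (insert i (I - {i})) z a"
    using I by (simp add: insert_absorb)
  also have "\<dots> = comb (I - {i}) z a"
    unfolding comb_def using I z a(1) zi
    by (subst finsum_insert) (auto simp: Pi_iff intro!: M.l_zero finsum_closed)
  finally show "x \<in> span (I - {i}) z"
    using a by (auto simp: span_def)
qed

definition independent :: "'i set \<Rightarrow> ('i \<Rightarrow> 'm) \<Rightarrow> bool"
  where "independent I z \<longleftrightarrow> (\<forall>a. a \<in> I \<rightarrow> loc n \<and> comb I z a = \<zero> \<longrightarrow> (\<forall>i\<in>I. a i = 0))"

definition torsion_free :: bool
  where "torsion_free \<longleftrightarrow> (\<forall>r\<in>loc n. \<forall>x\<in>carrier M. r \<odot> x = \<zero> \<longrightarrow> r = 0 \<or> x = \<zero>)"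

text \<open>Descent on the sum of the absolute values of the coefficients. While two coefficients
  are nonzero, a Euclidean step shrinks the larger one and does not shrink the span; a relation with
  one nonzero coefficient contradicts torsion-freeness or minimality.\<close>

lemma no_integer_relation:
  fixes a :: "'i \<Rightarrow> int"
  assumes torsion_free
    and I: "finite I"
    and minimal: "\<And>i z. \<lbrakk>i \<in> I; z \<in> I \<rightarrow> carrier M\<rbrakk> \<Longrightarrow> \<not> S \<subseteq> span (I - {i}) z"
    and z: "z \<in> I \<rightarrow> carrier M" "S \<subseteq> span I z" "comb I z (\<lambda>i. of_int (a i)) = \<zero>"
    and i: "i \<in> I" "a i \<noteq> 0"
  shows False
  using z i
proof (induction "nat (\<Sum>i\<in>I. \<bar>a i\<bar>)" arbitrary: z a i rule: less_induct)
  case less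
  have step: False if ij: "i \<in> I" "j \<in> I" "i \<noteq> j" "a j \<noteq> 0" "\<bar>a j\<bar> \<le> \<bar>a i\<bar>" for i j
  proof -
    \<comment> \<open>The sign that makes \<open>\<bar>a i - s * a j\<bar> = \<bar>a i\<bar> -
      \<bar>a j\<bar>\<close> when \<open>\<bar>a j\<bar> \<le> \<bar>a i\<bar>\<close>; a plain
      subtraction suffices for the descent, without quotients.\<close>
    define s where "s = sgn (a i) * sgn (a j)"
    define z' where "z' = z(j := z j \<oplus> of_int s \<odot> z i)"
    define a' where "a' = a(i := a i - s * a j)"
    have lt: "\<bar>a' i\<bar> < \<bar>a i\<bar>"
      using ij by (auto simp: a'_def s_def sgn_if)
    have "(\<Sum>i\<in>I. \<bar>a' i\<bar>) < (\<Sum>i\<in>I. \<bar>a i\<bar>)"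
      using I ij lt by (intro sum_strict_mono_ex1) (auto simp: a'_def)
    moreover have "0 \<le> (\<Sum>i\<in>I. \<bar>a' i\<bar>)"
      by (rule sum_nonneg) simp
    ultimately have less': "nat (\<Sum>i\<in>I. \<bar>a' i\<bar>) < nat (\<Sum>i\<in>I. \<bar>a i\<bar>)"
      by (simp only: nat_less_eq_zless)
    have z': "z' \<in> I \<rightarrow> carrier M"
      using less.prems(1) ij by (auto simp: z'_def Pi_iff)
    have sub: "span I z \<subseteq> span I z'"
    proof
      fix x assume "x \<in> span I z"
      then obtain b where b: "b \<in> I \<rightarrow> loc n" "x = comb I z b"
        by (auto simp: span_def)
      moreover have "b(i := b i - of_int s * b j) \<in> I \<rightarrow> loc n"
        using b ij n_pos by (auto simp: Pi_iff loc_diff loc_mult)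
      ultimately show "x \<in> span I z'"
        using comb_step[OF I ij(1-3) less.prems(1) b(1), of "of_int s"] by (auto simp: span_def z'_def)
    qed
    have "(\<lambda>k. of_int (a' k) :: rat) = (\<lambda>k. of_int (a k))(i := of_int (a i) - of_int s * of_int (a j))"
      by (auto simp: a'_def)
    then have "comb I z' (\<lambda>k. of_int (a' k)) = \<zero>"
      using comb_step[OF I ij(1-3) less.prems(1), of "\<lambda>k. of_int (a k)" "of_int s"] less.prems(3)
      by (simp add: z'_def)
    moreover have "a' j \<noteq> 0"
      using ij by (simp add: a'_def)
    ultimately show False
      using less.hyps[OF less' z'] sub less.prems(2) ij(2) by blast
  qed
  show False
  proof (cases "\<exists>j\<in>I. j \<noteq> i \<and> a j \<noteq> 0")
    case True
    then obtain j where j: "j \<in> I" "j \<noteq> i" "a j \<noteq> 0" by blast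
    show False
      using step[of i j] step[of j i] j less.prems(4,5) by (cases "\<bar>a j\<bar> \<le> \<bar>a i\<bar>") auto
  next
    case False
    have zi: "z i \<in> carrier M"
      using less.prems by auto
    have "comb I z (\<lambda>k. of_int (a k)) = comb (insert i (I - {i})) z (\<lambda>k. of_int (a k))"
      using less.prems(4) by (simp add: insert_absorb)
    also have "\<dots> = of_int (a i) \<odot> z i \<oplus> finsum M (\<lambda>k. of_int (a k) \<odot> z k) (I - {i})"
      unfolding comb_def using I less.prems(1) zi by (subst finsum_insert) (auto simp: Pi_iff)
    also have "finsum M (\<lambda>k. of_int (a k) \<odot> z k) (I - {i}) = finsum M (\<lambda>_. \<zero>) (I - {i})"
      using False less.prems(1) by (intro finsum_cong') (auto simp: Pi_iff)
    also have "\<dots> = \<zero>"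
      by (rule finsum_zero)
    finally have "of_int (a i) \<odot> z i = \<zero>"
      using less.prems(3) zi by simp
    then have "z i = \<zero>"
      using \<open>torsion_free\<close> less.prems(5) zi unfolding torsion_free_def by (metis loc_int of_int_eq_0_iff)
    then show False
      using minimal[OF less.prems(4,1)] span_remove[OF I less.prems(4,1)] less.prems(2) by blast
  qed
qed

lemma common_denominator:
  assumes "finite I" "a \<in> I \<rightarrow> loc n"
  shows "\<exists>k b. \<forall>i\<in>I. of_nat n ^ k * a i = of_int (b i)"
  using assms
proof (induction I rule: finite_induct)
  case (insert i I)
  then obtain k b where kb: "\<forall>i\<in>I. of_nat n ^ k * a i = of_int (b i)"
    by auto
  obtain c l where cl: "a i = of_int c / of_nat n ^ l"
    using insert.prems by (auto simp: loc_iff)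
  show ?case
  proof (intro exI ballI)
    fix j assume "j \<in> insert i I"
    then show "of_nat n ^ (k + l) * a j = of_int (((\<lambda>j. int n ^ l * b j)(i := int n ^ k * c)) j)"
      using kb cl n_pos insert.hyps by (auto simp: power_add mult.assoc mult.left_commute)
  qed
qed simp

text \<open>Among all families whose span contains \<open>S\<close>, one with the fewest members is
  independent: a relation over \<open>loc n\<close> becomes integral after multiplication by a power
  of \<open>n\<close>, and \<open>no_integer_relation\<close> excludes integral ones.\<close>

theorem independent_spanning_family:
  assumes torsion_free
    and S: "finite S" "S \<subseteq> carrier M"
  obtains I :: "'m set" and z where "finite I" "z \<in> I \<rightarrow> carrier M" "S \<subseteq> span I z" "independent I z"
proof -
  \<comment> \<open>Index sets are taken in the type of the module so that \<open>S\<close>, indexed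
    by itself, is an admissible family to start from.\<close>
  let ?P = "\<lambda>k. \<exists>(I :: 'm set) z. finite I \<and> card I = k \<and> z \<in> I \<rightarrow> carrier M \<and> S \<subseteq> span I z"
  have "S \<subseteq> span S (\<lambda>y. y)"
  proof
    fix x assume x: "x \<in> S"
    let ?a = "\<lambda>y. if y = x then 1 else 0 :: rat"
    have "comb S (\<lambda>y. y) ?a = comb (insert x (S - {x})) (\<lambda>y. y) ?a"
      using x by (simp add: insert_absorb)
    also have "\<dots> = x \<oplus> finsum M (\<lambda>y. ?a y \<odot> y) (S - {x})"
      unfolding comb_def using x S by (subst finsum_insert) (auto simp: Pi_iff)
    also have "finsum M (\<lambda>y. ?a y \<odot> y) (S - {x}) = finsum M (\<lambda>_. \<zero>) (S - {x})"
      using S by (intro finsum_cong') auto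
    finally have "comb S (\<lambda>y. y) ?a = x"
      using x S by auto
    moreover have "?a \<in> S \<rightarrow> loc n"
      by auto
    ultimately show "x \<in> span S (\<lambda>y. y)"
      unfolding span_def by (intro CollectI exI[of _ ?a] conjI) simp_all
  qed
  then have "?P (card S)"
    using S by (intro exI[of _ S] exI[of _ "\<lambda>y. y"]) auto
  then have "?P (LEAST k. ?P k)"
    by (rule LeastI)
  moreover have least: "(LEAST k. ?P k) \<le> k" if "?P k" for k
    using that by (rule Least_le)
  ultimately obtain I :: "'m set" and z where I: "finite I" "card I = (LEAST k. ?P k)" "z \<in> I \<rightarrow> carrier M" "S \<subseteq> span I z"
    by blast
  have minimal: "\<not> S \<subseteq> span (I - {i}) y" if "i \<in> I" "y \<in> I \<rightarrow> carrier M" for i y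
  proof
    assume "S \<subseteq> span (I - {i}) y"
    then have "?P (card (I - {i}))"
      using I(1) that by (intro exI[of _ "I - {i}"] exI[of _ y]) auto
    then show False
      using least[of "card (I - {i})"] I(1,2) that(1) card_Diff1_less[of I i] by simp
  qed
  have "independent I z"
    unfolding independent_def
  proof (intro allI impI ballI, rule ccontr)
    fix a i assume a: "a \<in> I \<rightarrow> loc n \<and> comb I z a = \<zero>" and i: "i \<in> I" "a i \<noteq> 0"
    obtain k b where b: "\<And>i. i \<in> I \<Longrightarrow> of_nat n ^ k * a i = of_int (b i)"
      using common_denominator[OF I(1)] a by blast
    have nk: "of_nat n ^ k \<in> loc n"
      using loc_int[of "int n ^ k" n] by simp
    have "comb I z (\<lambda>i. of_int (b i)) = comb I z (\<lambda>i. of_nat n ^ k * a i)"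
      unfolding comb_def using I(3) b by (intro finsum_cong') (auto simp: Pi_iff)
    also have "\<dots> = \<zero>"
      using comb_scale[OF I(1,3), of a "of_nat n ^ k"] a nk by simp
    finally have "comb I z (\<lambda>i. of_int (b i)) = \<zero>" .
    moreover have "b i \<noteq> 0"
      using b[OF i(1)] i(2) n_pos by auto
    ultimately show False
    proof (intro no_integer_relation[of I S z b i])
      show torsion_free by fact
      show "\<not> S \<subseteq> span (I - {i}) y" if "i \<in> I" "y \<in> I \<rightarrow> carrier M" for i y
        using that by (rule minimal)
    qed (use I i in simp_all)
  qed
  then show thesis
    using that I by blast
qed

end

section \<open>Flatness of torsion-free modules\<close>

lemma finsupp_loc_iff: "u \<in> finsupp (int_localization n) X \<longleftrightarrow>
    (\<forall>x\<in>X. u x \<in> loc n) \<and> (\<forall>x. x \<notin> X \<longrightarrow> u x = 0) \<and> finite {x. u x \<noteq> 0}"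
  by (simp add: finsupp_def)

lemma finsupp_loc_apply: "u \<in> finsupp (int_localization n) X \<Longrightarrow> u x \<in> loc n"
  unfolding finsupp_loc_iff by (cases "x \<in> X") auto

lemma free_module_simps [simp]:
  "carrier (free_module (int_localization n) X) = finsupp (int_localization n) X"
  "add (free_module (int_localization n) X) = (+)"
  "zero (free_module (int_localization n) X) = 0"
  "smult (free_module (int_localization n) X) = (\<lambda>r u x. r * u x)"
  by (simp_all add: free_module_def fun_eq_iff)

lemma basis_elem_loc: "basis_elem (int_localization n) x = (\<lambda>y. if y = x then 1 else 0)"
  by (simp add: basis_elem_def fun_eq_iff)

lemma finsupp_loc_diff:
  assumes "0 < n" "u \<in> finsupp (int_localization n) X" "v \<in> finsupp (int_localization n) X"
  shows "u - v \<in> finsupp (int_localization n) X"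
proof -
  have "finite ({x. u x \<noteq> 0} \<union> {x. v x \<noteq> 0})"
    using assms by (simp add: finsupp_loc_iff)
  then have "finite {x. (u - v) x \<noteq> 0}"
    by (rule finite_subset[rotated]) auto
  then show ?thesis
    using assms by (simp add: finsupp_loc_iff loc_diff)
qed

lemma finsupp_loc_zero: "0 \<in> finsupp (int_localization n) X"
  by (simp add: finsupp_loc_iff)

lemma finsupp_loc_uminus: "0 < n \<Longrightarrow> u \<in> finsupp (int_localization n) X \<Longrightarrow> - u \<in> finsupp (int_localization n) X"
  using finsupp_loc_diff[of n 0 X u] by (simp add: finsupp_loc_zero)

lemma finsupp_loc_add:
  "\<lbrakk>0 < n; u \<in> finsupp (int_localization n) X; v \<in> finsupp (int_localization n) X\<rbrakk> \<Longrightarrow> u + v \<in> finsupp (int_localization n) X"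
  using finsupp_loc_diff[of n u X "- v"] finsupp_loc_uminus[of n v X] by simp

lemma finsupp_loc_scale:
  assumes "r \<in> loc n" "u \<in> finsupp (int_localization n) X"
  shows "(\<lambda>x. r * u x) \<in> finsupp (int_localization n) X"
proof -
  have "finite {x. u x \<noteq> 0}"
    using assms by (simp add: finsupp_loc_iff)
  then have "finite {x. r * u x \<noteq> 0}"
    by (rule finite_subset[rotated]) auto
  then show ?thesis
    using assms by (simp add: finsupp_loc_iff loc_mult)
qed

lemma basis_elem_finsupp: "x \<in> X \<Longrightarrow> basis_elem (int_localization n) x \<in> finsupp (int_localization n) X"
  by (auto simp: finsupp_loc_iff basis_elem_loc)

lemma module_free_loc:
  assumes "0 < n"
  shows "Module.module (int_localization n) (free_module (int_localization n) X)"
proof (rule Module.moduleI)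
  show "cring (int_localization n)"
    using assms by (rule cring_int_localization)
  show "abelian_group (free_module (int_localization n) X)"
  proof (rule abelian_groupI)
    show "\<exists>v\<in>carrier (free_module (int_localization n) X).
        v \<oplus>\<^bsub>free_module (int_localization n) X\<^esub> u = \<zero>\<^bsub>free_module (int_localization n) X\<^esub>"
      if "u \<in> carrier (free_module (int_localization n) X)" for u
      using that finsupp_loc_uminus[OF assms] by (intro bexI[of _ "- u"]) auto
  qed (auto simp: finsupp_loc_zero finsupp_loc_add assms add_ac)
qed (auto simp: finsupp_loc_scale algebra_simps fun_eq_iff)

lemma free_module_a_minus:
  assumes "0 < n" "u \<in> finsupp (int_localization n) X" "v \<in> finsupp (int_localization n) X"
  shows "u \<ominus>\<^bsub>free_module (int_localization n) X\<^esub> v = u - v"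
proof -
  interpret F: Module.module "int_localization n" "free_module (int_localization n) X"
    by (rule module_free_loc[OF assms(1)])
  show ?thesis
    using a_inv_eq_uminus[OF F.abelian_group_axioms, of v] assms finsupp_loc_uminus[of n v X]
    by (simp add: a_minus_def)
qed

section \<open>The kernel of the tensor product and evaluation at functionals\<close>

locale loc_tensor = loc_module n M + N: loc_module n N
  for n :: nat and M :: "(rat, 'm, 'f) module_scheme" (structure) and N :: "(rat, 'n, 'h) module_scheme"
begin

abbreviation "L \<equiv> free_module (int_localization n) (carrier M \<times> carrier N)"
abbreviation "FS \<equiv> finsupp (int_localization n) (carrier M \<times> carrier N)"
abbreviation b :: "'m \<Rightarrow> 'n \<Rightarrow> 'm \<times> 'n \<Rightarrow> rat" where "b x y \<equiv> basis_elem (int_localization n) (x, y)"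
abbreviation "K \<equiv> tensor_kernel (int_localization n) M N"

lemma b_mem: "\<lbrakk>x \<in> carrier M; y \<in> carrier N\<rbrakk> \<Longrightarrow> b x y \<in> FS"
  by (simp add: basis_elem_finsupp)

lemma K_def: "K = \<Inter>{H. submodule H (int_localization n) L \<and> tensor_relations (int_localization n) M N \<subseteq> H}"
  by (simp add: tensor_kernel_def)

lemma relations_in:
  assumes "\<And>x x' y. \<lbrakk>x \<in> carrier M; x' \<in> carrier M; y \<in> carrier N\<rbrakk> \<Longrightarrow> b (x \<oplus> x') y - (b x y + b x' y) \<in> H"
    and "\<And>x y y'. \<lbrakk>x \<in> carrier M; y \<in> carrier N; y' \<in> carrier N\<rbrakk> \<Longrightarrow> b x (y \<oplus>\<^bsub>N\<^esub> y') - (b x y + b x y') \<in> H"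
    and "\<And>r x y. \<lbrakk>r \<in> loc n; x \<in> carrier M; y \<in> carrier N\<rbrakk> \<Longrightarrow> b (r \<odot> x) y - (\<lambda>p. r * b x y p) \<in> H"
    and "\<And>r x y. \<lbrakk>r \<in> loc n; x \<in> carrier M; y \<in> carrier N\<rbrakk> \<Longrightarrow> b x (r \<odot>\<^bsub>N\<^esub> y) - (\<lambda>p. r * b x y p) \<in> H"
  shows "tensor_relations (int_localization n) M N \<subseteq> H"
  using assms unfolding tensor_relations_def Let_def
  by (auto simp: free_module_a_minus n_pos b_mem finsupp_loc_add finsupp_loc_scale)

lemma relations_K:
  shows K_add_left: "\<lbrakk>x \<in> carrier M; x' \<in> carrier M; y \<in> carrier N\<rbrakk> \<Longrightarrow> b (x \<oplus> x') y - (b x y + b x' y) \<in> K"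
    and K_add_right: "\<lbrakk>x \<in> carrier M; y \<in> carrier N; y' \<in> carrier N\<rbrakk> \<Longrightarrow> b x (y \<oplus>\<^bsub>N\<^esub> y') - (b x y + b x y') \<in> K"
    and K_smult_left: "\<lbrakk>r \<in> loc n; x \<in> carrier M; y \<in> carrier N\<rbrakk> \<Longrightarrow> b (r \<odot> x) y - (\<lambda>p. r * b x y p) \<in> K"
    and K_smult_right: "\<lbrakk>r \<in> loc n; x \<in> carrier M; y \<in> carrier N\<rbrakk> \<Longrightarrow> b x (r \<odot>\<^bsub>N\<^esub> y) - (\<lambda>p. r * b x y p) \<in> K"
proof -
  have sub: "tensor_relations (int_localization n) M N \<subseteq> K"
    unfolding K_def by blast
  note minus = free_module_a_minus[of n _ "carrier M \<times> carrier N", OF n_pos]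
  show "b (x \<oplus> x') y - (b x y + b x' y) \<in> K" if "x \<in> carrier M" "x' \<in> carrier M" "y \<in> carrier N" for x x' y
  proof -
    have "b (x \<oplus> x') y \<ominus>\<^bsub>L\<^esub> (b x y \<oplus>\<^bsub>L\<^esub> b x' y) \<in> tensor_relations (int_localization n) M N"
      unfolding tensor_relations_def Let_def using that by blast
    then show ?thesis
      using sub that by (auto simp: minus b_mem finsupp_loc_add n_pos)
  qed
  show "b x (y \<oplus>\<^bsub>N\<^esub> y') - (b x y + b x y') \<in> K" if "x \<in> carrier M" "y \<in> carrier N" "y' \<in> carrier N" for x y y'
  proof -
    have "b x (y \<oplus>\<^bsub>N\<^esub> y') \<ominus>\<^bsub>L\<^esub> (b x y \<oplus>\<^bsub>L\<^esub> b x y') \<in> tensor_relations (int_localization n) M N"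
      unfolding tensor_relations_def Let_def using that by blast
    then show ?thesis
      using sub that by (auto simp: minus b_mem finsupp_loc_add n_pos)
  qed
  show "b (r \<odot> x) y - (\<lambda>p. r * b x y p) \<in> K" if "r \<in> loc n" "x \<in> carrier M" "y \<in> carrier N" for r x y
  proof -
    have "b (r \<odot> x) y \<ominus>\<^bsub>L\<^esub> r \<odot>\<^bsub>L\<^esub> b x y \<in> tensor_relations (int_localization n) M N"
      unfolding tensor_relations_def Let_def carrier_int_localization using that by blast
    then show ?thesis
      using sub that by (auto simp: minus b_mem finsupp_loc_scale n_pos)
  qed
  show "b x (r \<odot>\<^bsub>N\<^esub> y) - (\<lambda>p. r * b x y p) \<in> K" if "r \<in> loc n" "x \<in> carrier M" "y \<in> carrier N" for r x y
  proof -
    have "b x (r \<odot>\<^bsub>N\<^esub> y) \<ominus>\<^bsub>L\<^esub> r \<odot>\<^bsub>L\<^esub> b x y \<in> tensor_relations (int_localization n) M N"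
      unfolding tensor_relations_def Let_def carrier_int_localization using that by blast
    then show ?thesis
      using sub that by (auto simp: minus b_mem finsupp_loc_scale n_pos)
  qed
qed

lemma submodule_L:
  assumes "H \<subseteq> FS" "0 \<in> H" "\<And>u v. \<lbrakk>u \<in> H; v \<in> H\<rbrakk> \<Longrightarrow> u - v \<in> H"
    and "\<And>r u. \<lbrakk>r \<in> loc n; u \<in> H\<rbrakk> \<Longrightarrow> (\<lambda>p. r * u p) \<in> H"
  shows "submodule H (int_localization n) L"
proof -
  interpret L: Module.module "int_localization n" L
    by (rule module_free_loc[OF n_pos])
  have neg: "- u \<in> H" if "u \<in> H" for u
    using assms(3)[OF assms(2) that] by simp
  show ?thesis
  proof (rule L.submoduleI)
    show "\<ominus>\<^bsub>L\<^esub> u \<in> H" if "u \<in> H" for u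
      using a_inv_eq_uminus[OF L.abelian_group_axioms, of u] neg[OF that] that subsetD[OF assms(1)] by simp
    show "u \<oplus>\<^bsub>L\<^esub> v \<in> H" if "u \<in> H" "v \<in> H" for u v
      using assms(3)[OF that(1) neg[OF that(2)]] by simp
  qed (use assms in auto)
qed

lemma FS_submodule: "submodule FS (int_localization n) L"
  by (rule submodule_L) (auto simp: finsupp_loc_zero finsupp_loc_diff finsupp_loc_scale n_pos)

lemma submodule_diff:
  assumes "submodule H (int_localization n) L" "u \<in> H" "v \<in> H"
  shows "u - v \<in> H"
proof -
  interpret L: Module.module "int_localization n" L
    by (rule module_free_loc[OF n_pos])
  have "u \<in> FS" "v \<in> FS"
    using assms L.submoduleE(1)[OF assms(1)] by auto
  moreover have "u \<ominus>\<^bsub>L\<^esub> v \<in> H"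
    unfolding a_minus_def using assms L.submoduleE(3,5)[OF assms(1)] by blast
  ultimately show ?thesis
    by (simp add: free_module_a_minus n_pos)
qed

lemma K_submodule: "submodule K (int_localization n) L"
proof (rule submodule_L)
  interpret L: Module.module "int_localization n" L
    by (rule module_free_loc[OF n_pos])
  have rel: "tensor_relations (int_localization n) M N \<subseteq> FS"
    by (rule relations_in) (auto intro!: finsupp_loc_diff finsupp_loc_add finsupp_loc_scale b_mem n_pos)
  show "K \<subseteq> FS"
    unfolding K_def using FS_submodule rel by blast
  show "0 \<in> K"
    unfolding K_def using submodule.axioms(1) subgroup.one_closed by fastforce
  show "u - v \<in> K" if "u \<in> K" "v \<in> K" for u v
    using that submodule_diff unfolding K_def by blast
  show "(\<lambda>p. r * u p) \<in> K" if "r \<in> loc n" "u \<in> K" for r u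
  proof -
    have "(\<lambda>p. r * u p) \<in> H" if "submodule H (int_localization n) L" "u \<in> H" for H
      using submodule.smult_closed[OF that(1), of r u] that \<open>r \<in> loc n\<close> by simp
    then show ?thesis
      using that(2) unfolding K_def by blast
  qed
qed

lemma K_diff: "\<lbrakk>u \<in> K; v \<in> K\<rbrakk> \<Longrightarrow> u - v \<in> K"
  by (rule submodule_diff[OF K_submodule])

lemma K_zero: "0 \<in> K"
  using subgroup.one_closed[OF submodule.axioms(1)[OF K_submodule]] by simp

lemma K_uminus: "u \<in> K \<Longrightarrow> - u \<in> K"
  using K_diff[OF K_zero, of u] by simp

lemma K_add: "\<lbrakk>u \<in> K; v \<in> K\<rbrakk> \<Longrightarrow> u + v \<in> K"
  using K_diff[of u "- v"] K_uminus[of v] by simp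

lemma K_scale: "\<lbrakk>r \<in> loc n; u \<in> K\<rbrakk> \<Longrightarrow> (\<lambda>p. r * u p) \<in> K"
  using submodule.smult_closed[OF K_submodule, of r u] by simp

lemma K_sum: "(\<And>i. i \<in> I \<Longrightarrow> f i \<in> K) \<Longrightarrow> sum f I \<in> K"
  by (induction I rule: infinite_finite_induct) (auto intro: K_zero K_add)

lemma K_zero_left: "y \<in> carrier N \<Longrightarrow> b \<zero> y \<in> K"
  using K_uminus[OF K_add_left[of \<zero> \<zero> y]] by simp

lemma K_zero_right: "x \<in> carrier M \<Longrightarrow> b x \<zero>\<^bsub>N\<^esub> \<in> K"
  using K_uminus[OF K_add_right[of x "\<zero>\<^bsub>N\<^esub>" "\<zero>\<^bsub>N\<^esub>"]] by simp

lemma functional_fst: "\<lbrakk>\<phi> \<in> S \<rightarrow> loc n; p \<in> S \<times> carrier N\<rbrakk> \<Longrightarrow> \<phi> (fst p) \<in> loc n"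
  by (cases p) auto

text \<open>The value at a pure tensor of the map \<open>M \<otimes> N \<rightarrow> N\<close> induced by a linear functional \<open>\<phi>\<close> on \<open>M\<close> is
  \<open>\<phi> x \<odot> y\<close>.\<close>

definition eval_at :: "('m \<Rightarrow> rat) \<Rightarrow> ('m \<times> 'n \<Rightarrow> rat) \<Rightarrow> 'n"
  where "eval_at \<phi> u = finsum N (\<lambda>p. (u p * \<phi> (fst p)) \<odot>\<^bsub>N\<^esub> snd p) {p. u p \<noteq> 0}"

text \<open>Functionals will be given only on a part \<open>S\<close> of \<open>M\<close>, so
  evaluation is meaningful only for \<open>u\<close> whose first components lie in
  \<open>S\<close>.\<close>

definition supported :: "'m set \<Rightarrow> ('m \<times> 'n \<Rightarrow> rat) set"
  where "supported S = {u \<in> FS. \<forall>p. u p \<noteq> 0 \<longrightarrow> fst p \<in> S}"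

lemma eval_at_superset:
  assumes u: "u \<in> supported S" and \<phi>: "\<phi> \<in> S \<rightarrow> loc n" and T: "finite T" "{p. u p \<noteq> 0} \<subseteq> T" "T \<subseteq> S \<times> carrier N"
  shows "eval_at \<phi> u = finsum N (\<lambda>p. (u p * \<phi> (fst p)) \<odot>\<^bsub>N\<^esub> snd p) T"
proof -
  have "(u p * \<phi> (fst p)) \<odot>\<^bsub>N\<^esub> snd p \<in> carrier N" if "p \<in> T" for p
  proof -
    have "u p \<in> loc n"
      using u unfolding supported_def by (blast intro: finsupp_loc_apply)
    moreover have "p \<in> S \<times> carrier N"
      using that T(3) by blast
    then have "\<phi> (fst p) \<in> loc n" "snd p \<in> carrier N"
      using functional_fst[OF \<phi>] by auto
    ultimately show ?thesis
      by (simp add: loc_mult)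
  qed
  then show ?thesis
    unfolding eval_at_def using T
    by (intro N.add.finprod_mono_neutral_cong_left) auto
qed

lemma supported_supp:
  assumes "u \<in> supported S"
  shows "finite {p. u p \<noteq> 0}" "{p. u p \<noteq> 0} \<subseteq> S \<times> carrier N" "u p \<in> loc n"
proof -
  have u: "u \<in> FS" and S: "\<And>p. u p \<noteq> 0 \<Longrightarrow> fst p \<in> S"
    using assms by (auto simp: supported_def)
  show "finite {p. u p \<noteq> 0}" "u p \<in> loc n"
    using u finsupp_loc_apply[OF u] by (simp_all add: finsupp_loc_iff)
  show "{p. u p \<noteq> 0} \<subseteq> S \<times> carrier N"
  proof
    fix p assume p: "p \<in> {p. u p \<noteq> 0}"
    then have "p \<in> carrier M \<times> carrier N"
      using u unfolding finsupp_loc_iff by blast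
    then show "p \<in> S \<times> carrier N"
      using S[of p] p by (auto simp: mem_Times_iff)
  qed
qed

lemma eval_at_closed:
  assumes "u \<in> supported S" "\<phi> \<in> S \<rightarrow> loc n"
  shows "eval_at \<phi> u \<in> carrier N"
  unfolding eval_at_def
proof (rule N.finsum_closed, rule Pi_I)
  fix p assume "p \<in> {p. u p \<noteq> 0}"
  then have "p \<in> S \<times> carrier N"
    using supported_supp(2)[OF assms(1)] by blast
  then have "\<phi> (fst p) \<in> loc n" "snd p \<in> carrier N"
    using functional_fst[OF assms(2)] by auto
  then show "(u p * \<phi> (fst p)) \<odot>\<^bsub>N\<^esub> snd p \<in> carrier N"
    using supported_supp(3)[OF assms(1)] by (simp add: loc_mult)
qed

lemma supported_add: "\<lbrakk>u \<in> supported S; v \<in> supported S\<rbrakk> \<Longrightarrow> u + v \<in> supported S"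
  by (auto simp: supported_def finsupp_loc_add n_pos) (metis add.right_neutral)

lemma supported_scale: "\<lbrakk>r \<in> loc n; u \<in> supported S\<rbrakk> \<Longrightarrow> (\<lambda>p. r * u p) \<in> supported S"
  by (auto simp: supported_def finsupp_loc_scale)

lemma supported_uminus: "u \<in> supported S \<Longrightarrow> - u \<in> supported S"
  by (auto simp: supported_def finsupp_loc_uminus n_pos)

lemma supported_diff: "\<lbrakk>u \<in> supported S; v \<in> supported S\<rbrakk> \<Longrightarrow> u - v \<in> supported S"
  using supported_add[of u S "- v"] supported_uminus[of v S] by simp

lemma supported_b: "\<lbrakk>x \<in> S; x \<in> carrier M; y \<in> carrier N\<rbrakk> \<Longrightarrow> b x y \<in> supported S"
  by (auto simp: supported_def b_mem) (auto simp: basis_elem_loc split: if_splits)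

lemma eval_at_add:
  assumes u: "u \<in> supported S" and v: "v \<in> supported S" and \<phi>: "\<phi> \<in> S \<rightarrow> loc n"
  shows "eval_at \<phi> (u + v) = eval_at \<phi> u \<oplus>\<^bsub>N\<^esub> eval_at \<phi> v"
proof -
  let ?T = "{p. u p \<noteq> 0} \<union> {p. v p \<noteq> 0}"
  have T: "finite ?T" "?T \<subseteq> S \<times> carrier N"
    using supported_supp[OF u] supported_supp[OF v] by auto
  have \<phi>T: "\<phi> (fst p) \<in> loc n" "snd p \<in> carrier N" if "p \<in> ?T" for p
    using that T(2) functional_fst[OF \<phi>, of p] by auto
  have "eval_at \<phi> (u + v) = finsum N (\<lambda>p. ((u + v) p * \<phi> (fst p)) \<odot>\<^bsub>N\<^esub> snd p) ?T"
    by (rule eval_at_superset[OF supported_add[OF u v] \<phi> T(1) _ T(2)]) auto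
  also have "\<dots> = finsum N (\<lambda>p. (u p * \<phi> (fst p)) \<odot>\<^bsub>N\<^esub> snd p \<oplus>\<^bsub>N\<^esub> (v p * \<phi> (fst p)) \<odot>\<^bsub>N\<^esub> snd p) ?T"
    using \<phi>T supported_supp(3)[OF u] supported_supp(3)[OF v]
    by (intro N.finsum_cong') (auto simp: distrib_right N.sm_add loc_mult)
  also have "\<dots> = finsum N (\<lambda>p. (u p * \<phi> (fst p)) \<odot>\<^bsub>N\<^esub> snd p) ?T \<oplus>\<^bsub>N\<^esub> finsum N (\<lambda>p. (v p * \<phi> (fst p)) \<odot>\<^bsub>N\<^esub> snd p) ?T"
    using \<phi>T supported_supp(3)[OF u] supported_supp(3)[OF v]
    by (intro N.finsum_addf) (auto simp: Pi_iff loc_mult)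
  also have "\<dots> = eval_at \<phi> u \<oplus>\<^bsub>N\<^esub> eval_at \<phi> v"
    using eval_at_superset[OF u \<phi> T(1) _ T(2)] eval_at_superset[OF v \<phi> T(1) _ T(2)] by simp
  finally show ?thesis .
qed

lemma eval_at_scale:
  assumes u: "u \<in> supported S" and \<phi>: "\<phi> \<in> S \<rightarrow> loc n" and r: "r \<in> loc n"
  shows "eval_at \<phi> (\<lambda>p. r * u p) = r \<odot>\<^bsub>N\<^esub> eval_at \<phi> u"
proof -
  note supp = supported_supp[OF u]
  have \<phi>T: "\<phi> (fst p) \<in> loc n" "snd p \<in> carrier N" if "u p \<noteq> 0" for p
    using that supp(2) functional_fst[OF \<phi>, of p] by auto
  have "eval_at \<phi> (\<lambda>p. r * u p) = finsum N (\<lambda>p. (r * u p * \<phi> (fst p)) \<odot>\<^bsub>N\<^esub> snd p) {p. u p \<noteq> 0}"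
    by (rule eval_at_superset[OF supported_scale[OF r u] \<phi> supp(1) _ supp(2)]) auto
  also have "\<dots> = finsum N (\<lambda>p. r \<odot>\<^bsub>N\<^esub> ((u p * \<phi> (fst p)) \<odot>\<^bsub>N\<^esub> snd p)) {p. u p \<noteq> 0}"
    using \<phi>T supp(3) r by (intro N.finsum_cong') (auto simp: N.sm_mult[symmetric] loc_mult mult.assoc)
  also have "\<dots> = r \<odot>\<^bsub>N\<^esub> eval_at \<phi> u"
    unfolding eval_at_def using \<phi>T supp r by (subst N.sm_finsum) (auto simp: loc_mult)
  finally show ?thesis .
qed

lemma eval_at_diff:
  assumes "u \<in> supported S" "v \<in> supported S" "\<phi> \<in> S \<rightarrow> loc n"
  shows "eval_at \<phi> (u - v) = eval_at \<phi> u \<ominus>\<^bsub>N\<^esub> eval_at \<phi> v"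
proof -
  have "eval_at \<phi> u = eval_at \<phi> (u - v) \<oplus>\<^bsub>N\<^esub> eval_at \<phi> v"
    using eval_at_add[OF supported_diff[OF assms(1,2)] assms(2,3)] by simp
  then show ?thesis
    using eval_at_closed[OF supported_diff[OF assms(1,2)] assms(3)] eval_at_closed[OF assms(2,3)]
    by (simp add: N.minus_eq N.a_assoc N.r_neg)
qed

lemma eval_at_b:
  assumes "x \<in> S" "x \<in> carrier M" "y \<in> carrier N" "\<phi> \<in> S \<rightarrow> loc n"
  shows "eval_at \<phi> (b x y) = \<phi> x \<odot>\<^bsub>N\<^esub> y"
proof -
  have "{p. b x y p \<noteq> 0} = {(x, y)}"
    by (auto simp: basis_elem_loc split: if_splits)
  moreover have "\<phi> x \<odot>\<^bsub>N\<^esub> y \<in> carrier N"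
    using assms by (auto simp: Pi_iff)
  ultimately show ?thesis
    by (simp add: eval_at_def basis_elem_loc)
qed

definition functional :: "'m set \<Rightarrow> ('m \<Rightarrow> rat) \<Rightarrow> bool"
  where "functional S \<phi> \<longleftrightarrow> S \<subseteq> carrier M \<and> \<phi> \<in> S \<rightarrow> loc n \<and>
    (\<forall>x\<in>S. \<forall>y\<in>S. x \<oplus> y \<in> S \<and> \<phi> (x \<oplus> y) = \<phi> x + \<phi> y) \<and>
    (\<forall>r\<in>loc n. \<forall>x\<in>S. r \<odot> x \<in> S \<and> \<phi> (r \<odot> x) = r * \<phi> x)"

text \<open>Only finitely many elements of \<open>M\<close> occur in a derivation of a relation, so that it suffices to
  evaluate functionals defined on a submodule that contains these.\<close>

lemma K_eval_at:
  assumes "u \<in> K"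
  obtains S where "finite S" "S \<subseteq> carrier M"
    "\<And>T \<phi>. \<lbrakk>functional T \<phi>; S \<subseteq> T\<rbrakk> \<Longrightarrow> u \<in> supported T \<and> eval_at \<phi> u = \<zero>\<^bsub>N\<^esub>"
proof -
  \<comment> \<open>The elements with such a finite witness \<open>S\<close> form a submodule that
    contains all relations, hence contains \<open>K\<close>. The witnesses of two elements are
    united.\<close>
  define P where "P u S \<longleftrightarrow> finite S \<and> S \<subseteq> carrier M \<and>
      (\<forall>T \<phi>. functional T \<phi> \<longrightarrow> S \<subseteq> T \<longrightarrow> u \<in> supported T \<and> eval_at \<phi> u = \<zero>\<^bsub>N\<^esub>)" for u S
  define H where "H = {u \<in> FS. \<exists>S. P u S}"
  have "submodule H (int_localization n) L"
  proof (rule submodule_L)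
    have "P 0 {}"
      by (auto simp: P_def supported_def finsupp_loc_zero eval_at_def)
    then show "0 \<in> H"
      by (auto simp: H_def finsupp_loc_zero)
    show "u - v \<in> H" if uv: "u \<in> H" "v \<in> H" for u v
    proof -
      obtain S S' where S: "P u S" "P v S'"
        using uv by (auto simp: H_def)
      have "P (u - v) (S \<union> S')"
        unfolding P_def
      proof (intro conjI allI impI)
        fix T \<phi> assume T: "functional T \<phi>" "S \<union> S' \<subseteq> T"
        then have uv': "u \<in> supported T" "v \<in> supported T" "eval_at \<phi> u = \<zero>\<^bsub>N\<^esub>" "eval_at \<phi> v = \<zero>\<^bsub>N\<^esub>"
          using S by (auto simp: P_def)
        then show "u - v \<in> supported T"
          using supported_diff by blast
        have "\<phi> \<in> T \<rightarrow> loc n"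
          using T(1) by (simp add: functional_def)
        then show "eval_at \<phi> (u - v) = \<zero>\<^bsub>N\<^esub>"
          using eval_at_diff[OF uv'(1,2)] uv'(3,4) by (simp add: N.minus_eq)
      qed (use S in \<open>auto simp: P_def\<close>)
      then show ?thesis
        using uv by (auto simp: H_def finsupp_loc_diff n_pos)
    qed
    show "(\<lambda>p. r * u p) \<in> H" if r: "r \<in> loc n" and u: "u \<in> H" for r u
    proof -
      obtain S where S: "P u S"
        using u by (auto simp: H_def)
      have "P (\<lambda>p. r * u p) S"
        unfolding P_def
      proof (intro conjI allI impI)
        fix T \<phi> assume T: "functional T \<phi>" "S \<subseteq> T"
        then have u': "u \<in> supported T" "eval_at \<phi> u = \<zero>\<^bsub>N\<^esub>"
          using S by (auto simp: P_def)
        then show "(\<lambda>p. r * u p) \<in> supported T"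
          using supported_scale r by blast
        have "\<phi> \<in> T \<rightarrow> loc n"
          using T(1) by (simp add: functional_def)
        then show "eval_at \<phi> (\<lambda>p. r * u p) = \<zero>\<^bsub>N\<^esub>"
          using eval_at_scale[OF u'(1) _ r] u'(2) r by simp
      qed (use S in \<open>auto simp: P_def\<close>)
      then show ?thesis
        using u r by (auto simp: H_def finsupp_loc_scale)
    qed
  qed (auto simp: H_def)
  moreover have "tensor_relations (int_localization n) M N \<subseteq> H"
  proof (rule relations_in)
    fix x x' y assume xy: "x \<in> carrier M" "x' \<in> carrier M" "y \<in> carrier N"
    \<comment> \<open>The sum \<open>x \<oplus> x'\<close> need not be listed in the witness,
      because the domain of a functional is closed under addition.\<close>
    have "P (b (x \<oplus> x') y - (b x y + b x' y)) {x, x'}"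
      unfolding P_def
    proof (intro conjI allI impI)
      fix T \<phi> assume T: "functional T \<phi>" "{x, x'} \<subseteq> T"
      then have f: "\<phi> \<in> T \<rightarrow> loc n" "x \<oplus> x' \<in> T" "\<phi> (x \<oplus> x') = \<phi> x + \<phi> x'" "x \<in> T" "x' \<in> T"
        by (auto simp: functional_def)
      then show "b (x \<oplus> x') y - (b x y + b x' y) \<in> supported T"
        using xy by (intro supported_diff supported_add supported_b) auto
      show "eval_at \<phi> (b (x \<oplus> x') y - (b x y + b x' y)) = \<zero>\<^bsub>N\<^esub>"
        using f xy N.sm_add[of "\<phi> x" "\<phi> x'" y]
        by (subst eval_at_diff[of _ T] eval_at_add[of _ T], auto intro!: supported_b supported_add)+
          (auto simp: eval_at_b[of _ T] N.r_neg N.minus_eq Pi_iff)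
    qed (use xy in auto)
    then show "b (x \<oplus> x') y - (b x y + b x' y) \<in> H"
      using xy by (auto simp: H_def finsupp_loc_diff finsupp_loc_add b_mem n_pos)
  next
    fix x y y' assume xy: "x \<in> carrier M" "y \<in> carrier N" "y' \<in> carrier N"
    have "P (b x (y \<oplus>\<^bsub>N\<^esub> y') - (b x y + b x y')) {x}"
      unfolding P_def
    proof (intro conjI allI impI)
      fix T \<phi> assume T: "functional T \<phi>" "{x} \<subseteq> T"
      then have f: "\<phi> \<in> T \<rightarrow> loc n" "x \<in> T" "\<phi> x \<in> loc n"
        by (auto simp: functional_def)
      then show "b x (y \<oplus>\<^bsub>N\<^esub> y') - (b x y + b x y') \<in> supported T"
        using xy by (intro supported_diff supported_add supported_b) auto
      show "eval_at \<phi> (b x (y \<oplus>\<^bsub>N\<^esub> y') - (b x y + b x y')) = \<zero>\<^bsub>N\<^esub>"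
        using f xy N.sm_distr[of "\<phi> x" y y']
        by (subst eval_at_diff[of _ T] eval_at_add[of _ T], auto intro!: supported_b supported_add)+
          (auto simp: eval_at_b[of _ T] N.r_neg N.minus_eq)
    qed (use xy in auto)
    then show "b x (y \<oplus>\<^bsub>N\<^esub> y') - (b x y + b x y') \<in> H"
      using xy by (auto simp: H_def finsupp_loc_diff finsupp_loc_add b_mem n_pos)
  next
    fix r x y assume xy: "r \<in> loc n" "x \<in> carrier M" "y \<in> carrier N"
    have "P (b (r \<odot> x) y - (\<lambda>p. r * b x y p)) {x}"
      unfolding P_def
    proof (intro conjI allI impI)
      fix T \<phi> assume T: "functional T \<phi>" "{x} \<subseteq> T"
      then have f: "\<phi> \<in> T \<rightarrow> loc n" "x \<in> T" "\<phi> x \<in> loc n" "r \<odot> x \<in> T" "\<phi> (r \<odot> x) = r * \<phi> x"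
        using xy by (auto simp: functional_def)
      then show "b (r \<odot> x) y - (\<lambda>p. r * b x y p) \<in> supported T"
        using xy by (intro supported_diff supported_scale supported_b) auto
      show "eval_at \<phi> (b (r \<odot> x) y - (\<lambda>p. r * b x y p)) = \<zero>\<^bsub>N\<^esub>"
        using f xy N.sm_mult[of r "\<phi> x" y] eval_at_scale[OF supported_b[OF f(2) xy(2,3)] f(1) xy(1)]
        by (subst eval_at_diff[of _ T], auto intro!: supported_b supported_scale)
          (auto simp: eval_at_b[of _ T] N.r_neg N.minus_eq)
    qed (use xy in auto)
    then show "b (r \<odot> x) y - (\<lambda>p. r * b x y p) \<in> H"
      using xy by (auto simp: H_def finsupp_loc_diff finsupp_loc_scale b_mem n_pos)
  next
    fix r x y assume xy: "r \<in> loc n" "x \<in> carrier M" "y \<in> carrier N"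
    have "P (b x (r \<odot>\<^bsub>N\<^esub> y) - (\<lambda>p. r * b x y p)) {x}"
      unfolding P_def
    proof (intro conjI allI impI)
      fix T \<phi> assume T: "functional T \<phi>" "{x} \<subseteq> T"
      then have f: "\<phi> \<in> T \<rightarrow> loc n" "x \<in> T" "\<phi> x \<in> loc n"
        using xy by (auto simp: functional_def)
      then show "b x (r \<odot>\<^bsub>N\<^esub> y) - (\<lambda>p. r * b x y p) \<in> supported T"
        using xy by (intro supported_diff supported_scale supported_b) auto
      show "eval_at \<phi> (b x (r \<odot>\<^bsub>N\<^esub> y) - (\<lambda>p. r * b x y p)) = \<zero>\<^bsub>N\<^esub>"
        using f xy N.sm_mult[of r "\<phi> x" y] N.sm_mult[of "\<phi> x" r y]
          eval_at_scale[OF supported_b[OF f(2) xy(2,3)] f(1) xy(1)]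
        by (subst eval_at_diff[of _ T], auto intro!: supported_b supported_scale)
          (auto simp: eval_at_b[of _ T] N.r_neg N.minus_eq mult.commute)
    qed (use xy in auto)
    then show "b x (r \<odot>\<^bsub>N\<^esub> y) - (\<lambda>p. r * b x y p) \<in> H"
      using xy by (auto simp: H_def finsupp_loc_diff finsupp_loc_scale b_mem n_pos)
  qed
  ultimately have "u \<in> H"
    using assms unfolding K_def by blast
  then show thesis
    using that by (auto simp: H_def P_def)
qed

end

context loc_module
begin

lemma independent_unique:
  assumes "independent I z" "finite I" "z \<in> I \<rightarrow> carrier M" "a \<in> I \<rightarrow> loc n" "c \<in> I \<rightarrow> loc n"
    and eq: "comb I z a = comb I z c" and "i \<in> I"
  shows "a i = c i"
proof -
  have d: "(\<lambda>i. a i - c i) \<in> I \<rightarrow> loc n"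
    using assms n_pos by (auto simp: Pi_iff loc_diff)
  have "comb I z a = comb I z (\<lambda>i. a i - c i) \<oplus> comb I z c"
    using comb_add[OF assms(3) d assms(5)] by simp
  then have "comb I z (\<lambda>i. a i - c i) = \<zero>"
    using eq comb_closed[OF assms(3) d] comb_closed[OF assms(3,5)] by simp
  then show ?thesis
    using assms(1,7) d unfolding independent_def by force
qed

text \<open>An arbitrary choice of coefficients; independence of the family makes it unique and
  therefore linear in \<open>x\<close>.\<close>

definition coord :: "'i set \<Rightarrow> ('i \<Rightarrow> 'm) \<Rightarrow> 'i \<Rightarrow> 'm \<Rightarrow> rat"
  where "coord I z i x = (SOME a. a \<in> I \<rightarrow> loc n \<and> x = comb I z a) i"

lemma coord:
  assumes "x \<in> span I z"
  shows "(\<lambda>i. coord I z i x) \<in> I \<rightarrow> loc n" "x = comb I z (\<lambda>i. coord I z i x)"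
proof -
  have "\<exists>a. a \<in> I \<rightarrow> loc n \<and> x = comb I z a"
    using assms by (auto simp: span_def)
  then show "(\<lambda>i. coord I z i x) \<in> I \<rightarrow> loc n" "x = comb I z (\<lambda>i. coord I z i x)"
    unfolding coord_def by (metis (mono_tags, lifting) someI_ex)+
qed

lemma span_closed: "z \<in> I \<rightarrow> carrier M \<Longrightarrow> span I z \<subseteq> carrier M"
  by (auto simp: span_def comb_closed)

lemma coord_add:
  assumes ind: "independent I z" "finite I" "z \<in> I \<rightarrow> carrier M" and x: "x \<in> span I z" and y: "y \<in> span I z" and i: "i \<in> I"
  shows "x \<oplus> y \<in> span I z" "coord I z i (x \<oplus> y) = coord I z i x + coord I z i y"
proof -
  have c: "(\<lambda>i. coord I z i x + coord I z i y) \<in> I \<rightarrow> loc n"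
    using coord(1)[OF x] coord(1)[OF y] n_pos by (auto simp: Pi_iff loc_add)
  have eq: "x \<oplus> y = comb I z (\<lambda>i. coord I z i x + coord I z i y)"
    using comb_add[OF ind(3) coord(1)[OF x] coord(1)[OF y]] coord(2)[OF x] coord(2)[OF y] by simp
  show xy: "x \<oplus> y \<in> span I z"
    using c eq by (auto simp: span_def)
  show "coord I z i (x \<oplus> y) = coord I z i x + coord I z i y"
    by (rule independent_unique[OF ind coord(1)[OF xy] c _ i]) (use coord(2)[OF xy] eq in simp)
qed

lemma coord_scale:
  assumes ind: "independent I z" "finite I" "z \<in> I \<rightarrow> carrier M" and x: "x \<in> span I z" and r: "r \<in> loc n" and i: "i \<in> I"
  shows "r \<odot> x \<in> span I z" "coord I z i (r \<odot> x) = r * coord I z i x"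
proof -
  have c: "(\<lambda>i. r * coord I z i x) \<in> I \<rightarrow> loc n"
    using coord(1)[OF x] r by (auto simp: Pi_iff loc_mult)
  have eq: "r \<odot> x = comb I z (\<lambda>i. r * coord I z i x)"
    using comb_scale[OF ind(2,3) coord(1)[OF x] r] coord(2)[OF x] by simp
  show rx: "r \<odot> x \<in> span I z"
    using c eq by (auto simp: span_def)
  show "coord I z i (r \<odot> x) = r * coord I z i x"
    by (rule independent_unique[OF ind coord(1)[OF rx] c _ i]) (use coord(2)[OF rx] eq in simp)
qed

end

context loc_tensor
begin

lemma functional_coord:
  assumes "independent I z" "finite I" "z \<in> I \<rightarrow> carrier M" "i \<in> I"
  shows "functional (span I z) (coord I z i)"
  using span_closed[OF assms(3)] Pi_mem[OF coord(1) assms(4)] coord_add[OF assms(1-3) _ _ assms(4)] coord_scale[OF assms(1-3) _ _ assms(4)] assms(4)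
  unfolding functional_def by (auto simp: Pi_iff)

lemma K_finsum_left:
  assumes "finite I" "w \<in> I \<rightarrow> carrier M" "y \<in> carrier N"
  shows "b (finsum M w I) y - (\<Sum>i\<in>I. b (w i) y) \<in> K"
  using assms
proof (induction I rule: finite_induct)
  case empty
  then show ?case
    using K_zero_left by simp
next
  case (insert i I)
  have w: "w i \<in> carrier M" "w \<in> I \<rightarrow> carrier M" "finsum M w I \<in> carrier M"
    using insert.prems by (auto intro: finsum_closed)
  let ?F = "finsum M w I" and ?s = "\<Sum>i\<in>I. b (w i) y"
  have "b (w i \<oplus> ?F) y - (b (w i) y + b ?F y) + (b ?F y - ?s) \<in> K"
    by (intro K_add[OF K_add_left[OF w(1,3) insert.prems(2)]] insert.IH w insert.prems)
  moreover have "b (w i \<oplus> ?F) y - (b (w i) y + b ?F y) + (b ?F y - ?s) =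
      b (finsum M w (insert i I)) y - (\<Sum>i\<in>insert i I. b (w i) y)"
    using insert.hyps w by (simp add: fun_eq_iff)
  ultimately show ?case
    by (rule back_subst[of "\<lambda>u. u \<in> K"])
qed

lemma K_move:
  assumes "r \<in> loc n" "x \<in> carrier M" "y \<in> carrier N"
  shows "b (r \<odot> x) y - b x (r \<odot>\<^bsub>N\<^esub> y) \<in> K"
  using K_diff[OF K_smult_left[OF assms] K_smult_right[OF assms]] by simp

lemma K_expand_b:
  assumes ind: "finite I" "z \<in> I \<rightarrow> carrier M" and x: "x \<in> span I z" and y: "y \<in> carrier N"
  shows "b x y - (\<Sum>i\<in>I. b (z i) (coord I z i x \<odot>\<^bsub>N\<^esub> y)) \<in> K"
proof -
  have c: "coord I z i x \<in> loc n" "z i \<in> carrier M" if "i \<in> I" for i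
    using coord(1)[OF x] that ind(2) by (auto simp: Pi_iff)
  have "x = finsum M (\<lambda>i. coord I z i x \<odot> z i) I"
    using coord(2)[OF x] by (simp add: comb_def)
  moreover have "b (finsum M (\<lambda>i. coord I z i x \<odot> z i) I) y - (\<Sum>i\<in>I. b (coord I z i x \<odot> z i) y) \<in> K"
    using ind c y by (intro K_finsum_left) auto
  ultimately have "b x y - (\<Sum>i\<in>I. b (coord I z i x \<odot> z i) y) \<in> K"
    by simp
  moreover have "(\<Sum>i\<in>I. b (coord I z i x \<odot> z i) y - b (z i) (coord I z i x \<odot>\<^bsub>N\<^esub> y)) \<in> K"
    using c y by (intro K_sum K_move) auto
  ultimately have "(b x y - (\<Sum>i\<in>I. b (coord I z i x \<odot> z i) y)) +
      (\<Sum>i\<in>I. b (coord I z i x \<odot> z i) y - b (z i) (coord I z i x \<odot>\<^bsub>N\<^esub> y)) \<in> K"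
    by (rule K_add)
  then show ?thesis
    by (simp add: sum_subtractf)
qed

definition expansion where "expansion I z u = (\<Sum>i\<in>I. b (z i) (eval_at (coord I z i) u))"

text \<open>Modulo \<open>K\<close> both terms are additive in \<open>u\<close>, and
  \<open>u\<close> is a finite sum of multiples of pure tensors. For these,
  \<open>K_expand_b\<close> writes the left factor in the family and moves the coefficients to the
  right factor.\<close>

lemma K_expand:
  assumes ind: "independent I z" "finite I" "z \<in> I \<rightarrow> carrier M" and u: "u \<in> supported (span I z)"
  shows "u - expansion I z u \<in> K"
proof -
  let ?S = "span I z"
  have f: "coord I z i \<in> ?S \<rightarrow> loc n" if "i \<in> I" for i
    using functional_coord[OF ind that] by (simp add: functional_def)
  have zi: "z i \<in> carrier M" if "i \<in> I" for i
    using that ind(3) by auto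
  have add: "(u + v) - expansion I z (u + v) \<in> K"
    if uv: "u \<in> supported ?S" "v \<in> supported ?S" and K: "u - expansion I z u \<in> K" "v - expansion I z v \<in> K" for u v
  proof -
    let ?e = "\<lambda>i w. eval_at (coord I z i) w"
    have "(\<Sum>i\<in>I. b (z i) (?e i u \<oplus>\<^bsub>N\<^esub> ?e i v) - (b (z i) (?e i u) + b (z i) (?e i v))) \<in> K"
      using zi f uv by (intro K_sum K_add_right eval_at_closed) auto
    moreover have "expansion I z (u + v) = (\<Sum>i\<in>I. b (z i) (?e i u \<oplus>\<^bsub>N\<^esub> ?e i v))"
      unfolding expansion_def using f uv by (intro sum.cong refl) (simp add: eval_at_add)
    ultimately have "expansion I z (u + v) - (expansion I z u + expansion I z v) \<in> K"
      by (simp add: expansion_def sum_subtractf sum.distrib)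
    then have "(u - expansion I z u) + (v - expansion I z v) - (expansion I z (u + v) - (expansion I z u + expansion I z v)) \<in> K"
      by (rule K_diff[OF K_add[OF K]])
    then show ?thesis
      by (simp add: algebra_simps)
  qed
  have single: "(\<lambda>p. r * b x y p) - expansion I z (\<lambda>p. r * b x y p) \<in> K"
    if r: "r \<in> loc n" and x: "x \<in> ?S" and y: "y \<in> carrier N" for r x y
  proof -
    have xM: "x \<in> carrier M"
      using x span_closed[OF ind(3)] by auto
    let ?c = "\<lambda>i. coord I z i x"
    have c: "?c i \<in> loc n" "?c i \<odot>\<^bsub>N\<^esub> y \<in> carrier N" if "i \<in> I" for i
      using f[OF that] x y by (auto simp: Pi_iff)
    have e: "eval_at (coord I z i) (\<lambda>p. r * b x y p) = r \<odot>\<^bsub>N\<^esub> (?c i \<odot>\<^bsub>N\<^esub> y)" if "i \<in> I" for i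
      using eval_at_scale[OF supported_b[OF x xM y] f[OF that] r] eval_at_b[OF x xM y f[OF that]] by simp
    have "(\<lambda>p. r * (b x y - (\<Sum>i\<in>I. b (z i) (?c i \<odot>\<^bsub>N\<^esub> y))) p) \<in> K"
      by (intro K_scale r K_expand_b ind x y)
    moreover have "(\<Sum>i\<in>I. b (z i) (r \<odot>\<^bsub>N\<^esub> (?c i \<odot>\<^bsub>N\<^esub> y)) - (\<lambda>p. r * b (z i) (?c i \<odot>\<^bsub>N\<^esub> y) p)) \<in> K"
      using c zi r by (intro K_sum K_smult_right) auto
    ultimately have "(\<lambda>p. r * (b x y - (\<Sum>i\<in>I. b (z i) (?c i \<odot>\<^bsub>N\<^esub> y))) p) -
        (\<Sum>i\<in>I. b (z i) (r \<odot>\<^bsub>N\<^esub> (?c i \<odot>\<^bsub>N\<^esub> y)) - (\<lambda>p. r * b (z i) (?c i \<odot>\<^bsub>N\<^esub> y) p)) \<in> K"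
      by (rule K_diff)
    moreover have "(\<lambda>p. r * (b x y - (\<Sum>i\<in>I. b (z i) (?c i \<odot>\<^bsub>N\<^esub> y))) p) -
        (\<Sum>i\<in>I. b (z i) (r \<odot>\<^bsub>N\<^esub> (?c i \<odot>\<^bsub>N\<^esub> y)) - (\<lambda>p. r * b (z i) (?c i \<odot>\<^bsub>N\<^esub> y) p)) =
        (\<lambda>p. r * b x y p) - (\<Sum>i\<in>I. b (z i) (r \<odot>\<^bsub>N\<^esub> (?c i \<odot>\<^bsub>N\<^esub> y)))"
      by (simp add: fun_eq_iff sum_apply right_diff_distrib sum_distrib_left sum_subtractf)
    moreover have "expansion I z (\<lambda>p. r * b x y p) = (\<Sum>i\<in>I. b (z i) (r \<odot>\<^bsub>N\<^esub> (?c i \<odot>\<^bsub>N\<^esub> y)))"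
      unfolding expansion_def using e by (intro sum.cong) auto
    ultimately show ?thesis
      by simp
  qed
  have zero: "0 - expansion I z 0 \<in> K"
  proof -
    have "eval_at (coord I z i) 0 = \<zero>\<^bsub>N\<^esub>" for i
      by (simp add: eval_at_def)
    then have "expansion I z 0 \<in> K"
      using zi by (auto simp: expansion_def intro!: K_sum K_zero_right)
    then show ?thesis
      by (rule K_diff[OF K_zero])
  qed
  define P where "P v \<longleftrightarrow> v \<in> supported ?S \<and> v - expansion I z v \<in> K" for v
  have sum: "P (\<Sum>p\<in>T. (\<lambda>q. u p * b (fst p) (snd p) q))"
    if "finite T" "T \<subseteq> ?S \<times> carrier N" for T
    using that
  proof (induction T rule: finite_induct)
    case empty
    have "0 \<in> supported ?S"
      by (simp add: supported_def finsupp_loc_zero)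
    then show ?case
      unfolding sum.empty P_def using zero by blast
  next
    case (insert p T)
    then have p: "fst p \<in> ?S" "fst p \<in> carrier M" "snd p \<in> carrier N"
      using span_closed[OF ind(3)] by auto
    have "P (\<lambda>q. u p * b (fst p) (snd p) q)"
      unfolding P_def using p supported_supp(3)[OF u] by (intro conjI supported_scale supported_b single) auto
    moreover have "P (\<Sum>p\<in>T. (\<lambda>q. u p * b (fst p) (snd p) q))"
      using insert by blast
    ultimately have "P ((\<lambda>q. u p * b (fst p) (snd p) q) + (\<Sum>p\<in>T. (\<lambda>q. u p * b (fst p) (snd p) q)))"
      unfolding P_def using add supported_add by blast
    then show ?case
      unfolding sum.insert[OF insert.hyps] .
  qed
  have "u = (\<Sum>p\<in>{p. u p \<noteq> 0}. (\<lambda>q. u p * b (fst p) (snd p) q))"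
  proof
    fix q
    have "(\<Sum>p\<in>{p. u p \<noteq> 0}. u p * b (fst p) (snd p) q) = (\<Sum>p\<in>{p. u p \<noteq> 0}. if p = q then u q else 0)"
      by (intro sum.cong) (auto simp: basis_elem_loc)
    also have "\<dots> = u q"
      using supported_supp(1)[OF u] by (simp add: sum.delta')
    finally show "u q = (\<Sum>p\<in>{p. u p \<noteq> 0}. (\<lambda>q. u p * b (fst p) (snd p) q)) q"
      by (simp add: sum_apply)
  qed
  then show ?thesis
    using sum[OF supported_supp(1,2)[OF u]] by (simp only: P_def)
qed

text \<open>A converse to \<open>K_eval_at\<close>: the coordinate functionals of an independent
  family detect membership in \<open>K\<close>, because when they vanish the expansion is a sum of
  tensors with right factor zero.\<close>

lemma K_I:
  assumes ind: "independent I z" "finite I" "z \<in> I \<rightarrow> carrier M" and u: "u \<in> supported (span I z)"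
    and zero: "\<And>i. i \<in> I \<Longrightarrow> eval_at (coord I z i) u = \<zero>\<^bsub>N\<^esub>"
  shows "u \<in> K"
proof -
  have "expansion I z u \<in> K"
    unfolding expansion_def using zero ind(3) by (intro K_sum) (auto intro: K_zero_right)
  then have "(u - expansion I z u) + expansion I z u \<in> K"
    using K_expand[OF ind u] by (intro K_add)
  then show ?thesis
    by simp
qed

end

section \<open>Injectivity of the induced map of tensor products\<close>

locale loc_tensor_map = A: loc_tensor n M N + B: loc_tensor n M N'
  for n :: nat and M :: "(rat, 'm, 'f) module_scheme" (structure)
    and N :: "(rat, 'n, 'h) module_scheme" and N' :: "(rat, 'k, 'l) module_scheme" +
  fixes f
  assumes f_hom: "f \<in> mod_hom (int_localization n) N N'" and f_inj: "inj_on f (carrier N)"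
begin

lemma f_closed: "y \<in> carrier N \<Longrightarrow> f y \<in> carrier N'"
  and f_add: "\<lbrakk>x \<in> carrier N; y \<in> carrier N\<rbrakk> \<Longrightarrow> f (x \<oplus>\<^bsub>N\<^esub> y) = f x \<oplus>\<^bsub>N'\<^esub> f y"
  and f_smult: "\<lbrakk>r \<in> loc n; y \<in> carrier N\<rbrakk> \<Longrightarrow> f (r \<odot>\<^bsub>N\<^esub> y) = r \<odot>\<^bsub>N'\<^esub> f y"
  using f_hom by (auto simp: mod_hom_def)

lemma f_zero: "f \<zero>\<^bsub>N\<^esub> = \<zero>\<^bsub>N'\<^esub>"
  using f_smult[of 0 "\<zero>\<^bsub>N\<^esub>"] f_closed[of "\<zero>\<^bsub>N\<^esub>"] by simp

lemma f_finsum: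
  assumes "finite I" "h \<in> I \<rightarrow> carrier N"
  shows "f (finsum N h I) = finsum N' (\<lambda>i. f (h i)) I"
  using assms
  by (induction I rule: finite_induct) (auto simp: f_zero f_add f_closed Pi_iff)

definition g :: "'m \<times> 'n \<Rightarrow> 'm \<times> 'k" where "g = map_prod id f"
abbreviation fm where "fm \<equiv> free_map (int_localization n) g"

lemma g_simps [simp]: "fst (g p) = fst p" "snd (g p) = f (snd p)"
  by (simp_all add: g_def)

lemma g_inj: "\<lbrakk>p \<in> carrier M \<times> carrier N; q \<in> carrier M \<times> carrier N; g p = g q\<rbrakk> \<Longrightarrow> p = q"
  using f_inj by (cases p; cases q) (auto simp: g_def dest: inj_onD)

lemma fm_eq_sum:
  assumes "u \<in> A.FS"
  shows "fm u q = (\<Sum>p\<in>{p. u p \<noteq> 0 \<and> g p = q}. u p)"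
proof -
  have "abelian_monoid (int_localization n)"
    using cring_int_localization[OF A.n_pos] by (simp add: cring_def ring_def abelian_group_def)
  then show ?thesis
    unfolding free_map_def using finsupp_loc_apply[OF assms]
    by (subst finsum_eq_sum) auto
qed

lemma supp_carrier: "u \<in> A.FS \<Longrightarrow> u p \<noteq> 0 \<Longrightarrow> p \<in> carrier M \<times> carrier N"
  unfolding finsupp_loc_iff by blast

text \<open>As \<open>f\<close> is injective on the carrier, each point has at most one preimage in
  the support; the induced map of free modules merely relabels the basis.\<close>

lemma fm_g:
  assumes u: "u \<in> A.FS" and p: "p \<in> carrier M \<times> carrier N"
  shows "fm u (g p) = u p"
proof -
  have "p' = p" if "u p' \<noteq> 0" "g p' = g p" for p'
    using g_inj[OF supp_carrier[OF u that(1)] p that(2)] .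
  then have eq: "{p'. u p' \<noteq> 0 \<and> g p' = g p} = (if u p = 0 then {} else {p})"
    by auto
  show ?thesis
    unfolding fm_eq_sum[OF u] eq by simp
qed

lemma fm_outside:
  assumes u: "u \<in> A.FS" and q: "q \<notin> g ` (carrier M \<times> carrier N)"
  shows "fm u q = 0"
proof -
  have eq: "{p. u p \<noteq> 0 \<and> g p = q} = {}"
    using supp_carrier[OF u] q by blast
  show ?thesis
    unfolding fm_eq_sum[OF u] eq by simp
qed

lemma fm_supp:
  assumes u: "u \<in> A.FS"
  shows "{q. fm u q \<noteq> 0} = g ` {p. u p \<noteq> 0}"
proof (intro equalityI subsetI)
  fix q assume q: "q \<in> {q. fm u q \<noteq> 0}"
  then obtain p where "p \<in> carrier M \<times> carrier N" "q = g p"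
    using fm_outside[OF u, of q] by blast
  then show "q \<in> g ` {p. u p \<noteq> 0}"
    using q fm_g[OF u] by auto
next
  fix q assume "q \<in> g ` {p. u p \<noteq> 0}"
  then obtain p where "q = g p" "u p \<noteq> 0"
    by blast
  then show "q \<in> {q. fm u q \<noteq> 0}"
    using fm_g[OF u supp_carrier[OF u]] by auto
qed

lemma fm_mem:
  assumes u: "u \<in> A.FS"
  shows "fm u \<in> B.FS"
proof -
  have "fm u q \<in> loc n" for q
    unfolding fm_eq_sum[OF u] using finsupp_loc_apply[OF u] A.n_pos by (intro loc_sum)
  moreover have "finite {q. fm u q \<noteq> 0}"
    unfolding fm_supp[OF u] using u by (simp add: finsupp_loc_iff)
  moreover have "fm u q = 0" if "q \<notin> carrier M \<times> carrier N'" for q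
    using fm_outside[OF u, of q] that f_closed by (force simp: g_def)
  ultimately show ?thesis
    by (simp add: finsupp_loc_iff)
qed

lemma fm_diff:
  assumes "u \<in> A.FS" "v \<in> A.FS"
  shows "fm (u - v) = fm u - fm v"
proof
  fix q
  have uv: "u - v \<in> A.FS"
    using assms A.n_pos by (simp add: finsupp_loc_diff)
  show "fm (u - v) q = (fm u - fm v) q"
  proof (cases "q \<in> g ` (carrier M \<times> carrier N)")
    case True
    then obtain p where "p \<in> carrier M \<times> carrier N" "q = g p" by blast
    then show ?thesis
      using fm_g assms uv by simp
  next
    case False
    then show ?thesis
      using fm_outside assms uv by simp
  qed
qed

lemma eval_at_fm:
  assumes u: "u \<in> A.supported S" and \<phi>: "\<phi> \<in> S \<rightarrow> loc n"
  shows "B.eval_at \<phi> (fm u) = f (A.eval_at \<phi> u)"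
proof -
  have uF: "u \<in> A.FS"
    using u by (simp add: A.supported_def)
  have mem: "(u p * \<phi> (fst p)) \<odot>\<^bsub>N\<^esub> snd p \<in> carrier N" "snd p \<in> carrier N" "u p * \<phi> (fst p) \<in> loc n"
    if "u p \<noteq> 0" for p
  proof -
    have "p \<in> S \<times> carrier N"
      using that A.supported_supp(2)[OF u] by blast
    then show "(u p * \<phi> (fst p)) \<odot>\<^bsub>N\<^esub> snd p \<in> carrier N" "snd p \<in> carrier N" "u p * \<phi> (fst p) \<in> loc n"
      using A.functional_fst[OF \<phi>] A.supported_supp(3)[OF u] by (auto simp: loc_mult)
  qed
  let ?h = "\<lambda>q. (fm u q * \<phi> (fst q)) \<odot>\<^bsub>N'\<^esub> snd q"
  have h: "?h (g p) = f ((u p * \<phi> (fst p)) \<odot>\<^bsub>N\<^esub> snd p)" if "u p \<noteq> 0" for p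
    using fm_g[OF uF supp_carrier[OF uF that]] mem[OF that] by (simp add: f_smult)
  have "B.eval_at \<phi> (fm u) = finsum N' ?h (g ` {p. u p \<noteq> 0})"
    unfolding B.eval_at_def fm_supp[OF uF] ..
  also have "\<dots> = finsum N' (\<lambda>p. ?h (g p)) {p. u p \<noteq> 0}"
  proof (rule B.N.finsum_reindex)
    show "?h \<in> g ` {p. u p \<noteq> 0} \<rightarrow> carrier N'"
      using h mem f_closed by fastforce
    show "inj_on g {p. u p \<noteq> 0}"
    proof (rule inj_onI)
      show "p = q" if "p \<in> {p. u p \<noteq> 0}" "q \<in> {p. u p \<noteq> 0}" "g p = g q" for p q
        using that g_inj[OF supp_carrier[OF uF] supp_carrier[OF uF], of p q] by simp
    qed
  qed
  also have "\<dots> = finsum N' (\<lambda>p. f ((u p * \<phi> (fst p)) \<odot>\<^bsub>N\<^esub> snd p)) {p. u p \<noteq> 0}"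
    using h mem f_closed by (intro B.N.finsum_cong') auto
  also have "\<dots> = f (A.eval_at \<phi> u)"
    unfolding A.eval_at_def using mem A.supported_supp(1)[OF u] by (intro f_finsum[symmetric]) auto
  finally show ?thesis .
qed

text \<open>Every coordinate functional kills \<open>fm u\<close> by \<open>K_eval_at\<close>, and
  evaluation commutes with \<open>f\<close>. Injectivity of \<open>f\<close> then shows that it
  kills \<open>u\<close>, so \<open>K_I\<close> applies.\<close>

lemma K_reflect:
  assumes torsion_free: A.torsion_free
    and u: "u \<in> A.FS" and K: "fm u \<in> B.K"
  shows "u \<in> A.K"
proof -
  obtain S where S: "finite S" "S \<subseteq> carrier M"
    and eval: "\<And>T \<phi>. \<lbrakk>B.functional T \<phi>; S \<subseteq> T\<rbrakk> \<Longrightarrow> fm u \<in> B.supported T \<and> B.eval_at \<phi> (fm u) = \<zero>\<^bsub>N'\<^esub>"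
    using B.K_eval_at[OF K] by blast
  \<comment> \<open>The free submodule has to contain both the elements occurring in the derivation
    of \<open>fm u \<in> B.K\<close> and the first components of \<open>u\<close> itself.\<close>
  let ?S = "S \<union> fst ` {p. u p \<noteq> 0}"
  have "finite {p. u p \<noteq> 0}"
    using u by (simp add: finsupp_loc_iff)
  moreover have "fst p \<in> carrier M" if "u p \<noteq> 0" for p
    using supp_carrier[OF u that] by (simp add: mem_Times_iff)
  ultimately have S': "finite ?S" "?S \<subseteq> carrier M"
    using S by blast+
  obtain I :: "'m set" and z where I: "finite I" "z \<in> I \<rightarrow> carrier M" "?S \<subseteq> A.span I z" "A.independent I z"
    by (rule A.independent_spanning_family[OF torsion_free S'])
  have uS: "u \<in> A.supported (A.span I z)"
    using u I(3) by (auto simp: A.supported_def)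
  show ?thesis
  proof (rule A.K_I[OF I(4,1,2) uS])
    fix i assume i: "i \<in> I"
    have F: "A.functional (A.span I z) (A.coord I z i)"
      by (rule A.functional_coord[OF I(4,1,2) i])
    then have "f (A.eval_at (A.coord I z i) u) = \<zero>\<^bsub>N'\<^esub>"
      using eval[of "A.span I z" "A.coord I z i"] I(3) eval_at_fm[OF uS]
      by (simp add: A.functional_def B.functional_def)
    moreover have "A.eval_at (A.coord I z i) u \<in> carrier N"
      using A.eval_at_closed[OF uS] F by (simp add: A.functional_def)
    ultimately show "A.eval_at (A.coord I z i) u = \<zero>\<^bsub>N\<^esub>"
      using f_inj f_zero by (auto simp: inj_on_def)
  qed
qed

lemma inj_tensor_map:
  assumes torsion_free: A.torsion_free
  shows "inj_on (tensor_map (int_localization n) M N' f) (carrier (tensor_product (int_localization n) M N))"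
proof (rule inj_onI)
  interpret Q: quotient "int_localization n" A.L A.K
    by (intro quotient.intro quotient_axioms.intro module_free_loc A.n_pos A.K_submodule)
  interpret Q': quotient "int_localization n" B.L B.K
    by (intro quotient.intro quotient_axioms.intro module_free_loc A.n_pos B.K_submodule)
  fix X Y
  assume "X \<in> carrier (tensor_product (int_localization n) M N)" "Y \<in> carrier (tensor_product (int_localization n) M N)"
    and eq: "tensor_map (int_localization n) M N' f X = tensor_map (int_localization n) M N' f Y"
  then obtain u v where u: "X = A.K +>\<^bsub>A.L\<^esub> u" "u \<in> A.FS" and v: "Y = A.K +>\<^bsub>A.L\<^esub> v" "v \<in> A.FS"
    unfolding tensor_product_def Q.carrier_quotient by auto
  have "fm u \<in> B.K +>\<^bsub>B.L\<^esub> fm u"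
    using Q'.coset_self[of "fm u"] fm_mem[OF u(2)] by simp
  then have "fm u \<in> tensor_map (int_localization n) M N' f X"
    unfolding tensor_map_def u(1) g_def using Q.coset_self[of u] u(2) by auto
  \<comment> \<open>The image of a coset is a union over its representatives; equality of the images
    therefore yields only some representative \<open>w\<close> of \<open>Y\<close> whose image
    agrees with that of \<open>u\<close> modulo \<open>B.K\<close>.\<close>
  then obtain w where w: "w \<in> A.K +>\<^bsub>A.L\<^esub> v" "fm u \<in> B.K +>\<^bsub>B.L\<^esub> fm w"
    unfolding eq unfolding tensor_map_def v(1) g_def by blast
  have wF: "w \<in> A.FS"
    using w(1) Q.M.a_r_coset_subset_G[OF Q.H_subset, of v] v(2) by auto
  have "fm (u - w) \<in> B.K"
    using Q'.coset_mem_iff[of "fm w" "fm u"] w(2) fm_mem u(2) wF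
    by (simp add: fm_diff free_module_a_minus A.n_pos)
  then have "u - w \<in> A.K"
    using K_reflect[OF torsion_free] u(2) wF A.n_pos by (simp add: finsupp_loc_diff)
  then have "A.K +>\<^bsub>A.L\<^esub> u = A.K +>\<^bsub>A.L\<^esub> w"
    using Q.coset_eq_iff[of u w] u(2) wF by (simp add: free_module_a_minus A.n_pos)
  moreover have "A.K +>\<^bsub>A.L\<^esub> v = A.K +>\<^bsub>A.L\<^esub> w"
    using Q.M.a_repr_independence[OF w(1) _ Q.subgroup_H] v(2) by simp
  ultimately show "X = Y"
    using u(1) v(1) by simp
qed

end

theorem flat_if_torsion_free:
  fixes M :: "(rat, 'm, 'f) module_scheme" (structure)
  assumes n: "0 < n" and M: "Module.module (int_localization n) M"
    and torsion_free: "\<forall>r\<in>loc n. \<forall>x\<in>carrier M. r \<odot> x = \<zero> \<longrightarrow> r = 0 \<or> x = \<zero>"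
  shows "flat_module T (int_localization n) M"
  unfolding flat_module_def
proof (intro conjI allI impI M)
  fix N N' :: "(rat, 'n) module" and f
  assume *: "Module.module (int_localization n) N \<and> Module.module (int_localization n) N' \<and>
    f \<in> mod_hom (int_localization n) N N' \<and> inj_on f (carrier N)"
  interpret loc_tensor_map n M N N' f
    by (intro loc_tensor_map.intro loc_tensor.intro loc_module.intro loc_tensor_map_axioms.intro) (use * n M in auto)
  show "inj_on (tensor_map (int_localization n) M N' f) (carrier (tensor_product (int_localization n) M N))"
    by (rule inj_tensor_map) (use torsion_free in \<open>simp add: A.torsion_free_def\<close>)
qed

section \<open>Cohomology with group ring coefficients\<close>

context loc_group_ring
begin

abbreviation Reg :: "('g \<Rightarrow> rat, 'g \<Rightarrow> rat) module" where "Reg \<equiv> regular_module (group_ring (int_localization n) G)"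

lemma Reg_simps [simp]:
  "carrier Reg = carrier RG" "add Reg = (+)" "zero Reg = 0" "smult Reg = mult RG"
  by (simp_all add: regular_module_def)

lemma abelian_group_Reg: "abelian_group Reg"
proof (rule abelian_groupI)
  show "\<exists>b\<in>carrier Reg. b \<oplus>\<^bsub>Reg\<^esub> a = \<zero>\<^bsub>Reg\<^esub>" if "a \<in> carrier Reg" for a
    using that RG_uminus_mem[of a] by (intro bexI[of _ "- a"]) auto
qed (auto simp: RG_add_mem add_ac)

abbreviation d :: "nat \<Rightarrow> ('g list \<Rightarrow> 'g \<Rightarrow> rat) \<Rightarrow> 'g list \<Rightarrow> 'g \<Rightarrow> rat"
  where "d \<equiv> cob G translate"

definition C :: "nat \<Rightarrow> ('g list \<Rightarrow> 'g \<Rightarrow> rat) set"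
  where "C k = {c. (\<forall>xs\<in>tuples G k. c xs \<in> carrier RG) \<and> (\<forall>xs. xs \<notin> tuples G k \<longrightarrow> c xs = 0)}"

lemma C_mem: "c \<in> C k \<Longrightarrow> xs \<in> tuples G k \<Longrightarrow> c xs \<in> carrier RG"
  by (simp add: C_def)

lemma C_outside: "c \<in> C k \<Longrightarrow> xs \<notin> tuples G k \<Longrightarrow> c xs = 0"
  by (simp add: C_def)

lemma cochains_simps [simp]:
  "carrier (cochains R G Reg k) = C k" "add (cochains R G Reg k) = (+)" "zero (cochains R G Reg k) = 0"
  by (auto simp: cochains_def C_def tuples_def fun_eq_iff split: if_splits)

lemma C_zero: "0 \<in> C k"
  by (simp add: C_def)

lemma C_diff: "\<lbrakk>c \<in> C k; e \<in> C k\<rbrakk> \<Longrightarrow> c - e \<in> C k"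
  by (auto simp: C_def RG_diff_mem)

lemma C_scale: "\<lbrakk>r \<in> loc n; c \<in> C k\<rbrakk> \<Longrightarrow> (\<lambda>xs g. r * c xs g) \<in> C k"
  by (auto simp: C_def RG_scale_mem fun_eq_iff)

lemma cochains_smult:
  assumes "r \<in> loc n" "c \<in> C k"
  shows "r \<odot>\<^bsub>cochains R G Reg k\<^esub> c = (\<lambda>xs g. r * c xs g)"
proof
  fix xs
  have "c xs \<in> carrier RG"
    using assms(2) by (cases "xs \<in> tuples G k") (auto simp: C_def)
  moreover have "(\<lambda>g. if g = \<one> then r else \<zero>\<^bsub>R\<^esub>) = (\<lambda>g. if g = \<one> then r else 0)"
    by (simp add: fun_eq_iff)
  ultimately show "(r \<odot>\<^bsub>cochains R G Reg k\<^esub> c) xs = (\<lambda>g. r * c xs g)"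
    using scaled_basis_mult[of \<one> r "c xs"] assms(1) G_module.act_one[OF G_module_RG]
    by (simp add: cochains_def)
qed

text \<open>The bridge from the official definition to \<open>cob\<close>. The guard has to be kept,
  since \<open>cob\<close> is unconstrained off the tuples while cochains vanish there.\<close>

lemma coboundary_eq:
  assumes "c \<in> C k"
  shows "coboundary R G Reg k c = (\<lambda>xs. if xs \<in> tuples G (Suc k) then d k c xs else 0)"
proof
  fix xs
  show "coboundary R G Reg k c xs = (if xs \<in> tuples G (Suc k) then d k c xs else 0)"
  proof (cases "xs \<in> tuples G (Suc k)")
    case True
    have sgn: "alt_sign Reg i a = signed i a" if "a \<in> carrier RG" for i a
      using a_inv_eq_uminus[OF abelian_group_Reg, of a] that RG_uminus_mem[OF that]
      by (simp add: alt_sign_def signed_def)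
    have m: "c (merge_at G i xs) \<in> carrier RG" if "i < k" for i
      using C_mem[OF assms tuples_merge[OF True that]] .
    have "finsum Reg (\<lambda>i. alt_sign Reg (Suc i) (c (merge_at G i xs))) {..<k} =
        finsum Reg (\<lambda>i. signed (Suc i) (c (merge_at G i xs))) {..<k}"
      using m sgn abelian_group.axioms(1)[OF abelian_group_Reg] G_module.signed_mem[OF G_module_RG]
      by (intro abelian_monoid.finsum_cong') (auto simp: signed_def RG_uminus_mem)
    also have "\<dots> = (\<Sum>i<k. signed (Suc i) (c (merge_at G i xs)))"
      using m abelian_group.axioms(1)[OF abelian_group_Reg]
      by (intro finsum_eq_sum) (auto simp: signed_def RG_uminus_mem)
    finally have sum: "finsum Reg (\<lambda>i. alt_sign Reg (Suc i) (c (merge_at G i xs))) {..<k} =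
      (\<Sum>i<k. signed (Suc i) (c (merge_at G i xs)))" .
    have "basis_elem R (hd xs) \<otimes>\<^bsub>RG\<^esub> c (tl xs) = translate (hd xs) (c (tl xs))"
      using True C_mem[OF assms tuples_tl[OF True]] by (intro basis_mult tuples_hd)
    then show ?thesis
      using True sum sgn[OF C_mem[OF assms tuples_butlast[OF True]], of "Suc k"]
      by (simp add: coboundary_def cob_def tuples_def[symmetric]) (simp add: tuples_def)
  next
    case False
    then show ?thesis
      by (auto simp: coboundary_def tuples_def)
  qed
qed

lemma coboundary_mem: "c \<in> C k \<Longrightarrow> coboundary R G Reg k c \<in> C (Suc k)"
  unfolding coboundary_eq using G_module.cob_mem[OF G_module_RG, of _ k c]
  by (auto simp: C_def)

definition Z :: "nat \<Rightarrow> ('g list \<Rightarrow> 'g \<Rightarrow> rat) set"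
  where "Z k = {c \<in> C k. \<forall>xs\<in>tuples G (Suc k). d k c xs = 0}"

definition B :: "nat \<Rightarrow> ('g list \<Rightarrow> 'g \<Rightarrow> rat) set"
  where "B k = coboundaries R G Reg k"

lemma cocycles_eq: "cocycles R G Reg k = Z k"
  unfolding cocycles_def Z_def
  by (auto simp: coboundary_eq fun_eq_iff split: if_splits)

lemma B_0: "B 0 = {0}"
  by (simp add: B_def fun_eq_iff)

lemma B_Suc_iff: "c \<in> B (Suc k) \<longleftrightarrow> c \<in> C (Suc k) \<and> (\<exists>b\<in>C k. \<forall>xs\<in>tuples G (Suc k). d k b xs = c xs)"
proof
  assume "c \<in> B (Suc k)"
  then obtain b where "b \<in> C k" "c = coboundary R G Reg k b"
    by (auto simp: B_def)
  then show "c \<in> C (Suc k) \<and> (\<exists>b\<in>C k. \<forall>xs\<in>tuples G (Suc k). d k b xs = c xs)"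
    using coboundary_mem coboundary_eq by auto
next
  assume c: "c \<in> C (Suc k) \<and> (\<exists>b\<in>C k. \<forall>xs\<in>tuples G (Suc k). d k b xs = c xs)"
  then obtain b where b: "b \<in> C k" "\<forall>xs\<in>tuples G (Suc k). d k b xs = c xs"
    by blast
  then have "c = coboundary R G Reg k b"
    using c C_outside[of c "Suc k"] by (auto simp: coboundary_eq fun_eq_iff)
  then show "c \<in> B (Suc k)"
    using b(1) by (auto simp: B_def)
qed

lemma d_diff:
  "\<lbrakk>xs \<in> tuples G (Suc k); c \<in> C k; e \<in> C k\<rbrakk> \<Longrightarrow> d k (c - e) xs = d k c xs - d k e xs"
  using G_module.cob_diff[OF G_module_RG, of xs k c e] by (simp add: C_def fun_diff_def)

lemma d_scale:
  assumes "xs \<in> tuples G (Suc k)" "r \<in> loc n" "c \<in> C k"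
  shows "d k (\<lambda>xs g. r * c xs g) xs = (\<lambda>g. r * d k c xs g)"
  using assms C_mem[OF assms(3)]
  by (intro G_module.cob_equivariant[OF G_module_RG, where \<theta> = "\<lambda>a g. r * a g"])
    (auto simp: translate_def fun_eq_iff right_diff_distrib)

lemma d_d: "\<lbrakk>xs \<in> tuples G (Suc (Suc k)); c \<in> C k\<rbrakk> \<Longrightarrow> d (Suc k) (coboundary R G Reg k c) xs = 0"
  using G_module.cob_cob[OF G_module_RG, of xs k c] C_mem[of c k]
    cob_cong[of xs "Suc k" "coboundary R G Reg k c" "d k c"]
  by (simp add: coboundary_eq)

lemma Z_zero: "0 \<in> Z k"
proof -
  have "d k 0 xs = 0" if "xs \<in> tuples G (Suc k)" for xs
    using G_module.cob_zero[OF G_module_RG that] by (simp add: zero_fun_def)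
  then show ?thesis
    using C_zero by (simp add: Z_def)
qed

lemma Z_diff: "\<lbrakk>c \<in> Z k; e \<in> Z k\<rbrakk> \<Longrightarrow> c - e \<in> Z k"
  by (simp add: Z_def C_diff d_diff)

lemma Z_scale: "\<lbrakk>r \<in> loc n; c \<in> Z k\<rbrakk> \<Longrightarrow> (\<lambda>xs g. r * c xs g) \<in> Z k"
  by (auto simp: Z_def C_scale d_scale fun_eq_iff)

lemma B_zero: "0 \<in> B k"
proof (cases k)
  case (Suc m)
  have "d m 0 xs = 0" if "xs \<in> tuples G (Suc m)" for xs
    using G_module.cob_zero[OF G_module_RG that] by (simp add: zero_fun_def)
  then show ?thesis
    unfolding Suc B_Suc_iff using C_zero by (auto intro!: bexI[of _ 0])
qed (simp add: B_0)

lemma B_diff: "\<lbrakk>c \<in> B k; e \<in> B k\<rbrakk> \<Longrightarrow> c - e \<in> B k"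
proof (cases k)
  case (Suc m)
  assume *: "c \<in> B k" "e \<in> B k"
  then obtain b b' where "b \<in> C m" "b' \<in> C m" "\<forall>xs\<in>tuples G k. d m b xs = c xs" "\<forall>xs\<in>tuples G k. d m b' xs = e xs"
    unfolding Suc B_Suc_iff by blast
  then show ?thesis
    using * unfolding Suc B_Suc_iff by (auto simp: C_diff d_diff intro!: bexI[of _ "b - b'"])
qed (simp add: B_0)

lemma B_scale: "\<lbrakk>r \<in> loc n; c \<in> B k\<rbrakk> \<Longrightarrow> (\<lambda>xs g. r * c xs g) \<in> B k"
proof (cases k)
  case (Suc m)
  assume *: "r \<in> loc n" "c \<in> B k"
  then obtain b where "b \<in> C m" "\<forall>xs\<in>tuples G k. d m b xs = c xs"
    unfolding Suc B_Suc_iff by blast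
  then show ?thesis
    using * unfolding Suc B_Suc_iff by (auto simp: C_scale d_scale intro!: bexI[of _ "\<lambda>xs g. r * b xs g"])
qed (simp add: B_0 fun_eq_iff)

lemma B_Z: "c \<in> B k \<Longrightarrow> c \<in> Z k"
proof (cases k)
  case 0
  then show "c \<in> B k \<Longrightarrow> c \<in> Z k"
    using Z_zero by (simp add: B_0)
next
  case (Suc m)
  assume "c \<in> B k"
  then obtain b where "b \<in> C m" "c = coboundary R G Reg m b"
    by (auto simp: B_def Suc)
  then show ?thesis
    using d_d coboundary_mem by (simp add: Z_def Suc)
qed

definition ZM :: "nat \<Rightarrow> (rat, 'g list \<Rightarrow> 'g \<Rightarrow> rat) module"
  where "ZM k = (cochains R G Reg k)\<lparr>carrier := Z k\<rparr>"

lemma ZM_simps [simp]: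
  "carrier (ZM k) = Z k" "add (ZM k) = (+)" "zero (ZM k) = 0"
  using cochains_simps[of k] by (simp_all add: ZM_def)

lemma ZM_smult: "\<lbrakk>r \<in> loc n; c \<in> Z k\<rbrakk> \<Longrightarrow> r \<odot>\<^bsub>ZM k\<^esub> c = (\<lambda>xs g. r * c xs g)"
  using cochains_smult[of r c k] by (simp add: ZM_def Z_def)

lemma Z_uminus: "c \<in> Z k \<Longrightarrow> - c \<in> Z k"
  using Z_diff[OF Z_zero, of c k] by simp

lemma Z_add: "\<lbrakk>c \<in> Z k; e \<in> Z k\<rbrakk> \<Longrightarrow> c + e \<in> Z k"
  using Z_diff[of c k "- e"] Z_uminus[of e k] by simp

lemma B_uminus: "c \<in> B k \<Longrightarrow> - c \<in> B k"
  using B_diff[OF B_zero, of c k] by simp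

lemma B_add: "\<lbrakk>c \<in> B k; e \<in> B k\<rbrakk> \<Longrightarrow> c + e \<in> B k"
  using B_diff[of c k "- e"] B_uminus[of e k] by simp

lemma module_ZM: "Module.module R (ZM k)"
proof (rule Module.moduleI)
  show "abelian_group (ZM k)"
  proof (rule abelian_groupI)
    show "\<exists>e\<in>carrier (ZM k). e \<oplus>\<^bsub>ZM k\<^esub> c = \<zero>\<^bsub>ZM k\<^esub>" if "c \<in> carrier (ZM k)" for c
      using that Z_uminus[of c k] by (intro bexI[of _ "- c"]) auto
  qed (auto simp: Z_zero Z_add add_ac)
qed (auto simp: cring_R ZM_smult Z_scale Z_add n_pos loc_add loc_mult algebra_simps fun_eq_iff)

lemma submodule_B: "submodule (B k) R (ZM k)"
proof -
  interpret ZM: Module.module R "ZM k" by (rule module_ZM)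
  show ?thesis
  proof (rule ZM.submoduleI)
    show "\<ominus>\<^bsub>ZM k\<^esub> c \<in> B k" if "c \<in> B k" for c
      using a_inv_eq_uminus[OF ZM.abelian_group_axioms, of c] that B_Z[OF that] Z_uminus[of c k] B_uminus[OF that] by simp
    show "r \<odot>\<^bsub>ZM k\<^esub> c \<in> B k" if "r \<in> carrier R" "c \<in> B k" for r c
      using that B_Z B_scale by (simp add: ZM_smult)
  qed (auto simp: B_Z B_zero B_add)
qed

lemma quotient_B: "quotient R (ZM k) (B k)"
  by (intro quotient.intro quotient_axioms.intro module_ZM submodule_B)

lemma cohomology_eq: "cohomology R G Reg k = quotient_module (ZM k) (B k)"
  by (simp add: cohomology_def cocycles_eq ZM_def B_def)

lemma module_cohomology: "Module.module R (cohomology R G Reg k)"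
  unfolding cohomology_eq by (rule quotient.module_quotient[OF quotient_B])

lemma cohomology_trivial:
  assumes "Z k \<subseteq> B k"
  shows "carrier (cohomology R G Reg k) = {\<zero>\<^bsub>cohomology R G Reg k\<^esub>}"
proof -
  interpret Q: quotient R "ZM k" "B k" by (rule quotient_B)
  have "B k +>\<^bsub>ZM k\<^esub> c = B k" if "c \<in> Z k" for c
    using Q.coset_eq_H[of c] that assms by auto
  then show ?thesis
    unfolding cohomology_eq Q.carrier_quotient Q.quotient_zero using Z_zero by fastforce
qed

text \<open>The hypothesis is torsion-freeness of the cohomology module, expressed by
  representatives.\<close>

lemma flat_cohomology:
  assumes "\<And>r c. \<lbrakk>r \<in> loc n; r \<noteq> 0; c \<in> Z k; (\<lambda>xs g. r * c xs g) \<in> B k\<rbrakk> \<Longrightarrow> c \<in> B k"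
  shows "flat_module T R (cohomology R G Reg k)"
proof (rule flat_if_torsion_free[OF n_pos module_cohomology], intro ballI impI)
  interpret Q: quotient R "ZM k" "B k" by (rule quotient_B)
  fix r X
  assume r: "r \<in> loc n" and X: "X \<in> carrier (cohomology R G Reg k)"
    and eq: "r \<odot>\<^bsub>cohomology R G Reg k\<^esub> X = \<zero>\<^bsub>cohomology R G Reg k\<^esub>"
  obtain c where c: "X = B k +>\<^bsub>ZM k\<^esub> c" "c \<in> Z k"
    using X unfolding cohomology_eq Q.carrier_quotient by auto
  have "B k +>\<^bsub>ZM k\<^esub> (\<lambda>xs g. r * c xs g) = B k"
    using eq r c Q.quotient_smult[of r c] unfolding cohomology_eq Q.quotient_zero by (simp add: ZM_smult)
  then have "(\<lambda>xs g. r * c xs g) \<in> B k"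
    using Q.coset_eq_H[of "\<lambda>xs g. r * c xs g"] r c by (simp add: Z_scale)
  then show "r = 0 \<or> X = \<zero>\<^bsub>cohomology R G Reg k\<^esub>"
    using assms[OF r _ c(2)] Q.coset_eq_H[of c] c unfolding cohomology_eq Q.quotient_zero by auto
qed

end

section \<open>One-endedness and low degrees\<close>

text \<open>With two values this is the description of at most one end by almost invariant subsets.
  A general value type is allowed because \<open>derivation_mod\<close> takes residue classes modulo
  \<open>r\<close>, which are sets of rationals, as values. Finite groups are not excluded
  here.\<close>

definition one_ended :: "('g, 'b) monoid_scheme \<Rightarrow> 'c itself \<Rightarrow> bool"
  where "one_ended G (T :: 'c itself) \<longleftrightarrow>
    (\<forall>u :: 'g \<Rightarrow> 'c. (\<forall>g\<in>carrier G. finite {x \<in> carrier G. u (g \<otimes>\<^bsub>G\<^esub> x) \<noteq> u x}) \<longrightarrow>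
      (\<exists>c. finite {x \<in> carrier G. u x \<noteq> c}))"

locale one_ended_group_ring = loc_group_ring +
  assumes infinite: "infinite (carrier G)" and one_ended: "one_ended G TYPE(rat set)"
begin

lemma tuples_0 [simp]: "xs \<in> tuples G 0 \<longleftrightarrow> xs = []"
  by (auto simp: tuples_def)

lemma d_0: "d 0 c [x] = translate x (c []) - c []"
  by (simp add: cob_def signed_def)

lemma d_1: "d 1 c [x, y] = translate x (c [y]) - c [x \<otimes> y] + c [x]"
  by (simp add: cob_def signed_def)

text \<open>A 0-cocycle is a translation invariant element of the group ring. It is constant on the
  infinite carrier, so finite support forces it to be zero.\<close>

lemma cocycles_0_trivial: "Z 0 \<subseteq> B 0"
proof
  fix c assume c: "c \<in> Z 0"
  have a: "c [] \<in> carrier RG"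
    using c by (simp add: Z_def C_def)
  have inv: "translate x (c []) = c []" if "x \<in> carrier G" for x
    using c that d_0[of c x] by (simp add: Z_def tuples_def)
  have "c [] y = 0" for y
  proof (rule ccontr)
    assume y: "c [] y \<noteq> 0"
    then have yG: "y \<in> carrier G"
      using RG_outside[OF a] by blast
    have "carrier G \<subseteq> (\<lambda>z. z \<otimes> inv y) ` {z. c [] z \<noteq> 0}"
    proof
      fix x assume x: "x \<in> carrier G"
      have "c [] (x \<otimes> y) = translate x (c []) (x \<otimes> y)"
        using inv[OF x] by simp
      also have "\<dots> = c [] y"
        using x yG by (simp add: translate_def m_assoc[symmetric])
      finally show "x \<in> (\<lambda>z. z \<otimes> inv y) ` {z. c [] z \<noteq> 0}"
        using x y yG by (intro image_eqI[of _ _ "x \<otimes> y"]) (auto simp: m_assoc)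
    qed
    then show False
      using RG_finite[OF a] infinite finite_surj by blast
  qed
  then have "c xs = 0" for xs
    using c by (cases "xs = []") (auto simp: Z_def C_def fun_eq_iff)
  then show "c \<in> B 0"
    by (simp add: B_0 fun_eq_iff)
qed

text \<open>A derivation modulo \<open>r\<close> is of the form \<open>x \<mapsto> x u - u\<close> for a function \<open>u\<close> that need not have finite
  support. One-endedness makes \<open>u\<close> constant outside a finite set modulo \<open>r\<close>. The case \<open>r = 0\<close> is the
  vanishing of the first cohomology, the case \<open>r \<noteq> 0\<close> shows that the second one has no \<open>r\<close>-torsion.\<close>

lemma derivation_mod:
  assumes r: "r \<in> loc n" and b: "b \<in> C 1"
    and der: "\<And>x y z. \<lbrakk>x \<in> carrier G; y \<in> carrier G\<rbrakk> \<Longrightarrow> \<exists>s\<in>loc n. d 1 b [x, y] z = r * s"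
  obtains a where "a \<in> carrier RG"
    "\<And>x z. x \<in> carrier G \<Longrightarrow> \<exists>s\<in>loc n. (b [x] - (translate x a - a)) z = r * s"
proof -
  define I where "I = {r * s | s. s \<in> loc n}"
  have I_zero: "0 \<in> I"
    unfolding I_def by (auto intro!: exI[of _ 0])
  have I_diff: "x - y \<in> I" if xy: "x \<in> I" "y \<in> I" for x y
  proof -
    obtain s s' where "x = r * s" "y = r * s'" "s \<in> loc n" "s' \<in> loc n"
      using xy by (auto simp: I_def)
    then have "x - y = r * (s - s')" "s - s' \<in> loc n"
      using n_pos by (auto simp: right_diff_distrib loc_diff)
    then show ?thesis
      unfolding I_def by blast
  qed
  have I_uminus: "- x \<in> I" if "x \<in> I" for x
    using I_diff[OF I_zero that] by simp
  have I_add: "x + y \<in> I" if "x \<in> I" "y \<in> I" for x y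
    using I_diff[OF that(1) I_uminus[OF that(2)]] by simp
  have bM: "b [x] \<in> carrier RG" if "x \<in> carrier G" for x
    using b that by (auto simp: C_def tuples_def)
  \<comment> \<open>Obtained by reading \<open>b [g] = translate g u - u\<close> at the unit with
    \<open>g = inv x\<close>. This fixes \<open>u\<close> up to the constant
    \<open>u \<one>\<close>, which does not affect the right hand side.\<close>
  define u where "u x = b [inv x] \<one>" for x
  define U where "U x = {y. y - u x \<in> I}" for x
  have U_eq: "U x = U y \<longleftrightarrow> u x - u y \<in> I" for x y
  proof
    assume "U x = U y"
    moreover have "u x \<in> U x"
      by (simp add: U_def I_zero)
    ultimately show "u x - u y \<in> I"
      by (simp add: U_def)
  next
    assume *: "u x - u y \<in> I"
    have "z - u x \<in> I \<longleftrightarrow> z - u y \<in> I" for z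
      using I_add[OF _ *, of "z - u x"] I_diff[OF _ *, of "z - u y"] by (auto simp: algebra_simps)
    then show "U x = U y"
      by (simp add: U_def)
  qed
  have key: "b [g] x - (u (inv g \<otimes> x) - u x) \<in> I" if "g \<in> carrier G" "x \<in> carrier G" for g x
  proof -
    have "d 1 b [inv x, g] \<one> \<in> I"
      using der[of "inv x" g \<one>] that by (auto simp: I_def)
    then show ?thesis
      unfolding d_1 using that by (simp add: u_def translate_def inv_mult_group algebra_simps)
  qed
  have fin: "finite {x \<in> carrier G. U (g \<otimes> x) \<noteq> U x}" if g: "g \<in> carrier G" for g
  proof (rule finite_subset[OF _ RG_finite[OF bM[of "inv g"]]])
    show "{x \<in> carrier G. U (g \<otimes> x) \<noteq> U x} \<subseteq> {x. b [inv g] x \<noteq> 0}"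
    proof (intro subsetI CollectI notI)
      fix x assume x: "x \<in> {x \<in> carrier G. U (g \<otimes> x) \<noteq> U x}" and "b [inv g] x = 0"
      then have "- (u (g \<otimes> x) - u x) \<in> I"
        using key[of "inv g" x] g by simp
      then have "u (g \<otimes> x) - u x \<in> I"
        using I_uminus[of "- (u (g \<otimes> x) - u x)"] by simp
      then show False
        using x by (simp add: U_eq)
    qed
  qed (use g in auto)
  obtain c where c: "finite {x \<in> carrier G. U x \<noteq> c}"
    using one_ended fin unfolding one_ended_def by blast
  then have "\<not> carrier G \<subseteq> {x \<in> carrier G. U x \<noteq> c}"
    using infinite finite_subset by blast
  then obtain x0 where x0: "x0 \<in> carrier G" "U x0 = c"
    by blast
  \<comment> \<open>Subtracting the constant \<open>u x0\<close> changes no differences. At points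
    of the generic class the result lies in \<open>I\<close> and may be replaced by 0, which makes
    the support finite.\<close>
  define a where "a x = (if x \<in> carrier G \<and> U x \<noteq> c then u x - u x0 else 0)" for x
  have uM: "u x \<in> loc n" if "x \<in> carrier G" for x
    using RG_apply[OF bM] that by (simp add: u_def)
  have a_mem: "a \<in> carrier RG"
    unfolding RG_iff
  proof (intro conjI ballI allI impI)
    show "finite {x. a x \<noteq> 0}"
      by (rule finite_subset[OF _ c]) (auto simp: a_def)
  qed (use uM x0 n_pos in \<open>auto simp: a_def loc_diff\<close>)
  have a_u: "a x - (u x - u x0) \<in> I" if "x \<in> carrier G" for x
    using that U_eq[of x x0] x0 I_zero I_uminus[of "u x - u x0"] by (auto simp: a_def)
  have ba: "(b [g] - (translate g a - a)) x \<in> I" if g: "g \<in> carrier G" for g x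
  proof (cases "x \<in> carrier G")
    case True
    have "b [g] x - (u (inv g \<otimes> x) - u x) - (a (inv g \<otimes> x) - (u (inv g \<otimes> x) - u x0)) + (a x - (u x - u x0)) \<in> I"
      using g True by (intro I_add[OF I_diff[OF key[OF g True] a_u] a_u]) auto
    then show ?thesis
      using True by (simp add: translate_def algebra_simps)
  next
    case False
    then show ?thesis
      using RG_outside[OF bM[OF g]] I_zero by (simp add: translate_def a_def)
  qed
  show thesis
  proof (rule that[OF a_mem])
    show "\<exists>s\<in>loc n. (b [x] - (translate x a - a)) z = r * s" if "x \<in> carrier G" for x z
      using ba[OF that, of z] unfolding I_def by blast
  qed
qed

lemma cocycles_1_trivial: "Z 1 \<subseteq> B 1"
proof
  fix c assume c: "c \<in> Z 1"
  have cC: "c \<in> C 1"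
    using c by (simp add: Z_def)
  have d0: "d 1 c [x, y] = 0" if "x \<in> carrier G" "y \<in> carrier G" for x y
    using c that by (simp add: Z_def tuples_def)
  obtain a where a: "a \<in> carrier RG"
    and ca: "\<And>x z. x \<in> carrier G \<Longrightarrow> \<exists>s\<in>loc n. (c [x] - (translate x a - a)) z = 0 * s"
  proof (rule derivation_mod[of 0 c])
    show "\<exists>s\<in>loc n. d 1 c [x, y] z = 0 * s" if "x \<in> carrier G" "y \<in> carrier G" for x y z
      unfolding d0[OF that] by (intro bexI[of _ 0]) auto
  qed (use cC in auto)
  have "c [x] = translate x a - a" if "x \<in> carrier G" for x
    using ca[OF that] by (simp add: fun_eq_iff)
  then have "d 0 (\<lambda>xs. if xs = [] then a else 0) xs = c xs" if "xs \<in> tuples G 1" for xs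
    using that d_0 by (auto simp: tuples_def length_Suc_conv)
  moreover have "(\<lambda>xs. if xs = [] then a else 0) \<in> C 0"
    using a by (simp add: C_def)
  ultimately show "c \<in> B 1"
    using cC unfolding One_nat_def B_Suc_iff by blast
qed

text \<open>If \<open>r c\<close> is the coboundary of \<open>b\<close>, then \<open>b\<close> is a
  derivation modulo \<open>r\<close>, so it differs from a coboundary by some \<open>r b'\<close>,
  and the coboundary of \<open>b'\<close> is \<open>c\<close>. In other words,
  \<open>r\<close>-torsion in degree two comes from degree one with coefficients modulo
  \<open>r\<close>.\<close>

lemma B_2_torsion_free:
  assumes r: "r \<in> loc n" "r \<noteq> 0" and c: "c \<in> Z 2" and rc: "(\<lambda>xs g. r * c xs g) \<in> B 2"
  shows "c \<in> B 2"
proof -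
  obtain b where b: "b \<in> C 1" and db: "\<And>xs. xs \<in> tuples G 2 \<Longrightarrow> d 1 b xs = (\<lambda>g. r * c xs g)"
    using rc unfolding numeral_2_eq_2 One_nat_def B_Suc_iff by blast
  have cM: "c xs \<in> carrier RG" if "xs \<in> tuples G 2" for xs
    using c that by (simp add: Z_def C_def)
  obtain a where a: "a \<in> carrier RG"
    and ba: "\<And>x z. x \<in> carrier G \<Longrightarrow> \<exists>s\<in>loc n. (b [x] - (translate x a - a)) z = r * s"
  proof (rule derivation_mod[OF r(1) b])
    show "\<exists>s\<in>loc n. d 1 b [x, y] z = r * s" if "x \<in> carrier G" "y \<in> carrier G" for x y z
      using db[of "[x, y]"] cM[of "[x, y]"] that RG_apply by (auto simp: tuples_def)
  qed (rule that)
  define a' where "a' xs = (if xs = [] then a else 0)" for xs :: "'a list"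
  have a': "a' \<in> C 0"
    using a by (auto simp: a'_def C_def)
  define e where "e = b - coboundary R G Reg 0 a'"
  have e: "e \<in> C 1"
    unfolding e_def One_nat_def using b coboundary_mem[OF a'] by (intro C_diff) auto
  have e_val: "\<exists>s\<in>loc n. e xs z = r * s" for xs z
  proof (cases "xs \<in> tuples G 1")
    case True
    then obtain x where x: "xs = [x]" "x \<in> carrier G"
      by (auto simp: tuples_def length_Suc_conv)
    then show ?thesis
      using ba[OF x(2), of z] True coboundary_eq[OF a'] d_0 by (simp add: e_def a'_def)
  next
    case False
    then show ?thesis
      using C_outside[OF e False] by (auto intro!: bexI[of _ 0])
  qed
  define b' where "b' xs z = e xs z / r" for xs z
  have b': "b' \<in> C 1"
    unfolding C_def
  proof (intro CollectI conjI ballI allI impI)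
    fix xs assume xs: "xs \<in> tuples G 1"
    have "b' xs z \<in> loc n" for z
      using e_val[of xs z] r by (auto simp: b'_def)
    moreover have "finite {z. b' xs z \<noteq> 0}"
      using RG_finite[OF C_mem[OF e xs]] r by (simp add: b'_def)
    ultimately show "b' xs \<in> carrier RG"
      using RG_outside[OF C_mem[OF e xs]] by (simp add: RG_iff b'_def)
  qed (use C_outside[OF e] in \<open>auto simp: b'_def fun_eq_iff\<close>)
  have e_b': "e = (\<lambda>xs z. r * b' xs z)"
    using r by (simp add: b'_def fun_eq_iff)
  have "d 1 b' xs = c xs" if xs: "xs \<in> tuples G 2" for xs
  proof -
    have xs': "xs \<in> tuples G (Suc 1)"
      using xs by (simp add: numeral_2_eq_2)
    have "(\<lambda>g. r * d 1 b' xs g) = d 1 e xs"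
      unfolding e_b' using d_scale[OF xs' r(1) b'] by simp
    also have "\<dots> = d 1 b xs - d 1 (coboundary R G Reg 0 a') xs"
      unfolding e_def using b coboundary_mem[OF a'] by (intro d_diff[OF xs']) auto
    also have "d 1 (coboundary R G Reg 0 a') xs = 0"
      using d_d[OF _ a', of xs] xs' by simp
    finally show ?thesis
      using db[OF xs] r by (simp add: fun_eq_iff)
  qed
  then show ?thesis
    unfolding numeral_2_eq_2 B_Suc_iff using c b' by (auto simp: Z_def numeral_2_eq_2)
qed

end

section \<open>The lamplighter group and its single end\<close>

locale lamplighter = F: group F for F :: "('a, 'b) monoid_scheme" +
  assumes finite_F: "finite (carrier F)" and nontrivial: "carrier F \<noteq> {\<one>\<^bsub>F\<^esub>}"
begin

definition Conf :: "(int \<Rightarrow> 'a) set"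
  where "Conf = {f. (\<forall>i. f i \<in> carrier F) \<and> finite {i. f i \<noteq> \<one>\<^bsub>F\<^esub>}}"

abbreviation G :: "((int \<Rightarrow> 'a) \<times> int) monoid" where "G \<equiv> lamplighter_group F"

lemma carrier_G: "carrier G = Conf \<times> UNIV"
  by (auto simp: lamplighter_group_def semidirect_product_def carrier_sum_group F.group_axioms Conf_def PiE_UNIV_domain)

lemma mult_G: "(f, h) \<otimes>\<^bsub>G\<^esub> (g, k) = ((\<lambda>i. f i \<otimes>\<^bsub>F\<^esub> g (i - h)), h + k)"
  by (simp add: lamplighter_group_def semidirect_product_def shift_def fun_eq_iff)

lemma one_G: "\<one>\<^bsub>G\<^esub> = ((\<lambda>_. \<one>\<^bsub>F\<^esub>), 0)"
  by (simp add: lamplighter_group_def semidirect_product_def fun_eq_iff)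

lemma Conf_closed: "f \<in> Conf \<Longrightarrow> f i \<in> carrier F"
  by (simp add: Conf_def)

lemma Conf_finite: "f \<in> Conf \<Longrightarrow> finite {i. f i \<noteq> \<one>\<^bsub>F\<^esub>}"
  by (simp add: Conf_def)

lemma Conf_one: "(\<lambda>_. \<one>\<^bsub>F\<^esub>) \<in> Conf"
  by (simp add: Conf_def)

lemma Conf_mult:
  assumes "f \<in> Conf" "g \<in> Conf"
  shows "(\<lambda>i. f i \<otimes>\<^bsub>F\<^esub> g i) \<in> Conf"
proof -
  have "{i. f i \<otimes>\<^bsub>F\<^esub> g i \<noteq> \<one>\<^bsub>F\<^esub>} \<subseteq> {i. f i \<noteq> \<one>\<^bsub>F\<^esub>} \<union> {i. g i \<noteq> \<one>\<^bsub>F\<^esub>}"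
    using assms by (auto simp: Conf_def)
  then show ?thesis
    using assms finite_subset by (auto simp: Conf_def)
qed

lemma Conf_shift:
  assumes "f \<in> Conf"
  shows "(\<lambda>i. f (i + p)) \<in> Conf"
proof -
  have "{i. f (i + p) \<noteq> \<one>\<^bsub>F\<^esub>} = (\<lambda>i. i - p) ` {i. f i \<noteq> \<one>\<^bsub>F\<^esub>}"
  proof (intro equalityI subsetI)
    fix i assume "i \<in> {i. f (i + p) \<noteq> \<one>\<^bsub>F\<^esub>}"
    then show "i \<in> (\<lambda>i. i - p) ` {i. f i \<noteq> \<one>\<^bsub>F\<^esub>}"
      by (intro image_eqI[of _ _ "i + p"]) auto
  qed auto
  then show ?thesis
    using assms by (simp add: Conf_def)
qed

lemma Conf_upd:
  assumes "f \<in> Conf" "y \<in> carrier F"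
  shows "f(p := y) \<in> Conf"
proof -
  have "{i. (f(p := y)) i \<noteq> \<one>\<^bsub>F\<^esub>} \<subseteq> insert p {i. f i \<noteq> \<one>\<^bsub>F\<^esub>}"
    by auto
  then have "finite {i. (f(p := y)) i \<noteq> \<one>\<^bsub>F\<^esub>}"
    using assms Conf_finite finite_subset by blast
  then show ?thesis
    using assms by (simp add: Conf_def)
qed

lemma Conf_inv: "f \<in> Conf \<Longrightarrow> (\<lambda>i. inv\<^bsub>F\<^esub> f i) \<in> Conf"
  by (simp add: Conf_def)

lemma group_G: "group G"
proof (rule groupI)
  show "x \<otimes>\<^bsub>G\<^esub> y \<in> carrier G" if "x \<in> carrier G" "y \<in> carrier G" for x y
    using that Conf_mult Conf_shift[of _ "- h" for h] by (auto simp: carrier_G mult_G)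
  show "\<exists>y\<in>carrier G. y \<otimes>\<^bsub>G\<^esub> x = \<one>\<^bsub>G\<^esub>" if "x \<in> carrier G" for x
  proof -
    obtain f h where x: "x = (f, h)" "f \<in> Conf"
      using \<open>x \<in> carrier G\<close> by (auto simp: carrier_G)
    then show ?thesis
      using Conf_inv[OF Conf_shift[OF x(2), of h]] Conf_closed[OF x(2)]
      by (intro bexI[of _ "((\<lambda>i. inv\<^bsub>F\<^esub> f (i + h)), - h)"]) (auto simp: mult_G one_G carrier_G)
  qed
qed (auto simp: carrier_G mult_G one_G Conf_one Conf_closed F.m_assoc algebra_simps)

lemma infinite_G: "infinite (carrier G)"
proof
  assume "finite (carrier G)"
  then have "finite (UNIV :: int set)"
    using Conf_one by (auto simp: carrier_G finite_cartesian_product_iff)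
  then show False
    by simp
qed

text \<open>A group element read as a lamp configuration together with the position of the lamplighter, so that
  left multiplications move the lamplighter or change the lamp at its position.\<close>

definition state :: "(int \<Rightarrow> 'a) \<Rightarrow> int \<Rightarrow> (int \<Rightarrow> 'a) \<times> int"
  where "state f p = ((\<lambda>i. f (i + p)), - p)"

lemma state_inj: "state f p = state g q \<Longrightarrow> f = g \<and> p = q"
proof -
  assume *: "state f p = state g q"
  then have "p = q"
    by (simp add: state_def)
  moreover have "f i = g i" for i
    using * fun_cong[of "\<lambda>i. f (i + p)" "\<lambda>i. g (i + q)" "i - p"] \<open>p = q\<close> by (simp add: state_def)
  ultimately show ?thesis
    by blast
qed

lemma state_closed: "f \<in> Conf \<Longrightarrow> state f p \<in> carrier G"
  by (simp add: carrier_G state_def Conf_shift)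

lemma state_surj:
  assumes "x \<in> carrier G"
  obtains f p where "f \<in> Conf" "x = state f p"
proof (rule that)
  show "(\<lambda>i. fst x (i + snd x)) \<in> Conf"
    using assms by (auto simp: carrier_G intro: Conf_shift)
  show "x = state (\<lambda>i. fst x (i + snd x)) (- snd x)"
    by (simp add: state_def)
qed

definition t :: "(int \<Rightarrow> 'a) \<times> int"
  where "t = ((\<lambda>_. \<one>\<^bsub>F\<^esub>), 1)"

lemma t_closed: "t \<in> carrier G"
  by (simp add: t_def carrier_G Conf_one)

definition lamp :: "'a \<Rightarrow> (int \<Rightarrow> 'a) \<times> int"
  where "lamp y = ((\<lambda>_. \<one>\<^bsub>F\<^esub>)(0 := y), 0)"

lemma lamp_closed: "y \<in> carrier F \<Longrightarrow> lamp y \<in> carrier G"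
  by (simp add: lamp_def carrier_G Conf_one Conf_upd)

lemma t_state: "f \<in> Conf \<Longrightarrow> t \<otimes>\<^bsub>G\<^esub> state f p = state f (p - 1)"
  by (auto simp: t_def state_def mult_G Conf_closed algebra_simps)

text \<open>The multiplier depends on the current value of the lamp but ranges over finitely many
  group elements, so all switches together are covered by a finite generating set.\<close>

lemma lamp_state:
  assumes "f \<in> Conf" "y \<in> carrier F"
  shows "lamp (y \<otimes>\<^bsub>F\<^esub> inv\<^bsub>F\<^esub> f p) \<otimes>\<^bsub>G\<^esub> state f p = state (f(p := y)) p"
  using assms by (auto simp: lamp_def state_def mult_G Conf_closed F.m_assoc fun_eq_iff)

text \<open>Walking and switching change \<open>v\<close> only at the finitely many states in
  \<open>Bad\<close>. A configuration outside \<open>\<Phi>\<close> therefore has a value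
  independent of the position. Two such configurations are joined by switching lamps one at a time
  while a lamp far away is lit, which keeps every intermediate configuration outside
  \<open>\<Phi>\<close>. For a configuration in \<open>\<Phi>\<close> with the lamplighter far out,
  switching on the lamp there leads out of \<open>\<Phi>\<close>. Only \<open>\<Phi>\<close> with
  bounded positions remains.\<close>

lemma one_ended_G: "one_ended G TYPE('c)"
  unfolding one_ended_def
proof (intro allI impI)
  fix u :: "(int \<Rightarrow> 'a) \<times> int \<Rightarrow> 'c"
  assume u: "\<forall>g\<in>carrier G. finite {x \<in> carrier G. u (g \<otimes>\<^bsub>G\<^esub> x) \<noteq> u x}"
  define E where "E = (\<Union>g\<in>insert t (lamp ` carrier F). {x \<in> carrier G. u (g \<otimes>\<^bsub>G\<^esub> x) \<noteq> u x})"
  have "finite E"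
    unfolding E_def using u t_closed lamp_closed finite_F by (intro finite_UN_I) auto
  define v where "v f p = u (state f p)" for f p
  define Bad where "Bad = {(f, p). f \<in> Conf \<and> state f p \<in> E}"
  have "inj_on (\<lambda>(f, p). state f p) Bad"
    using state_inj by (auto intro!: inj_onI)
  moreover have "(\<lambda>(f, p). state f p) ` Bad \<subseteq> E"
    by (auto simp: Bad_def)
  ultimately have fin_Bad: "finite Bad"
    using \<open>finite E\<close> finite_imageD finite_subset by blast
  have move: "v f (p - 1) = v f p" if "f \<in> Conf" "(f, p) \<notin> Bad" for f p
  proof (rule ccontr)
    assume "v f (p - 1) \<noteq> v f p"
    then have "state f p \<in> {x \<in> carrier G. u (t \<otimes>\<^bsub>G\<^esub> x) \<noteq> u x}"
      using that(1) by (simp add: v_def t_state state_closed)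
    then show False
      using that by (auto simp: Bad_def E_def)
  qed
  have switch: "v (f(p := y)) p = v f p" if "f \<in> Conf" "(f, p) \<notin> Bad" "y \<in> carrier F" for f p y
  proof (rule ccontr)
    assume "v (f(p := y)) p \<noteq> v f p"
    then have "state f p \<in> {x \<in> carrier G. u (lamp (y \<otimes>\<^bsub>F\<^esub> inv\<^bsub>F\<^esub> f p) \<otimes>\<^bsub>G\<^esub> x) \<noteq> u x}"
      using that by (simp add: v_def lamp_state state_closed)
    moreover have "lamp (y \<otimes>\<^bsub>F\<^esub> inv\<^bsub>F\<^esub> f p) \<in> lamp ` carrier F"
      using that Conf_closed by auto
    ultimately show False
      using that by (auto simp: Bad_def E_def)
  qed
  define \<Phi> where "\<Phi> = fst ` Bad"
  have "finite (snd ` Bad \<union> (\<Union>f\<in>\<Phi>. {i. f i \<noteq> \<one>\<^bsub>F\<^esub>}))"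
    using fin_Bad Conf_finite by (auto simp: \<Phi>_def Bad_def)
  then have fin: "finite (abs ` (snd ` Bad \<union> (\<Union>f\<in>\<Phi>. {i. f i \<noteq> \<one>\<^bsub>F\<^esub>})))"
    by blast
  \<comment> \<open>Bounds the positions of bad states and the supports of the configurations in
    \<open>\<Phi>\<close>. A lamp lit beyond \<open>m\<close> thus certifies that a configuration is
    not in \<open>\<Phi>\<close>.\<close>
  define m where "m = Max (insert 0 (abs ` (snd ` Bad \<union> (\<Union>f\<in>\<Phi>. {i. f i \<noteq> \<one>\<^bsub>F\<^esub>}))))"
  have m: "\<bar>i\<bar> \<le> m" if "i \<in> snd ` Bad \<union> (\<Union>f\<in>\<Phi>. {i. f i \<noteq> \<one>\<^bsub>F\<^esub>})" for i
    unfolding m_def using fin that by (intro Max_ge) auto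
  have far: "f \<notin> \<Phi>" if "f q \<noteq> \<one>\<^bsub>F\<^esub>" "m < \<bar>q\<bar>" for f q
    using m[of q] that by force
  have good: "(f, p) \<notin> Bad" if "f \<notin> \<Phi> \<or> m < \<bar>p\<bar>" for f p
    using m[of p] that by (force simp: \<Phi>_def)
  define w where "w f = v f 0" for f
  have v_w: "v f p = w f" if f: "f \<in> Conf" "f \<notin> \<Phi>" for f p
  proof -
    have pos: "v f (int k) = w f" for k
      using move[OF f(1) good, of "int (Suc k)" for k] f(2) by (induction k) (auto simp: w_def)
    have neg: "v f (- int k) = w f" for k
    proof (induction k)
      case (Suc k)
      have "- int (Suc k) = - int k - 1"
        by simp
      then show ?case
        using Suc move[OF f(1) good, of "- int k"] f(2) by (simp only:) simp
    qed (simp add: w_def)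
    show ?thesis
      using pos neg by (cases p rule: int_cases2) auto
  qed
  have w_upd: "w (f(q := y)) = w f" if "f \<in> Conf" "f \<notin> \<Phi>" "f(q := y) \<notin> \<Phi>" "y \<in> carrier F" for f q y
    using switch[OF that(1) good, of q y] v_w[OF that(1,2), of q] v_w[OF Conf_upd[OF that(1,4)] that(3), of q] that(2,4)
    by simp
  obtain y where y: "y \<in> carrier F" "y \<noteq> \<one>\<^bsub>F\<^esub>"
    using nontrivial F.one_closed by blast
  have const: "w f = w g" if f: "f \<in> Conf" "f \<notin> \<Phi>" and g: "g \<in> Conf" "g \<notin> \<Phi>" for f g
  proof -
    let ?S = "{i. f i \<noteq> \<one>\<^bsub>F\<^esub>} \<union> {i. g i \<noteq> \<one>\<^bsub>F\<^esub>}"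
    have S: "finite ?S"
      using f g Conf_finite by blast
    then have "finite ({..\<bar>m\<bar>} \<inter> {0..} \<union> ?S)"
      by (simp add: atLeastAtMost_def[symmetric] Int_commute)
    then obtain q where q: "q \<notin> {..\<bar>m\<bar>} \<inter> {0..} \<union> ?S" "0 \<le> q"
      using infinite_Ici[of "0 :: int"] finite_subset[of "{0..}" "{..\<bar>m\<bar>} \<inter> {0..} \<union> ?S"] by auto
    then have qm: "m < \<bar>q\<bar>"
      by auto
    \<comment> \<open>The lamp at \<open>q\<close> is the marker: it stays lit while the lamps of
      \<open>f\<close> are changed into those of \<open>g\<close>, so \<open>far\<close> applies to
      all intermediate configurations.\<close>
    have "w ((\<lambda>i. if i \<in> T then g i else f i)(q := y)) = w (f(q := y))" if "finite T" "q \<notin> T" for T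
      using that
    proof (induction T rule: finite_induct)
      case (insert r T)
      let ?h = "\<lambda>T. (\<lambda>i. if i \<in> T then g i else f i)(q := y)"
      have hC: "?h T \<in> Conf"
      proof -
        have "{i. (if i \<in> T then g i else f i) \<noteq> \<one>\<^bsub>F\<^esub>} \<subseteq> ?S"
          by auto
        then have "finite {i. (if i \<in> T then g i else f i) \<noteq> \<one>\<^bsub>F\<^esub>}"
          using S by (rule finite_subset)
        then have "(\<lambda>i. if i \<in> T then g i else f i) \<in> Conf"
          using Conf_closed[OF f(1)] Conf_closed[OF g(1)] by (simp add: Conf_def)
        then show ?thesis
          using y Conf_upd by blast
      qed
      have upd: "?h (insert r T) = (?h T)(r := g r)"
        using insert.prems by (auto simp: fun_eq_iff)
      have step: "w ((?h T)(r := g r)) = w (?h T)"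
      proof (rule w_upd[OF hC])
        show "?h T \<notin> \<Phi>" "(?h T)(r := g r) \<notin> \<Phi>"
          using far[OF _ qm] y insert.prems by auto
      qed (use g Conf_closed in auto)
      have "w (?h T) = w (f(q := y))"
        using insert.IH insert.prems by blast
      then show ?case
        by (simp only: upd step)
    qed simp
    from this[OF S] have "w ((\<lambda>i. if i \<in> ?S then g i else f i)(q := y)) = w (f(q := y))"
      using q(1) by blast
    moreover have "(\<lambda>i. if i \<in> ?S then g i else f i) = g"
      by auto
    ultimately have "w (g(q := y)) = w (f(q := y))"
      by (simp only:)
    moreover have "w (f(q := y)) = w f" "w (g(q := y)) = w g"
      using w_upd[OF f, of q y] w_upd[OF g, of q y] far[OF _ qm] y by auto
    ultimately show ?thesis
      by simp
  qed
  define f0 where "f0 = (\<lambda>_. \<one>\<^bsub>F\<^esub>)(\<bar>m\<bar> + 1 := y)"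
  have f0: "f0 \<in> Conf" "f0 \<notin> \<Phi>"
    using Conf_upd[OF Conf_one y(1)] far[of f0 "\<bar>m\<bar> + 1"] y by (auto simp: f0_def)
  have "{x \<in> carrier G. u x \<noteq> w f0} \<subseteq> (\<lambda>(f, p). state f p) ` (\<Phi> \<times> {- m..m})"
  proof
    fix x assume x: "x \<in> {x \<in> carrier G. u x \<noteq> w f0}"
    then obtain f p where fp: "f \<in> Conf" "x = state f p"
      using state_surj by blast
    have f: "f \<in> \<Phi>"
      using x v_w[OF fp(1), of p] const[OF fp(1) _ f0] fp(2) by (auto simp: v_def)
    have "\<not> m < \<bar>p\<bar>"
    proof
      assume p: "m < \<bar>p\<bar>"
      \<comment> \<open>The switched lamp is at the position \<open>p\<close> itself, and
        \<open>(f, p)\<close> is not bad because \<open>p\<close> lies beyond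
        \<open>m\<close>.\<close>
      have n: "f(p := y) \<notin> \<Phi>"
        using far[OF _ p] y by auto
      have "v f p = v (f(p := y)) p"
        using switch[OF fp(1) good y(1), of p] p by simp
      also have "\<dots> = w f0"
        using v_w[OF Conf_upd[OF fp(1) y(1)] n] const[OF Conf_upd[OF fp(1) y(1)] n f0] by simp
      finally show False
        using x fp(2) by (simp add: v_def)
    qed
    then show "x \<in> (\<lambda>(f, p). state f p) ` (\<Phi> \<times> {- m..m})"
      using f fp(2) by (intro image_eqI[of _ _ "(f, p)"]) auto
  qed
  moreover have "finite ((\<lambda>(f, p). state f p) ` (\<Phi> \<times> {- m..m}))"
    using fin_Bad by (simp add: \<Phi>_def)
  ultimately show "\<exists>c. finite {x \<in> carrier G. u x \<noteq> c}"
    using finite_subset by blast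
qed

end

section \<open>The base group as a union of finite subgroups\<close>

locale tower_group_ring = loc_group_ring G n + tower_group G D t ht
  for G :: "('g, 'b) monoid_scheme" (structure) and n D t ht +
  assumes card_D_power: "\<exists>m. card (D j) = n ^ m"
begin

lemma inverse_card_loc: "1 / of_nat (card (D j)) \<in> loc n"
  using card_D_power[of j] loc_divide_power[OF loc_1, of n] by auto

lemma RG_divide_mem: "a \<in> carrier RG \<Longrightarrow> (\<lambda>z. a z / of_nat (card (D j))) \<in> carrier RG"
  using RG_scale_mem[OF inverse_card_loc[of j], of a] by simp

lemma tower_module_RG: "tower_module G D t ht translate (carrier RG)"
proof (intro tower_module.intro tower_module_axioms.intro)
  show "tower_group G D t ht"
    by (rule tower_group_axioms)
  show "G_module G translate (carrier RG)"
    by (rule G_module_RG)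
qed (auto simp: RG_divide_mem translate_def)

lemma cocycles_above_2_trivial: "Z (Suc (Suc (Suc m))) \<subseteq> B (Suc (Suc (Suc m)))"
proof
  fix c assume c: "c \<in> Z (Suc (Suc (Suc m)))"
  obtain b where b: "\<And>ys. ys \<in> tuples G (Suc (Suc m)) \<Longrightarrow> b ys \<in> carrier RG"
    "\<And>ys. ys \<in> tuples G (Suc (Suc (Suc m))) \<Longrightarrow> d (Suc (Suc m)) b ys = c ys"
    by (rule tower_module.acyclic_above_2[OF tower_module_RG, of m c]) (use c in \<open>auto simp: Z_def C_def\<close>)
  define b' where "b' xs = (if xs \<in> tuples G (Suc (Suc m)) then b xs else 0)" for xs
  have "d (Suc (Suc m)) b' ys = c ys" if "ys \<in> tuples G (Suc (Suc (Suc m)))" for ys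
    using b(2)[OF that] cob_cong[OF that, of b' b translate] by (simp add: b'_def)
  moreover have "b' \<in> C (Suc (Suc m))"
    using b(1) by (simp add: b'_def C_def)
  ultimately show "c \<in> B (Suc (Suc (Suc m)))"
    using c unfolding B_Suc_iff Z_def by blast
qed

end

section \<open>Lamp configurations with bounded support and generators of the group\<close>

context lamplighter
begin

definition D :: "nat \<Rightarrow> ((int \<Rightarrow> 'a) \<times> int) set"
  where "D j = {f \<in> Conf. \<forall>i. f i \<noteq> \<one>\<^bsub>F\<^esub> \<longrightarrow> \<bar>i\<bar> \<le> int j} \<times> {0}"

lemma inv_G: "f \<in> Conf \<Longrightarrow> inv\<^bsub>G\<^esub> (f, h) = ((\<lambda>i. inv\<^bsub>F\<^esub> f (i + h)), - h)"
  using Conf_inv[OF Conf_shift[of f h]] Conf_closed[of f]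
  by (intro group.inv_equality[OF group_G]) (auto simp: mult_G one_G carrier_G)

lemma bij_D: "bij_betw (\<lambda>x. restrict (fst x) {- int j..int j}) (D j) ({- int j..int j} \<rightarrow>\<^sub>E carrier F)"
proof (rule bij_betwI[of _ _ _ "\<lambda>f. ((\<lambda>i. if i \<in> {- int j..int j} then f i else \<one>\<^bsub>F\<^esub>), 0)"])
  show "(\<lambda>f. ((\<lambda>i. if i \<in> {- int j..int j} then f i else \<one>\<^bsub>F\<^esub>), 0)) \<in> ({- int j..int j} \<rightarrow>\<^sub>E carrier F) \<rightarrow> D j"
  proof
    fix f assume f: "f \<in> {- int j..int j} \<rightarrow>\<^sub>E carrier F"
    have "finite {i. (if i \<in> {- int j..int j} then f i else \<one>\<^bsub>F\<^esub>) \<noteq> \<one>\<^bsub>F\<^esub>}"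
      by (rule finite_subset[of _ "{- int j..int j}"]) auto
    then show "((\<lambda>i. if i \<in> {- int j..int j} then f i else \<one>\<^bsub>F\<^esub>), 0) \<in> D j"
      using f by (auto simp: D_def Conf_def)
  qed
next
  fix x assume "x \<in> D j"
  then obtain f where x: "x = (f, 0)" and f: "\<And>i. f i \<noteq> \<one>\<^bsub>F\<^esub> \<Longrightarrow> \<bar>i\<bar> \<le> int j"
    by (auto simp: D_def)
  have eq: "(\<lambda>i. if i \<in> {- int j..int j} then restrict f {- int j..int j} i else \<one>\<^bsub>F\<^esub>) = f"
  proof
    fix i
    show "(if i \<in> {- int j..int j} then restrict f {- int j..int j} i else \<one>\<^bsub>F\<^esub>) = f i"
      using f[of i] by (cases "f i = \<one>\<^bsub>F\<^esub>") (auto simp: abs_le_iff)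
  qed
  show "((\<lambda>i. if i \<in> {- int j..int j} then restrict (fst x) {- int j..int j} i else \<one>\<^bsub>F\<^esub>), 0) = x"
    by (simp only: x fst_conv eq)
next
  fix f assume f: "f \<in> {- int j..int j} \<rightarrow>\<^sub>E carrier F"
  show "restrict (fst ((\<lambda>i. if i \<in> {- int j..int j} then f i else \<one>\<^bsub>F\<^esub>), 0)) {- int j..int j} = f"
    by (rule extensionalityI[of _ "{- int j..int j}"]) (use f in \<open>auto simp: PiE_def\<close>)
qed (auto simp: D_def Conf_closed)

text \<open>A power of \<open>order F\<close>, hence a unit in the coefficient ring; this is the
  purpose of inverting the order.\<close>

lemma card_D: "card (D j) = order F ^ card {- int j..int j}"
  using bij_betw_same_card[OF bij_D[of j]] by (simp add: card_PiE order_def)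

lemma finite_D: "finite (D j)"
  using bij_betw_finite[OF bij_D[of j]] finite_F by (simp add: finite_PiE)

lemma D_subgroup: "subgroup (D j) G"
proof (rule group.subgroupI[OF group_G])
  show "D j \<subseteq> carrier G" "D j \<noteq> {}"
    using Conf_one by (auto simp: D_def carrier_G)
  show "inv\<^bsub>G\<^esub> x \<in> D j" if "x \<in> D j" for x
    using that Conf_inv by (auto simp: D_def inv_G) (metis F.inv_one)
  show "x \<otimes>\<^bsub>G\<^esub> y \<in> D j" if "x \<in> D j" "y \<in> D j" for x y
    using that Conf_mult by (auto simp: D_def mult_G) (metis F.l_one F.one_closed)
qed

lemma tower_G: "tower_group G D t snd"
proof (intro tower_group.intro tower_group_axioms.intro group_G D_subgroup finite_D t_closed)
  show "D j \<subseteq> D (Suc j)" for j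
    by (auto simp: D_def)
  show "inv\<^bsub>G\<^esub> t \<otimes>\<^bsub>G\<^esub> x \<otimes>\<^bsub>G\<^esub> t \<in> D (Suc j)" if x: "x \<in> D j" for x j
  proof -
    obtain f where f: "x = (f, 0)" "f \<in> Conf" "\<And>i. f i \<noteq> \<one>\<^bsub>F\<^esub> \<Longrightarrow> \<bar>i\<bar> \<le> int j"
      using x by (auto simp: D_def)
    have "inv\<^bsub>G\<^esub> t \<otimes>\<^bsub>G\<^esub> x \<otimes>\<^bsub>G\<^esub> t = ((\<lambda>i. f (i + 1)), 0)"
      using f Conf_closed[OF f(2)] by (simp add: t_def inv_G Conf_one mult_G)
    \<comment> \<open>Conjugation by \<open>t\<close> shifts the configuration by one place, so its
      support may leave the interval by one.\<close>
    moreover have "\<bar>i\<bar> \<le> int (Suc j)" if "f (i + 1) \<noteq> \<one>\<^bsub>F\<^esub>" for i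
      using f(3)[OF that] by simp
    ultimately show ?thesis
      using Conf_shift[OF f(2), of 1] by (simp add: D_def)
  qed
  show "snd x = 0 \<longleftrightarrow> (\<exists>j. x \<in> D j)" if x: "x \<in> carrier G" for x
  proof
    assume "snd x = 0"
    then obtain f where f: "x = (f, 0)" "f \<in> Conf"
      using x by (cases x) (auto simp: carrier_G)
    have fin: "finite ((\<lambda>i. nat \<bar>i\<bar>) ` {i. f i \<noteq> \<one>\<^bsub>F\<^esub>})"
      using Conf_finite[OF f(2)] by blast
    have "\<bar>i\<bar> \<le> int (Max (insert 0 ((\<lambda>i. nat \<bar>i\<bar>) ` {i. f i \<noteq> \<one>\<^bsub>F\<^esub>})))" if "f i \<noteq> \<one>\<^bsub>F\<^esub>" for i
    proof -
      have "nat \<bar>i\<bar> \<le> Max (insert 0 ((\<lambda>i. nat \<bar>i\<bar>) ` {i. f i \<noteq> \<one>\<^bsub>F\<^esub>}))"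
        using fin that by (intro Max_ge) auto
      then show ?thesis
        by linarith
    qed
    then show "\<exists>j. x \<in> D j"
      using f by (auto simp: D_def)
  qed (auto simp: D_def)
qed (auto simp: carrier_G mult_G t_def)

lemma order_pos: "0 < order F"
  using finite_F F.order_gt_0_iff_finite by blast

lemma tower_group_ring_G: "tower_group_ring G (order F) D t snd"
proof (intro tower_group_ring.intro tower_group_ring_axioms.intro loc_group_ring.intro loc_group_ring_axioms.intro)
  show "\<exists>m. card (D j) = order F ^ m" for j
    using card_D by blast
qed (simp_all add: group_G order_pos tower_G)

lemma one_ended_group_ring_G: "one_ended_group_ring G (order F)"
  by (intro one_ended_group_ring.intro one_ended_group_ring_axioms.intro loc_group_ring.intro loc_group_ring_axioms.intro
      group_G order_pos infinite_G one_ended_G)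

text \<open>Induction along words: walk to position \<open>i\<close>, set the lamp there by right
  multiplication, walk back to 0, and repeat for the finitely many lit lamps. No inverses of lamps
  are needed.\<close>

lemma right_generated:
  assumes one: "P \<one>\<^bsub>G\<^esub>"
    and t: "\<And>x. \<lbrakk>x \<in> carrier G; P x\<rbrakk> \<Longrightarrow> P (x \<otimes>\<^bsub>G\<^esub> t)"
    and t_inv: "\<And>x. \<lbrakk>x \<in> carrier G; P x\<rbrakk> \<Longrightarrow> P (x \<otimes>\<^bsub>G\<^esub> inv\<^bsub>G\<^esub> t)"
    and lamp: "\<And>x y. \<lbrakk>x \<in> carrier G; y \<in> carrier F; P x\<rbrakk> \<Longrightarrow> P (x \<otimes>\<^bsub>G\<^esub> lamp y)"
    and x: "x \<in> carrier G"
  shows "P x"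
proof -
  have up: "P (f, k + 1)" if "f \<in> Conf" "P (f, k)" for f k
    using t[of "(f, k)"] that Conf_closed[OF that(1)] by (simp add: carrier_G mult_G t_def)
  have down: "P (f, k - 1)" if "f \<in> Conf" "P (f, k)" for f k
    using t_inv[of "(f, k)"] that Conf_closed[OF that(1)] by (simp add: carrier_G mult_G t_def inv_G Conf_one)
  have move: "P (f, k)" if f: "f \<in> Conf" "P (f, 0)" for f k
  proof (induction k rule: int_induct[where k = 0])
    case base
    show ?case by (rule f(2))
  next
    case (step1 i)
    then show ?case using up[OF f(1)] by simp
  next
    case (step2 i)
    then show ?case using down[OF f(1)] by simp
  qed
  have move': "P (f, 0)" if f: "f \<in> Conf" "P (f, k)" for f k
    using f(2)
  proof (induction k rule: int_induct[where k = 0])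
    case (step1 i)
    then show ?case using down[OF f(1), of "i + 1"] by simp
  next
    case (step2 i)
    then show ?case using up[OF f(1), of "i - 1"] by simp
  qed
  obtain f k where x_eq: "x = (f, k)" and f: "f \<in> Conf"
    using x by (auto simp: carrier_G)
  let ?r = "\<lambda>T i. if i \<in> T then f i else \<one>\<^bsub>F\<^esub>"
  have r: "?r T \<in> Conf" if "finite T" for T
  proof -
    have "finite {i. ?r T i \<noteq> \<one>\<^bsub>F\<^esub>}"
      using that by (rule finite_subset[rotated]) auto
    then show ?thesis
      using Conf_closed[OF f] by (simp add: Conf_def)
  qed
  have "P (?r T, 0)" if "finite T" for T
    using that
  proof (induction T rule: finite_induct)
    case empty
    then show ?case
      using one by (simp add: one_G)
  next
    case (insert i T)
    have "P ((?r T, i) \<otimes>\<^bsub>G\<^esub> lamp (f i))"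
      using move[OF r[OF insert.hyps(1)] insert.IH] r[OF insert.hyps(1)] Conf_closed[OF f] by (intro lamp) (auto simp: carrier_G)
    moreover have "(?r T, i) \<otimes>\<^bsub>G\<^esub> lamp (f i) = (?r (insert i T), i)"
      using insert.hyps Conf_closed[OF f] by (auto simp: lamp_def mult_G fun_eq_iff)
    ultimately have "P (?r (insert i T), i)"
      by (simp only:)
    then show ?case
      by (rule move'[rotated]) (use insert.hyps in \<open>intro r, simp\<close>)
  qed
  from this[OF Conf_finite[OF f]] have "P (f, 0)"
  proof -
    assume *: "P (?r {i. f i \<noteq> \<one>\<^bsub>F\<^esub>}, 0)"
    have "?r {i. f i \<noteq> \<one>\<^bsub>F\<^esub>} = f"
      by auto
    then show ?thesis
      using * by (simp only:)
  qed
  then show ?thesis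
    unfolding x_eq by (rule move[OF f])
qed

end

section \<open>Projective modules over the group ring\<close>

context loc_group_ring
begin

lemma mult_zero_right: "a \<in> carrier RG \<Longrightarrow> a \<otimes>\<^bsub>RG\<^esub> 0 = 0"
  using ring.ring_simprules(25)[OF ring_RG, of a] by simp

lemma mult_add_right: "\<lbrakk>a \<in> carrier RG; b \<in> carrier RG; c \<in> carrier RG\<rbrakk> \<Longrightarrow> a \<otimes>\<^bsub>RG\<^esub> (b + c) = a \<otimes>\<^bsub>RG\<^esub> b + a \<otimes>\<^bsub>RG\<^esub> c"
  using ring.ring_simprules(23)[OF ring_RG, of b c a] by simp

lemma mult_add_left: "\<lbrakk>a \<in> carrier RG; b \<in> carrier RG; c \<in> carrier RG\<rbrakk> \<Longrightarrow> (a + b) \<otimes>\<^bsub>RG\<^esub> c = a \<otimes>\<^bsub>RG\<^esub> c + b \<otimes>\<^bsub>RG\<^esub> c"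
  using ring.ring_simprules(13)[OF ring_RG, of a b c] by simp

lemma mult_one_left: "a \<in> carrier RG \<Longrightarrow> \<one>\<^bsub>RG\<^esub> \<otimes>\<^bsub>RG\<^esub> a = a"
  and mult_one_right: "a \<in> carrier RG \<Longrightarrow> a \<otimes>\<^bsub>RG\<^esub> \<one>\<^bsub>RG\<^esub> = a"
  and one_mem: "\<one>\<^bsub>RG\<^esub> \<in> carrier RG"
  using monoid.l_one[of RG a] monoid.r_one[of RG a] monoid.one_closed[of RG] ring.is_monoid[OF ring_RG] by auto

lemma mult_uminus_right: "\<lbrakk>a \<in> carrier RG; b \<in> carrier RG\<rbrakk> \<Longrightarrow> a \<otimes>\<^bsub>RG\<^esub> (- b) = - (a \<otimes>\<^bsub>RG\<^esub> b)"
  using mult_add_right[of a b "- b"] RG_uminus_mem[of b] mult_zero_right[of a] by (simp add: eq_neg_iff_add_eq_0 add.commute)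

lemma mult_diff_right: "\<lbrakk>a \<in> carrier RG; b \<in> carrier RG; c \<in> carrier RG\<rbrakk> \<Longrightarrow> a \<otimes>\<^bsub>RG\<^esub> (b - c) = a \<otimes>\<^bsub>RG\<^esub> b - a \<otimes>\<^bsub>RG\<^esub> c"
  using mult_add_right[of a b "- c"] RG_uminus_mem[of c] mult_uminus_right[of a c] by simp

text \<open>These are the right multiplications by elements of \<open>RG\<close>.\<close>

definition linop :: "(('g \<Rightarrow> rat) \<Rightarrow> 'g \<Rightarrow> rat) \<Rightarrow> bool"
  where "linop T \<longleftrightarrow> (\<forall>a\<in>carrier RG. T a \<in> carrier RG) \<and>
    (\<forall>a\<in>carrier RG. \<forall>b\<in>carrier RG. T (a + b) = T a + T b \<and> T (a \<otimes>\<^bsub>RG\<^esub> b) = a \<otimes>\<^bsub>RG\<^esub> T b)"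

lemma linop_closed: "\<lbrakk>linop T; a \<in> carrier RG\<rbrakk> \<Longrightarrow> T a \<in> carrier RG"
  and linop_add: "\<lbrakk>linop T; a \<in> carrier RG; b \<in> carrier RG\<rbrakk> \<Longrightarrow> T (a + b) = T a + T b"
  and linop_mult: "\<lbrakk>linop T; a \<in> carrier RG; b \<in> carrier RG\<rbrakk> \<Longrightarrow> T (a \<otimes>\<^bsub>RG\<^esub> b) = a \<otimes>\<^bsub>RG\<^esub> T b"
  by (auto simp: linop_def)

lemma linop_zero: "linop T \<Longrightarrow> T 0 = 0"
  using linop_add[of T 0 0] by simp

lemma linop_uminus: "\<lbrakk>linop T; a \<in> carrier RG\<rbrakk> \<Longrightarrow> T (- a) = - T a"
  using linop_add[of T a "- a"] RG_uminus_mem[of a] linop_zero[of T] by (simp add: eq_neg_iff_add_eq_0 add.commute)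

lemma linop_diff: "\<lbrakk>linop T; a \<in> carrier RG; b \<in> carrier RG\<rbrakk> \<Longrightarrow> T (a - b) = T a - T b"
  using linop_add[of T a "- b"] RG_uminus_mem[of b] linop_uminus[of T b] by simp

lemma linop_id: "linop (\<lambda>a. a)"
  by (simp add: linop_def)

text \<open>Right multiplication by \<open>c\<close> times the sum of the inverses of the elements
  of \<open>H\<close>. Both averages and right translations are of this form.\<close>

definition rop :: "rat \<Rightarrow> 'g set \<Rightarrow> ('g \<Rightarrow> rat) \<Rightarrow> 'g \<Rightarrow> rat"
  where "rop c H b = (\<lambda>x. if x \<in> carrier G then c * (\<Sum>h\<in>H. b (x \<otimes> h)) else 0)"

lemma linop_rop:
  assumes H: "finite H" "H \<subseteq> carrier G" and c: "c \<in> loc n"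
  shows "linop (rop c H)"
  unfolding linop_def
proof (intro conjI ballI)
  show mem: "rop c H b \<in> carrier RG" if b: "b \<in> carrier RG" for b
    unfolding RG_iff
  proof (intro conjI ballI allI impI)
    have "{x. rop c H b x \<noteq> 0} \<subseteq> (\<lambda>(y, h). y \<otimes> inv h) ` ({y. b y \<noteq> 0} \<times> H)"
    proof
      fix x assume "x \<in> {x. rop c H b x \<noteq> 0}"
      then have x: "x \<in> carrier G" and "(\<Sum>h\<in>H. b (x \<otimes> h)) \<noteq> 0"
        by (auto simp: rop_def split: if_splits)
      then obtain h where h: "h \<in> H" "b (x \<otimes> h) \<noteq> 0"
        by (meson sum.not_neutral_contains_not_neutral)
      then have "x = x \<otimes> h \<otimes> inv h"
        using x H by (auto simp: m_assoc)
      then show "x \<in> (\<lambda>(y, h). y \<otimes> inv h) ` ({y. b y \<noteq> 0} \<times> H)"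
        using h by (intro image_eqI[of _ _ "(x \<otimes> h, h)"]) auto
    qed
    moreover have "finite ((\<lambda>(y, h). y \<otimes> inv h) ` ({y. b y \<noteq> 0} \<times> H))"
      using H RG_finite[OF b] by blast
    ultimately show "finite {x. rop c H b x \<noteq> 0}"
      by (rule finite_subset)
    show "rop c H b x \<in> loc n" for x
      using c RG_apply[OF b] n_pos by (auto simp: rop_def intro!: loc_mult loc_sum)
  qed (simp add: rop_def)
  fix a b assume a: "a \<in> carrier RG" and b: "b \<in> carrier RG"
  show "rop c H (a + b) = rop c H a + rop c H b"
    by (simp add: rop_def fun_eq_iff sum.distrib distrib_left)
  show "rop c H (a \<otimes>\<^bsub>RG\<^esub> b) = a \<otimes>\<^bsub>RG\<^esub> rop c H b"
  proof (rule RG_eqI)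
    fix x assume x: "x \<in> carrier G"
    let ?A = "{x. a x \<noteq> 0}"
    note A = RG_finite[OF a] RG_supp[OF a]
    have "rop c H (a \<otimes>\<^bsub>RG\<^esub> b) x = c * (\<Sum>h\<in>H. \<Sum>k\<in>?A. a k * b (inv k \<otimes> (x \<otimes> h)))"
      using x H by (auto simp: rop_def intro!: sum.cong mult_eq_sum[OF a b A order_refl])
    also have "\<dots> = (\<Sum>k\<in>?A. a k * (c * (\<Sum>h\<in>H. b (inv k \<otimes> (x \<otimes> h)))))"
      by (subst sum.swap) (simp add: sum_distrib_left mult.left_commute)
    also have "\<dots> = (\<Sum>k\<in>?A. a k * rop c H b (inv k \<otimes> x))"
    proof (rule sum.cong)
      fix k assume "k \<in> ?A"
      then have k: "k \<in> carrier G"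
        using A by blast
      have "(\<Sum>h\<in>H. b (inv k \<otimes> (x \<otimes> h))) = (\<Sum>h\<in>H. b (inv k \<otimes> x \<otimes> h))"
        using k x H by (intro sum.cong) (auto simp: m_assoc)
      then show "a k * (c * (\<Sum>h\<in>H. b (inv k \<otimes> (x \<otimes> h)))) = a k * rop c H b (inv k \<otimes> x)"
        using k x by (simp add: rop_def)
    qed simp
    also have "\<dots> = (a \<otimes>\<^bsub>RG\<^esub> rop c H b) x"
      using mult_eq_sum[OF a mem[OF b] A order_refl x] by simp
    finally show "rop c H (a \<otimes>\<^bsub>RG\<^esub> b) x = (a \<otimes>\<^bsub>RG\<^esub> rop c H b) x" .
  qed (use a b mem mult_mem in auto)
qed

definition rmul :: "'g \<Rightarrow> ('g \<Rightarrow> rat) \<Rightarrow> 'g \<Rightarrow> rat"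
  where "rmul s = rop 1 {inv s}"

lemma linop_rmul: "s \<in> carrier G \<Longrightarrow> linop (rmul s)"
  unfolding rmul_def by (rule linop_rop) auto

lemma rmul_apply: "rmul s b x = (if x \<in> carrier G then b (x \<otimes> inv s) else 0)"
  by (simp add: rmul_def rop_def)

definition aug :: "('g \<Rightarrow> rat) \<Rightarrow> rat"
  where "aug a = (\<Sum>x\<in>{x. a x \<noteq> 0}. a x)"

lemma aug_superset: "\<lbrakk>finite K; {x. a x \<noteq> 0} \<subseteq> K\<rbrakk> \<Longrightarrow> aug a = (\<Sum>x\<in>K. a x)"
  unfolding aug_def by (rule sum.mono_neutral_left) auto

lemma aug_zero [simp]: "aug 0 = 0"
  by (simp add: aug_def)

lemma aug_closed: "a \<in> carrier RG \<Longrightarrow> aug a \<in> loc n"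
  unfolding aug_def using RG_apply n_pos by (intro loc_sum)

lemma aug_add:
  assumes "a \<in> carrier RG" "b \<in> carrier RG"
  shows "aug (a + b) = aug a + aug b"
proof -
  have "finite ({x. a x \<noteq> 0} \<union> {x. b x \<noteq> 0})"
    using assms RG_finite by blast
  then show ?thesis
    using aug_superset[of "{x. a x \<noteq> 0} \<union> {x. b x \<noteq> 0}" a] aug_superset[of "{x. a x \<noteq> 0} \<union> {x. b x \<noteq> 0}" b]
      aug_superset[of "{x. a x \<noteq> 0} \<union> {x. b x \<noteq> 0}" "a + b"]
    by (force simp: sum.distrib)
qed

lemma aug_sum: "(\<And>i. i \<in> I \<Longrightarrow> f i \<in> carrier RG) \<Longrightarrow> aug (sum f I) = (\<Sum>i\<in>I. aug (f i))"
  by (induction I rule: infinite_finite_induct) (auto simp: aug_add RG_sum_mem)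

lemma aug_scale: "aug (\<lambda>x. r * a x) = r * aug a"
  by (cases "r = 0") (simp_all add: aug_def sum_distrib_left)

lemma aug_translate:
  assumes g: "g \<in> carrier G" and a: "a \<in> carrier RG"
  shows "aug (translate g a) = aug a"
proof -
  have "{x. translate g a x \<noteq> 0} = (\<lambda>x. g \<otimes> x) ` {x. a x \<noteq> 0}"
  proof (intro equalityI subsetI)
    fix x assume "x \<in> {x. translate g a x \<noteq> 0}"
    then show "x \<in> (\<lambda>x. g \<otimes> x) ` {x. a x \<noteq> 0}"
      using g by (intro image_eqI[of _ _ "inv g \<otimes> x"]) (auto simp: translate_def m_assoc[symmetric] split: if_splits)
  next
    fix x assume "x \<in> (\<lambda>x. g \<otimes> x) ` {x. a x \<noteq> 0}"
    then show "x \<in> {x. translate g a x \<noteq> 0}"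
      using g RG_supp[OF a] by (auto simp: translate_def m_assoc[symmetric])
  qed
  moreover have "inj_on (\<lambda>x. g \<otimes> x) {x. a x \<noteq> 0}"
  proof (rule inj_onI)
    fix x y assume "x \<in> {x. a x \<noteq> 0}" "y \<in> {x. a x \<noteq> 0}" and eq: "g \<otimes> x = g \<otimes> y"
    then have "x \<in> carrier G" "y \<in> carrier G"
      using RG_supp[OF a] by blast+
    then show "x = y"
      using eq g by simp
  qed
  moreover have "translate g a (g \<otimes> x) = a x" if "a x \<noteq> 0" for x
    using g that RG_supp[OF a] by (auto simp: translate_def m_assoc[symmetric])
  ultimately show ?thesis
    by (simp add: aug_def sum.reindex)
qed

lemma aug_mult:
  assumes "a \<in> carrier RG" "b \<in> carrier RG"
  shows "aug (a \<otimes>\<^bsub>RG\<^esub> b) = aug a * aug b"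
proof -
  have s: "h \<in> carrier G" if "a h \<noteq> 0" for h
    using that RG_supp[OF assms(1)] by blast
  have "aug (a \<otimes>\<^bsub>RG\<^esub> b) = (\<Sum>h\<in>{h. a h \<noteq> 0}. aug (\<lambda>x. a h * translate h b x))"
    unfolding mult_eq_sum_translate[OF assms] using s assms RG_apply[OF assms(1)]
    by (intro aug_sum RG_scale_mem translate_mem) auto
  also have "\<dots> = (\<Sum>h\<in>{h. a h \<noteq> 0}. a h * aug b)"
    using s assms by (simp add: aug_scale aug_translate)
  also have "\<dots> = aug a * aug b"
    by (simp add: aug_def sum_distrib_right)
  finally show ?thesis .
qed

abbreviation Triv :: "('g \<Rightarrow> rat, rat) module" where "Triv \<equiv> trivial_module (int_localization n)"

lemma Triv_simps [simp]:
  "carrier Triv = loc n" "add Triv = (+)" "zero Triv = 0"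
  by (simp_all add: trivial_module_def)

lemma Triv_smult: "a \<in> carrier RG \<Longrightarrow> a \<odot>\<^bsub>Triv\<^esub> r = aug a * r"
  using finsum_R[of a "{g. a g \<noteq> 0}"] RG_apply[of a] by (simp add: trivial_module_def aug_def Pi_iff)

subsection \<open>Summands of free modules cut out by idempotent operators\<close>

lemma finsupp_RG_iff: "u \<in> finsupp RG X \<longleftrightarrow>
    (\<forall>x\<in>X. u x \<in> carrier RG) \<and> (\<forall>x. x \<notin> X \<longrightarrow> u x = 0) \<and> finite {x. u x \<noteq> 0}"
  by (simp add: finsupp_def)

lemma free_RG_simps [simp]:
  "carrier (free_module RG X) = finsupp RG X" "add (free_module RG X) = (+)" "zero (free_module RG X) = 0"
  "smult (free_module RG X) = (\<lambda>a u x. a \<otimes>\<^bsub>RG\<^esub> u x)"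
  by (simp_all add: free_module_def fun_eq_iff)

text \<open>For idempotent operators this is the direct sum of their images, one summand for each
  index. The identity gives the free module on \<open>X\<close>.\<close>

definition fixed_module :: "'x set \<Rightarrow> ('x \<Rightarrow> ('g \<Rightarrow> rat) \<Rightarrow> 'g \<Rightarrow> rat) \<Rightarrow> ('g \<Rightarrow> rat, 'x \<Rightarrow> 'g \<Rightarrow> rat) module"
  where "fixed_module X T = (free_module RG X)\<lparr>carrier := {u \<in> finsupp RG X. \<forall>x\<in>X. T x (u x) = u x}\<rparr>"

lemma fixed_simps [simp]:
  "add (fixed_module X T) = (+)" "zero (fixed_module X T) = 0"
  "smult (fixed_module X T) = (\<lambda>a u x. a \<otimes>\<^bsub>RG\<^esub> u x)"
  by (simp_all add: fixed_module_def)

lemma fixed_iff: "u \<in> carrier (fixed_module X T) \<longleftrightarrow>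
    (\<forall>x\<in>X. u x \<in> carrier RG \<and> T x (u x) = u x) \<and> (\<forall>x. x \<notin> X \<longrightarrow> u x = 0) \<and> finite {x. u x \<noteq> 0}"
  by (auto simp: fixed_module_def finsupp_RG_iff)

lemma fixed_apply: "u \<in> carrier (fixed_module X T) \<Longrightarrow> u x \<in> carrier RG"
  unfolding fixed_iff by (cases "x \<in> X") auto

lemma fixed_add:
  assumes T: "\<And>x. x \<in> X \<Longrightarrow> linop (T x)" and u: "u \<in> carrier (fixed_module X T)" and v: "v \<in> carrier (fixed_module X T)"
  shows "u + v \<in> carrier (fixed_module X T)"
proof -
  have "finite ({x. u x \<noteq> 0} \<union> {x. v x \<noteq> 0})"
    using u v by (simp add: fixed_iff)
  then have "finite {x. (u + v) x \<noteq> 0}"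
    by (rule finite_subset[rotated]) auto
  then show ?thesis
    using u v linop_add[OF T] by (simp add: fixed_iff RG_add_mem)
qed

lemma fixed_uminus:
  assumes T: "\<And>x. x \<in> X \<Longrightarrow> linop (T x)" and u: "u \<in> carrier (fixed_module X T)"
  shows "- u \<in> carrier (fixed_module X T)"
  using u linop_uminus[OF T] by (simp add: fixed_iff RG_uminus_mem)

lemma fixed_smult:
  assumes T: "\<And>x. x \<in> X \<Longrightarrow> linop (T x)" and u: "u \<in> carrier (fixed_module X T)" and a: "a \<in> carrier RG"
  shows "(\<lambda>x. a \<otimes>\<^bsub>RG\<^esub> u x) \<in> carrier (fixed_module X T)"
proof -
  have "finite {x. u x \<noteq> 0}"
    using u by (simp add: fixed_iff)
  then have "finite {x. a \<otimes>\<^bsub>RG\<^esub> u x \<noteq> 0}"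
    by (rule finite_subset[rotated]) (use a mult_zero_right in auto)
  then show ?thesis
    using u a linop_mult[OF T] by (simp add: fixed_iff mult_mem mult_zero_right)
qed

lemma left_module_fixed:
  assumes T: "\<And>x. x \<in> X \<Longrightarrow> linop (T x)"
  shows "left_module RG (fixed_module X T)"
proof (intro left_module.intro left_module_axioms.intro ring_RG)
  show "abelian_group (fixed_module X T)"
  proof (rule abelian_groupI)
    show "\<zero>\<^bsub>fixed_module X T\<^esub> \<in> carrier (fixed_module X T)"
      using linop_zero[OF T] by (simp add: fixed_iff)
    show "\<exists>v\<in>carrier (fixed_module X T). v \<oplus>\<^bsub>fixed_module X T\<^esub> u = \<zero>\<^bsub>fixed_module X T\<^esub>"
      if "u \<in> carrier (fixed_module X T)" for u
      using fixed_uminus[OF T that] by (intro bexI[of _ "- u"]) auto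
    show "u \<oplus>\<^bsub>fixed_module X T\<^esub> v \<in> carrier (fixed_module X T)"
      if "u \<in> carrier (fixed_module X T)" "v \<in> carrier (fixed_module X T)" for u v
      using fixed_add[OF T that] by simp
  qed (auto simp: add_ac)
  show "a \<odot>\<^bsub>fixed_module X T\<^esub> u \<in> carrier (fixed_module X T)"
    if "a \<in> carrier RG" "u \<in> carrier (fixed_module X T)" for a u
    using fixed_smult[OF T that(2,1)] by simp
qed (auto simp: fun_eq_iff fixed_apply mult_assoc_RG mult_one_left,
    auto simp: mult_add_left mult_add_right fixed_apply)

text \<open>\<open>projective\<close> asks for a basis inside the element type of the module. This
  injects the index type into it; the functions serve as names only and need not lie in the
  module.\<close>

definition label :: "'x \<Rightarrow> 'x \<Rightarrow> 'g \<Rightarrow> rat"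
  where "label x = (\<lambda>y. if y = x then (\<lambda>_. 1) else 0)"

lemma label_inj: "label x = label y \<longleftrightarrow> x = y"
proof
  assume "label x = label y"
  then have "label x x undefined = label y x undefined"
    by simp
  then show "x = y"
    by (simp add: label_def split: if_splits)
qed simp

text \<open>The operators themselves retract the free module onto the fixed module; idempotence puts
  their values into it, and linearity makes the retraction a homomorphism.\<close>

lemma projective_fixed:
  assumes T: "\<And>x. x \<in> X \<Longrightarrow> linop (T x)"
    and idem: "\<And>x a. \<lbrakk>x \<in> X; a \<in> carrier RG\<rbrakk> \<Longrightarrow> T x (T x a) = T x a"
  shows "projective RG (fixed_module X T)"
  unfolding projective_def
proof (intro conjI left_module_fixed exI)
  let ?Y = "label ` X" and ?M = "fixed_module X T"
  define i where "i u m = (if m \<in> ?Y then u (inv_into X label m) else 0)" for u :: "'a \<Rightarrow> 'g \<Rightarrow> rat" and m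
  define p where "p w x = (if x \<in> X then T x (w (label x)) else 0)" for w :: "('a \<Rightarrow> 'g \<Rightarrow> rat) \<Rightarrow> 'g \<Rightarrow> rat" and x
  have inj: "inj_on label X"
    by (auto intro!: inj_onI simp: label_inj)
  have i_label: "i u (label x) = u x" if "x \<in> X" for u x
    using that inj by (simp add: i_def)
  show "i \<in> mod_hom RG ?M (free_module RG ?Y)"
    unfolding mod_hom_def
  proof (intro CollectI conjI ballI Pi_I)
    fix u assume u: "u \<in> carrier ?M"
    have "{m. i u m \<noteq> 0} \<subseteq> label ` {x. u x \<noteq> 0}"
    proof
      fix m assume m: "m \<in> {m. i u m \<noteq> 0}"
      then obtain x where "x \<in> X" "m = label x"
        by (auto simp: i_def split: if_splits)
      then show "m \<in> label ` {x. u x \<noteq> 0}"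
        using m i_label by auto
    qed
    then have "finite {m. i u m \<noteq> 0}"
      using u finite_surj unfolding fixed_iff by blast
    moreover have "i u m \<in> carrier RG" for m
      using fixed_apply[OF u] by (simp add: i_def)
    ultimately show "i u \<in> carrier (free_module RG ?Y)"
      by (simp add: finsupp_RG_iff) (simp add: i_def)
    show "i (a \<odot>\<^bsub>?M\<^esub> u) = a \<odot>\<^bsub>free_module RG ?Y\<^esub> i u" if "a \<in> carrier RG" for a
      using that by (auto simp: i_def fun_eq_iff mult_zero_right)
  qed (auto simp: i_def fun_eq_iff)
  show "p \<in> mod_hom RG (free_module RG ?Y) ?M"
    unfolding mod_hom_def
  proof (intro CollectI conjI ballI Pi_I)
    fix w assume w: "w \<in> carrier (free_module RG ?Y)"
    then have wM: "w (label x) \<in> carrier RG" if "x \<in> X" for x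
      using that by (simp add: finsupp_RG_iff)
    have "{x \<in> X. w (label x) \<noteq> 0} \<subseteq> (\<lambda>x. label x) -` {m. w m \<noteq> 0} \<inter> X"
      by auto
    moreover have "finite ((\<lambda>x. label x) -` {m. w m \<noteq> 0} \<inter> X)"
      using w inj by (intro finite_vimage_IntI) (auto simp: finsupp_RG_iff)
    ultimately have "finite {x \<in> X. w (label x) \<noteq> 0}"
      by (rule finite_subset)
    then have "finite {x. p w x \<noteq> 0}"
      by (rule finite_subset[rotated]) (use linop_zero[OF T] in \<open>auto simp: p_def\<close>)
    then show "p w \<in> carrier ?M"
      using wM T idem by (simp add: fixed_iff p_def linop_closed)
    show "p (a \<odot>\<^bsub>free_module RG ?Y\<^esub> w) = a \<odot>\<^bsub>?M\<^esub> p w" if "a \<in> carrier RG" for a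
      using that wM linop_mult[OF T] by (auto simp: p_def fun_eq_iff mult_zero_right)
    fix v assume "v \<in> carrier (free_module RG ?Y)"
    then have vM: "v (label x) \<in> carrier RG" if "x \<in> X" for x
      using that by (simp add: finsupp_RG_iff)
    show "p (w \<oplus>\<^bsub>free_module RG ?Y\<^esub> v) = p w \<oplus>\<^bsub>?M\<^esub> p v"
      using wM vM linop_add[OF T] by (auto simp: p_def fun_eq_iff)
  qed
  show "\<forall>u\<in>carrier ?M. p (i u) = u"
    by (auto simp: p_def i_label fixed_iff fun_eq_iff)
qed (use T in auto)

lemma fin_gen_free:
  assumes X: "finite X"
  shows "fin_gen_module RG (fixed_module X (\<lambda>_ a. a))"
  unfolding fin_gen_module_def
proof (intro exI conjI ballI)
  let ?M = "fixed_module X (\<lambda>_ a. a)"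
  define e where "e x = (\<lambda>y. if y = x then \<one>\<^bsub>RG\<^esub> else 0)" for x :: 'a
  have e: "e x \<in> carrier ?M" if "x \<in> X" for x
  proof -
    have "finite {y. e x y \<noteq> 0}"
      by (rule finite_subset[of _ "{x}"]) (auto simp: e_def)
    then show ?thesis
      using that one_mem by (auto simp: fixed_iff e_def)
  qed
  have one: "\<one>\<^bsub>RG\<^esub> \<noteq> (0 :: 'g \<Rightarrow> rat)"
  proof
    assume "\<one>\<^bsub>RG\<^esub> = (0 :: 'g \<Rightarrow> rat)"
    then have "\<one>\<^bsub>RG\<^esub> \<one> = (0 :: 'g \<Rightarrow> rat) \<one>"
      by simp
    then show False
      by (simp add: one_RG basis_elem_R)
  qed
  have inj: "inj_on e X"
    using one by (auto intro!: inj_onI simp: e_def fun_eq_iff split: if_splits)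
  show "e ` X \<subseteq> carrier ?M" "finite (e ` X)"
    using e X by auto
  fix u assume u: "u \<in> carrier ?M"
  interpret M: left_module RG ?M
    by (rule left_module_fixed[OF linop_id])
  define a where "a s = u (inv_into X e s)" for s
  have "finsum ?M (\<lambda>s. a s \<odot>\<^bsub>?M\<^esub> s) (e ` X) = (\<Sum>s\<in>e ` X. a s \<odot>\<^bsub>?M\<^esub> s)"
  proof (rule finsum_eq_sum)
    show "(\<lambda>s. a s \<odot>\<^bsub>?M\<^esub> s) \<in> e ` X \<rightarrow> carrier ?M"
      using e fixed_apply[OF u] M.left_smult_closed by (auto simp: a_def simp del: fixed_simps)
  qed (simp_all add: M.M.abelian_monoid_axioms)
  also have "\<dots> = (\<Sum>x\<in>X. (\<lambda>y. u x \<otimes>\<^bsub>RG\<^esub> e x y))"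
    using inj by (simp add: sum.reindex a_def)
  also have "\<dots> = u"
  proof
    fix y
    have "(\<Sum>x\<in>X. u x \<otimes>\<^bsub>RG\<^esub> e x y) = (\<Sum>x\<in>X. if x = y then u x else 0)"
      using fixed_apply[OF u] by (intro sum.cong) (auto simp: e_def mult_zero_right mult_one_right)
    also have "\<dots> = u y"
      using X u by (auto simp: fixed_iff)
    finally show "(\<Sum>x\<in>X. (\<lambda>y. u x \<otimes>\<^bsub>RG\<^esub> e x y)) y = u y"
      by (simp add: sum_apply)
  qed
  finally have "u = finsum ?M (\<lambda>s. a s \<odot>\<^bsub>?M\<^esub> s) (e ` X)"
    by simp
  moreover have "a \<in> e ` X \<rightarrow> carrier RG"
    using fixed_apply[OF u] by (simp add: a_def)
  ultimately show "\<exists>a\<in>e ` X \<rightarrow> carrier RG. u = finsum ?M (\<lambda>s. a s \<odot>\<^bsub>?M\<^esub> s) (e ` X)"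
    by blast
qed

lemma mult_sum_right:
  assumes a: "a \<in> carrier RG" and f: "\<And>i. i \<in> I \<Longrightarrow> f i \<in> carrier RG"
  shows "a \<otimes>\<^bsub>RG\<^esub> sum f I = (\<Sum>i\<in>I. a \<otimes>\<^bsub>RG\<^esub> f i)"
  using f
proof (induction I rule: infinite_finite_induct)
  case (insert i I)
  have "a \<otimes>\<^bsub>RG\<^esub> (f i + sum f I) = a \<otimes>\<^bsub>RG\<^esub> f i + a \<otimes>\<^bsub>RG\<^esub> sum f I"
    using a insert.prems by (intro mult_add_right RG_sum_mem) auto
  moreover have "a \<otimes>\<^bsub>RG\<^esub> sum f I = (\<Sum>i\<in>I. a \<otimes>\<^bsub>RG\<^esub> f i)"
    using insert by blast
  ultimately show ?case
    unfolding sum.insert[OF insert.hyps] by (simp only:)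
qed (simp_all add: a mult_zero_right)

lemma aug_hom:
  assumes "x \<in> X" "T x = (\<lambda>a. a)"
  shows "(\<lambda>u. aug (u x)) \<in> mod_hom RG (fixed_module X T) Triv"
  using fixed_apply[of _ X T]
  by (auto simp: mod_hom_def aug_closed aug_add aug_mult Triv_smult)

section \<open>Finite generation implies type FP in degree one\<close>

definition diff_map :: "'g set \<Rightarrow> ('g list \<Rightarrow> 'g \<Rightarrow> rat) \<Rightarrow> 'g list \<Rightarrow> 'g \<Rightarrow> rat"
  where "diff_map S u = (\<lambda>xs. if xs = [] then \<Sum>s\<in>S. rmul s (u [s]) - u [s] else 0)"

text \<open>The left ideal generated by the elements \<open>s - 1\<close>, in the form in which it
  arises as the image of \<open>diff_map\<close>.\<close>

definition aug_span :: "'g set \<Rightarrow> ('g \<Rightarrow> rat) set"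
  where "aug_span S = {\<Sum>s\<in>S. rmul s (u s) - u s | u. \<forall>s\<in>S. u s \<in> carrier RG}"

lemma aug_span_mem: "S \<subseteq> carrier G \<Longrightarrow> a \<in> aug_span S \<Longrightarrow> a \<in> carrier RG"
  by (auto simp: aug_span_def intro!: RG_sum_mem RG_diff_mem linop_closed[OF linop_rmul])

lemma aug_span_diff:
  assumes "S \<subseteq> carrier G" "a \<in> aug_span S" "b \<in> aug_span S"
  shows "a - b \<in> aug_span S"
proof -
  obtain u v where uv: "\<forall>s\<in>S. u s \<in> carrier RG" "\<forall>s\<in>S. v s \<in> carrier RG"
    and ab: "a = (\<Sum>s\<in>S. rmul s (u s) - u s)" "b = (\<Sum>s\<in>S. rmul s (v s) - v s)"
    using assms(2,3) by (auto simp: aug_span_def)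
  have "a - b = (\<Sum>s\<in>S. rmul s (u s - v s) - (u s - v s))"
    unfolding ab sum_subtractf[symmetric]
    using assms(1) uv by (intro sum.cong refl) (simp add: linop_diff[OF linop_rmul] subsetD)
  then show ?thesis
    using uv by (auto simp: aug_span_def intro!: exI[of _ "\<lambda>s. u s - v s"] RG_diff_mem)
qed

lemma aug_span_zero: "0 \<in> aug_span S"
proof -
  have "rmul s 0 = 0" for s
    by (simp add: rmul_apply fun_eq_iff)
  then show ?thesis
    unfolding aug_span_def by (auto intro!: exI[of _ "\<lambda>_. 0"])
qed

lemma aug_span_add: "\<lbrakk>S \<subseteq> carrier G; a \<in> aug_span S; b \<in> aug_span S\<rbrakk> \<Longrightarrow> a + b \<in> aug_span S"
  using aug_span_diff[of S a "0 - b"] aug_span_diff[of S 0 b] aug_span_zero[of S] by simp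

lemma aug_span_sum:
  "\<lbrakk>S \<subseteq> carrier G; \<And>i. i \<in> I \<Longrightarrow> f i \<in> aug_span S\<rbrakk> \<Longrightarrow> sum f I \<in> aug_span S"
  by (induction I rule: infinite_finite_induct) (auto simp: aug_span_zero aug_span_add)

lemma aug_span_gen:
  assumes "finite S" "S \<subseteq> carrier G" "s \<in> S" "a \<in> carrier RG"
  shows "rmul s a - a \<in> aug_span S"
proof -
  have z: "rmul s' 0 = 0" for s'
    by (simp add: rmul_apply fun_eq_iff)
  have "(\<Sum>s'\<in>S. rmul s' (if s' = s then a else 0) - (if s' = s then a else 0)) =
      (\<Sum>s'\<in>S. if s' = s then rmul s a - a else 0)"
    by (intro sum.cong) (auto simp: z)
  also have "\<dots> = rmul s a - a"
    using assms by simp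
  finally show ?thesis
    unfolding aug_span_def using assms by (auto intro!: exI[of _ "\<lambda>s'. if s' = s then a else 0"])
qed

lemma aug_span_scale:
  assumes "S \<subseteq> carrier G" "r \<in> loc n" "a \<in> aug_span S"
  shows "(\<lambda>x. r * a x) \<in> aug_span S"
proof -
  obtain u where u: "\<forall>s\<in>S. u s \<in> carrier RG" "a = (\<Sum>s\<in>S. rmul s (u s) - u s)"
    using assms(3) by (auto simp: aug_span_def)
  have "(\<lambda>x. r * a x) = (\<Sum>s\<in>S. rmul s (\<lambda>x. r * u s x) - (\<lambda>x. r * u s x))"
    by (auto simp: u(2) fun_eq_iff sum_apply sum_distrib_left right_diff_distrib rmul_apply intro!: sum.cong)
  then show ?thesis
    using u(1) assms(2) by (auto simp: aug_span_def intro!: exI[of _ "\<lambda>s x. r * u s x"] RG_scale_mem)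
qed

lemma aug_rmul:
  assumes s: "s \<in> carrier G" and a: "a \<in> carrier RG"
  shows "aug (rmul s a) = aug a"
proof -
  have "rmul s a = rmul s (a \<otimes>\<^bsub>RG\<^esub> \<one>\<^bsub>RG\<^esub>)"
    using a by (simp add: mult_one_right)
  also have "\<dots> = a \<otimes>\<^bsub>RG\<^esub> rmul s \<one>\<^bsub>RG\<^esub>"
    using a s by (intro linop_mult linop_rmul one_mem)
  finally have "aug (rmul s a) = aug a * aug (rmul s \<one>\<^bsub>RG\<^esub>)"
    using a s by (simp add: aug_mult linop_closed[OF linop_rmul] one_mem)
  moreover have "rmul s \<one>\<^bsub>RG\<^esub> = (\<lambda>x. if x = s then 1 else 0)"
  proof
    fix x
    show "rmul s \<one>\<^bsub>RG\<^esub> x = (if x = s then 1 else 0)"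
      using s inv_equality[of "inv s" x] by (auto simp: rmul_apply one_RG basis_elem_R)
        (metis inv_closed inv_equality inv_inv)
  qed
  moreover have "aug (\<lambda>x. if x = s then 1 else 0) = 1"
    using aug_superset[of "{s}" "\<lambda>x. if x = s then 1 else 0"] by auto
  ultimately show ?thesis
    by simp
qed

text \<open>For a generating set \<open>S\<close>, here encoded as an induction principle, the
  augmentation ideal is generated by the \<open>s - 1\<close>: the differences \<open>x - 1\<close>
  are reached by induction along words and span it over the base ring.\<close>

lemma type_FP_1:
  assumes S: "finite S" "S \<subseteq> carrier G"
    and gen: "\<And>P x. \<lbrakk>P \<one>; \<And>x s. \<lbrakk>x \<in> carrier G; s \<in> S; P x\<rbrakk> \<Longrightarrow> P (x \<otimes> s);
      \<And>x s. \<lbrakk>x \<in> carrier G; s \<in> S; P x\<rbrakk> \<Longrightarrow> P (x \<otimes> inv s); x \<in> carrier G\<rbrakk> \<Longrightarrow> P x"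
  shows "type_FP R G 1"
proof -
  \<comment> \<open>The basis elements are indexed by the empty list and by one-element lists, to
    fit the module type fixed in \<open>type_FP\<close>.\<close>
  define X0 :: "'g list set" where "X0 = {[]}"
  define X1 where "X1 = (\<lambda>s. [s]) ` S"
  define P0 where "P0 = fixed_module X0 (\<lambda>_ a. a)"
  define P1 where "P1 = fixed_module X1 (\<lambda>_ a. a)"
  have X1: "[s] \<in> X1 \<longleftrightarrow> s \<in> S" for s
    by (auto simp: X1_def)
  have P0_iff: "u \<in> carrier P0 \<longleftrightarrow> u [] \<in> carrier RG \<and> (\<forall>xs. xs \<noteq> [] \<longrightarrow> u xs = 0)" for u
  proof -
    have "finite {xs. u xs \<noteq> 0}" if "\<forall>xs. xs \<noteq> [] \<longrightarrow> u xs = 0"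
      by (rule finite_subset[of _ "{[]}"]) (use that in auto)
    then show ?thesis
      by (auto simp: P0_def X0_def fixed_iff)
  qed
  have P1_apply: "u [s] \<in> carrier RG" if "u \<in> carrier P1" for u s
    using that fixed_apply by (simp add: P1_def)
  have d_mem: "diff_map S u \<in> carrier P0" and d_span: "diff_map S u [] \<in> aug_span S" if "u \<in> carrier P1" for u
  proof -
    show "diff_map S u [] \<in> aug_span S"
      using P1_apply[OF that] by (auto simp: diff_map_def aug_span_def intro!: exI[of _ "\<lambda>s. u [s]"])
    then show "diff_map S u \<in> carrier P0"
      using aug_span_mem[OF S(2)] by (simp add: P0_iff diff_map_def)
  qed
  have aug_d: "aug a = 0" if a: "a \<in> aug_span S" for a
  proof -
    obtain u where u: "\<forall>s\<in>S. u s \<in> carrier RG" "a = (\<Sum>s\<in>S. rmul s (u s) - u s)"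
      using a by (auto simp: aug_span_def)
    have "aug (rmul s (u s) - u s) = 0" if s: "s \<in> S" for s
    proof -
      have m: "u s \<in> carrier RG" "rmul s (u s) \<in> carrier RG"
        using u s S linop_closed[OF linop_rmul] by auto
      have "aug (rmul s (u s)) = aug (rmul s (u s) - u s) + aug (u s)"
        using aug_add[OF RG_diff_mem[OF m(2,1)] m(1)] by simp
      then show ?thesis
        using aug_rmul[of s "u s"] s S m by auto
    qed
    moreover have "aug a = (\<Sum>s\<in>S. aug (rmul s (u s) - u s))"
      unfolding u(2) using u(1) S by (intro aug_sum RG_diff_mem linop_closed[OF linop_rmul]) auto
    ultimately show ?thesis
      by simp
  qed
  have basis: "basis_elem R x - basis_elem R \<one> \<in> aug_span S" if x: "x \<in> carrier G" for x
  proof (rule gen[of "\<lambda>x. basis_elem R x - basis_elem R \<one> \<in> aug_span S", OF _ _ _ x])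
    have rm: "rmul s (basis_elem R y) = basis_elem R (y \<otimes> s)" if "y \<in> carrier G" "s \<in> carrier G" for y s
    proof
      fix z
      have "z \<otimes> inv s = y \<longleftrightarrow> z = y \<otimes> s" if "z \<in> carrier G"
        using that \<open>y \<in> carrier G\<close> \<open>s \<in> carrier G\<close> by (auto simp: m_assoc)
      then show "rmul s (basis_elem R y) z = basis_elem R (y \<otimes> s) z"
        using that by (auto simp: rmul_apply basis_elem_R)
    qed
    show "basis_elem R (y \<otimes> s) - basis_elem R \<one> \<in> aug_span S"
      if "y \<in> carrier G" "s \<in> S" "basis_elem R y - basis_elem R \<one> \<in> aug_span S" for y s
      using aug_span_add[OF S(2) aug_span_gen[OF S that(2) basis_elem_mem[OF that(1)]] that(3)] rm[of y s] that S
      by auto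
    show "basis_elem R (y \<otimes> inv s) - basis_elem R \<one> \<in> aug_span S"
      if "y \<in> carrier G" "s \<in> S" "basis_elem R y - basis_elem R \<one> \<in> aug_span S" for y s
    proof -
      have s: "s \<in> carrier G"
        using that S by auto
      have "rmul s (basis_elem R (y \<otimes> inv s)) - basis_elem R (y \<otimes> inv s) \<in> aug_span S"
        using that s by (intro aug_span_gen[OF S] basis_elem_mem) auto
      then have "basis_elem R y - basis_elem R (y \<otimes> inv s) \<in> aug_span S"
        using rm[of "y \<otimes> inv s" s] that(1) s by (simp add: m_assoc)
      then show ?thesis
        using aug_span_diff[OF S(2) that(3)] by fastforce
    qed
  qed (simp add: aug_span_zero)
  have in_span: "a \<in> aug_span S" if a: "a \<in> carrier RG" "aug a = 0" for a
  proof -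
    \<comment> \<open>The terms with the unit add up to \<open>aug a\<close> times the unit, which
      is zero.\<close>
    have "a = (\<Sum>x\<in>{x. a x \<noteq> 0}. (\<lambda>z. a x * (basis_elem R x - basis_elem R \<one>) z))"
    proof
      fix z
      have "(\<Sum>x\<in>{x. a x \<noteq> 0}. a x * (basis_elem R x - basis_elem R \<one>) z) =
          (\<Sum>x\<in>{x. a x \<noteq> 0}. if x = z then a z else 0) - aug a * basis_elem R \<one> z"
        unfolding aug_def sum_distrib_right sum_subtractf[symmetric]
        by (intro sum.cong) (auto simp: basis_elem_R)
      also have "\<dots> = a z"
        using a RG_finite[OF a(1)] by simp
      finally show "a z = (\<Sum>x\<in>{x. a x \<noteq> 0}. (\<lambda>z. a x * (basis_elem R x - basis_elem R \<one>) z)) z"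
        by (simp add: sum_apply)
    qed
    also have "\<dots> \<in> aug_span S"
    proof (rule aug_span_sum[OF S(2)])
      fix x assume "x \<in> {x. a x \<noteq> 0}"
      then show "(\<lambda>z. a x * (basis_elem R x - basis_elem R \<one>) z) \<in> aug_span S"
        using RG_supp[OF a(1)] RG_apply[OF a(1)] by (intro aug_span_scale[OF S(2)] basis) auto
    qed
    finally show ?thesis .
  qed
  define P where "P i = (if i = 0 then P0 else P1)" for i :: nat
  show ?thesis
    unfolding type_FP_def
  proof (intro exI conjI)
    show "\<forall>i\<le>1. fin_gen_module RG (P i)"
      using S by (auto simp: P_def P0_def P1_def X0_def X1_def intro!: fin_gen_free)
    show "partial_proj_resolution RG Triv 1 P (\<lambda>_. diff_map S) (\<lambda>u. aug (u []))"
      unfolding partial_proj_resolution_def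
    proof (intro conjI allI impI)
      show "projective RG (P i)" for i
        by (auto simp: P_def P0_def P1_def intro!: projective_fixed linop_id)
      show "(\<lambda>u. aug (u [])) \<in> mod_hom RG (P 0) Triv"
        using aug_hom[of "[]" X0 "\<lambda>_ a. a"] by (simp add: P_def P0_def X0_def)
      show "(\<lambda>u. aug (u [])) ` carrier (P 0) = carrier Triv"
      proof (intro equalityI subsetI)
        fix r assume "r \<in> carrier Triv"
        then have r: "r \<in> loc n"
          by simp
        let ?a = "\<lambda>x. r * basis_elem R \<one> x"
        have "aug ?a = r"
          using aug_superset[of "{\<one>}" "basis_elem R \<one>"] by (subst aug_scale) (auto simp: basis_elem_R)
        moreover have "?a \<in> carrier RG"
          using r by (intro RG_scale_mem basis_elem_mem) auto
        ultimately show "r \<in> (\<lambda>u. aug (u [])) ` carrier (P 0)"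
          by (intro image_eqI[of _ _ "\<lambda>xs. if xs = [] then ?a else 0"]) (auto simp: P_def P0_iff)
      qed (auto simp: P_def P0_iff aug_closed)
      show "diff_map S \<in> mod_hom RG (P (Suc i)) (P i)" if "i < 1" for i
        unfolding mod_hom_def
      proof (intro CollectI conjI ballI Pi_I)
        fix u assume "u \<in> carrier (P (Suc i))"
        then have u: "u \<in> carrier P1"
          by (simp add: P_def)
        then show "diff_map S u \<in> carrier (P i)"
          using d_mem that by (simp add: P_def)
        show "diff_map S (a \<odot>\<^bsub>P (Suc i)\<^esub> u) = a \<odot>\<^bsub>P i\<^esub> diff_map S u" if a: "a \<in> carrier RG" for a
        proof -
          have "(\<Sum>s\<in>S. rmul s (a \<otimes>\<^bsub>RG\<^esub> u [s]) - a \<otimes>\<^bsub>RG\<^esub> u [s]) = (\<Sum>s\<in>S. a \<otimes>\<^bsub>RG\<^esub> (rmul s (u [s]) - u [s]))"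
            using a P1_apply[OF u] S
            by (intro sum.cong) (auto simp: linop_mult[OF linop_rmul] mult_diff_right linop_closed[OF linop_rmul] subsetD)
          also have "\<dots> = a \<otimes>\<^bsub>RG\<^esub> (\<Sum>s\<in>S. rmul s (u [s]) - u [s])"
            using a P1_apply[OF u] S
            by (intro mult_sum_right[symmetric] RG_diff_mem linop_closed[OF linop_rmul]) auto
          finally show ?thesis
            using \<open>i < 1\<close> a by (auto simp: P_def P0_def P1_def diff_map_def mult_zero_right fun_eq_iff)
        qed
        fix v assume "v \<in> carrier (P (Suc i))"
        then have v: "v \<in> carrier P1"
          by (simp add: P_def)
        have "(\<Sum>s\<in>S. rmul s (u [s] + v [s]) - (u [s] + v [s])) =
            (\<Sum>s\<in>S. rmul s (u [s]) - u [s]) + (\<Sum>s\<in>S. rmul s (v [s]) - v [s])"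
          unfolding sum.distrib[symmetric] using P1_apply[OF u] P1_apply[OF v] S
          by (intro sum.cong) (auto simp: linop_add[OF linop_rmul] subsetD)
        then show "diff_map S (u \<oplus>\<^bsub>P (Suc i)\<^esub> v) = diff_map S u \<oplus>\<^bsub>P i\<^esub> diff_map S v"
          using \<open>i < 1\<close> by (auto simp: P_def P0_def P1_def diff_map_def fun_eq_iff)
      qed
      show "diff_map S ` carrier (P 1) = a_kernel (P 0) Triv (\<lambda>u. aug (u []))"
      proof (intro equalityI subsetI)
        fix w assume "w \<in> diff_map S ` carrier (P 1)"
        then show "w \<in> a_kernel (P 0) Triv (\<lambda>u. aug (u []))"
          using d_mem aug_d[OF d_span] by (auto simp: a_kernel_def' P_def)
      next
        fix w assume "w \<in> a_kernel (P 0) Triv (\<lambda>u. aug (u []))"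
        then have w: "w \<in> carrier P0" "aug (w []) = 0"
          by (auto simp: a_kernel_def' P_def)
        then have "w [] \<in> aug_span S"
          using in_span by (simp add: P0_iff)
        then obtain u where u: "\<forall>s\<in>S. u s \<in> carrier RG" "w [] = (\<Sum>s\<in>S. rmul s (u s) - u s)"
          by (auto simp: aug_span_def)
        define v where "v xs = (if xs \<in> X1 then u (hd xs) else 0)" for xs
        have "finite {xs. v xs \<noteq> 0}"
          by (rule finite_subset[of _ X1]) (use S in \<open>auto simp: v_def X1_def\<close>)
        then have "v \<in> carrier P1"
          using u(1) by (auto simp: P1_def fixed_iff v_def X1_def)
        moreover have "w = diff_map S v"
          using w(1) u(2) by (auto simp: diff_map_def fun_eq_iff P0_iff v_def X1)
        ultimately show "w \<in> diff_map S ` carrier (P 1)"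
          by (auto simp: P_def)
      qed
    qed simp
  qed
qed

end

section \<open>A projective resolution of length two\<close>

context tower_group_ring
begin

lemma avg_rop: "avg j = rop (1 / of_nat (card (D j))) (D j)"
  by (simp add: fun_eq_iff avg_def rop_def)

lemma linop_avg: "linop (avg j)"
  unfolding avg_rop using inverse_card_loc D_closed by (intro linop_rop D_finite) auto

text \<open>Right multiplication by an element of \<open>H\<close> only permutes the sum over
  \<open>D j\<close>, so a preceding average over any nonempty \<open>H\<close> inside
  \<open>D j\<close> has no effect. Used for a smaller \<open>D i\<close> and for a conjugate of
  \<open>D i\<close> by \<open>t\<close>.\<close>

lemma avg_absorb:
  assumes H: "finite H" "H \<subseteq> D j" "H \<noteq> {}"
  shows "avg j (rop (1 / of_nat (card H)) H a) = avg j a"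
proof
  fix x
  show "avg j (rop (1 / of_nat (card H)) H a) x = avg j a x"
  proof (cases "x \<in> carrier G")
    case True
    have k: "(\<Sum>h\<in>D j. a (x \<otimes> h \<otimes> k)) = (\<Sum>h\<in>D j. a (x \<otimes> h))" if "k \<in> H" for k
    proof -
      have kD: "k \<in> D j" "k \<in> carrier G"
        using that H D_closed by auto
      have "bij_betw (\<lambda>h. h \<otimes> k) (D j) (D j)"
        by (rule bij_betwI[of _ _ _ "\<lambda>h. h \<otimes> inv k"])
          (use kD D_closed in \<open>auto simp: m_assoc intro: subgroup.m_closed[OF D_subgroup] subgroup.m_inv_closed[OF D_subgroup]\<close>)
      then have "(\<Sum>h\<in>D j. a (x \<otimes> (h \<otimes> k))) = (\<Sum>h\<in>D j. a (x \<otimes> h))"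
        by (rule sum.reindex_bij_betw)
      then show ?thesis
        using True kD D_closed by (simp add: m_assoc cong: sum.cong)
    qed
    have "(\<Sum>h\<in>D j. rop (1 / of_nat (card H)) H a (x \<otimes> h)) =
        1 / of_nat (card H) * (\<Sum>k\<in>H. \<Sum>h\<in>D j. a (x \<otimes> h \<otimes> k))"
      using True D_closed by (subst sum.swap) (simp add: rop_def sum_distrib_left cong: sum.cong)
    also have "\<dots> = (\<Sum>h\<in>D j. a (x \<otimes> h))"
      using k H by (simp add: card_eq_0_iff)
    finally show ?thesis
      using True by (simp add: avg_def)
  qed (simp add: avg_def)
qed

lemma D_nonempty: "D j \<noteq> {}"
  using subgroup.one_closed[OF D_subgroup, of j] by auto

lemma avg_avg: "i \<le> j \<Longrightarrow> avg j (avg i a) = avg j a"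
  unfolding avg_rop[of i] using D_finite D_mono D_nonempty by (intro avg_absorb) auto

text \<open>Right multiplication by \<open>t\<close> turns the average over \<open>D j\<close> into
  the average over its conjugate, which lies in \<open>D (Suc j)\<close> and is absorbed there. This
  makes \<open>alpha\<close> and \<open>beta\<close> commute.\<close>

lemma avg_rmul_t_avg: "avg (Suc j) (rmul t (avg j a)) = avg (Suc j) (rmul t a)"
proof -
  let ?c = "\<lambda>h. inv t \<otimes> h \<otimes> t"
  let ?H = "?c ` D j"
  have inj: "inj_on ?c (D j)"
  proof (rule inj_onI)
    fix h k assume hk: "h \<in> D j" "k \<in> D j" and eq: "?c h = ?c k"
    have "h = t \<otimes> ?c h \<otimes> inv t" "k = t \<otimes> ?c k \<otimes> inv t"
      using hk D_closed by (simp_all add: m_assoc inv_solve_left[symmetric])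
    then show "h = k"
      using eq by metis
  qed
  have "rmul t (avg j a) = rop (1 / of_nat (card ?H)) ?H (rmul t a)"
  proof
    fix x
    show "rmul t (avg j a) x = rop (1 / of_nat (card ?H)) ?H (rmul t a) x"
    proof (cases "x \<in> carrier G")
      case True
      have "(\<Sum>h\<in>?H. rmul t a (x \<otimes> h)) = (\<Sum>h\<in>D j. rmul t a (x \<otimes> ?c h))"
        using inj by (simp add: sum.reindex)
      also have "\<dots> = (\<Sum>h\<in>D j. a (x \<otimes> inv t \<otimes> h))"
        using True D_closed by (intro sum.cong) (auto simp: rmul_apply m_assoc)
      finally show ?thesis
        using True card_image[OF inj] by (simp add: rop_def rmul_apply avg_def)
    qed (simp add: rop_def rmul_apply)
  qed
  then show ?thesis
    using D_conj D_finite D_nonempty by (simp only:) (intro avg_absorb, auto)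
qed

subsection \<open>Sums over the cosets of the base group\<close>

text \<open>The image of \<open>a\<close> under the map to chains on the cosets of the base group,
  which are indexed by the height.\<close>

definition hsum :: "('g \<Rightarrow> rat) \<Rightarrow> int \<Rightarrow> rat"
  where "hsum a i = (\<Sum>x\<in>{x. a x \<noteq> 0}. if ht x = i then a x else 0)"

lemma hsum_superset:
  "\<lbrakk>finite K; {x. a x \<noteq> 0} \<subseteq> K\<rbrakk> \<Longrightarrow> hsum a i = (\<Sum>x\<in>K. if ht x = i then a x else 0)"
  unfolding hsum_def by (rule sum.mono_neutral_left) auto

lemma hsum_zero [simp]: "hsum 0 i = 0"
  by (simp add: hsum_def)

lemma hsum_add:
  assumes "a \<in> carrier RG" "b \<in> carrier RG"
  shows "hsum (a + b) i = hsum a i + hsum b i"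
proof -
  let ?K = "{x. a x \<noteq> 0} \<union> {x. b x \<noteq> 0}"
  have K: "finite ?K"
    using assms RG_finite by blast
  have "hsum (a + b) i = (\<Sum>x\<in>?K. if ht x = i then (a + b) x else 0)"
    by (rule hsum_superset[OF K]) auto
  also have "\<dots> = (\<Sum>x\<in>?K. (if ht x = i then a x else 0) + (if ht x = i then b x else 0))"
    by (rule sum.cong) auto
  also have "\<dots> = hsum a i + hsum b i"
    using hsum_superset[OF K, of a i] hsum_superset[OF K, of b i] by (simp add: sum.distrib)
  finally show ?thesis .
qed

lemma hsum_scale: "hsum (\<lambda>x. r * a x) i = r * hsum a i"
proof (cases "r = 0")
  case False
  have "(\<Sum>x\<in>{x. a x \<noteq> 0}. if ht x = i then r * a x else 0) = (\<Sum>x\<in>{x. a x \<noteq> 0}. r * (if ht x = i then a x else 0))"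
    by (rule sum.cong) auto
  then show ?thesis
    using False by (simp add: hsum_def sum_distrib_left)
qed (simp add: hsum_def)

lemma hsum_sum: "(\<And>k. k \<in> I \<Longrightarrow> f k \<in> carrier RG) \<Longrightarrow> hsum (sum f I) i = (\<Sum>k\<in>I. hsum (f k) i)"
  by (induction I rule: infinite_finite_induct) (auto simp: hsum_add RG_sum_mem)

lemma hsum_closed: "a \<in> carrier RG \<Longrightarrow> hsum a i \<in> loc n"
  unfolding hsum_def using RG_apply n_pos by (intro loc_sum) auto

lemma hsum_rmul:
  assumes s: "s \<in> carrier G" and a: "a \<in> carrier RG"
  shows "hsum (rmul s a) i = hsum a (i - ht s)"
proof -
  have supp: "{x. rmul s a x \<noteq> 0} = (\<lambda>x. x \<otimes> s) ` {x. a x \<noteq> 0}"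
  proof (intro equalityI subsetI)
    fix x assume "x \<in> {x. rmul s a x \<noteq> 0}"
    then show "x \<in> (\<lambda>x. x \<otimes> s) ` {x. a x \<noteq> 0}"
      using s by (intro image_eqI[of _ _ "x \<otimes> inv s"]) (auto simp: rmul_apply m_assoc split: if_splits)
  next
    fix x assume "x \<in> (\<lambda>x. x \<otimes> s) ` {x. a x \<noteq> 0}"
    then obtain y where y: "a y \<noteq> 0" "x = y \<otimes> s"
      by blast
    then have "y \<in> carrier G"
      using RG_supp[OF a] by blast
    then show "x \<in> {x. rmul s a x \<noteq> 0}"
      using y s by (simp add: rmul_apply m_assoc)
  qed
  have inj: "inj_on (\<lambda>x. x \<otimes> s) {x. a x \<noteq> 0}"
  proof (rule inj_onI)
    fix x y assume "x \<in> {x. a x \<noteq> 0}" "y \<in> {x. a x \<noteq> 0}" and eq: "x \<otimes> s = y \<otimes> s"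
    then have "x \<in> carrier G" "y \<in> carrier G"
      using RG_supp[OF a] by blast+
    then show "x = y"
      using eq s by simp
  qed
  have "hsum (rmul s a) i = (\<Sum>x\<in>{x. a x \<noteq> 0}. if ht (x \<otimes> s) = i then rmul s a (x \<otimes> s) else 0)"
    unfolding hsum_def supp using inj by (simp add: sum.reindex)
  also have "\<dots> = hsum a (i - ht s)"
    unfolding hsum_def
  proof (rule sum.cong)
    fix x assume "x \<in> {x. a x \<noteq> 0}"
    then have x: "x \<in> carrier G"
      using RG_supp[OF a] by blast
    then show "(if ht (x \<otimes> s) = i then rmul s a (x \<otimes> s) else 0) = (if ht x = i - ht s then a x else 0)"
      using s by (auto simp: rmul_apply m_assoc ht_mult)
  qed simp
  finally show ?thesis .
qed

lemma hsum_avg: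
  assumes a: "a \<in> carrier RG"
  shows "hsum (avg j a) i = hsum a i"
proof -
  have m: "rmul (inv h) a \<in> carrier RG" if "h \<in> D j" for h
    using that a D_closed by (intro linop_closed[OF linop_rmul]) auto
  have "avg j a = (\<lambda>x. 1 / of_nat (card (D j)) * (\<Sum>h\<in>D j. rmul (inv h) a) x)"
    using D_closed by (auto simp: fun_eq_iff avg_def sum_apply rmul_apply cong: sum.cong)
  then have "hsum (avg j a) i = 1 / of_nat (card (D j)) * (\<Sum>h\<in>D j. hsum (rmul (inv h) a) i)"
    using m by (simp only: hsum_scale hsum_sum)
  also have "(\<Sum>h\<in>D j. hsum (rmul (inv h) a) i) = (\<Sum>h\<in>D j. hsum a i)"
    using a D_closed D_ht by (intro sum.cong) (auto simp: hsum_rmul ht_inv)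
  finally show ?thesis
    using card_D[of j] by simp
qed

lemma aug_hsum:
  assumes "finite I" "ht ` {x. a x \<noteq> 0} \<subseteq> I" "finite {x. a x \<noteq> 0}"
  shows "aug a = (\<Sum>i\<in>I. hsum a i)"
  unfolding aug_def hsum_def using assms by (subst sum.swap) (auto intro!: sum.cong)

text \<open>Chains on the cosets of the base group are the direct limit of the chains on the cosets
  of \<open>D j\<close>. Finitely many support points of equal height differ by elements of one
  \<open>D J\<close>, so for \<open>j \<ge> J\<close> a coset of \<open>D j\<close> that meets the
  support contains all support points of its height, and the average there is a multiple of a height
  sum.\<close>

lemma avg_eventually_zero:
  assumes a: "a \<in> carrier RG" and zero: "\<And>i. hsum a i = 0"
  shows "\<exists>J. \<forall>j\<ge>J. avg j a = 0"
proof -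
  let ?S = "{x. a x \<noteq> 0}"
  note S = RG_finite[OF a] RG_supp[OF a]
  define k where "k p = (LEAST j. inv (fst p) \<otimes> snd p \<in> D j)" for p
  define J where "J = Max (insert 0 (k ` (?S \<times> ?S)))"
  have J: "inv y \<otimes> y' \<in> D j" if "a y \<noteq> 0" "a y' \<noteq> 0" "ht y = ht y'" "J \<le> j" for y y' j
  proof -
    have "y \<in> carrier G" "y' \<in> carrier G"
      using that S(2) by blast+
    then have "\<exists>j. inv y \<otimes> y' \<in> D j"
      using ht_eq_0_iff[of "inv y \<otimes> y'"] that(3) by (simp add: ht_mult ht_inv)
    then have "inv y \<otimes> y' \<in> D (k (y, y'))"
      unfolding k_def fst_conv snd_conv by (rule LeastI_ex)
    moreover have "k (y, y') \<le> J"
      unfolding J_def using S(1) that by (intro Max_ge) auto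
    ultimately show ?thesis
      using D_mono[of "k (y, y')" j] that(4) by auto
  qed
  have "avg j a x = 0" if j: "J \<le> j" and x: "x \<in> carrier G" for j x
  proof (cases "\<exists>h\<in>D j. a (x \<otimes> h) \<noteq> 0")
    case False
    then show ?thesis
      by (simp add: avg_def)
  next
    case True
    then obtain h0 where h0: "h0 \<in> D j" "a (x \<otimes> h0) \<noteq> 0"
      by blast
    have inj: "inj_on (\<lambda>h. x \<otimes> h) (D j)"
    proof (rule inj_onI)
      fix h k assume "h \<in> D j" "k \<in> D j" "x \<otimes> h = x \<otimes> k"
      then show "h = k"
        using x D_closed[of h j] D_closed[of k j] by simp
    qed
    \<comment> \<open>The chosen point \<open>x \<otimes> h0\<close> links every other support point
      of this height to the coset of \<open>x\<close>.\<close>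
    have sub: "y \<in> (\<lambda>h. x \<otimes> h) ` D j" if "a y \<noteq> 0" "ht y = ht x" for y
    proof -
      have y: "y \<in> carrier G"
        using that S by blast
      have "inv (x \<otimes> h0) \<otimes> y \<in> D j"
        using that h0 x D_closed[OF h0(1)] D_ht[OF h0(1)] by (intro J j) (auto simp: ht_mult)
      then have "h0 \<otimes> (inv (x \<otimes> h0) \<otimes> y) \<in> D j"
        by (rule subgroup.m_closed[OF D_subgroup h0(1)])
      moreover have "x \<otimes> (h0 \<otimes> (inv (x \<otimes> h0) \<otimes> y)) = y"
        using x y D_closed[OF h0(1)] by (simp add: m_assoc[symmetric])
      ultimately show ?thesis
        by (intro image_eqI[of _ _ "h0 \<otimes> (inv (x \<otimes> h0) \<otimes> y)"]) auto
    qed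
    let ?K = "?S \<union> (\<lambda>h. x \<otimes> h) ` D j"
    have K: "finite ?K"
      using S D_finite by blast
    have "(\<Sum>h\<in>D j. a (x \<otimes> h)) = (\<Sum>y\<in>(\<lambda>h. x \<otimes> h) ` D j. a y)"
      using inj by (simp add: sum.reindex)
    also have "\<dots> = (\<Sum>y\<in>(\<lambda>h. x \<otimes> h) ` D j. if ht y = ht x then a y else 0)"
      using x D_closed D_ht by (intro sum.cong) (auto simp: ht_mult)
    also have "\<dots> = (\<Sum>y\<in>?K. if ht y = ht x then a y else 0)"
      using K sub by (intro sum.mono_neutral_left) auto
    also have "\<dots> = hsum a (ht x)"
      using K by (intro hsum_superset[symmetric]) auto
    finally show ?thesis
      using zero by (simp add: avg_def)
  qed
  then have "\<forall>j\<ge>J. avg j a = 0"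
    by (auto simp: fun_eq_iff) (auto simp: avg_def)
  then show ?thesis
    by blast
qed

text \<open>The module of \<open>G\<close>-chains on the disjoint union of the coset spaces \<open>G / D j\<close>, a direct sum of
  projective modules \<open>RG e\<^sub>j\<close> for the averaging idempotents \<open>e\<^sub>j\<close>. For \<open>T\<close> the identity, \<open>push T\<close> is induced
  by the projections \<open>G / D j \<rightarrow> G / D (j + 1)\<close>, for \<open>T\<close> the right multiplication with \<open>t\<close> by the maps
  \<open>x D j \<mapsto> x t D (j + 1)\<close>.\<close>

definition PP :: "(nat \<Rightarrow> 'g \<Rightarrow> rat) set"
  where "PP = {f. (\<forall>j. f j \<in> carrier RG \<and> avg j (f j) = f j) \<and> finite {j. f j \<noteq> 0}}"

definition push :: "(('g \<Rightarrow> rat) \<Rightarrow> 'g \<Rightarrow> rat) \<Rightarrow> (nat \<Rightarrow> 'g \<Rightarrow> rat) \<Rightarrow> nat \<Rightarrow> 'g \<Rightarrow> rat"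
  where "push T f = (\<lambda>j. case j of 0 \<Rightarrow> 0 | Suc i \<Rightarrow> avg (Suc i) (T (f i)))"

abbreviation "alpha \<equiv> push (\<lambda>a. a)"
abbreviation "beta \<equiv> push (rmul t)"

lemma push_0 [simp]: "push T f 0 = 0" and push_Suc [simp]: "push T f (Suc i) = avg (Suc i) (T (f i))"
  by (simp_all add: push_def)

lemma PP_mem: "f \<in> PP \<Longrightarrow> f j \<in> carrier RG" and PP_avg: "f \<in> PP \<Longrightarrow> avg j (f j) = f j"
  and PP_finite: "f \<in> PP \<Longrightarrow> finite {j. f j \<noteq> 0}"
  by (auto simp: PP_def)

lemma PP_zero: "0 \<in> PP"
  using linop_zero[OF linop_avg] by (simp add: PP_def)

lemma PP_diff:
  assumes f: "f \<in> PP" and g: "g \<in> PP"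
  shows "f - g \<in> PP"
proof -
  have "finite ({j. f j \<noteq> 0} \<union> {j. g j \<noteq> 0})"
    using f g PP_finite by blast
  then have "finite {j. (f - g) j \<noteq> 0}"
    by (rule finite_subset[rotated]) auto
  then show ?thesis
    using f g by (simp add: PP_def RG_diff_mem linop_diff[OF linop_avg])
qed

lemma PP_uminus: "f \<in> PP \<Longrightarrow> - f \<in> PP"
  using PP_diff[OF PP_zero, of f] by simp

lemma PP_add: "\<lbrakk>f \<in> PP; g \<in> PP\<rbrakk> \<Longrightarrow> f + g \<in> PP"
  using PP_diff[of f "- g"] PP_uminus[of g] by simp

lemma push_mem:
  assumes T: "linop T" and f: "f \<in> PP"
  shows "push T f \<in> PP"
proof -
  have "{j. push T f j \<noteq> 0} \<subseteq> Suc ` {j. f j \<noteq> 0}"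
  proof
    fix j assume "j \<in> {j. push T f j \<noteq> 0}"
    then obtain i where i: "j = Suc i" "avg (Suc i) (T (f i)) \<noteq> 0"
      by (cases j) auto
    have "f i \<noteq> 0"
      using i(2) linop_zero[OF T] linop_zero[OF linop_avg, of "Suc i"] by metis
    then show "j \<in> Suc ` {j. f j \<noteq> 0}"
      using i(1) by blast
  qed
  then have "finite {j. push T f j \<noteq> 0}"
    using PP_finite[OF f] finite_surj by blast
  moreover have "push T f j \<in> carrier RG \<and> avg j (push T f j) = push T f j" for j
    using PP_mem[OF f] linop_closed[OF linop_avg] linop_closed[OF T] linop_zero[OF linop_avg]
    by (cases j) (simp_all add: avg_avg)
  ultimately show ?thesis
    by (simp add: PP_def)
qed

lemma push_diff:
  assumes T: "linop T" and f: "f \<in> PP" and g: "g \<in> PP"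
  shows "push T (f - g) = push T f - push T g"
proof
  fix j
  show "push T (f - g) j = (push T f - push T g) j"
    using PP_mem[OF f] PP_mem[OF g] linop_closed[OF T]
    by (cases j) (simp_all add: linop_diff[OF T] linop_diff[OF linop_avg])
qed

lemma push_add:
  assumes T: "linop T" and f: "f \<in> PP" and g: "g \<in> PP"
  shows "push T (f + g) = push T f + push T g"
proof
  fix j
  show "push T (f + g) j = (push T f + push T g) j"
    using PP_mem[OF f] PP_mem[OF g] linop_closed[OF T]
    by (cases j) (simp_all add: linop_add[OF T] linop_add[OF linop_avg])
qed

lemma push_mult:
  assumes T: "linop T" and a: "a \<in> carrier RG" and f: "f \<in> PP"
  shows "push T (\<lambda>j. a \<otimes>\<^bsub>RG\<^esub> f j) = (\<lambda>j. a \<otimes>\<^bsub>RG\<^esub> push T f j)"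
proof
  fix j
  show "push T (\<lambda>j. a \<otimes>\<^bsub>RG\<^esub> f j) j = a \<otimes>\<^bsub>RG\<^esub> push T f j"
    using PP_mem[OF f] linop_closed[OF T] a
    by (cases j) (simp_all add: linop_mult[OF T] linop_mult[OF linop_avg] mult_zero_right)
qed

lemma linop_t: "linop (rmul t)"
  by (rule linop_rmul) simp

lemmas alpha_mem = push_mem[OF linop_id] and beta_mem = push_mem[OF linop_t]
lemmas alpha_diff = push_diff[OF linop_id] and beta_diff = push_diff[OF linop_t]

lemma alpha_beta: "alpha (beta f) = beta (alpha f)"
proof
  fix j
  have "rmul t 0 = 0"
    by (rule linop_zero[OF linop_t])
  then show "alpha (beta f) j = beta (alpha f) j"
    using linop_zero[OF linop_avg] by (cases j; cases "j - 1") (auto simp: avg_avg avg_rmul_t_avg)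
qed

section \<open>Augmentation and height sums on the telescope\<close>

definition tot :: "(('g \<Rightarrow> rat) \<Rightarrow> rat) \<Rightarrow> (nat \<Rightarrow> 'g \<Rightarrow> rat) \<Rightarrow> rat"
  where "tot L f = (\<Sum>j\<in>{j. f j \<noteq> 0}. L (f j))"

lemma tot_eq: "\<lbrakk>L 0 = 0; \<And>j. N \<le> j \<Longrightarrow> f j = 0\<rbrakk> \<Longrightarrow> tot L f = (\<Sum>j<N. L (f j))"
  unfolding tot_def by (rule sum.mono_neutral_left) (auto simp: not_le[symmetric])

lemma PP_bound:
  assumes "f \<in> PP"
  obtains N where "\<And>j. N \<le> j \<Longrightarrow> f j = 0"
proof -
  obtain N where "\<forall>j\<in>{j. f j \<noteq> 0}. j < N"
    using PP_finite[OF assms] finite_nat_set_iff_bounded by blast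
  then show thesis
    using that[of N] by force
qed

lemma tot_diff:
  assumes f: "f \<in> PP" and g: "g \<in> PP" and L0: "L 0 = 0"
    and L: "\<And>a b. \<lbrakk>a \<in> carrier RG; b \<in> carrier RG\<rbrakk> \<Longrightarrow> L (a + b) = L a + L b"
  shows "tot L (f - g) = tot L f - tot L g"
proof -
  obtain M N where M: "\<And>j. M \<le> j \<Longrightarrow> f j = 0" and N: "\<And>j. N \<le> j \<Longrightarrow> g j = 0"
    using PP_bound[OF f] PP_bound[OF g] by metis
  let ?K = "max M N"
  have Ld: "L (a - b) = L a - L b" if "a \<in> carrier RG" "b \<in> carrier RG" for a b
    using L[OF RG_diff_mem[OF that] that(2)] by simp
  have "tot L (f - g) = (\<Sum>j<?K. L ((f - g) j))"
    by (rule tot_eq[of L ?K "f - g", OF L0]) (simp add: M N)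
  also have "\<dots> = (\<Sum>j<?K. L (f j)) - (\<Sum>j<?K. L (g j))"
    using PP_mem[OF f] PP_mem[OF g] by (simp add: Ld sum_subtractf)
  also have "\<dots> = tot L f - tot L g"
    using tot_eq[of L ?K f, OF L0] tot_eq[of L ?K g, OF L0] M N by simp
  finally show ?thesis .
qed

lemma tot_push:
  assumes f: "f \<in> PP" and T: "linop T" and L0: "L 0 = 0" "L' 0 = 0"
    and L: "\<And>i a. a \<in> carrier RG \<Longrightarrow> L (avg i (T a)) = L' a"
  shows "tot L (push T f) = tot L' f"
proof -
  obtain N where N: "\<And>j. N \<le> j \<Longrightarrow> f j = 0"
    using PP_bound[OF f] by metis
  have "push T f j = 0" if "Suc N \<le> j" for j
    using that N[of "j - 1"] linop_zero[OF T] linop_zero[OF linop_avg] by (cases j) auto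
  then have "tot L (push T f) = (\<Sum>j<Suc N. L (push T f j))"
    by (rule tot_eq[of L "Suc N" "push T f", OF L0(1)])
  also have "\<dots> = (\<Sum>j<N. L' (f j))"
    using L[OF PP_mem[OF f]] by (simp add: sum.lessThan_Suc_shift L0 del: sum.lessThan_Suc)
  also have "\<dots> = tot L' f"
    using tot_eq[of L' N f, OF L0(2)] N by simp
  finally show ?thesis .
qed

lemma aug_avg:
  assumes "a \<in> carrier RG"
  shows "aug (avg j a) = aug a"
proof -
  let ?I = "ht ` {x. a x \<noteq> 0} \<union> ht ` {x. avg j a x \<noteq> 0}"
  have "finite {x. a x \<noteq> 0}" "finite {x. avg j a x \<noteq> 0}"
    using assms RG_finite linop_closed[OF linop_avg] by blast+
  then show ?thesis
    using aug_hsum[of ?I a] aug_hsum[of ?I "avg j a"] hsum_avg[OF assms] by simp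
qed

text \<open>The augmentation of the telescope: it sends chains on all the coset spaces to finitely
  supported functions on the integers, ignores \<open>alpha\<close> and turns \<open>beta\<close>
  into the shift.\<close>

definition rho :: "(nat \<Rightarrow> 'g \<Rightarrow> rat) \<Rightarrow> int \<Rightarrow> rat"
  where "rho f i = tot (\<lambda>a. hsum a i) f"

lemma rho_diff: "\<lbrakk>f \<in> PP; g \<in> PP\<rbrakk> \<Longrightarrow> rho (f - g) i = rho f i - rho g i"
  unfolding rho_def by (rule tot_diff) (auto simp: hsum_add)

lemma rho_alpha: "f \<in> PP \<Longrightarrow> rho (alpha f) i = rho f i"
  unfolding rho_def by (rule tot_push[OF _ linop_id]) (auto simp: hsum_avg)

lemma rho_beta: "f \<in> PP \<Longrightarrow> rho (beta f) i = rho f (i - 1)"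
  unfolding rho_def by (rule tot_push[OF _ linop_t]) (auto simp: hsum_avg linop_closed[OF linop_t] hsum_rmul ht_t)

lemma aug_alpha: "f \<in> PP \<Longrightarrow> tot aug (alpha f) = tot aug f"
  by (rule tot_push[OF _ linop_id]) (auto simp: aug_avg)

lemma aug_beta: "f \<in> PP \<Longrightarrow> tot aug (beta f) = tot aug f"
  by (rule tot_push[OF _ linop_t]) (auto simp: aug_avg linop_closed[OF linop_t] aug_rmul)

lemma rho_closed: "f \<in> PP \<Longrightarrow> rho f i \<in> loc n"
  unfolding rho_def tot_def using hsum_closed PP_mem n_pos by (intro loc_sum) auto

lemma rho_support:
  assumes "f \<in> PP"
  obtains I where "finite I" "\<And>i. i \<notin> I \<Longrightarrow> rho f i = 0" "tot aug f = (\<Sum>i\<in>I. rho f i)"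
proof
  let ?I = "\<Union>j\<in>{j. f j \<noteq> 0}. ht ` {x. f j x \<noteq> 0}"
  show fin: "finite ?I"
    using PP_finite[OF assms] RG_finite[OF PP_mem[OF assms]] by blast
  show "rho f i = 0" if "i \<notin> ?I" for i
    unfolding rho_def tot_def hsum_def using that by (intro sum.neutral ballI) auto
  have "tot aug f = (\<Sum>j\<in>{j. f j \<noteq> 0}. \<Sum>i\<in>?I. hsum (f j) i)"
    unfolding tot_def using fin RG_finite[OF PP_mem[OF assms]] by (intro sum.cong refl aug_hsum) blast+
  also have "\<dots> = (\<Sum>i\<in>?I. rho f i)"
    unfolding rho_def tot_def by (rule sum.swap)
  finally show "tot aug f = (\<Sum>i\<in>?I. rho f i)" .
qed

text \<open>Pushing raises the level by one and leaves 0 at level 0, so a fixed element vanishes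
  level by level.\<close>

lemma alpha_fixed_zero:
  assumes f: "f \<in> PP" and eq: "f - alpha f = 0"
  shows "f = 0"
proof -
  have fa: "f j = alpha f j" for j
    using fun_cong[OF eq, of j] by simp
  have "f j = 0" for j
  proof (induction j)
    case 0
    then show ?case
      using fa[of 0] by simp
  next
    case (Suc j)
    have "f (Suc j) = avg (Suc j) (f j)"
      using fa[of "Suc j"] by (simp only: push_Suc)
    then show ?case
      by (simp only: Suc linop_zero[OF linop_avg])
  qed
  then show ?thesis
    by (simp add: fun_eq_iff)
qed

text \<open>Exactness of the telescope: the kernel of \<open>rho\<close> is the image of
  \<open>1 - alpha\<close>.\<close>

lemma rho_zero_exact:
  assumes f: "f \<in> PP" and zero: "\<And>i. rho f i = 0"
  obtains w where "w \<in> PP" "f = w - alpha w"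
proof
  \<comment> \<open>The geometric series of \<open>alpha\<close> applied to \<open>f\<close>:
    everything from the levels up to \<open>j\<close>, pushed to level \<open>j\<close>. It is
    finitely supported because the total has zero height sums, so \<open>avg_eventually_zero\<close>
    applies to it.\<close>
  define w where "w j = avg j (\<Sum>i\<le>j. f i)" for j
  note fM = PP_mem[OF f]
  have sM: "(\<Sum>i\<in>I. f i) \<in> carrier RG" for I
    using fM by (intro RG_sum_mem)
  obtain N where N: "\<And>j. N \<le> j \<Longrightarrow> f j = 0"
    using PP_bound[OF f] by metis
  have tot: "(\<Sum>i\<le>j. f i) = (\<Sum>i<N. f i)" if "N \<le> j" for j
    using that N by (intro sum.mono_neutral_right) auto
  have "hsum (\<Sum>i<N. f i) k = 0" for k
    using zero[of k] tot_eq[of "\<lambda>a. hsum a k" N f] N hsum_sum[of "{..<N}" f k] fM by (simp add: rho_def)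
  then obtain J where J: "\<forall>j\<ge>J. avg j (\<Sum>i<N. f i) = 0"
    using avg_eventually_zero[OF sM] by blast
  have "w j = 0" if "max J N \<le> j" for j
    using that J tot by (simp add: w_def)
  then have "{j. w j \<noteq> 0} \<subseteq> {..<max J N}"
    by (auto simp: not_le[symmetric])
  then have "finite {j. w j \<noteq> 0}"
    using finite_subset by blast
  then show "w \<in> PP"
    using sM linop_closed[OF linop_avg] by (simp add: PP_def w_def avg_avg)
  show "f = w - alpha w"
  proof
    fix j
    show "f j = (w - alpha w) j"
    proof (cases j)
      case 0
      then show ?thesis
        using PP_avg[OF f, of 0] by (simp add: w_def)
    next
      case (Suc i)
      have "w (Suc i) = avg (Suc i) (\<Sum>i\<le>i. f i) + avg (Suc i) (f (Suc i))"
        unfolding w_def sum.atMost_Suc using sM fM by (rule linop_add[OF linop_avg])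
      then show ?thesis
        using PP_avg[OF f, of "Suc i"] by (simp add: Suc) (simp add: w_def avg_avg)
    qed
  qed
qed

text \<open>The value \<open>\<psi> i\<close> is placed at the representative
  \<open>t [^] i\<close>. Averaging at level 0 makes this an element of \<open>PP\<close> and keeps
  the height sums.\<close>

lemma rho_lift:
  assumes \<psi>: "\<And>i. \<psi> i \<in> loc n" and fin: "finite {i :: int. \<psi> i \<noteq> 0}"
  obtains v where "v \<in> PP" "\<And>i. rho v i = \<psi> i"
proof
  define b where "b x = (if x \<in> carrier G \<and> x = t [^] ht x then \<psi> (ht x) else 0)" for x
  have "{x. b x \<noteq> 0} \<subseteq> (\<lambda>i. t [^] i) ` {i. \<psi> i \<noteq> 0}"
    by (auto simp: b_def split: if_splits)
  then have K: "finite ((\<lambda>i. t [^] i) ` {i. \<psi> i \<noteq> 0})" "{x. b x \<noteq> 0} \<subseteq> (\<lambda>i. t [^] i) ` {i. \<psi> i \<noteq> 0}"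
    using fin by auto
  have "finite {x. b x \<noteq> 0}"
    using K finite_subset by blast
  moreover have "b x \<in> loc n" "x \<notin> carrier G \<Longrightarrow> b x = 0" for x
    using \<psi> by (simp_all add: b_def)
  ultimately have b: "b \<in> carrier RG"
    by (simp add: RG_iff)
  have b_pow: "b (t [^] i) = \<psi> i" for i :: int
    by (simp add: b_def ht_pow)
  have inj: "inj_on (\<lambda>i::int. t [^] i) X" for X
    by (rule inj_onI) (metis ht_pow)
  have hsum_b: "hsum b i = \<psi> i" for i
  proof -
    have "hsum b i = (\<Sum>x\<in>(\<lambda>i. t [^] i) ` {i. \<psi> i \<noteq> 0}. if ht x = i then b x else 0)"
      by (rule hsum_superset[OF K])
    also have "\<dots> = (\<Sum>k\<in>{i. \<psi> i \<noteq> 0}. if ht (t [^] k) = i then b (t [^] k) else 0)"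
      by (subst sum.reindex[OF inj]) simp
    also have "\<dots> = (\<Sum>k\<in>{i. \<psi> i \<noteq> 0}. if k = i then \<psi> i else 0)"
      by (rule sum.cong) (auto simp: ht_pow b_pow)
    finally have "hsum b i = (\<Sum>k\<in>{i. \<psi> i \<noteq> 0}. if k = i then \<psi> i else 0)" .
    then show ?thesis
      using fin by simp
  qed
  define v where "v j = (if j = 0 then avg 0 b else 0)" for j :: nat
  have "finite {j. v j \<noteq> 0}"
    by (rule finite_subset[of _ "{0}"]) (auto simp: v_def)
  then show "v \<in> PP"
    using linop_closed[OF linop_avg b] linop_zero[OF linop_avg] by (auto simp: PP_def v_def avg_avg)
  show "rho v i = \<psi> i" for i
    using tot_eq[of "\<lambda>a. hsum a i" 1 v] b by (simp add: rho_def v_def hsum_avg hsum_b)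
qed

lemma int_shift_zero:
  fixes \<phi> :: "int \<Rightarrow> rat"
  assumes eq: "\<And>i. \<phi> i = \<phi> (i - 1)" and I: "finite I" "\<And>i. i \<notin> I \<Longrightarrow> \<phi> i = 0"
  shows "\<phi> i = 0"
proof -
  have "\<phi> i = \<phi> (i - int k)" for k
  proof (induction k)
    case (Suc k)
    then show ?case
      using eq[of "i - int k"] by (simp add: algebra_simps)
  qed simp
  moreover have "\<exists>k. i - int k \<notin> I"
  proof (rule ccontr)
    assume "\<nexists>k. i - int k \<notin> I"
    then have "range (\<lambda>k. i - int k) \<subseteq> I"
      by auto
    then have "finite (range (\<lambda>k. i - int k))"
      using I(1) finite_subset by blast
    moreover have "inj (\<lambda>k. i - int k)"
      by (auto intro!: injI)
    ultimately show False
      using finite_imageD by blast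
  qed
  ultimately show ?thesis
    using I(2) by metis
qed

text \<open>The solution is the function of partial sums, which vanishes to the left of
  \<open>I\<close> as an empty sum and to the right because the total is zero.\<close>

lemma int_shift_solve:
  fixes \<phi> :: "int \<Rightarrow> rat"
  assumes \<phi>: "\<And>i. \<phi> i \<in> loc n" and I: "finite I" "\<And>i. i \<notin> I \<Longrightarrow> \<phi> i = 0" and sum: "sum \<phi> I = 0"
  obtains \<psi> where "\<And>i. \<psi> i \<in> loc n" "finite {i. \<psi> i \<noteq> 0}" "\<And>i. \<psi> i - \<psi> (i - 1) = \<phi> i"
proof
  define \<psi> where "\<psi> i = (\<Sum>l\<in>{l \<in> I. l \<le> i}. \<phi> l)" for i
  show "\<psi> i \<in> loc n" for i
    unfolding \<psi>_def using \<phi> n_pos by (intro loc_sum)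
  show "\<psi> i - \<psi> (i - 1) = \<phi> i" for i
  proof (cases "i \<in> I")
    case True
    then have "{l \<in> I. l \<le> i} = insert i {l \<in> I. l \<le> i - 1}"
      by auto
    then show ?thesis
      using I(1) by (simp add: \<psi>_def)
  next
    case False
    have "l \<le> i \<longleftrightarrow> l \<le> i - 1" if "l \<in> I" for l
      using that False by (cases "l = i") auto
    then have "{l \<in> I. l \<le> i} = {l \<in> I. l \<le> i - 1}"
      by blast
    then show ?thesis
      using I(2)[OF False] by (simp add: \<psi>_def)
  qed
  have "\<psi> i = 0" if i: "i \<notin> {Min (insert 0 I)..Max (insert 0 I)}" for i
  proof (cases "i < Min (insert 0 I)")
    case True
    have "Min (insert 0 I) \<le> l" if "l \<in> I" for l
      using that I(1) by (intro Min_le) auto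
    then have "{l \<in> I. l \<le> i} = {}"
      using True by force
    then show ?thesis
      unfolding \<psi>_def by (simp only: sum.empty)
  next
    case False
    have "l \<le> Max (insert 0 I)" if "l \<in> I" for l
      using that I(1) by (intro Max_ge) auto
    then have "{l \<in> I. l \<le> i} = I"
      using False i by force
    then show ?thesis
      using sum by (simp add: \<psi>_def)
  qed
  then have "{i. \<psi> i \<noteq> 0} \<subseteq> {Min (insert 0 I)..Max (insert 0 I)}"
    by blast
  then show "finite {i. \<psi> i \<noteq> 0}"
    using finite_subset by blast
qed

text \<open>The height sums of \<open>f\<close> add up to zero, so they are the difference of a
  function and its shift. After lifting that function to \<open>v\<close>, what remains of
  \<open>f\<close> is in the kernel of \<open>rho\<close>, hence in the image of
  \<open>1 - alpha\<close>.\<close>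

lemma exact_0:
  assumes f: "f \<in> PP" and zero: "tot aug f = 0"
  obtains u v where "u \<in> PP" "v \<in> PP" "f = (u - alpha u) + (v - beta v)"
proof -
  obtain I where I: "finite I" "\<And>i. i \<notin> I \<Longrightarrow> rho f i = 0" "tot aug f = (\<Sum>i\<in>I. rho f i)"
    using rho_support[OF f] by metis
  obtain \<psi> where \<psi>: "\<And>i. \<psi> i \<in> loc n" "finite {i. \<psi> i \<noteq> 0}" "\<And>i. \<psi> i - \<psi> (i - 1) = rho f i"
    by (rule int_shift_solve[of "rho f" I]) (use I zero rho_closed[OF f] in auto)
  obtain v where v: "v \<in> PP" "\<And>i. rho v i = \<psi> i"
    using rho_lift[OF \<psi>(1,2)] by metis
  have vb: "v - beta v \<in> PP"
    by (intro PP_diff beta_mem v)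
  have "rho (f - (v - beta v)) i = 0" for i
    using rho_diff[OF f vb] rho_diff[OF v(1) beta_mem[OF v(1)]] rho_beta[OF v(1)] v(2) \<psi>(3) by simp
  then obtain u where u: "u \<in> PP" "f - (v - beta v) = u - alpha u"
    using rho_zero_exact[OF PP_diff[OF f vb]] by metis
  have "f = (u - alpha u) + (v - beta v)"
    using u(2) by (simp add: algebra_simps)
  then show thesis
    by (rule that[OF u(1) v(1)])
qed

text \<open>The height sums of \<open>v\<close> are shift invariant with finite support, hence zero,
  so \<open>v = w - alpha w\<close>. Then \<open>u + (w - beta w)\<close> is fixed by
  \<open>alpha\<close> and vanishes.\<close>

lemma exact_1:
  assumes u: "u \<in> PP" and v: "v \<in> PP" and zero: "(u - alpha u) + (v - beta v) = 0"
  obtains w where "w \<in> PP" "u = w - beta w" "v = - (w - alpha w)"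
proof -
  have ua: "u - alpha u \<in> PP" and vb: "v - beta v \<in> PP"
    using u v by (auto intro!: PP_diff alpha_mem beta_mem)
  have eq: "v - beta v = 0 - (u - alpha u)"
    using zero by (simp only: add_eq_0_iff diff_0)
  have "rho v i - rho v (i - 1) = 0" for i
  proof -
    have "rho v i - rho v (i - 1) = rho (v - beta v) i"
      by (simp only: rho_diff[OF v beta_mem[OF v]] rho_beta[OF v])
    also have "\<dots> = rho 0 i - rho (u - alpha u) i"
      unfolding eq by (rule rho_diff[OF PP_zero ua])
    also have "rho 0 i = 0"
      by (simp add: rho_def tot_def)
    also have "rho (u - alpha u) i = 0"
      using rho_diff[OF u alpha_mem[OF u]] rho_alpha[OF u] by simp
    finally show ?thesis
      by simp
  qed
  then have step: "rho v i = rho v (i - 1)" for i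
    by simp
  obtain I where I: "finite I" "\<And>i. i \<notin> I \<Longrightarrow> rho v i = 0"
    using rho_support[OF v] by metis
  have "rho v i = 0" for i
    by (rule int_shift_zero[of "rho v" I, OF step I])
  then obtain w where w: "w \<in> PP" "v = w - alpha w"
    using rho_zero_exact[OF v] by metis
  define z where "z = u + (w - beta w)"
  have wb: "w - beta w \<in> PP"
    by (intro PP_diff beta_mem w)
  have z: "z \<in> PP"
    unfolding z_def by (intro PP_add u wb)
  have "alpha z = alpha u + alpha (w - beta w)"
    unfolding z_def by (rule push_add[OF linop_id u wb])
  also have "alpha (w - beta w) = alpha w - alpha (beta w)"
    by (rule alpha_diff[OF w(1) beta_mem[OF w(1)]])
  finally have az: "alpha z = alpha u + (alpha w - beta (alpha w))"
    by (simp only: alpha_beta)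
  have bv: "beta v = beta w - beta (alpha w)"
    unfolding w(2) by (rule beta_diff[OF w(1) alpha_mem[OF w(1)]])
  have "z - alpha z = (u - alpha u) + (v - beta v)"
    unfolding az bv unfolding z_def w(2) by simp
  then have "z - alpha z = 0"
    by (simp only: zero)
  then have "z = 0"
    by (rule alpha_fixed_zero[OF z])
  then have "w - beta w = - u"
    by (simp only: z_def add_eq_0_iff)
  then have uw: "u = - w - (- beta w)"
    by (metis minus_diff_commute minus_diff_eq minus_minus)
  have neg: "alpha (- w) = - alpha w" "beta (- w) = - beta w"
    using alpha_diff[OF PP_zero w(1)] beta_diff[OF PP_zero w(1)]
      alpha_diff[OF PP_zero PP_zero] beta_diff[OF PP_zero PP_zero] by simp_all
  \<comment> \<open>The argument produces \<open>v = w - alpha w\<close> and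
    \<open>u = - (w - beta w)\<close>; the opposite signs are wanted to match
    \<open>d1\<close>.\<close>
  show thesis
    by (rule that[of "- w"]) (use uw w neg in \<open>auto simp: PP_uminus\<close>)
qed

text \<open>The type of resolutions in the definition of cohomological dimension forces the summands to be
  indexed by lists; a list of units encodes its length. In the middle term the even lengths belong to
  the first and the odd lengths to the second summand.\<close>

definition ix :: "nat \<Rightarrow> 'g list"
  where "ix m = replicate m \<one>"

lemma length_ix [simp]: "length (ix m) = m"
  by (simp add: ix_def)

lemma ix_eq_iff [simp]: "ix m = ix k \<longleftrightarrow> m = k"
  by (metis length_ix)

text \<open>The weight \<open>l\<close> assigns to a list length the level of its coset space. The
  identity gives the telescope once, and halving gives it twice.\<close>

definition Q :: "(nat \<Rightarrow> nat) \<Rightarrow> ('g \<Rightarrow> rat, 'g list \<Rightarrow> 'g \<Rightarrow> rat) module"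
  where "Q l = fixed_module (range ix) (\<lambda>xs. avg (l (length xs)))"

definition enc :: "(nat \<Rightarrow> 'g \<Rightarrow> rat) \<Rightarrow> 'g list \<Rightarrow> 'g \<Rightarrow> rat"
  where "enc f xs = (if xs \<in> range ix then f (length xs) else 0)"

definition dec :: "('g list \<Rightarrow> 'g \<Rightarrow> rat) \<Rightarrow> nat \<Rightarrow> 'g \<Rightarrow> rat"
  where "dec u m = u (ix m)"

definition join :: "(nat \<Rightarrow> 'g \<Rightarrow> rat) \<Rightarrow> (nat \<Rightarrow> 'g \<Rightarrow> rat) \<Rightarrow> 'g list \<Rightarrow> 'g \<Rightarrow> rat"
  where "join f g = enc (\<lambda>m. if even m then f (m div 2) else g (m div 2))"

definition ev :: "('g list \<Rightarrow> 'g \<Rightarrow> rat) \<Rightarrow> nat \<Rightarrow> 'g \<Rightarrow> rat"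
  where "ev u m = u (ix (2 * m))"

definition od :: "('g list \<Rightarrow> 'g \<Rightarrow> rat) \<Rightarrow> nat \<Rightarrow> 'g \<Rightarrow> rat"
  where "od u m = u (ix (Suc (2 * m)))"

abbreviation "P0 \<equiv> Q (\<lambda>m. m)"
abbreviation "P1 \<equiv> Q (\<lambda>m. m div 2)"

lemma projective_Q: "projective RG (Q l)"
  unfolding Q_def using linop_closed[OF linop_avg] by (intro projective_fixed linop_avg) (simp add: avg_avg)

lemma Q_simps [simp]: "add (Q l) = (+)" "zero (Q l) = 0" "smult (Q l) = (\<lambda>a u x. a \<otimes>\<^bsub>RG\<^esub> u x)"
  by (simp_all add: Q_def)

lemma enc_mem_iff: "enc f \<in> carrier (Q l) \<longleftrightarrow>
    (\<forall>m. f m \<in> carrier RG \<and> avg (l m) (f m) = f m) \<and> finite {m. f m \<noteq> 0}"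
proof -
  have "{xs. enc f xs \<noteq> 0} = ix ` {m. f m \<noteq> 0}"
    by (auto simp: enc_def split: if_splits)
  moreover have "inj_on ix {m. f m \<noteq> 0}"
    by (auto intro!: inj_onI)
  ultimately have "finite {xs. enc f xs \<noteq> 0} \<longleftrightarrow> finite {m. f m \<noteq> 0}"
    by (simp add: finite_image_iff)
  then show ?thesis
    by (auto simp: Q_def fixed_iff) (auto simp: enc_def)
qed

lemma enc_P0: "enc f \<in> carrier P0 \<longleftrightarrow> f \<in> PP"
  by (simp add: enc_mem_iff PP_def)

lemma dec_enc [simp]: "dec (enc f) = f"
  by (simp add: dec_def enc_def fun_eq_iff)

lemma enc_dec: "u \<in> carrier (Q l) \<Longrightarrow> enc (dec u) = u"
  by (auto simp: dec_def enc_def fun_eq_iff Q_def fixed_iff)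

lemma dec_mem: "u \<in> carrier P0 \<Longrightarrow> dec u \<in> PP"
  using enc_P0[of "dec u"] enc_dec[of u "\<lambda>m. m"] by simp

lemma ev_join [simp]: "ev (join f g) = f" and od_join [simp]: "od (join f g) = g"
  by (simp_all add: ev_def od_def join_def enc_def fun_eq_iff)

lemma join_mem:
  assumes f: "f \<in> PP" and g: "g \<in> PP"
  shows "join f g \<in> carrier P1"
proof -
  have "{m. (if even m then f (m div 2) else g (m div 2)) \<noteq> 0} \<subseteq>
      (\<lambda>m. 2 * m) ` {m. f m \<noteq> 0} \<union> (\<lambda>m. Suc (2 * m)) ` {m. g m \<noteq> 0}"
  proof
    fix m assume m: "m \<in> {m. (if even m then f (m div 2) else g (m div 2)) \<noteq> 0}"
    show "m \<in> (\<lambda>m. 2 * m) ` {m. f m \<noteq> 0} \<union> (\<lambda>m. Suc (2 * m)) ` {m. g m \<noteq> 0}"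
    proof (cases "even m")
      case True
      then show ?thesis
        using m by (intro UnI1 image_eqI[of _ _ "m div 2"]) auto
    next
      case False
      then show ?thesis
        using m by (intro UnI2 image_eqI[of _ _ "m div 2"]) auto
    qed
  qed
  moreover have "finite ((\<lambda>m. 2 * m) ` {m. f m \<noteq> 0} \<union> (\<lambda>m. Suc (2 * m)) ` {m. g m \<noteq> 0})"
    using PP_finite[OF f] PP_finite[OF g] by blast
  ultimately have "finite {m. (if even m then f (m div 2) else g (m div 2)) \<noteq> 0}"
    by (rule finite_subset)
  then show ?thesis
    unfolding join_def enc_mem_iff using PP_mem[OF f] PP_mem[OF g] PP_avg[OF f] PP_avg[OF g] by simp
qed

lemma join_ev_od:
  assumes "u \<in> carrier P1"
  shows "join (ev u) (od u) = u"
proof -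
  have "(\<lambda>m. if even m then ev u (m div 2) else od u (m div 2)) = dec u"
    by (rule ext) (auto simp: ev_def od_def dec_def)
  then show ?thesis
    using enc_dec[OF assms] by (simp only: join_def)
qed

lemma P1_mem: "u \<in> carrier P1 \<Longrightarrow> u xs \<in> carrier RG"
  unfolding Q_def by (rule fixed_apply)

lemma ev_mem:
  assumes u: "u \<in> carrier P1"
  shows "ev u \<in> PP" and "od u \<in> PP"
proof -
  have fixed: "avg (m div 2) (u (ix m)) = u (ix m)" for m
    using u by (auto simp: Q_def fixed_iff)
  have fin: "finite {xs. u xs \<noteq> 0}"
    using u by (simp add: Q_def fixed_iff)
  have eq: "{m. ev u m \<noteq> 0} = (\<lambda>m. ix (2 * m)) -` {xs. u xs \<noteq> 0}" "{m. od u m \<noteq> 0} = (\<lambda>m. ix (Suc (2 * m))) -` {xs. u xs \<noteq> 0}"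
    by (auto simp: ev_def od_def)
  have "inj (\<lambda>m. ix (2 * m))" "inj (\<lambda>m. ix (Suc (2 * m)))"
    by (auto intro!: injI)
  then have "finite {m. ev u m \<noteq> 0}" "finite {m. od u m \<noteq> 0}"
    unfolding eq using fin by (blast intro: finite_vimageI)+
  then show "ev u \<in> PP" "od u \<in> PP"
    using P1_mem[OF u] fixed[of "2 * m" for m] fixed[of "Suc (2 * m)" for m] by (auto simp: PP_def ev_def od_def)
qed

lemma enc_add: "enc (f + g) = enc f + enc g"
  and enc_mult: "a \<in> carrier RG \<Longrightarrow> enc (\<lambda>j. a \<otimes>\<^bsub>RG\<^esub> f j) = (\<lambda>xs. a \<otimes>\<^bsub>RG\<^esub> enc f xs)"
  by (auto simp: enc_def fun_eq_iff mult_zero_right)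

lemma join_add: "join (f + f') (g + g') = join f g + join f' g'"
  unfolding join_def enc_add[symmetric] by (rule arg_cong[of _ _ enc]) (auto simp: fun_eq_iff)

lemma join_mult: "a \<in> carrier RG \<Longrightarrow> join (\<lambda>j. a \<otimes>\<^bsub>RG\<^esub> f j) (\<lambda>j. a \<otimes>\<^bsub>RG\<^esub> g j) = (\<lambda>xs. a \<otimes>\<^bsub>RG\<^esub> join f g xs)"
  unfolding join_def enc_mult[symmetric] by (rule arg_cong[of _ _ enc]) (auto simp: fun_eq_iff)

lemma dec_add: "dec (u + v) = dec u + dec v" and ev_add: "ev (u + v) = ev u + ev v" and od_add: "od (u + v) = od u + od v"
  by (simp_all add: dec_def ev_def od_def fun_eq_iff)

section \<open>The Koszul complex of \<open>1 - alpha\<close> and \<open>1 - beta\<close>\<close>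

definition del :: "(('g \<Rightarrow> rat) \<Rightarrow> 'g \<Rightarrow> rat) \<Rightarrow> (nat \<Rightarrow> 'g \<Rightarrow> rat) \<Rightarrow> nat \<Rightarrow> 'g \<Rightarrow> rat"
  where "del T f = f - push T f"

lemma del_mem: "\<lbrakk>linop T; f \<in> PP\<rbrakk> \<Longrightarrow> del T f \<in> PP"
  unfolding del_def by (intro PP_diff push_mem)

lemma del_add: "\<lbrakk>linop T; f \<in> PP; g \<in> PP\<rbrakk> \<Longrightarrow> del T (f + g) = del T f + del T g"
  by (simp add: del_def push_add algebra_simps)

lemma del_mult:
  assumes T: "linop T" and a: "a \<in> carrier RG" and f: "f \<in> PP"
  shows "del T (\<lambda>j. a \<otimes>\<^bsub>RG\<^esub> f j) = (\<lambda>j. a \<otimes>\<^bsub>RG\<^esub> del T f j)"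
  using PP_mem[OF f] PP_mem[OF push_mem[OF T f]] a
  by (simp add: del_def push_mult[OF T a f] fun_diff_def[of "\<lambda>j. a \<otimes>\<^bsub>RG\<^esub> f j"] mult_diff_right)

definition d0 :: "('g list \<Rightarrow> 'g \<Rightarrow> rat) \<Rightarrow> 'g list \<Rightarrow> 'g \<Rightarrow> rat"
  where "d0 u = enc (del (\<lambda>a. a) (ev u) + del (rmul t) (od u))"

text \<open>With this sign, \<open>d0\<close> after \<open>d1\<close> is the commutator of
  \<open>1 - alpha\<close> and \<open>1 - beta\<close>.\<close>

definition d1 :: "('g list \<Rightarrow> 'g \<Rightarrow> rat) \<Rightarrow> 'g list \<Rightarrow> 'g \<Rightarrow> rat"
  where "d1 u = join (del (rmul t) (dec u)) (- del (\<lambda>a. a) (dec u))"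

lemma d0_mem: "u \<in> carrier P1 \<Longrightarrow> d0 u \<in> carrier P0"
  unfolding d0_def enc_P0 by (intro PP_add del_mem linop_id linop_t ev_mem)

lemma d1_mem: "u \<in> carrier P0 \<Longrightarrow> d1 u \<in> carrier P1"
  unfolding d1_def by (intro join_mem PP_uminus del_mem linop_id linop_t dec_mem)

lemma d0_hom: "d0 \<in> mod_hom RG P1 P0"
  unfolding mod_hom_def
proof (intro CollectI conjI ballI Pi_I d0_mem)
  fix u assume u: "u \<in> carrier P1"
  note m = ev_mem[OF u]
  show "d0 (u \<oplus>\<^bsub>P1\<^esub> v) = d0 u \<oplus>\<^bsub>P0\<^esub> d0 v" if v: "v \<in> carrier P1" for v
  proof -
    have "d0 (u + v) = enc ((del (\<lambda>a. a) (ev u) + del (rmul t) (od u)) + (del (\<lambda>a. a) (ev v) + del (rmul t) (od v)))"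
      unfolding d0_def ev_add od_add del_add[OF linop_id m(1) ev_mem(1)[OF v]] del_add[OF linop_t m(2) ev_mem(2)[OF v]]
      by (simp only: add_ac)
    then show ?thesis
      by (simp only: Q_simps enc_add[of "del (\<lambda>a. a) (ev u) + del (rmul t) (od u)"] d0_def[of u, symmetric] d0_def[of v, symmetric])
  qed
  show "d0 (a \<odot>\<^bsub>P1\<^esub> u) = a \<odot>\<^bsub>P0\<^esub> d0 u" if a: "a \<in> carrier RG" for a
  proof -
    have "ev (\<lambda>xs. a \<otimes>\<^bsub>RG\<^esub> u xs) = (\<lambda>j. a \<otimes>\<^bsub>RG\<^esub> ev u j)" "od (\<lambda>xs. a \<otimes>\<^bsub>RG\<^esub> u xs) = (\<lambda>j. a \<otimes>\<^bsub>RG\<^esub> od u j)"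
      by (simp_all add: ev_def od_def fun_eq_iff)
    then have "d0 (\<lambda>xs. a \<otimes>\<^bsub>RG\<^esub> u xs) =
        enc ((\<lambda>j. a \<otimes>\<^bsub>RG\<^esub> del (\<lambda>a. a) (ev u) j) + (\<lambda>j. a \<otimes>\<^bsub>RG\<^esub> del (rmul t) (od u) j))"
      by (simp only: d0_def del_mult[OF linop_id a m(1)] del_mult[OF linop_t a m(2)])
    also have "(\<lambda>j. a \<otimes>\<^bsub>RG\<^esub> del (\<lambda>a. a) (ev u) j) + (\<lambda>j. a \<otimes>\<^bsub>RG\<^esub> del (rmul t) (od u) j) =
        (\<lambda>j. a \<otimes>\<^bsub>RG\<^esub> (del (\<lambda>a. a) (ev u) + del (rmul t) (od u)) j)"
      using PP_mem[OF del_mem[OF linop_id m(1)]] PP_mem[OF del_mem[OF linop_t m(2)]] a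
      by (simp add: fun_eq_iff mult_add_right)
    also have "enc \<dots> = (\<lambda>xs. a \<otimes>\<^bsub>RG\<^esub> d0 u xs)"
      unfolding d0_def by (rule enc_mult[OF a])
    finally show ?thesis
      by (simp only: Q_simps)
  qed
qed

lemma d1_hom: "d1 \<in> mod_hom RG P0 P1"
  unfolding mod_hom_def
proof (intro CollectI conjI ballI Pi_I d1_mem)
  fix u assume u: "u \<in> carrier P0"
  note m = dec_mem[OF u]
  show "d1 (u \<oplus>\<^bsub>P0\<^esub> v) = d1 u \<oplus>\<^bsub>P1\<^esub> d1 v" if v: "v \<in> carrier P0" for v
  proof -
    have "d1 (u + v) = join (del (rmul t) (dec u) + del (rmul t) (dec v)) (- del (\<lambda>a. a) (dec u) + - del (\<lambda>a. a) (dec v))"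
      unfolding d1_def dec_add del_add[OF linop_id m dec_mem[OF v]] del_add[OF linop_t m dec_mem[OF v]]
      by (simp only: minus_add_distrib)
    then show ?thesis
      unfolding join_add by (simp add: d1_def)
  qed
  show "d1 (a \<odot>\<^bsub>P0\<^esub> u) = a \<odot>\<^bsub>P1\<^esub> d1 u" if a: "a \<in> carrier RG" for a
  proof -
    have "dec (\<lambda>xs. a \<otimes>\<^bsub>RG\<^esub> u xs) = (\<lambda>j. a \<otimes>\<^bsub>RG\<^esub> dec u j)"
      by (simp add: dec_def fun_eq_iff)
    then have "d1 (\<lambda>xs. a \<otimes>\<^bsub>RG\<^esub> u xs) =
        join (\<lambda>j. a \<otimes>\<^bsub>RG\<^esub> del (rmul t) (dec u) j) (- (\<lambda>j. a \<otimes>\<^bsub>RG\<^esub> del (\<lambda>a. a) (dec u) j))"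
      by (simp only: d1_def del_mult[OF linop_id a m] del_mult[OF linop_t a m])
    also have "- (\<lambda>j. a \<otimes>\<^bsub>RG\<^esub> del (\<lambda>a. a) (dec u) j) = (\<lambda>j. a \<otimes>\<^bsub>RG\<^esub> (- del (\<lambda>a. a) (dec u)) j)"
      using PP_mem[OF del_mem[OF linop_id m]] a by (simp add: fun_eq_iff mult_uminus_right)
    also have "join (\<lambda>j. a \<otimes>\<^bsub>RG\<^esub> del (rmul t) (dec u) j) \<dots> = (\<lambda>xs. a \<otimes>\<^bsub>RG\<^esub> d1 u xs)"
      unfolding d1_def by (rule join_mult[OF a])
    finally show ?thesis
      by (simp only: Q_simps)
  qed
qed

definition e0 :: "('g list \<Rightarrow> 'g \<Rightarrow> rat) \<Rightarrow> rat"
  where "e0 u = tot aug (dec u)"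

lemma tot_aug_diff: "\<lbrakk>f \<in> PP; g \<in> PP\<rbrakk> \<Longrightarrow> tot aug (f - g) = tot aug f - tot aug g"
  by (rule tot_diff) (auto simp: aug_add)

lemma e0_hom: "e0 \<in> mod_hom RG P0 Triv"
  unfolding mod_hom_def
proof (intro CollectI conjI ballI Pi_I)
  fix u assume u: "u \<in> carrier P0"
  note m = dec_mem[OF u]
  show "e0 u \<in> carrier Triv"
    unfolding e0_def tot_def using aug_closed PP_mem[OF m] n_pos by (auto intro!: loc_sum)
  show "e0 (u \<oplus>\<^bsub>P0\<^esub> v) = e0 u \<oplus>\<^bsub>Triv\<^esub> e0 v" if v: "v \<in> carrier P0" for v
    using tot_aug_diff[OF PP_add[OF m dec_mem[OF v]] dec_mem[OF v]] by (simp add: e0_def dec_add)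
  show "e0 (a \<odot>\<^bsub>P0\<^esub> u) = a \<odot>\<^bsub>Triv\<^esub> e0 u" if a: "a \<in> carrier RG" for a
  proof -
    obtain N where N: "\<And>j. N \<le> j \<Longrightarrow> dec u j = 0"
      using PP_bound[OF m] by metis
    have "dec (\<lambda>xs. a \<otimes>\<^bsub>RG\<^esub> u xs) = (\<lambda>j. a \<otimes>\<^bsub>RG\<^esub> dec u j)"
      by (simp add: dec_def fun_eq_iff)
    moreover have "tot aug (\<lambda>j. a \<otimes>\<^bsub>RG\<^esub> dec u j) = (\<Sum>j<N. aug (a \<otimes>\<^bsub>RG\<^esub> dec u j))"
      using N a by (intro tot_eq) (simp_all add: mult_zero_right)
    ultimately have "e0 (\<lambda>xs. a \<otimes>\<^bsub>RG\<^esub> u xs) = (\<Sum>j<N. aug (a \<otimes>\<^bsub>RG\<^esub> dec u j))"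
      by (simp only: e0_def)
    also have "\<dots> = aug a * (\<Sum>j<N. aug (dec u j))"
      using a PP_mem[OF m] by (simp add: aug_mult sum_distrib_left)
    also have "\<dots> = aug a * e0 u"
      using tot_eq[of aug N "dec u"] N by (simp add: e0_def)
    finally show ?thesis
      using a by (simp add: Triv_smult)
  qed
qed

lemma e0_surj: "e0 ` carrier P0 = carrier Triv"
proof (intro equalityI subsetI)
  fix r assume "r \<in> carrier Triv"
  then have r: "r \<in> loc n"
    by simp
  have "finite {i :: int. (if i = 0 then r else 0) \<noteq> 0}"
    by (rule finite_subset[of _ "{0}"]) auto
  then obtain v where v: "v \<in> PP" "\<And>i. rho v i = (if i = 0 then r else 0)"
    using rho_lift[of "\<lambda>i. if i = 0 then r else 0"] r by (metis loc_0)
  obtain I where I: "finite I" "\<And>i. i \<notin> I \<Longrightarrow> rho v i = 0" "tot aug v = (\<Sum>i\<in>I. rho v i)"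
    using rho_support[OF v(1)] by metis
  have "tot aug v = r"
  proof (cases "0 \<in> I")
    case True
    then show ?thesis
      using I(1,3) by (simp add: v(2))
  next
    case False
    then show ?thesis
      using I(2)[OF False] I(3) by (simp add: v(2)) (metis (mono_tags, lifting) sum.neutral)
  qed
  then show "r \<in> e0 ` carrier P0"
    using v(1) enc_P0 by (intro image_eqI[of _ _ "enc v"]) (auto simp: e0_def)
qed (use e0_hom in \<open>auto simp: mod_hom_def\<close>)

lemma d0_exact: "d0 ` carrier P1 = a_kernel P0 Triv e0"
proof (intro equalityI subsetI)
  fix w assume "w \<in> d0 ` carrier P1"
  then obtain u where u: "u \<in> carrier P1" "w = d0 u"
    by blast
  note m = ev_mem[OF u(1)]
  have z: "tot aug (del (\<lambda>a. a) (ev u)) = 0" "tot aug (del (rmul t) (od u)) = 0"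
    unfolding del_def using m
    by (simp_all add: tot_aug_diff alpha_mem beta_mem aug_alpha aug_beta)
  have "tot aug (del (\<lambda>a. a) (ev u) + del (rmul t) (od u)) = 0"
    using tot_aug_diff[OF PP_add[OF del_mem[OF linop_id m(1)] del_mem[OF linop_t m(2)]] del_mem[OF linop_t m(2)]] z
    by simp
  then show "w \<in> a_kernel P0 Triv e0"
    using u d0_mem by (auto simp: a_kernel_def' e0_def d0_def)
next
  fix w assume "w \<in> a_kernel P0 Triv e0"
  then have w: "w \<in> carrier P0" "tot aug (dec w) = 0"
    by (auto simp: a_kernel_def' e0_def)
  obtain f g where fg: "f \<in> PP" "g \<in> PP" "dec w = (f - alpha f) + (g - beta g)"
    using exact_0[OF dec_mem[OF w(1)] w(2)] by metis
  have "w = d0 (join f g)"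
    using enc_dec[OF w(1)] fg(3) by (simp only: d0_def ev_join od_join del_def)
  then show "w \<in> d0 ` carrier P1"
    using join_mem[OF fg(1,2)] by blast
qed

lemma del_commute: "f \<in> PP \<Longrightarrow> del (\<lambda>a. a) (del (rmul t) f) = del (rmul t) (del (\<lambda>a. a) f)"
  unfolding del_def
  by (simp only: alpha_diff[OF _ beta_mem] beta_diff[OF _ alpha_mem] alpha_beta algebra_simps)

lemma d1_exact: "d1 ` carrier P0 = a_kernel P1 P0 d0"
proof (intro equalityI subsetI)
  fix w assume "w \<in> d1 ` carrier P0"
  then obtain u where u: "u \<in> carrier P0" "w = d1 u"
    by blast
  note m = dec_mem[OF u(1)]
  have "del (rmul t) (- del (\<lambda>a. a) (dec u)) + del (rmul t) (del (\<lambda>a. a) (dec u)) = del (rmul t) 0"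
    using del_add[OF linop_t PP_uminus[OF del_mem[OF linop_id m]] del_mem[OF linop_id m]] by simp
  also have "\<dots> = 0"
    using del_add[OF linop_t PP_zero PP_zero] by simp
  finally have "d0 w = enc 0"
    unfolding u(2) d0_def d1_def ev_join od_join del_commute[OF m] by (simp only: add.commute)
  also have "\<dots> = 0"
    by (simp add: enc_def fun_eq_iff)
  finally show "w \<in> a_kernel P1 P0 d0"
    using u d1_mem by (auto simp: a_kernel_def')
next
  fix w assume "w \<in> a_kernel P1 P0 d0"
  then have w: "w \<in> carrier P1" "d0 w = 0"
    by (auto simp: a_kernel_def')
  note m = ev_mem[OF w(1)]
  have "dec (d0 w) = 0"
    using w(2) by (simp add: dec_def fun_eq_iff)
  then have "(ev w - alpha (ev w)) + (od w - beta (od w)) = 0"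
    by (simp only: d0_def dec_enc del_def)
  then obtain v where v: "v \<in> PP" "ev w = v - beta v" "od w = - (v - alpha v)"
    using exact_1[OF m] by metis
  have "w = join (ev w) (od w)"
    using join_ev_od[OF w(1)] by simp
  also have "\<dots> = d1 (enc v)"
    by (simp only: v d1_def dec_enc del_def)
  finally show "w \<in> d1 ` carrier P0"
    using v(1) enc_P0 by blast
qed

text \<open>The second component alone suffices, since \<open>1 - alpha\<close> is
  injective.\<close>

lemma d1_injective: "a_kernel P0 P1 d1 = {0}"
proof (intro equalityI subsetI)
  fix w assume "w \<in> a_kernel P0 P1 d1"
  then have w: "w \<in> carrier P0" "d1 w = 0"
    by (auto simp: a_kernel_def')
  have "od (d1 w) = 0"
    using w(2) by (simp add: od_def fun_eq_iff)
  then have "del (\<lambda>a. a) (dec w) = 0"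
    by (simp only: d1_def od_join neg_equal_0_iff_equal)
  then have "dec w = 0"
    using alpha_fixed_zero[OF dec_mem[OF w(1)]] by (simp only: del_def)
  then have "w = enc 0"
    using enc_dec[OF w(1)] by simp
  then show "w \<in> {0}"
    by (simp add: enc_def fun_eq_iff)
next
  fix w :: "'g list \<Rightarrow> 'g \<Rightarrow> rat" assume "w \<in> {0}"
  then have w: "w = enc 0"
    by (simp add: enc_def fun_eq_iff)
  have "enc 0 \<in> carrier P0"
    using PP_zero by (simp only: enc_P0)
  moreover have "del T 0 = 0" if "linop T" for T
    using del_add[OF that PP_zero PP_zero] by simp
  then have "d1 (enc 0) = 0"
    by (simp add: d1_def dec_enc linop_id linop_t) (simp add: join_def enc_def fun_eq_iff)
  ultimately show "w \<in> a_kernel P0 P1 d1"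
    unfolding w a_kernel_def' by simp
qed

theorem proj_resolution: "has_proj_resolution_of_length R G 2"
proof -
  \<comment> \<open>A fourth term equal to zero expresses injectivity of \<open>d1\<close> as
    exactness, as the definition of a resolution of given length requires.\<close>
  define Z0 :: "('g \<Rightarrow> rat, 'g list \<Rightarrow> 'g \<Rightarrow> rat) module" where "Z0 = fixed_module {} (\<lambda>_ a. a)"
  have Z0: "carrier Z0 = {0}"
    by (auto simp: Z0_def fixed_iff fun_eq_iff)
  have Z0_hom: "(\<lambda>_. 0) \<in> mod_hom RG Z0 P0"
  proof -
    have "enc 0 = 0"
      by (simp add: enc_def fun_eq_iff)
    then have "0 \<in> carrier P0"
      using enc_P0[of 0] PP_zero by (simp only:)
    moreover have "a \<odot>\<^bsub>P0\<^esub> 0 = 0" if "a \<in> carrier RG" for a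
      using mult_zero_right[OF that] by (simp add: fun_eq_iff)
    ultimately show ?thesis
      by (simp only: mod_hom_def Q_simps) auto
  qed
  define P where "P i = (if i = 1 then P1 else if i \<le> 2 then P0 else Z0)" for i :: nat
  define D' where "D' i = (if i = 0 then d0 else if i = 1 then d1 else (\<lambda>_. 0))" for i :: nat
  have "partial_proj_resolution RG Triv (Suc 2) P D' e0"
    unfolding partial_proj_resolution_def
  proof (intro conjI allI impI)
    show "projective RG (P i)" for i
      by (auto simp: P_def projective_Q Z0_def intro!: projective_fixed)
    show "e0 \<in> mod_hom RG (P 0) Triv" "e0 ` carrier (P 0) = carrier Triv"
      using e0_hom e0_surj by (simp_all add: P_def)
    show "D' i \<in> mod_hom RG (P (Suc i)) (P i)" if "i < Suc 2" for i
    proof -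
      from that consider "i = 0" | "i = 1" | "i = 2"
        by linarith
      then show ?thesis
        using d0_hom d1_hom Z0_hom by cases (simp_all add: P_def D'_def)
    qed
    show "D' 0 ` carrier (P 1) = a_kernel (P 0) Triv e0"
      using d0_exact by (simp add: P_def D'_def)
    show "D' (Suc i) ` carrier (P (Suc (Suc i))) = a_kernel (P (Suc i)) (P i) (D' i)" if "Suc i < Suc 2" for i
    proof -
      from that consider "i = 0" | "i = 1"
        by linarith
      then show ?thesis
        using d1_exact d1_injective Z0 by cases (simp_all add: P_def D'_def)
    qed
  qed
  moreover have "carrier (P (Suc 2)) = {\<zero>\<^bsub>P (Suc 2)\<^esub>}"
    using Z0 by (simp add: P_def Z0_def)
  ultimately show ?thesis
    unfolding has_proj_resolution_of_length_def by blast
qed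

end

section \<open>Assembly for the lamplighter group\<close>

context lamplighter
begin

interpretation T: tower_group_ring G "order F" D t snd
  by (rule tower_group_ring_G)

interpretation E: one_ended_group_ring G "order F"
  by (rule one_ended_group_ring_G)

lemma type_FP_G: "type_FP T.R G 1"
proof (rule T.type_FP_1)
  show "finite (insert t (lamp ` carrier F))" "insert t (lamp ` carrier F) \<subseteq> carrier G"
    using finite_F t_closed lamp_closed by auto
  fix P x
  assume one: "P \<one>\<^bsub>G\<^esub>" and x: "x \<in> carrier G"
    and mult: "\<And>x s. \<lbrakk>x \<in> carrier G; s \<in> insert t (lamp ` carrier F); P x\<rbrakk> \<Longrightarrow> P (x \<otimes>\<^bsub>G\<^esub> s)"
    and mult_inv: "\<And>x s. \<lbrakk>x \<in> carrier G; s \<in> insert t (lamp ` carrier F); P x\<rbrakk> \<Longrightarrow> P (x \<otimes>\<^bsub>G\<^esub> inv\<^bsub>G\<^esub> s)"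
  show "P x"
  proof (rule right_generated[of P, OF one _ _ _ x])
    show "P (y \<otimes>\<^bsub>G\<^esub> t)" "P (y \<otimes>\<^bsub>G\<^esub> inv\<^bsub>G\<^esub> t)" if "y \<in> carrier G" "P y" for y
      using mult[OF that(1) insertI1 that(2)] mult_inv[OF that(1) insertI1 that(2)] .
    show "P (y \<otimes>\<^bsub>G\<^esub> lamp a)" if "y \<in> carrier G" "a \<in> carrier F" "P y" for y a
      using mult[OF that(1) insertI2[OF imageI[OF that(2)]] that(3)] .
  qed
qed

lemma cohomological_dim_G: "cohomological_dim T.R G \<le> enat 2"
  unfolding cohomological_dim_def using T.proj_resolution by (intro INF_lower) simp

lemma cocycles_trivial:
  assumes "k \<noteq> 2"
  shows "T.Z k \<subseteq> T.B k"
proof -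
  from assms consider "k = 0" | "k = 1" | m where "k = Suc (Suc (Suc m))"
    by (metis One_nat_def Suc_1 not0_implies_Suc)
  then show ?thesis
    using E.cocycles_0_trivial E.cocycles_1_trivial T.cocycles_above_2_trivial by cases simp_all
qed

text \<open>The tower of finite subgroups supplies the resolution and the vanishing above degree
  two. One-endedness supplies the vanishing below and the torsion-freeness that makes degree two
  flat. Finite generation gives the type condition in degree one.\<close>

theorem semiduality_group_G: "semiduality_group TYPE('n) T.R G 2"
  unfolding semiduality_group_def
proof (intro conjI allI impI)
  show "type_FP T.R G (2 - 1)"
    using type_FP_G by simp
  show "carrier (cohomology T.R G T.Reg k) = {\<zero>\<^bsub>cohomology T.R G T.Reg k\<^esub>}" if "k \<noteq> 2" for k
    by (rule T.cohomology_trivial[OF cocycles_trivial[OF that]])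
  show "flat_module TYPE('n) T.R (cohomology T.R G T.Reg 2)"
    by (rule T.flat_cohomology[OF E.B_2_torsion_free])
qed (simp_all add: T.cring_R group_G cohomological_dim_G)

end

theorem theorem47:
  fixes F :: "('a, 'b) monoid_scheme"
  assumes "group F" and "finite (carrier F)" and "carrier F \<noteq> {\<one>\<^bsub>F\<^esub>}"
  shows "semiduality_group TYPE('n) (int_localization (order F)) (lamplighter_group F) 2"
proof -
  interpret lamplighter F
    using assms by (intro lamplighter.intro lamplighter_axioms.intro)
  show ?thesis
    by (rule semiduality_group_G)
qed

end
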